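(* Let $\Lambda$ be a Gorenstein artin algebra and $a$ an idempotent element of $\Lambda$. Assume that the functor $\operatorname{mod}\Lambda\to\operatorname{mod}a\Lambda a$, $M\mapsto aM$, is an eventually homological isomorphism. Then there is a triangle equivalence between the stable categories of Cohen–Macaulay modules of $\Lambda$ and $a\Lambda a$: $$\underline{\operatorname{CM}}(\Lambda)\simeq\underline{\operatorname{CM}}(a\Lambda a).$$
   Context: Modules over an artin algebra are finitely generated left modules. An artin algebra $\Lambda$ is Gorenstein if $\Lambda$ has finite injective dimension both as a left and as a right $\Lambda$-module. For a Gorenstein artin algebra $\Lambda$, $\operatorname{CM}(\Lambda)=\{X\in\operatorname{mod}\Lambda\mid\operatorname{Ext}^n_\Lambda(X,\Lambda)=0\text{ for all }n\ge1\}$, and $\underline{\operatorname{CM}}(\Lambda)$ is its stable category modulo projectives, with its standard triangulated structure. A functor $f\colon\mathcal D\to\mathcal F$ between abelian categories is an eventually homological isomorphism if there is an integer $t$ such that $\operatorname{Ext}^j_{\mathcal D}(X,Y)\cong\operatorname{Ext}^j_{\mathcal F}(f(X),f(Y))$ for all objects $X,Y$ of $\mathcal D$ and all $j>t$. (Under the hypotheses, $a\Lambda a$ is also Gorenstein.) *)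

theory Defs
  imports "HOL-Algebra.Module" "HOL-Algebra.RingHom"
begin

section \<open>Modules over a not necessarily commutative ring\<close>

text \<open>
  The locale \<open>module\<close> of HOL-Algebra requires a commutative ring of scalars. The following is the
  analogue for left modules over an arbitrary ring; it uses the same record type.
\<close>

locale left_module = R?: ring R + M?: abelian_group M
  for R :: "('a, 'r) ring_scheme" (structure) and M :: "('a, 'b, 'm) module_scheme" (structure) +
  assumes lm_smult_closed:
      "\<lbrakk>r \<in> carrier R; x \<in> carrier M\<rbrakk> \<Longrightarrow> r \<odot>\<^bsub>M\<^esub> x \<in> carrier M"
    and lm_smult_l_distr:
      "\<lbrakk>r \<in> carrier R; s \<in> carrier R; x \<in> carrier M\<rbrakk> \<Longrightarrow>
        (r \<oplus> s) \<odot>\<^bsub>M\<^esub> x = r \<odot>\<^bsub>M\<^esub> x \<oplus>\<^bsub>M\<^esub> s \<odot>\<^bsub>M\<^esub> x"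
    and lm_smult_r_distr:
      "\<lbrakk>r \<in> carrier R; x \<in> carrier M; y \<in> carrier M\<rbrakk> \<Longrightarrow>
        r \<odot>\<^bsub>M\<^esub> (x \<oplus>\<^bsub>M\<^esub> y) = r \<odot>\<^bsub>M\<^esub> x \<oplus>\<^bsub>M\<^esub> r \<odot>\<^bsub>M\<^esub> y"
    and lm_smult_assoc:
      "\<lbrakk>r \<in> carrier R; s \<in> carrier R; x \<in> carrier M\<rbrakk> \<Longrightarrow>
        (r \<otimes> s) \<odot>\<^bsub>M\<^esub> x = r \<odot>\<^bsub>M\<^esub> (s \<odot>\<^bsub>M\<^esub> x)"
    and lm_smult_one:
      "x \<in> carrier M \<Longrightarrow> \<one> \<odot>\<^bsub>M\<^esub> x = x"

definition finitely_generated :: "('a, 'r) ring_scheme \<Rightarrow> ('a, 'b) module \<Rightarrow> bool" where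
  "finitely_generated R M \<longleftrightarrow>
     (\<exists>A. finite A \<and> A \<subseteq> carrier M \<and> (\<forall>H. submodule H R M \<and> A \<subseteq> H \<longrightarrow> H = carrier M))"

definition regular_module :: "('a, 'r) ring_scheme \<Rightarrow> ('a, 'a) module" where
  "regular_module R = \<lparr>carrier = carrier R, monoid.mult = monoid.mult R, monoid.one = monoid.one R,
     ring.zero = ring.zero R, ring.add = ring.add R, smult = monoid.mult R\<rparr>"

text \<open>Right modules over a ring are left modules over its opposite.\<close>

definition opposite_ring :: "'a ring \<Rightarrow> 'a ring" where
  "opposite_ring R = R\<lparr>monoid.mult := (\<lambda>x y. y \<otimes>\<^bsub>R\<^esub> x)\<rparr>"

text \<open>
  Homomorphisms are extensional functions, so that equality of morphisms is equality on the domain.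
\<close>

definition mod_hom :: "('a, 'r) ring_scheme \<Rightarrow> ('a, 'b) module \<Rightarrow> ('a, 'c) module \<Rightarrow> ('b \<Rightarrow> 'c) set" where
  "mod_hom R M N = {f \<in> carrier M \<rightarrow>\<^sub>E carrier N.
     (\<forall>x\<in>carrier M. \<forall>y\<in>carrier M. f (x \<oplus>\<^bsub>M\<^esub> y) = f x \<oplus>\<^bsub>N\<^esub> f y) \<and>
     (\<forall>r\<in>carrier R. \<forall>x\<in>carrier M. f (r \<odot>\<^bsub>M\<^esub> x) = r \<odot>\<^bsub>N\<^esub> f x)}"

definition mod_ker :: "('a, 'b) module \<Rightarrow> ('a, 'c) module \<Rightarrow> ('b \<Rightarrow> 'c) \<Rightarrow> 'b set" where
  "mod_ker M N f = {x \<in> carrier M. f x = \<zero>\<^bsub>N\<^esub>}"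

definition zero_map :: "('a, 'b) module \<Rightarrow> ('a, 'c) module \<Rightarrow> 'b \<Rightarrow> 'c" where
  "zero_map M N = (\<lambda>x\<in>carrier M. \<zero>\<^bsub>N\<^esub>)"

definition hom_group :: "('a, 'r) ring_scheme \<Rightarrow> ('a, 'b) module \<Rightarrow> ('a, 'c) module \<Rightarrow> ('b \<Rightarrow> 'c) monoid" where
  "hom_group R M N = \<lparr>carrier = mod_hom R M N,
     monoid.mult = (\<lambda>f g. \<lambda>x\<in>carrier M. f x \<oplus>\<^bsub>N\<^esub> g x),
     monoid.one = zero_map M N\<rparr>"


section \<open>The category of finitely generated modules\<close>

text \<open>
  The objects of \<open>mod R\<close> have to be taken with carriers in a fixed type. We use sets of sequences
  in \<open>R\<close>: a finitely generated module is isomorphic to some \<open>R\<^sup>n/U\<close>, whose elements are subsets of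
  \<open>R\<^sup>n\<close>, so every finitely generated \<open>R\<close>-module is isomorphic to an object of \<open>fg_modules R\<close>.
\<close>

type_synonym 'a fg_carrier = "(nat \<Rightarrow> 'a) set"
type_synonym 'a fg_module = "('a, 'a fg_carrier) module"
type_synonym 'a fg_map = "'a fg_carrier \<Rightarrow> 'a fg_carrier"

definition fg_modules :: "'a ring \<Rightarrow> 'a fg_module set" where
  "fg_modules R = {M. left_module R M \<and> finitely_generated R M}"

definition projectives :: "'a ring \<Rightarrow> 'a fg_module set" where
  "projectives R = {P \<in> fg_modules R.
     \<forall>M\<in>fg_modules R. \<forall>N\<in>fg_modules R. \<forall>g\<in>mod_hom R M N. \<forall>f\<in>mod_hom R P N.
       g ` carrier M = carrier N \<longrightarrow> (\<exists>h\<in>mod_hom R P M. compose (carrier P) g h = f)}"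

definition injectives :: "'a ring \<Rightarrow> 'a fg_module set" where
  "injectives R = {I \<in> fg_modules R.
     \<forall>M\<in>fg_modules R. \<forall>N\<in>fg_modules R. \<forall>g\<in>mod_hom R M N. \<forall>f\<in>mod_hom R M I.
       inj_on g (carrier M) \<longrightarrow> (\<exists>h\<in>mod_hom R N I. compose (carrier M) h g = f)}"

definition short_exact ::
  "'a ring \<Rightarrow> ('a, 'b) module \<Rightarrow> ('a, 'c) module \<Rightarrow> ('a, 'd) module \<Rightarrow> ('b \<Rightarrow> 'c) \<Rightarrow> ('c \<Rightarrow> 'd) \<Rightarrow> bool" where
  "short_exact R X Y Z f g \<longleftrightarrow> f \<in> mod_hom R X Y \<and> g \<in> mod_hom R Y Z \<and>
     inj_on f (carrier X) \<and> f ` carrier X = mod_ker Y Z g \<and> g ` carrier Y = carrier Z"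


section \<open>Ext groups\<close>

definition projective_resolution ::
  "'a ring \<Rightarrow> ('a, 'b) module \<Rightarrow> (nat \<Rightarrow> 'a fg_module) \<Rightarrow> (nat \<Rightarrow> 'a fg_map) \<Rightarrow> ('a fg_carrier \<Rightarrow> 'b) \<Rightarrow> bool" where
  "projective_resolution R X P d e \<longleftrightarrow>
     (\<forall>n. P n \<in> projectives R \<and> d n \<in> mod_hom R (P (Suc n)) (P n)) \<and>
     e \<in> mod_hom R (P 0) X \<and> e ` carrier (P 0) = carrier X \<and>
     d 0 ` carrier (P 1) = mod_ker (P 0) X e \<and>
     (\<forall>n. d (Suc n) ` carrier (P (Suc (Suc n))) = mod_ker (P (Suc n)) (P n) (d n))"

definition cocycles ::
  "'a ring \<Rightarrow> (nat \<Rightarrow> 'a fg_module) \<Rightarrow> (nat \<Rightarrow> 'a fg_map) \<Rightarrow> ('a, 'c) module \<Rightarrow> nat \<Rightarrow> ('a fg_carrier \<Rightarrow> 'c) set" where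
  "cocycles R P d Y n = {f \<in> mod_hom R (P n) Y.
     compose (carrier (P (Suc n))) f (d n) = zero_map (P (Suc n)) Y}"

definition coboundaries ::
  "'a ring \<Rightarrow> (nat \<Rightarrow> 'a fg_module) \<Rightarrow> (nat \<Rightarrow> 'a fg_map) \<Rightarrow> ('a, 'c) module \<Rightarrow> nat \<Rightarrow> ('a fg_carrier \<Rightarrow> 'c) set" where
  "coboundaries R P d Y n = (case n of
       0 \<Rightarrow> {zero_map (P 0) Y}
     | Suc m \<Rightarrow> (\<lambda>f. compose (carrier (P (Suc m))) f (d m)) ` mod_hom R (P m) Y)"

text \<open>
  \<open>Ext\<^sup>n(X, Y)\<close> is the \<open>n\<close>-th cohomology group of \<open>Hom(P, Y)\<close> for a chosen resolution \<open>P\<close> of \<open>X\<close>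
  by finitely generated projectives; up to isomorphism it does not depend on the choice. The module
  \<open>X\<close> is meant to be finitely generated over a left noetherian ring, so that \<open>P\<close> exists.
\<close>

definition ext_group ::
  "'a ring \<Rightarrow> nat \<Rightarrow> ('a, 'b) module \<Rightarrow> ('a, 'c) module \<Rightarrow> ('a fg_carrier \<Rightarrow> 'c) set monoid" where
  "ext_group R n X Y =
     (let (P, d, e) = (SOME (P, d, e). projective_resolution R X P d e)
      in (hom_group R (P n) Y)\<lparr>carrier := cocycles R P d Y n\<rparr> Mod coboundaries R P d Y n)"

definition ext_vanishes :: "'a ring \<Rightarrow> nat \<Rightarrow> ('a, 'b) module \<Rightarrow> ('a, 'c) module \<Rightarrow> bool" where
  "ext_vanishes R n X Y \<longleftrightarrow> carrier (ext_group R n X Y) = {\<one>\<^bsub>ext_group R n X Y\<^esub>}"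


section \<open>Gorenstein artin algebras and Cohen-Macaulay modules\<close>

definition artinian_ring :: "('k, 'r) ring_scheme \<Rightarrow> bool" where
  "artinian_ring k \<longleftrightarrow>
     (\<forall>I::nat \<Rightarrow> 'k set. (\<forall>n. ideal (I n) k \<and> I (Suc n) \<subseteq> I n) \<longrightarrow> (\<exists>N. \<forall>n\<ge>N. I n = I N))"

definition scalar_module :: "('k \<Rightarrow> 'a) \<Rightarrow> 'a ring \<Rightarrow> ('k, 'a) module" where
  "scalar_module \<phi> \<Lambda> = \<lparr>carrier = carrier \<Lambda>, monoid.mult = monoid.mult \<Lambda>, monoid.one = monoid.one \<Lambda>,
     ring.zero = ring.zero \<Lambda>, ring.add = ring.add \<Lambda>, smult = (\<lambda>r x. \<phi> r \<otimes>\<^bsub>\<Lambda>\<^esub> x)\<rparr>"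

text \<open>\<open>\<phi>\<close> is the structure map from the commutative artinian base ring \<open>k\<close> to the centre of \<open>\<Lambda>\<close>.\<close>

definition artin_algebra :: "'k ring \<Rightarrow> ('k \<Rightarrow> 'a) \<Rightarrow> 'a ring \<Rightarrow> bool" where
  "artin_algebra k \<phi> \<Lambda> \<longleftrightarrow> cring k \<and> artinian_ring k \<and> ring \<Lambda> \<and> \<phi> \<in> ring_hom k \<Lambda> \<and>
     (\<forall>r\<in>carrier k. \<forall>x\<in>carrier \<Lambda>. \<phi> r \<otimes>\<^bsub>\<Lambda>\<^esub> x = x \<otimes>\<^bsub>\<Lambda>\<^esub> \<phi> r) \<and>
     finitely_generated k (scalar_module \<phi> \<Lambda>)"

text \<open>
  An injective resolution of length at most \<open>n\<close>; exactness of \<open>d\<close> and vanishing of \<open>I i\<close> for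
  \<open>i > n\<close> make \<open>I (n - 1) \<rightarrow> I n\<close> surjective.
\<close>

definition injective_dimension_le :: "'a ring \<Rightarrow> ('a, 'b) module \<Rightarrow> nat \<Rightarrow> bool" where
  "injective_dimension_le R M n \<longleftrightarrow>
     (\<exists>(I :: nat \<Rightarrow> 'a fg_module) d e.
        (\<forall>i. I i \<in> injectives R \<and> d i \<in> mod_hom R (I i) (I (Suc i))) \<and>
        e \<in> mod_hom R M (I 0) \<and> inj_on e (carrier M) \<and>
        e ` carrier M = mod_ker (I 0) (I 1) (d 0) \<and>
        (\<forall>i. d i ` carrier (I i) = mod_ker (I (Suc i)) (I (Suc (Suc i))) (d (Suc i))) \<and>
        (\<forall>i>n. carrier (I i) = {\<zero>\<^bsub>I i\<^esub>}))"

definition finite_injective_dimension :: "'a ring \<Rightarrow> ('a, 'b) module \<Rightarrow> bool" where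
  "finite_injective_dimension R M \<longleftrightarrow> (\<exists>n. injective_dimension_le R M n)"

definition gorenstein :: "'a ring \<Rightarrow> bool" where
  "gorenstein \<Lambda> \<longleftrightarrow>
     finite_injective_dimension \<Lambda> (regular_module \<Lambda>) \<and>
     finite_injective_dimension (opposite_ring \<Lambda>) (regular_module (opposite_ring \<Lambda>))"

definition CM :: "'a ring \<Rightarrow> 'a fg_module set" where
  "CM \<Lambda> = {X \<in> fg_modules \<Lambda>. \<forall>n\<ge>1. ext_vanishes \<Lambda> n X (regular_module \<Lambda>)}"


section \<open>Preadditive categories, functors and equivalences\<close>

text \<open>
  Hom-sets carry their (multiplicatively written) abelian group structure. Composition and
  identities are indexed by objects, and hom-sets of different pairs of objects may overlap.
  The composite of \<open>f : X \<rightarrow> Y\<close> and \<open>g : Y \<rightarrow> Z\<close> is \<open>cat_comp C X Y Z g f\<close>.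
\<close>

record ('o, 'h) category_data =
  cat_ob :: "'o set"
  cat_hom :: "'o \<Rightarrow> 'o \<Rightarrow> 'h monoid"
  cat_comp :: "'o \<Rightarrow> 'o \<Rightarrow> 'o \<Rightarrow> 'h \<Rightarrow> 'h \<Rightarrow> 'h"
  cat_id :: "'o \<Rightarrow> 'h"

record ('o, 'h, 'p, 'i) functor_data =
  fun_ob :: "'o \<Rightarrow> 'p"
  fun_mor :: "'o \<Rightarrow> 'o \<Rightarrow> 'h \<Rightarrow> 'i"

abbreviation hom_set :: "('o, 'h, 'x) category_data_scheme \<Rightarrow> 'o \<Rightarrow> 'o \<Rightarrow> 'h set" where
  "hom_set C X Y \<equiv> carrier (cat_hom C X Y)"

definition is_functor ::
  "('o, 'h, 'x) category_data_scheme \<Rightarrow> ('p, 'i, 'y) category_data_scheme \<Rightarrow> ('o, 'h, 'p, 'i) functor_data \<Rightarrow> bool" where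
  "is_functor C D F \<longleftrightarrow>
     (\<forall>X\<in>cat_ob C. fun_ob F X \<in> cat_ob D) \<and>
     (\<forall>X\<in>cat_ob C. \<forall>Y\<in>cat_ob C. \<forall>f\<in>hom_set C X Y.
        fun_mor F X Y f \<in> hom_set D (fun_ob F X) (fun_ob F Y)) \<and>
     (\<forall>X\<in>cat_ob C. fun_mor F X X (cat_id C X) = cat_id D (fun_ob F X)) \<and>
     (\<forall>X\<in>cat_ob C. \<forall>Y\<in>cat_ob C. \<forall>Z\<in>cat_ob C. \<forall>f\<in>hom_set C X Y. \<forall>g\<in>hom_set C Y Z.
        fun_mor F X Z (cat_comp C X Y Z g f) =
        cat_comp D (fun_ob F X) (fun_ob F Y) (fun_ob F Z) (fun_mor F Y Z g) (fun_mor F X Y f))"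

definition additive_functor ::
  "('o, 'h, 'x) category_data_scheme \<Rightarrow> ('p, 'i, 'y) category_data_scheme \<Rightarrow> ('o, 'h, 'p, 'i) functor_data \<Rightarrow> bool" where
  "additive_functor C D F \<longleftrightarrow> is_functor C D F \<and>
     (\<forall>X\<in>cat_ob C. \<forall>Y\<in>cat_ob C.
        fun_mor F X Y \<in> hom (cat_hom C X Y) (cat_hom D (fun_ob F X) (fun_ob F Y)))"

definition id_functor :: "('o, 'h, 'o, 'h) functor_data" where
  "id_functor = \<lparr>fun_ob = (\<lambda>X. X), fun_mor = (\<lambda>X Y f. f)\<rparr>"

definition comp_functor ::
  "('p, 'i, 'q, 'j) functor_data \<Rightarrow> ('o, 'h, 'p, 'i) functor_data \<Rightarrow> ('o, 'h, 'q, 'j) functor_data" where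
  "comp_functor G F = \<lparr>fun_ob = (\<lambda>X. fun_ob G (fun_ob F X)),
     fun_mor = (\<lambda>X Y f. fun_mor G (fun_ob F X) (fun_ob F Y) (fun_mor F X Y f))\<rparr>"

definition is_isomorphism :: "('o, 'h, 'x) category_data_scheme \<Rightarrow> 'o \<Rightarrow> 'o \<Rightarrow> 'h \<Rightarrow> bool" where
  "is_isomorphism C X Y f \<longleftrightarrow> f \<in> hom_set C X Y \<and>
     (\<exists>g\<in>hom_set C Y X. cat_comp C X Y X g f = cat_id C X \<and> cat_comp C Y X Y f g = cat_id C Y)"

definition natural_iso ::
  "('o, 'h, 'x) category_data_scheme \<Rightarrow> ('p, 'i, 'y) category_data_scheme \<Rightarrow>
   ('o, 'h, 'p, 'i) functor_data \<Rightarrow> ('o, 'h, 'p, 'i) functor_data \<Rightarrow> ('o \<Rightarrow> 'i) \<Rightarrow> bool" where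
  "natural_iso C D F G \<eta> \<longleftrightarrow>
     (\<forall>X\<in>cat_ob C. is_isomorphism D (fun_ob F X) (fun_ob G X) (\<eta> X)) \<and>
     (\<forall>X\<in>cat_ob C. \<forall>Y\<in>cat_ob C. \<forall>f\<in>hom_set C X Y.
        cat_comp D (fun_ob F X) (fun_ob F Y) (fun_ob G Y) (\<eta> Y) (fun_mor F X Y f) =
        cat_comp D (fun_ob F X) (fun_ob G X) (fun_ob G Y) (fun_mor G X Y f) (\<eta> X))"

definition is_equivalence ::
  "('o, 'h, 'x) category_data_scheme \<Rightarrow> ('p, 'i, 'y) category_data_scheme \<Rightarrow> ('o, 'h, 'p, 'i) functor_data \<Rightarrow> bool" where
  "is_equivalence C D F \<longleftrightarrow> is_functor C D F \<and>
     (\<exists>G. is_functor D C G \<and>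
        (\<exists>\<alpha>. natural_iso C C (comp_functor G F) id_functor \<alpha>) \<and>
        (\<exists>\<beta>. natural_iso D D (comp_functor F G) id_functor \<beta>))"

definition is_pushout ::
  "('o, 'h, 'x) category_data_scheme \<Rightarrow> 'o \<Rightarrow> 'o \<Rightarrow> 'o \<Rightarrow> 'o \<Rightarrow> 'h \<Rightarrow> 'h \<Rightarrow> 'h \<Rightarrow> 'h \<Rightarrow> bool" where
  "is_pushout C X I Y Z i u j v \<longleftrightarrow>
     {X, I, Y, Z} \<subseteq> cat_ob C \<and>
     i \<in> hom_set C X I \<and> u \<in> hom_set C X Y \<and> j \<in> hom_set C I Z \<and> v \<in> hom_set C Y Z \<and>
     cat_comp C X I Z j i = cat_comp C X Y Z v u \<and>
     (\<forall>W\<in>cat_ob C. \<forall>p\<in>hom_set C I W. \<forall>q\<in>hom_set C Y W.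
        cat_comp C X I W p i = cat_comp C X Y W q u \<longrightarrow>
        (\<exists>!h. h \<in> hom_set C Z W \<and> cat_comp C I Z W h j = p \<and> cat_comp C Y Z W h v = q))"


section \<open>Shift, distinguished triangles and triangle equivalences\<close>

text \<open>
  A tuple \<open>(X, Y, Z, u, v, w)\<close> stands for the triangle \<open>X \<rightarrow> Y \<rightarrow> Z \<rightarrow> \<Sigma>X\<close> with maps
  \<open>u\<close>, \<open>v\<close>, \<open>w\<close>.
\<close>

type_synonym ('o, 'h) triangle = "'o \<times> 'o \<times> 'o \<times> 'h \<times> 'h \<times> 'h"

record ('o, 'h) triangulated_data = "('o, 'h) category_data" +
  tri_shift :: "('o, 'h, 'o, 'h) functor_data"
  tri_dist :: "('o, 'h) triangle set"

definition is_triangle ::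
  "('o, 'h, 'x) category_data_scheme \<Rightarrow> ('o, 'h, 'o, 'h) functor_data \<Rightarrow> ('o, 'h) triangle \<Rightarrow> bool" where
  "is_triangle C S T = (case T of (X, Y, Z, u, v, w) \<Rightarrow>
     X \<in> cat_ob C \<and> Y \<in> cat_ob C \<and> Z \<in> cat_ob C \<and>
     u \<in> hom_set C X Y \<and> v \<in> hom_set C Y Z \<and> w \<in> hom_set C Z (fun_ob S X))"

definition isomorphic_triangles ::
  "('o, 'h, 'x) category_data_scheme \<Rightarrow> ('o, 'h, 'o, 'h) functor_data \<Rightarrow> ('o, 'h) triangle \<Rightarrow> ('o, 'h) triangle \<Rightarrow> bool" where
  "isomorphic_triangles C S T T' =
     (case T of (X, Y, Z, u, v, w) \<Rightarrow> case T' of (X', Y', Z', u', v', w') \<Rightarrow>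
        \<exists>a b c. is_isomorphism C X X' a \<and> is_isomorphism C Y Y' b \<and> is_isomorphism C Z Z' c \<and>
          cat_comp C X Y Y' b u = cat_comp C X X' Y' u' a \<and>
          cat_comp C Y Z Z' c v = cat_comp C Y Y' Z' v' b \<and>
          cat_comp C Z (fun_ob S X) (fun_ob S X') (fun_mor S X X' a) w =
            cat_comp C Z Z' (fun_ob S X') w' c)"

text \<open>
  A triangle functor is an additive functor \<open>F\<close> together with a natural isomorphism
  \<open>\<eta> : F \<Sigma> \<rightarrow> \<Sigma> F\<close> such that distinguished triangles \<open>(u, v, w)\<close> are sent to distinguished
  triangles \<open>(F u, F v, \<eta>\<^sub>X \<circ> F w)\<close>.
\<close>

definition triangle_functor ::
  "('o, 'h) triangulated_data \<Rightarrow> ('p, 'i) triangulated_data \<Rightarrow> ('o, 'h, 'p, 'i) functor_data \<Rightarrow> ('o \<Rightarrow> 'i) \<Rightarrow> bool" where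
  "triangle_functor C D F \<eta> \<longleftrightarrow> additive_functor C D F \<and>
     natural_iso C D (comp_functor F (tri_shift C)) (comp_functor (tri_shift D) F) \<eta> \<and>
     (\<forall>X Y Z u v w. (X, Y, Z, u, v, w) \<in> tri_dist C \<longrightarrow>
        (fun_ob F X, fun_ob F Y, fun_ob F Z, fun_mor F X Y u, fun_mor F Y Z v,
         cat_comp D (fun_ob F Z) (fun_ob F (fun_ob (tri_shift C) X)) (fun_ob (tri_shift D) (fun_ob F X))
           (\<eta> X) (fun_mor F Z (fun_ob (tri_shift C) X) w)) \<in> tri_dist D)"

definition triangle_equivalent :: "('o, 'h) triangulated_data \<Rightarrow> ('p, 'i) triangulated_data \<Rightarrow> bool" where
  "triangle_equivalent C D \<longleftrightarrow> (\<exists>F \<eta>. triangle_functor C D F \<eta> \<and> is_equivalence C D F)"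


section \<open>The stable category of Cohen-Macaulay modules\<close>

definition mod_category :: "'a ring \<Rightarrow> ('a fg_module, 'a fg_map) category_data" where
  "mod_category R = \<lparr>cat_ob = fg_modules R, cat_hom = hom_group R,
     cat_comp = (\<lambda>X Y Z g f. compose (carrier X) g f),
     cat_id = (\<lambda>X. \<lambda>x\<in>carrier X. x)\<rparr>"

definition CM_category :: "'a ring \<Rightarrow> ('a fg_module, 'a fg_map) category_data" where
  "CM_category R = (mod_category R)\<lparr>cat_ob := CM R\<rparr>"

definition projective_maps :: "'a ring \<Rightarrow> 'a fg_module \<Rightarrow> 'a fg_module \<Rightarrow> 'a fg_map set" where
  "projective_maps R X Y =
     {compose (carrier X) h g | Q g h. Q \<in> projectives R \<and> g \<in> mod_hom R X Q \<and> h \<in> mod_hom R Q Y}"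

definition stable_class :: "'a ring \<Rightarrow> 'a fg_module \<Rightarrow> 'a fg_module \<Rightarrow> 'a fg_map \<Rightarrow> 'a fg_map set" where
  "stable_class R X Y f = projective_maps R X Y #>\<^bsub>hom_group R X Y\<^esub> f"

text \<open>
  All representatives of two stable maps have the same composite modulo \<open>projective_maps\<close>, so the
  union below is a single class.
\<close>

definition stable_category :: "'a ring \<Rightarrow> ('a fg_module, 'a fg_map set) category_data" where
  "stable_category R = \<lparr>cat_ob = CM R,
     cat_hom = (\<lambda>X Y. hom_group R X Y Mod projective_maps R X Y),
     cat_comp = (\<lambda>X Y Z G F. \<Union>g\<in>G. \<Union>f\<in>F. stable_class R X Z (compose (carrier X) g f)),
     cat_id = (\<lambda>X. stable_class R X X (\<lambda>x\<in>carrier X. x))\<rparr>"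

text \<open>
  The triangulated structure is Happel's structure on the stable category of a Frobenius category:
  for Gorenstein \<open>R\<close>, the exact category of Cohen-Macaulay modules is Frobenius with the projective
  modules as its projective-injective objects. We choose for every \<open>X\<close> an exact sequence
  \<open>0 \<rightarrow> X \<rightarrow> I X \<rightarrow> \<Sigma>X \<rightarrow> 0\<close> in it, with \<open>I X\<close> projective, with maps \<open>i\<close> and \<open>p\<close>.
\<close>

definition susp_sequence ::
  "'a ring \<Rightarrow> 'a fg_module \<Rightarrow> 'a fg_module \<times> 'a fg_module \<times> 'a fg_map \<times> 'a fg_map" where
  "susp_sequence R X = (SOME (I, S, i, p). I \<in> projectives R \<and> S \<in> CM R \<and> short_exact R X I S i p)"

definition susp_I :: "'a ring \<Rightarrow> 'a fg_module \<Rightarrow> 'a fg_module" where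
  "susp_I R X = (case susp_sequence R X of (I, S, i, p) \<Rightarrow> I)"

definition susp_ob :: "'a ring \<Rightarrow> 'a fg_module \<Rightarrow> 'a fg_module" where
  "susp_ob R X = (case susp_sequence R X of (I, S, i, p) \<Rightarrow> S)"

definition susp_i :: "'a ring \<Rightarrow> 'a fg_module \<Rightarrow> 'a fg_map" where
  "susp_i R X = (case susp_sequence R X of (I, S, i, p) \<Rightarrow> i)"

definition susp_p :: "'a ring \<Rightarrow> 'a fg_module \<Rightarrow> 'a fg_map" where
  "susp_p R X = (case susp_sequence R X of (I, S, i, p) \<Rightarrow> p)"

text \<open>
  The shift of the class of \<open>f\<close> is the class of any \<open>g\<close> which, for some \<open>h\<close>, makes
  \<open>(f, h, g)\<close> a map from the chosen sequence of \<open>X\<close> to that of \<open>Y\<close>. This class is independent of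
  \<open>f\<close>, \<open>g\<close>, \<open>h\<close>, so again the union is a single class.
\<close>

definition susp_mor :: "'a ring \<Rightarrow> 'a fg_module \<Rightarrow> 'a fg_module \<Rightarrow> 'a fg_map set \<Rightarrow> 'a fg_map set" where
  "susp_mor R X Y F = \<Union>{stable_class R (susp_ob R X) (susp_ob R Y) g | f h g.
     f \<in> F \<and> h \<in> mod_hom R (susp_I R X) (susp_I R Y) \<and> g \<in> mod_hom R (susp_ob R X) (susp_ob R Y) \<and>
     compose (carrier X) h (susp_i R X) = compose (carrier X) (susp_i R Y) f \<and>
     compose (carrier (susp_I R X)) g (susp_p R X) = compose (carrier (susp_I R X)) (susp_p R Y) h}"

definition susp_functor :: "'a ring \<Rightarrow> ('a fg_module, 'a fg_map set, 'a fg_module, 'a fg_map set) functor_data" where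
  "susp_functor R = \<lparr>fun_ob = susp_ob R, fun_mor = susp_mor R\<rparr>"

text \<open>
  The standard triangle of \<open>u : X \<rightarrow> Y\<close>, from the pushout of the chosen sequence of \<open>X\<close> along \<open>u\<close>:
  \<open>v : Y \<rightarrow> Z\<close> and \<open>j : I X \<rightarrow> Z\<close> are the pushout maps, and \<open>w : Z \<rightarrow> \<Sigma>X\<close> is determined by
  \<open>w \<circ> j = p\<close> and \<open>w \<circ> v = 0\<close>.
\<close>

definition standard_triangles :: "'a ring \<Rightarrow> ('a fg_module, 'a fg_map set) triangle set" where
  "standard_triangles R =
     {(X, Y, Z, stable_class R X Y u, stable_class R Y Z v, stable_class R Z (susp_ob R X) w)
       | X Y Z u v w j.
         is_pushout (CM_category R) X (susp_I R X) Y Z (susp_i R X) u j v \<and>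
         w \<in> mod_hom R Z (susp_ob R X) \<and>
         compose (carrier (susp_I R X)) w j = susp_p R X \<and>
         compose (carrier Y) w v = zero_map Y (susp_ob R X)}"

definition distinguished_triangles :: "'a ring \<Rightarrow> ('a fg_module, 'a fg_map set) triangle set" where
  "distinguished_triangles R = {T. is_triangle (stable_category R) (susp_functor R) T \<and>
     (\<exists>T'\<in>standard_triangles R. isomorphic_triangles (stable_category R) (susp_functor R) T T')}"

definition stable_CM :: "'a ring \<Rightarrow> ('a fg_module, 'a fg_map set) triangulated_data" where
  "stable_CM R = category_data.extend (stable_category R)
     (triangulated_data.fields (susp_functor R) (distinguished_triangles R))"


section \<open>Idempotents and eventually homological isomorphisms\<close>

definition corner_ring :: "'a ring \<Rightarrow> 'a \<Rightarrow> 'a ring" where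
  "corner_ring R a = R\<lparr>carrier := {a \<otimes>\<^bsub>R\<^esub> x \<otimes>\<^bsub>R\<^esub> a | x. x \<in> carrier R}, monoid.one := a\<rparr>"

definition corner_module :: "'a \<Rightarrow> ('a, 'b) module \<Rightarrow> ('a, 'b) module" where
  "corner_module a M = M\<lparr>carrier := {a \<odot>\<^bsub>M\<^esub> x | x. x \<in> carrier M}\<rparr>"

definition corner_functor :: "'a \<Rightarrow> ('a fg_module, 'a fg_map, 'a fg_module, 'a fg_map) functor_data" where
  "corner_functor a = \<lparr>fun_ob = corner_module a,
     fun_mor = (\<lambda>X Y f. restrict f (carrier (corner_module a X)))\<rparr>"

text \<open>The isomorphisms of Ext groups need not be natural or induced by the functor.\<close>

definition eventually_homological_iso ::
  "'a ring \<Rightarrow> 'b ring \<Rightarrow> ('a fg_module, 'a fg_map, 'b fg_module, 'b fg_map) functor_data \<Rightarrow> bool" where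
  "eventually_homological_iso R S F \<longleftrightarrow> is_functor (mod_category R) (mod_category S) F \<and>
     (\<exists>t::int. \<forall>X\<in>fg_modules R. \<forall>Y\<in>fg_modules R. \<forall>j::nat. int j > t \<longrightarrow>
        ext_group R j X Y \<cong> ext_group S j (fun_ob F X) (fun_ob F Y))"

end

theory Submission
 imports Defs
begin

text \<open>The restriction \<open>e M = a M\<close> is exact and has a left adjoint \<open>l\<close> with invertible unit \<open>N \<rightarrow> e (l N)\<close>.
 As an eventually homological isomorphism, \<open>e\<close> preserves and reflects finite projective dimension.
 Cohen-Macaulay modules have no extensions by modules of finite projective dimension, so Cohen-Macaulay
 approximations show that \<open>l\<close> maps Cohen-Macaulay modules to Cohen-Macaulay modules, preserves their
 short exact sequences, and is fully faithful modulo projectives. It is stably dense: if \<open>C\<close>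
 approximates \<open>e Z\<close>, the cone of \<open>l C \<rightarrow> Z\<close> is Cohen-Macaulay of finite projective dimension, hence
 projective. The equivalence below is a quasi-inverse of \<open>l\<close>.\<close>

text \<open>The given Ext isomorphisms are neither natural nor induced by the functor, so only the
  vanishing of Ext in high degrees passes between the two algebras. Finite projective dimension is
  therefore stated as eventual vanishing of Ext, and the transfer goes through it. That the corner
  is Gorenstein is not assumed: bounded Ext into the corner ring and embeddings of its
  Cohen-Macaulay modules into projectives are both derived along the adjunction. For the algebra
  itself, the left injective dimension bounds Ext into the ring, while the right one, through
  duality, embeds Cohen-Macaulay modules into projectives; the artinian base ring makes all rings
  involved noetherian on both sides. Restriction itself is not taken as the equivalence, because the
  restriction of a projective is only known to have finite projective dimension. The homological
  part lives in abstract exact categories whose arrows all lie in one ring, so that diagram chases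
  become ring algebra; homomorphisms of modules are put into this form as additive endomorphisms of
  one large product.\<close>

abbreviation (input) in_carrier (infix "IN" 50)
 where "x IN M \<equiv> x \<in> carrier M"

abbreviation (input) "reg \<equiv> regular_module"

abbreviation (input) "lmod \<equiv> left_module"

abbreviation (input) "cmp M \<equiv> compose (carrier M)"

abbreviation (input) "stcomp R \<equiv> cat_comp (stable_category R)"

abbreviation (input) "fgm \<equiv> fg_modules"

section \<open>Exact categories\<close>

lemma mult_eq_left: "a * b = c ==> a * (b * x) = c * (x::'e::semigroup_mult)"
 by (metis mult.assoc)

text \<open>Keeping all arrows in one ring lets composites and sums be simplified with
  \<open>mult.assoc\<close> and \<open>algebra_simps\<close> before any membership in hom-sets is
  checked. The ring class has no unit, so identities are the local units \<open>idn X\<close>. The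
  extra clauses of \<open>pullback\<close> and \<open>pushout\<close> say what happens when the
  other leg is itself a deflation or an inflation: its kernel or cokernel is inherited by the
  opposite side of the square.\<close>

locale exact_category =
 fixes Ob :: "'o set" and Hom :: "'o => 'o => 'e::ring set" and idn :: "'o => 'e"
  and ses :: "'o => 'o => 'o => 'e => 'e => bool"
 assumes Hom_Ob: "f \<in> Hom X Y ==> X \<in> Ob & Y \<in> Ob"
  and Hom_zero: "X \<in> Ob ==> Y \<in> Ob ==> 0 \<in> Hom X Y"
  and Hom_add: "f \<in> Hom X Y ==> g \<in> Hom X Y ==> f + g \<in> Hom X Y"
  and Hom_uminus: "f \<in> Hom X Y ==> - f \<in> Hom X Y"
  and Hom_comp: "f \<in> Hom X Y ==> g \<in> Hom Y Z ==> g * f \<in> Hom X Z"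
  and idn_Hom: "X \<in> Ob ==> idn X \<in> Hom X X"
  and idn_left: "f \<in> Hom X Y ==> idn Y * f = f"
  and idn_right: "f \<in> Hom X Y ==> f * idn X = f"
  and ses_Hom: "ses A B C i p ==> i \<in> Hom A B & p \<in> Hom B C"
  and ses_zero: "ses A B C i p ==> p * i = 0"
  and ses_mono: "ses A B C i p ==> g \<in> Hom D A ==> i * g = 0 ==> g = 0"
  and ses_epi: "ses A B C i p ==> g \<in> Hom C D ==> g * p = 0 ==> g = 0"
  and ses_ker: "ses A B C i p ==> f \<in> Hom D B ==> p * f = 0 ==> \<exists>g\<in>Hom D A. i * g = f"
  and ses_coker: "ses A B C i p ==> f \<in> Hom B D ==> f * i = 0 ==> \<exists>g\<in>Hom C D. g * p = f"
  and ses_iso: "ses A B C i p ==>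
    a \<in> Hom A' A ==> a' \<in> Hom A A' ==> a * a' = idn A ==> a' * a = idn A' ==>
    b \<in> Hom B B' ==> b' \<in> Hom B' B ==> b' * b = idn B ==> b * b' = idn B' ==>
    c \<in> Hom C C' ==> c' \<in> Hom C' C ==> c' * c = idn C ==> c * c' = idn C' ==>
    ses A' B' C' (b * i * a) (c * p * b')"
  and short_five: "ses A B C i p ==> ses A B' C i' p' ==> z \<in> Hom B B' ==> z * i = i' ==>
    p' * z = p ==> \<exists>z'\<in>Hom B' B. z' * z = idn B & z * z' = idn B'"
  and pullback: "ses A B C i p ==> f \<in> Hom D C ==>
    \<exists>E g i' p'. ses A E D i' p' & g \<in> Hom E B & g * i' = i & f * p' = p * g &
     (\<forall>K k. ses K D C k f --> (\<exists>k'. ses K E B k' g)) &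
     (\<forall>F q. ses D C F f q --> ses E B F g (q * p))"
  and pushout: "ses A B C i p ==> f \<in> Hom A D ==>
    \<exists>Z v j w. ses D Z C v w & j \<in> Hom B Z & j * i = v * f & w * j = p &
     (\<forall>F q. ses A D F f q --> (\<exists>q'. ses B Z F j q')) &
     (\<forall>K k. ses K A D k f --> ses K B Z (i * k) j) &
     (\<forall>W. \<forall>g\<in>Hom B W. \<forall>h\<in>Hom D W. g * i = h * f --> (\<exists>t\<in>Hom Z W. t * j = g & t * v = h))"
  and image_factorization: "f \<in> Hom A B ==>
    \<exists>T I F t q m r. ses T A I t q & ses I B F m r & f = m * q"
begin

lemma Hom_diff: "f \<in> Hom X Y ==> g \<in> Hom X Y ==> f - g \<in> Hom X Y"
 using Hom_add[of f X Y "- g"] Hom_uminus by simp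

lemma ses_Hom1: "ses A B C i p ==> i \<in> Hom A B"
 and ses_Hom2: "ses A B C i p ==> p \<in> Hom B C" using ses_Hom by auto

lemma ses_Ob: "ses A B C i p ==> A \<in> Ob & B \<in> Ob & C \<in> Ob"
 using ses_Hom Hom_Ob by blast

lemma ses_mono_eq: "ses A B C i p ==> g \<in> Hom D A ==> h \<in> Hom D A ==> i * g = i * h ==> g = h"
 using ses_mono[of A B C i p "g - h" D] Hom_diff[of g D A h] by (simp add: algebra_simps)

lemma ses_epi_eq: "ses A B C i p ==> g \<in> Hom C D ==> h \<in> Hom C D ==> g * p = h * p ==> g = h"
 using ses_epi[of A B C i p "g - h" D] Hom_diff[of g C D h] by (simp add: algebra_simps)

lemmas Hom_rules = Hom_comp Hom_add Hom_diff Hom_uminus Hom_zero idn_Hom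

lemma ses_iso_left:
 assumes "ses A B C i p" "a \<in> Hom A' A" "a' \<in> Hom A A'" "a * a' = idn A" "a' * a = idn A'"
 shows "ses A' B C (i * a) p"
proof -
 have "B \<in> Ob" "C \<in> Ob" using ses_Ob assms(1) by auto
 hence "ses A' B C (idn B * i * a) (idn C * p * idn B)" using ses_iso[OF assms] idn_Hom idn_left by blast
 thus ?thesis using ses_Hom1[OF assms(1)] ses_Hom2[OF assms(1)] by (simp add: idn_left idn_right)
qed

lemma ses_iso_mid:
 assumes "ses A B C i p" "b \<in> Hom B B'" "b' \<in> Hom B' B" "b' * b = idn B" "b * b' = idn B'"
 shows "ses A B' C (b * i) (p * b')"
proof -
 have O: "A \<in> Ob" "C \<in> Ob" using ses_Ob assms(1) by auto
 have H: "b * i \<in> Hom A B'" "p * b' \<in> Hom B' C" using assms ses_Hom Hom_comp by blast+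
 have "ses A B' C (b * i * idn A) (idn C * p * b')"
  by (rule ses_iso[OF assms(1) _ _ _ _ assms(2-5)]) (use O idn_Hom idn_left in blast)+
 thus ?thesis using idn_right[OF H(1)] idn_left[OF H(2)] by (simp add: mult.assoc)
qed

lemma ses_iso_right:
 assumes "ses A B C i p" "c \<in> Hom C C'" "c' \<in> Hom C' C" "c' * c = idn C" "c * c' = idn C'"
 shows "ses A B C' i (c * p)"
proof -
 have O: "A \<in> Ob" "B \<in> Ob" using ses_Ob assms(1) by auto
 have H: "c * p \<in> Hom B C'" using assms ses_Hom Hom_comp by blast
 have "ses A B C' (idn B * i * idn A) (c * p * idn B)"
  by (rule ses_iso[OF assms(1) _ _ _ _ _ _ _ _ assms(2-5)]) (use O idn_Hom idn_left in blast)+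
 thus ?thesis using idn_right[OF H] ses_Hom1[OF assms(1)] by (simp add: idn_left idn_right mult.assoc)
qed

text \<open>The axioms name no zero object; this produces one. In the image factorization
  \<open>m * q\<close> of the identity the kernel \<open>t\<close> is killed by
  \<open>m * q\<close>, hence zero, and a zero arrow that is mono has a source with
  \<open>idn T = 0\<close>.\<close>

lemma ses_idn:
 assumes "M \<in> Ob"
 obtains T where "ses T M M 0 (idn M)" "idn T = 0"
proof -
 obtain T I F t q m r where s: "ses T M I t q" "ses I M F m r" "idn M = m * q"
  using image_factorization[OF idn_Hom[OF assms]] by blast
 have h: "t \<in> Hom T M" "q \<in> Hom M I" "m \<in> Hom I M" using s ses_Hom by auto
 have "t = 0" using h s ses_zero[OF s(1)] idn_left[OF h(1)] by (metis mult.assoc mult_zero_right)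
 have "idn T = 0" using ses_mono[OF s(1), of "idn T" T] \<open>t = 0\<close> ses_Ob s(1) idn_Hom by simp
 have "m * (q * m) = m * idn I" using s(3) idn_left[OF h(3)] idn_right[OF h(3)] by (metis mult.assoc)
 hence "q * m = idn I" using ses_mono_eq[OF s(2), of "q * m" I "idn I"] h Hom_comp idn_Hom Hom_Ob by blast
 hence "ses T M M t (m * q)" using ses_iso_right[OF s(1) h(3) h(2)] s(3) by simp
 thus ?thesis using that \<open>idn T = 0\<close> \<open>t = 0\<close> s(3) by simp
qed

section \<open>Projective objects and arrows factoring through them\<close>

definition proj :: "'o => bool" where
 "proj P \<longleftrightarrow> P \<in> Ob & (\<forall>A B C i p f. ses A B C i p --> f \<in> Hom P C --> (\<exists>g\<in>Hom P B. p * g = f))"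

lemma proj_Ob: "proj P ==> P \<in> Ob" by (simp add: proj_def)

lemma proj_lift: "proj P ==> ses A B C i p ==> f \<in> Hom P C ==> \<exists>g\<in>Hom P B. p * g = f"
 unfolding proj_def by blast

lemma proj_retract:
 assumes "proj P" "s \<in> Hom X P" "r \<in> Hom P X" "r * s = idn X"
 shows "proj X"
 unfolding proj_def
proof (intro conjI allI impI)
 show "X \<in> Ob" using assms Hom_Ob by blast
 fix A B C i p f assume a: "ses A B C i p" "f \<in> Hom X C"
 then obtain g where g: "g \<in> Hom P B" "p * g = f * r"
  using proj_lift[OF assms(1) a(1), of "f * r"] Hom_comp assms by blast
 have "p * (g * s) = f" using g assms idn_right[OF a(2)] by (metis mult.assoc)
 thus "\<exists>g\<in>Hom X B. p * g = f" using g assms Hom_comp by blast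
qed

definition pmaps :: "'o => 'o => 'e set" where
 "pmaps X Y = {h * g | Q g h. proj Q & g \<in> Hom X Q & h \<in> Hom Q Y}"

lemma pmapsI: "proj Q ==> g \<in> Hom X Q ==> h \<in> Hom Q Y ==> h * g \<in> pmaps X Y"
 unfolding pmaps_def by blast

lemma pmapsE:
 assumes "f \<in> pmaps X Y"
 obtains Q g h where "proj Q" "g \<in> Hom X Q" "h \<in> Hom Q Y" "f = h * g"
 using assms unfolding pmaps_def by blast

lemma pmaps_Hom: "f \<in> pmaps X Y ==> f \<in> Hom X Y"
 using Hom_comp by (auto elim!: pmapsE)

lemma pmaps_left: "f \<in> pmaps X Y ==> g \<in> Hom Y Z ==> g * f \<in> pmaps X Z"
 using pmapsI[OF _ _ Hom_comp] by (auto elim!: pmapsE simp flip: mult.assoc)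

lemma pmaps_right: "f \<in> pmaps X Y ==> g \<in> Hom W X ==> f * g \<in> pmaps W Y"
 using pmapsI[OF _ Hom_comp] by (auto elim!: pmapsE simp: mult.assoc)

lemma pmaps_uminus: "f \<in> pmaps X Y ==> - f \<in> pmaps X Y"
 by (elim pmapsE) (metis Hom_uminus mult_minus_left pmapsI)

text \<open>A retract modulo arrows through projectives. Vanishing of Ext passes along this
  relation, and so do syzygies, which replaces direct sums with projectives in Schanuel-type
  arguments.\<close>

definition stable_retract :: "'o => 'o => bool" where
 "stable_retract X' X \<longleftrightarrow> (\<exists>f\<in>Hom X' X. \<exists>g\<in>Hom X X'. g * f - idn X' \<in> pmaps X' X')"

text \<open>\<open>ext1z X Y\<close> says that the first extension group vanishes, and \<open>extz n\<close> that the
 \<open>(n + 1)\<close>-st does.\<close>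

definition ext1z :: "'o => 'o => bool" where
 "ext1z X Y \<longleftrightarrow> (\<forall>K M k m f. ses K M X k m --> f \<in> Hom K Y --> (\<exists>g\<in>Hom M Y. g * k = f))"

lemma ext1z_extend: "ext1z X Y ==> ses K M X k m ==> f \<in> Hom K Y ==> \<exists>g\<in>Hom M Y. g * k = f"
 unfolding ext1z_def by blast

text \<open>A square between two sequences with the same end \<open>C\<close> is a pushout as soon
  as it commutes. The comparison \<open>z\<close> from the pushout of the axiom induces identities
  on both ends, so \<open>short_five\<close> inverts it, and the clauses of \<open>pushout\<close>
  can be moved along \<open>z\<close>.\<close>

lemma pushout_iso:
 assumes "ses A B C i p" "ses D Z C v w" "j \<in> Hom B Z" "f \<in> Hom A D" "j * i = v * f" "w * j = p"
 obtains Z0 v0 j0 w0 z z' where "ses D Z0 C v0 w0" "j0 \<in> Hom B Z0" "z \<in> Hom Z0 Z" "z' \<in> Hom Z Z0"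
  "z' * z = idn Z0" "z * z' = idn Z" "z * v0 = v" "z * j0 = j" "w * z = w0"
  "\<And>K k. ses K A D k f ==> ses K B Z0 (i * k) j0"
  "\<And>F q. ses A D F f q ==> \<exists>q'. ses B Z0 F j0 q'"
  "\<And>W g h. g \<in> Hom B W ==> h \<in> Hom D W ==> g * i = h * f ==> \<exists>t\<in>Hom Z0 W. t * j0 = g & t * v0 = h"
proof -
 obtain Z0 v0 j0 w0 where z0: "ses D Z0 C v0 w0" "j0 \<in> Hom B Z0" "j0 * i = v0 * f" "w0 * j0 = p"
  and z1: "\<And>K k. ses K A D k f ==> ses K B Z0 (i * k) j0"
  and z3: "\<And>F q. ses A D F f q ==> \<exists>q'. ses B Z0 F j0 q'"
  and z2: "\<And>W g h. g \<in> Hom B W ==> h \<in> Hom D W ==> g * i = h * f ==> \<exists>t\<in>Hom Z0 W. t * j0 = g & t * v0 = h"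
  using pushout[OF assms(1,4)] by metis
 obtain z where z: "z \<in> Hom Z0 Z" "z * j0 = j" "z * v0 = v" using z2[of j Z v] assms ses_Hom by blast
 have h: "w \<in> Hom Z C" "w0 \<in> Hom Z0 C" using assms z0 ses_Hom by auto
 \<comment> \<open>\<open>w * z\<close> and \<open>w0\<close> both vanish on \<open>v0\<close> and
   both become \<open>p\<close> on \<open>j0\<close>; the first fact gives a factor \<open>t\<close>
   of the difference through \<open>w0\<close>, the second forces \<open>t = 0\<close>.\<close>
 have "(w * z - w0) * v0 = 0" using z ses_zero[OF assms(2)] ses_zero[OF z0(1)] by (simp add: algebra_simps)
 then obtain t where t: "t \<in> Hom C C" "t * w0 = w * z - w0"
  using ses_coker[OF z0(1), of "w * z - w0" C] h z Hom_comp Hom_diff by blast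
 have "t * p = w * z * j0 - w0 * j0" using t(2) z0(4) by (metis left_diff_distrib mult.assoc)
 hence "t * p = 0" using z z0 assms by (simp add: mult.assoc)
 hence "t = 0" using ses_epi[OF assms(1) t(1)] by simp
 hence w: "w * z = w0" using t by simp
 obtain z' where z': "z' \<in> Hom Z Z0" "z' * z = idn Z0" "z * z' = idn Z"
  using short_five[OF z0(1) assms(2) z(1) z(3) w] by blast
 show ?thesis by (rule that[OF z0(1,2) z(1) z' z(3,2) w]) (fact z1 z3 z2)+
qed

lemma pushout_universal:
 assumes "ses A B C i p" "ses D Z C v w" "j \<in> Hom B Z" "f \<in> Hom A D" "j * i = v * f" "w * j = p"
  and "g \<in> Hom B W" "h \<in> Hom D W" "g * i = h * f"
 shows "\<exists>t\<in>Hom Z W. t * j = g & t * v = h"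
proof -
 obtain Z0 v0 j0 w0 z z' where z: "z \<in> Hom Z0 Z" "z' \<in> Hom Z Z0"
  "z' * z = idn Z0" "z * v0 = v" "z * j0 = j" "ses D Z0 C v0 w0" "j0 \<in> Hom B Z0"
  and u: "\<exists>t\<in>Hom Z0 W. t * j0 = g & t * v0 = h" using pushout_iso[OF assms(1-6)] assms(7-9) by metis
 obtain t where t: "t \<in> Hom Z0 W" "t * j0 = g" "t * v0 = h" using u by blast
 have "t * z' * z = t" using z(3) idn_right[OF t(1)] by (simp add: mult.assoc)
 hence "t * z' * j = g" "t * z' * v = h" using t z by (metis mult.assoc)+
 thus ?thesis using Hom_comp[OF z(2) t(1)] by blast
qed

lemma pushout_unique:
 assumes "ses A B C i p" "ses D Z C v w" "w * j = p" "j \<in> Hom B Z"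
  and "t \<in> Hom Z W" "t' \<in> Hom Z W" "t * j = t' * j" "t * v = t' * v"
 shows "t = t'"
proof -
 have "(t - t') * v = 0" using assms by (simp add: algebra_simps)
 then obtain s where s: "s \<in> Hom C W" "s * w = t - t'"
  using ses_coker[OF assms(2), of "t - t'" W] assms Hom_diff by blast
 have "s * p = (t - t') * j" using s assms(3) by (metis mult.assoc)
 also have "\<dots> = 0" using assms by (simp add: algebra_simps)
 finally have "s = 0" using ses_epi[OF assms(1) s(1)] by simp
 thus ?thesis using s by simp
qed

lemma pushout_deflation:
 assumes "ses A B C i p" "ses D Z C v w" "j \<in> Hom B Z" "f \<in> Hom A D" "j * i = v * f" "w * j = p"
  and "ses K A D k f"
 shows "ses K B Z (i * k) j"
proof -
 obtain Z0 v0 j0 w0 z z' where z: "z \<in> Hom Z0 Z" "z' \<in> Hom Z Z0"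
  "z' * z = idn Z0" "z * z' = idn Z" "z * j0 = j" "ses K B Z0 (i * k) j0"
  using pushout_iso[OF assms(1-6)] assms(7) by metis
 show ?thesis using ses_iso_right[OF z(6) z(1,2,3,4)] z(5) by simp
qed

text \<open>Projectivity of \<open>P\<close> makes every sequence ending in \<open>X\<close> a
  pushout of the given one along some \<open>t\<close>. An extension of \<open>f * t\<close> over
  \<open>P\<close> and \<open>f\<close> itself then glue to an extension of
  \<open>f\<close>.\<close>

lemma ext1z_proj_test:
 assumes s: "ses K P X k p" and "proj P" and ext: "\<And>f. f \<in> Hom K Y ==> \<exists>g\<in>Hom P Y. g * k = f"
 shows "ext1z X Y"
 unfolding ext1z_def
proof (intro allI impI)
 fix K' M k' m f assume a: "ses K' M X k' m" "f \<in> Hom K' Y"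
 obtain l where l: "l \<in> Hom P M" "m * l = p" using proj_lift[OF assms(2) a(1)] s ses_Hom by blast
 have "m * (l * k) = 0" using l ses_zero[OF s] by (metis mult.assoc)
 then obtain t where t: "t \<in> Hom K K'" "k' * t = l * k"
  using ses_ker[OF a(1), of "l * k" K] l s ses_Hom Hom_comp by blast
 obtain g where g: "g \<in> Hom P Y" "g * k = f * t" using ext[of "f * t"] t a Hom_comp by blast
 thus "\<exists>g\<in>Hom M Y. g * k' = f"
  using pushout_universal[OF s a(1) l(1) t(1) t(2)[symmetric] l(2) g(1) a(2)] by blast
qed

text \<open>The pullback of the sequence along \<open>f\<close> ends in \<open>X\<close>, so the
  identity of \<open>K\<close> extends to a retraction \<open>r\<close> and the sequence splits. The
  section \<open>t\<close> of \<open>m'\<close> followed by \<open>g\<close> lifts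
  \<open>f\<close>.\<close>

lemma ext1z_lift:
 assumes E: "ext1z X K" and s: "ses K M W k m" and f: "f \<in> Hom X W"
 shows "\<exists>g\<in>Hom X M. m * g = f"
proof -
 obtain N g k' m' where N: "ses K N X k' m'" "g \<in> Hom N M" "g * k' = k" "f * m' = m * g"
  using pullback[OF s f] by blast
 have O: "K \<in> Ob" "N \<in> Ob" "X \<in> Ob" using N ses_Ob by auto
 obtain r where r: "r \<in> Hom N K" "r * k' = idn K" using ext1z_extend[OF E N(1) idn_Hom[OF O(1)]] by blast
 have h: "k' \<in> Hom K N" "m' \<in> Hom N X" using N ses_Hom by auto
 have "(idn N - k' * r) * k' = 0" using r h by (simp add: algebra_simps idn_left idn_right)
 then obtain t where t: "t \<in> Hom X N" "t * m' = idn N - k' * r"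
  using ses_coker[OF N(1), of "idn N - k' * r" N] r h O Hom_diff Hom_comp idn_Hom by blast
 have "(m' * t) * m' = m' * idn N - m' * k' * r" using t(2) by (simp add: mult.assoc right_diff_distrib)
 also have "\<dots> = idn X * m'" using ses_zero[OF N(1)] h by (simp add: idn_left idn_right)
 finally have "(m' * t) * m' = idn X * m'" .
 hence "m' * t = idn X" using ses_epi_eq[OF N(1), of "m' * t" X "idn X"] t h O Hom_comp idn_Hom by blast
 hence "m * (g * t) = f" using N(4) idn_right[OF f] by (metis mult.assoc)
 thus ?thesis using t N Hom_comp by blast
qed

text \<open>The error \<open>g * f - idn X'\<close> is \<open>b * a\<close> through a projective,
  and \<open>b\<close> lifts to \<open>c\<close> through \<open>p'\<close>. Once
  \<open>c * (a * p')\<close> is subtracted, \<open>gP * fP - idn P'\<close> takes values in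
  \<open>K'\<close>, and this is the homotopy \<open>t\<close>.\<close>

lemma stable_retract_lift:
 assumes s: "ses K P X k p" "proj P" and s': "ses K' P' X' k' p'" "proj P'" and r: "stable_retract X' X"
 obtains fP fK gK t where "fP \<in> Hom P' P" "fK \<in> Hom K' K" "gK \<in> Hom K K'" "t \<in> Hom P' K'"
  "k * fK = fP * k'" "t * k' = gK * fK - idn K'"
proof -
 obtain f g where fg: "f \<in> Hom X' X" "g \<in> Hom X X'" "g * f - idn X' \<in> pmaps X' X'"
  using r unfolding stable_retract_def by blast
 obtain Q a b where Q: "proj Q" "a \<in> Hom X' Q" "b \<in> Hom Q X'" "g * f - idn X' = b * a"
  using fg(3) by (rule pmapsE)
 have h: "k \<in> Hom K P" "p \<in> Hom P X" "k' \<in> Hom K' P'" "p' \<in> Hom P' X'" using s s' ses_Hom by auto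
 have O: "P' \<in> Ob" "K' \<in> Ob" "X' \<in> Ob" using h Hom_Ob by auto
 obtain fP where fP: "fP \<in> Hom P' P" "p * fP = f * p'"
  using proj_lift[OF s'(2) s(1), of "f * p'"] h fg Hom_comp by blast
 obtain gP where gP: "gP \<in> Hom P P'" "p' * gP = g * p"
  using proj_lift[OF s(2) s'(1), of "g * p"] h fg Hom_comp by blast
 have "p * (fP * k') = 0" using fP ses_zero[OF s'(1)] by (metis mult.assoc mult_zero_right)
 then obtain fK where fK: "fK \<in> Hom K' K" "k * fK = fP * k'"
  using ses_ker[OF s(1), of "fP * k'" K'] fP h Hom_comp by blast
 have "p' * (gP * k) = 0" using gP ses_zero[OF s(1)] by (metis mult.assoc mult_zero_right)
 then obtain gK where gK: "gK \<in> Hom K K'" "k' * gK = gP * k"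
  using ses_ker[OF s'(1), of "gP * k" K] gP h Hom_comp by blast
 obtain c where c: "c \<in> Hom Q P'" "p' * c = b" using proj_lift[OF Q(1) s'(1) Q(3)] by blast
 have "b * (a * p') = (g * f - idn X') * p'" using Q(4) by (simp add: mult.assoc)
 also have "\<dots> = g * (f * p') - p'" using h(4) by (simp add: algebra_simps idn_left)
 finally have e: "b * (a * p') = g * (f * p') - p'" .
 have "p' * (gP * fP - idn P' - c * (a * p')) = p' * gP * fP - p' * idn P' - p' * c * (a * p')"
  by (simp add: algebra_simps)
 also have "\<dots> = 0" using e by (simp add: mult.assoc idn_right[OF h(4)] gP(2) fP(2) c(2))
 finally have "p' * (gP * fP - idn P' - c * (a * p')) = 0" .
 moreover have "gP * fP - idn P' - c * (a * p') \<in> Hom P' P'"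
  using gP(1) fP(1) c(1) Q(2) h(4) O by (intro Hom_diff) (blast intro: Hom_comp idn_Hom)+
 ultimately obtain t where t: "t \<in> Hom P' K'" "k' * t = gP * fP - idn P' - c * (a * p')"
  using ses_ker[OF s'(1)] by blast
 have "k' * (t * k') = (gP * fP - idn P' - c * (a * p')) * k'" using t(2) by (metis mult.assoc)
 also have "\<dots> = gP * (fP * k') - k'" using ses_zero[OF s'(1)] by (simp add: algebra_simps idn_left[OF h(3)])
 also have "\<dots> = k' * (gK * fK - idn K')"
  using gK(2)[THEN mult_eq_left] fK(2) by (simp add: algebra_simps idn_right[OF h(3)])
 finally have "t * k' = gK * fK - idn K'"
  using ses_mono_eq[OF s'(1) Hom_comp[OF h(3) t(1)] Hom_diff[OF Hom_comp[OF fK(1) gK(1)] idn_Hom[OF O(2)]]] by simp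
 thus ?thesis using that fP fK gK t by blast
qed

text \<open>For \<open>X' = X\<close> this is Schanuel's lemma: the kernels of two projective covers
  of the same object are stable retracts of each other.\<close>

lemma stable_retract_syzygy:
 assumes "ses K P X k p" "proj P" "ses K' P' X' k' p'" "proj P'" "stable_retract X' X"
 shows "stable_retract K' K"
proof -
 obtain fP fK gK t where t: "fK \<in> Hom K' K" "gK \<in> Hom K K'" "t \<in> Hom P' K'" "t * k' = gK * fK - idn K'"
  using stable_retract_lift[OF assms] by metis
 have "gK * fK - idn K' \<in> pmaps K' K'" using pmapsI[OF assms(4) _ t(3)] t(4) assms(3) ses_Hom by metis
 thus ?thesis unfolding stable_retract_def using t by blast
qed

lemma stable_retract_refl:
 assumes "ses K P X k p" "proj P" shows "stable_retract X X"
proof -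
 have O: "X \<in> Ob" using assms ses_Ob by blast
 have "idn X * idn X - idn X = 0 * 0" using idn_left[OF idn_Hom[OF O]] by simp
 also have "\<dots> \<in> pmaps X X" using pmapsI[OF assms(2)] Hom_zero O proj_Ob[OF assms(2)] by blast
 finally show ?thesis unfolding stable_retract_def using idn_Hom[OF O] by blast
qed

end

section \<open>Vanishing of higher Ext by dimension shifting\<close>

locale exact_category_projectives = exact_category Ob Hom idn ses
 for Ob :: "'o set" and Hom :: "'o => 'o => 'e::ring set" and idn ses +
 assumes enough_projectives: "X \<in> Ob ==> \<exists>K P k p. ses K P X k p & proj P"
begin

lemma proj_cover:
 assumes "X \<in> Ob" obtains K P k p where "ses K P X k p" "proj P" using enough_projectives[OF assms] by blast

lemma ext1z_stable_retract:
 assumes r: "stable_retract X' X" and E: "ext1z X Y"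
 shows "ext1z X' Y"
proof -
 have "X' \<in> Ob" "X \<in> Ob" using r Hom_Ob unfolding stable_retract_def by auto
 then obtain K P k p K' P' k' p' where s: "ses K P X k p" "proj P" and s': "ses K' P' X' k' p'" "proj P'"
  using proj_cover by metis
 obtain fP fK gK t where t: "fP \<in> Hom P' P" "fK \<in> Hom K' K" "gK \<in> Hom K K'" "t \<in> Hom P' K'"
  "k * fK = fP * k'" "t * k' = gK * fK - idn K'" using stable_retract_lift[OF s s' r] by metis
 show ?thesis
 proof (rule ext1z_proj_test[OF s'])
  fix f assume f: "f \<in> Hom K' Y"
  obtain e where e: "e \<in> Hom P Y" "e * k = f * gK"
   using ext1z_extend[OF E s(1), of "f * gK"] f t Hom_comp by blast
  \<comment> \<open>On \<open>K'\<close> the arrow \<open>e * fP\<close> is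
    \<open>f * gK * fK\<close>, which differs from \<open>f\<close> by \<open>f * t * k'\<close>; so
    \<open>e * fP - f * t\<close> extends \<open>f\<close>.\<close>
  have "e * (fP * k') = f * (gK * fK)" using e(2) t(5) by (metis mult.assoc)
  moreover have "f * (t * k') = f * (gK * fK) - f" using t(6) idn_right[OF f] by (simp only: right_diff_distrib)
  ultimately have "(e * fP - f * t) * k' = f" by (simp add: algebra_simps)
  moreover have "e * fP - f * t \<in> Hom P' Y" using e f t Hom_comp Hom_diff by blast
  ultimately show "\<exists>g\<in>Hom P' Y. g * k' = f" by blast
 qed
qed

text \<open>A fixed choice of first syzygy makes \<open>extz\<close> primitive recursive;
  \<open>extz_syzygy\<close> shows that any other projective cover gives the same result.\<close>

definition syz :: "'o => 'o" where
 "syz X = (SOME K. \<exists>P k p. ses K P X k p & proj P)"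

lemma syz_ses: assumes "X \<in> Ob" obtains P k p where "ses (syz X) P X k p" "proj P"
 using someI_ex[OF enough_projectives[OF assms]] unfolding syz_def by blast

primrec extz :: "nat => 'o => 'o => bool" where
 "extz 0 X Y = ext1z X Y"
| "extz (Suc n) X Y = extz n (syz X) Y"

lemma extz_stable_retract: "stable_retract X' X ==> extz n X Y ==> extz n X' Y"
proof (induction n arbitrary: X X')
 case 0 thus ?case using ext1z_stable_retract by simp
next
 case (Suc n)
 have "X' \<in> Ob" "X \<in> Ob" using Suc.prems Hom_Ob unfolding stable_retract_def by auto
 then obtain P k p P' k' p' where "ses (syz X) P X k p" "proj P" "ses (syz X') P' X' k' p'" "proj P'"
  using syz_ses by metis
 hence "stable_retract (syz X') (syz X)" using stable_retract_syzygy Suc.prems by blast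
 thus ?case using Suc by simp
qed

lemma extz_syzygy:
 assumes "ses K P X k p" "proj P"
 shows "extz (Suc n) X Y \<longleftrightarrow> extz n K Y"
proof -
 obtain P' k' p' where s: "ses (syz X) P' X k' p'" "proj P'" using syz_ses assms ses_Ob by metis
 have "stable_retract K (syz X)" "stable_retract (syz X) K"
  using stable_retract_syzygy s assms stable_retract_refl by metis+
 thus ?thesis using extz_stable_retract by auto
qed

lemma syz_Ob: "X \<in> Ob ==> syz X \<in> Ob"
 by (metis syz_ses ses_Ob)

lemma stable_retract_iso:
 assumes "f \<in> Hom X' X" "g \<in> Hom X X'" "g * f = idn X'"
 shows "stable_retract X' X"
proof -
 have O: "X' \<in> Ob" using assms Hom_Ob by auto
 obtain K P k p where "ses K P X' k p" "proj P" using proj_cover[OF O] by metis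
 hence "0 \<in> pmaps X' X'" using pmapsI[of P 0 X' 0 X'] O Hom_zero proj_Ob by simp
 thus ?thesis unfolding stable_retract_def using assms by force
qed

lemma extz_retract_right:
 assumes "s \<in> Hom Y' Y" "r \<in> Hom Y Y'" "r * s = idn Y'"
 shows "extz n X Y ==> extz n X Y'"
proof (induction n arbitrary: X)
 case 0
 show ?case unfolding extz.simps ext1z_def
 proof (intro allI impI)
  fix K M k m f assume a: "ses K M X k m" "f \<in> Hom K Y'"
  obtain g where g: "g \<in> Hom M Y" "g * k = s * f"
   using ext1z_extend[of X Y K M k m "s * f"] 0 a assms Hom_comp by auto
  have "r * g * k = f" using g assms idn_left[OF a(2)] by (metis mult.assoc)
  thus "\<exists>g\<in>Hom M Y'. g * k = f" using Hom_comp[OF g(1) assms(2)] by blast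
 qed
qed simp

lemma ext1z_proj: assumes "proj P" "Y \<in> Ob" shows "ext1z P Y"
proof -
 have O: "P \<in> Ob" using assms proj_Ob by auto
 obtain T where T: "ses T P P 0 (idn P)" "idn T = 0" using ses_idn[OF O] by metis
 show ?thesis
 proof (rule ext1z_proj_test[OF T(1) assms(1)])
  fix f assume f: "f \<in> Hom T Y"
  hence "f = 0" using idn_right[OF f] T by simp
  thus "\<exists>g\<in>Hom P Y. g * 0 = f" using Hom_zero O assms by auto
 qed
qed

lemma zero_proj: assumes "T \<in> Ob" "idn T = 0" shows "proj T"
 unfolding proj_def
proof (intro conjI allI impI)
 fix A B C i p f assume a: "ses A B C i p" "f \<in> Hom T C"
 hence "f = 0" using idn_right[OF a(2)] assms by simp
 thus "\<exists>g\<in>Hom T B. p * g = f" using Hom_zero a assms ses_Ob by (metis mult_zero_right)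
qed fact

lemma extz_proj: "proj P ==> Y \<in> Ob ==> extz n P Y"
proof (induction n arbitrary: P)
 case 0 thus ?case using ext1z_proj by simp
next
 case (Suc n)
 obtain T where T: "ses T P P 0 (idn P)" "idn T = 0" using ses_idn proj_Ob Suc by metis
 hence "proj T" using zero_proj ses_Ob by metis
 thus ?case using extz_syzygy[OF T(1) Suc.prems(1)] Suc by simp
qed

text \<open>For the nontrivial direction, vanishing against the kernel \<open>K\<close> of a cover
  lifts the identity, so \<open>X\<close> is a retract of \<open>P\<close>.\<close>

lemma proj_iff_ext1z: "proj X \<longleftrightarrow> X \<in> Ob & (\<forall>Y\<in>Ob. ext1z X Y)"
proof safe
 assume a: "X \<in> Ob" "\<forall>Y\<in>Ob. ext1z X Y"
 obtain K P k p where s: "ses K P X k p" "proj P" using proj_cover[OF a(1)] by metis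
 then obtain t where "t \<in> Hom X P" "p * t = idn X"
  using ext1z_lift[OF _ s(1) idn_Hom[OF a(1)]] a ses_Ob by metis
 thus "proj X" using proj_retract[OF s(2)] s(1) ses_Hom by blast
qed (auto simp: proj_Ob ext1z_proj)

text \<open>The pullback \<open>A'\<close> of \<open>B\<close> and \<open>P\<close> over
  \<open>C\<close> is \<open>A\<close> plus \<open>P\<close>, because the projection to the
  projective \<open>P\<close> splits; hence \<open>A\<close> and \<open>A'\<close> are stable
  retracts of each other. The same \<open>A'\<close> is an extension of \<open>B\<close> by the
  syzygy \<open>K\<close>. Repeated rotation does the work of the long exact sequence in the first
  variable.\<close>

lemma ses_rotate:
 assumes "ses A B C i p" "ses K P C k q" "proj P"
 obtains A' k' g where "ses K A' B k' g" "stable_retract A A'" "stable_retract A' A"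
proof -
 have q: "q \<in> Hom P C" using assms ses_Hom by blast
 obtain A' g i' p' where s: "ses A A' P i' p'" and "\<exists>k'. ses K A' B k' g"
  using pullback[OF assms(1) q] assms(2) by metis
 then obtain k' where k': "ses K A' B k' g" by blast
 have h: "i' \<in> Hom A A'" "p' \<in> Hom A' P" using s ses_Hom by auto
 have O: "A \<in> Ob" "A' \<in> Ob" "P \<in> Ob" using h Hom_Ob by auto
 obtain t where t: "t \<in> Hom P A'" "p' * t = idn P" using proj_lift[OF assms(3) s idn_Hom[OF O(3)]] by blast
 have "p' * (idn A' - t * p') = 0" using t h by (simp add: algebra_simps idn_right idn_left mult_eq_left[OF t(2)])
 then obtain r where r: "r \<in> Hom A' A" "i' * r = idn A' - t * p'"
  using ses_ker[OF s Hom_diff[OF idn_Hom[OF O(2)] Hom_comp[OF h(2) t(1)]]] by blast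
 have "i' * (r * i') = idn A' * i' - t * (p' * i')" using r(2) by (simp add: left_diff_distrib flip: mult.assoc)
 also have "\<dots> = i' * idn A" using ses_zero[OF s] h by (simp add: idn_right idn_left)
 finally have "r * i' = idn A" using ses_mono_eq[OF s, of "r * i'" A "idn A"] r h O idn_Hom Hom_comp by blast
 hence "stable_retract A A'" using stable_retract_iso h r by blast
 have "i' * r - idn A' = (- t) * p'" using r by simp
 hence "i' * r - idn A' \<in> pmaps A' A'" using pmapsI[OF assms(3) h(2), of "- t" A'] t Hom_uminus by metis
 hence "stable_retract A' A" unfolding stable_retract_def using r h by blast
 with \<open>stable_retract A A'\<close> k' that show ?thesis by blast
qed

text \<open>In a projective cover \<open>P\<close> of \<open>B\<close> with kernel \<open>K\<close>,
  the preimage \<open>L\<close> of \<open>A\<close> has \<open>L/K = A\<close> and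
  \<open>P/L = C\<close>. An arrow on \<open>K\<close> extends first to \<open>L\<close> and then to
  \<open>P\<close>.\<close>

lemma ext1z_extension:
 assumes s: "ses A B C i p" and "ext1z A Y" "ext1z C Y"
 shows "ext1z B Y"
proof -
 have O: "B \<in> Ob" using s ses_Ob by auto
 obtain K P k q where P: "ses K P B k q" "proj P" using proj_cover[OF O] by metis
 obtain L g k' q' where L: "ses K L A k' q'" "g \<in> Hom L P" "g * k' = k" and "\<forall>F q1. ses A B F i q1 --> ses L P F g (q1 * q)"
  using pullback[OF P(1), of i A] ses_Hom1[OF s] by metis
 hence L2: "ses L P C g (p * q)" using s by blast
 show ?thesis
 proof (rule ext1z_proj_test[OF P])
  fix f assume "f \<in> Hom K Y"
  then obtain f' where "f' \<in> Hom L Y" "f' * k' = f" using ext1z_extend[OF assms(2) L(1)] by blast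
  moreover then obtain f'' where "f'' \<in> Hom P Y" "f'' * g = f'" using ext1z_extend[OF assms(3) L2] by blast
  ultimately show "\<exists>g\<in>Hom P Y. g * k = f" using L(3) by (metis mult.assoc)
 qed
qed

text \<open>Three rotations give a sequence of syzygies of \<open>A\<close>, \<open>B\<close> and
  \<open>C\<close> up to stable retracts, a horseshoe lemma that suffices for the induction.\<close>

lemma extz_extension: "ses A B C i p ==> extz n A Y ==> extz n C Y ==> extz n B Y"
proof (induction n arbitrary: A B C i p)
 case 0 thus ?case using ext1z_extension by simp
next
 case (Suc n)
 have O: "A \<in> Ob" "B \<in> Ob" "C \<in> Ob" using Suc.prems ses_Ob by auto
 obtain KC PC kC qC where C: "ses KC PC C kC qC" "proj PC" using proj_cover[OF O(3)] by metis
 obtain KB PB kB qB where B: "ses KB PB B kB qB" "proj PB" using proj_cover[OF O(2)] by metis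
 obtain A' k' g where 1: "ses KC A' B k' g" "stable_retract A' A" using ses_rotate[OF Suc.prems(1) C] by metis
 obtain KA PA kA qA where A: "ses KA PA A' kA qA" "proj PA" using proj_cover ses_Ob[OF 1(1)] by metis
 obtain KC' k1 g1 where 2: "ses KB KC' A' k1 g1" "stable_retract KC' KC" using ses_rotate[OF 1(1) B] by metis
 obtain KB' k2 g2 where 3: "ses KA KB' KC' k2 g2" "stable_retract KB KB'" using ses_rotate[OF 2(1) A] by metis
 have "extz (Suc n) A' Y" using Suc.prems 1 extz_stable_retract by blast
 hence "extz n KA Y" using extz_syzygy A by blast
 moreover have "extz n KC Y" using Suc.prems extz_syzygy C by blast
 hence "extz n KC' Y" using extz_stable_retract 2 by blast
 ultimately have "extz n KB' Y" using Suc.IH[OF 3(1)] by blast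
 hence "extz n KB Y" using extz_stable_retract 3 by blast
 thus ?case using extz_syzygy B by blast
qed

text \<open>Rotation presents \<open>A\<close>, up to stable retracts, as an extension of
  \<open>B\<close> by a syzygy of \<open>C\<close>; passing to that syzygy accounts for the higher
  degree at \<open>C\<close>.\<close>

lemma extz_kernel:
 assumes "ses A B C i p" "extz n B Y" "extz (Suc n) C Y"
 shows "extz n A Y"
proof -
 obtain K P k q where C: "ses K P C k q" "proj P" using proj_cover ses_Ob[OF assms(1)] by metis
 obtain A' k' g where 1: "ses K A' B k' g" "stable_retract A A'" using ses_rotate[OF assms(1) C] by metis
 thus ?thesis using extz_extension[OF 1(1)] extz_syzygy[OF C] assms extz_stable_retract by blast
qed

lemma extz_cokernel:
 assumes "ses A B C i p" "extz n A Y" "extz (Suc n) B Y"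
 shows "extz (Suc n) C Y"
proof -
 obtain K P k q where C: "ses K P C k q" "proj P" using proj_cover ses_Ob[OF assms(1)] by metis
 obtain A' k' g where 1: "ses K A' B k' g" "stable_retract A' A" using ses_rotate[OF assms(1) C] by metis
 thus ?thesis using extz_kernel[OF 1(1)] extz_syzygy[OF C] assms extz_stable_retract by blast
qed

text \<open>This is the segment Ext^1(X,Y3), Ext^2(X,Y1), Ext^2(X,Y2) of the long exact sequence in
  the second variable, with Ext^2(X,-) read as Ext^1(K,-).\<close>

lemma ext1z_right_kernel:
 assumes s: "ses Y1 Y2 Y3 y z" and "ses K P X k p" "proj P" and E: "ext1z X Y3" "ext1z K Y2"
 shows "ext1z K Y1"
proof -
 have hk: "k \<in> Hom K P" using assms ses_Hom by blast
 obtain K' P' k' p' where P': "ses K' P' K k' p'" "proj P'" using proj_cover ses_Ob[OF assms(2)] by metis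
 have h: "y \<in> Hom Y1 Y2" "z \<in> Hom Y2 Y3" "k' \<in> Hom K' P'" "p' \<in> Hom P' K" using s P' ses_Hom by auto
 show ?thesis
 proof (rule ext1z_proj_test[OF P'])
  fix f assume f: "f \<in> Hom K' Y1"
  obtain g where g: "g \<in> Hom P' Y2" "g * k' = y * f" using ext1z_extend[OF E(2) P'(1)] h f Hom_comp by blast
  have "z * g * k' = 0" using g ses_zero[OF s] by (metis mult.assoc mult_zero_left)
  \<comment> \<open>\<open>h1\<close> is the obstruction to \<open>g\<close> taking values in
    \<open>Y1\<close>. It extends over \<open>P\<close> and lifts to \<open>Y2\<close> as
    \<open>h3\<close>, and subtracting \<open>h3 * (k * p')\<close> removes it without changing
    \<open>g * k'\<close>.\<close>
  then obtain h1 where h1: "h1 \<in> Hom K Y3" "h1 * p' = z * g"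
   using ses_coker[OF P'(1), of "z * g" Y3] g h Hom_comp by blast
  obtain h2 where h2: "h2 \<in> Hom P Y3" "h2 * k = h1" using ext1z_extend[OF E(1) assms(2) h1(1)] by blast
  obtain h3 where h3: "h3 \<in> Hom P Y2" "z * h3 = h2" using proj_lift[OF assms(3) s h2(1)] by blast
  have "z * (h3 * (k * p')) = z * g" using h1 h2 h3 by (metis mult.assoc)
  hence "z * (g - h3 * (k * p')) = 0" by (simp add: algebra_simps)
  moreover have "g - h3 * (k * p') \<in> Hom P' Y2" using g h3 hk h Hom_comp Hom_diff by blast
  ultimately obtain t where t: "t \<in> Hom P' Y1" "y * t = g - h3 * (k * p')" using ses_ker[OF s] by blast
  have "y * (t * k') = (g - h3 * (k * p')) * k'" using t(2) by (metis mult.assoc)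
  also have "\<dots> = y * f" using g ses_zero[OF P'(1)] by (simp add: algebra_simps)
  finally have "t * k' = f" using ses_mono_eq[OF s, of "t * k'" K' f] t h f Hom_comp by blast
  thus "\<exists>g\<in>Hom P' Y1. g * k' = f" using t by blast
 qed
qed

text \<open>The segment Ext^1(X,Y2), Ext^1(X,Y3), Ext^2(X,Y1), where the last group is
  Ext^1(K,Y1).\<close>

lemma ext1z_right_cokernel:
 assumes s: "ses Y1 Y2 Y3 y z" and "ses K P X k p" "proj P" and E: "ext1z X Y2" "ext1z K Y1"
 shows "ext1z X Y3"
proof (rule ext1z_proj_test[OF assms(2,3)])
 fix f assume "f \<in> Hom K Y3"
 then obtain g where g: "g \<in> Hom K Y2" "z * g = f" using ext1z_lift[OF E(2) s] by blast
 then obtain g' where g': "g' \<in> Hom P Y2" "g' * k = g" using ext1z_extend[OF E(1) assms(2)] by blast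
 have "z * g' * k = f" using g g' by (metis mult.assoc)
 thus "\<exists>g\<in>Hom P Y3. g * k = f" using g' ses_Hom2[OF s] Hom_comp by blast
qed

text \<open>Finite projective dimension, put as vanishing of Ext from some degree on and uniformly
  in \<open>Y\<close>. In this form it can be compared between two categories whose Ext groups agree
  only in high degrees.\<close>

definition fpd :: "'o => bool" where
 "fpd X \<longleftrightarrow> X \<in> Ob & (\<exists>m. \<forall>n\<ge>m. \<forall>Y\<in>Ob. extz n X Y)"

lemma fpd_Ob: "fpd X ==> X \<in> Ob" by (simp add: fpd_def)

lemma fpd_proj: "proj P ==> fpd P"
 unfolding fpd_def using extz_proj proj_Ob by blast

lemma fpd_kernel:
 assumes "ses A B C i p" "fpd B" "fpd C" shows "fpd A"
proof -
 obtain m m' where "\<forall>n\<ge>m. \<forall>Y\<in>Ob. extz n B Y" "\<forall>n\<ge>m'. \<forall>Y\<in>Ob. extz n C Y"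
  using assms unfolding fpd_def by auto
 hence "\<forall>n\<ge>max m m'. \<forall>Y\<in>Ob. extz n A Y" using extz_kernel[OF assms(1)]
  by (metis le_SucI max.bounded_iff)
 thus ?thesis unfolding fpd_def using ses_Ob[OF assms(1)] by blast
qed

lemma fpd_cokernel:
 assumes "ses A B C i p" "fpd A" "fpd B" shows "fpd C"
proof -
 obtain m m' where "\<forall>n\<ge>m. \<forall>Y\<in>Ob. extz n A Y" "\<forall>n\<ge>m'. \<forall>Y\<in>Ob. extz n B Y"
  using assms unfolding fpd_def by auto
 hence "\<forall>n\<ge>Suc (max m m'). \<forall>Y\<in>Ob. extz n C Y" using extz_cokernel[OF assms(1)]
  by (metis le_SucI max.bounded_iff Suc_le_D Suc_le_mono)
 thus ?thesis unfolding fpd_def using ses_Ob[OF assms(1)] by blast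
qed

end

section \<open>Cohen-Macaulay objects\<close>

locale exact_category_regular = exact_category_projectives Ob Hom idn ses
 for Ob :: "'o set" and Hom :: "'o => 'o => 'e::ring set" and idn ses +
 fixes Reg :: 'o
 assumes Reg_Ob: "Reg \<in> Ob"
  and ext1z_Reg_proj: "ext1z X Reg ==> proj P ==> ext1z X P"
begin

text \<open>\<open>extz n\<close> concerns the (n+1)-st Ext, so ranging over all \<open>n\<close>
  from 0 covers exactly the degrees at least 1. \<open>Reg\<close> stands for the ring as a module;
  the axiom \<open>ext1z_Reg_proj\<close> replaces the fact that projectives are summands of its
  finite powers.\<close>

definition cm :: "'o => bool" where
 "cm X \<longleftrightarrow> X \<in> Ob & (\<forall>n. extz n X Reg)"

lemma extz_Reg_proj: "extz n X Reg ==> proj P ==> extz n X P"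
 by (induction n arbitrary: X) (auto intro: ext1z_Reg_proj)

lemma cm_Ob: "cm X ==> X \<in> Ob" by (simp add: cm_def)

lemma cm_ext1z_proj: "cm X ==> proj P ==> ext1z X P"
 unfolding cm_def using ext1z_Reg_proj by (metis extz.simps(1))

lemma cm_proj: "proj P ==> cm P"
 unfolding cm_def using extz_proj proj_Ob Reg_Ob by blast

lemma cm_stable_retract: "stable_retract X' X ==> cm X ==> cm X'"
 unfolding cm_def using extz_stable_retract Hom_Ob stable_retract_def by blast

lemma cm_extension: "ses A B C i p ==> cm A ==> cm C ==> cm B"
 unfolding cm_def using extz_extension ses_Ob by blast

lemma cm_kernel: "ses A B C i p ==> cm B ==> cm C ==> cm A"
 unfolding cm_def using extz_kernel ses_Ob by blast

text \<open>In degrees above one, vanishing at \<open>C\<close> is inherited from \<open>A\<close>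
  and \<open>B\<close> by \<open>extz_cokernel\<close>; degree one is what has to be
  supplied.\<close>

lemma cm_cokernel: "ses A B C i p ==> cm A ==> cm B ==> ext1z C Reg ==> cm C"
 unfolding cm_def using extz_cokernel ses_Ob by (metis extz.simps(1) not0_implies_Suc)

text \<open>Induction on the projective dimension of \<open>W\<close>: with syzygies
  \<open>K\<close> of \<open>W\<close> and \<open>L\<close> of \<open>X\<close>, Ext^1(X,W) lies
  between Ext^1(X,P) = 0 and Ext^2(X,K) = Ext^1(L,K), where \<open>L\<close> is again Cohen-Macaulay
  and \<open>K\<close> has smaller dimension.\<close>

lemma cm_fpd_ext1z:
 assumes "cm X" "fpd W" shows "ext1z X W"
proof -
 obtain m where "\<forall>n\<ge>m. \<forall>Y\<in>Ob. extz n W Y" "W \<in> Ob" using assms(2) unfolding fpd_def by auto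
 thus ?thesis using assms(1)
 proof (induction m arbitrary: X W)
  case 0
  hence "proj W" unfolding proj_iff_ext1z by (metis extz.simps(1) le0)
  thus ?case using cm_ext1z_proj 0 by blast
 next
  case (Suc m)
  obtain K P k p where K: "ses K P W k p" "proj P" using proj_cover[OF Suc.prems(2)] by metis
  obtain L Q l q where L: "ses L Q X l q" "proj Q" using proj_cover cm_Ob[OF Suc.prems(3)] by metis
  have "cm L" using cm_kernel[OF L(1)] cm_proj L Suc.prems by blast
  moreover have "\<forall>n\<ge>m. \<forall>Y\<in>Ob. extz n K Y" using Suc.prems(1) extz_syzygy[OF K] by (metis Suc_le_mono)
  ultimately have "ext1z L K" using Suc.IH ses_Ob[OF K(1)] by blast
  thus ?case using ext1z_right_cokernel[OF K(1) L] cm_ext1z_proj Suc.prems K by blast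
 qed
qed

text \<open>The kernel of a projective cover again has finite projective dimension, so the identity
  of \<open>X\<close> lifts and the cover splits.\<close>

lemma cm_fpd_proj: assumes "cm X" "fpd X" shows "proj X"
proof -
 obtain K P k p where K: "ses K P X k p" "proj P" using proj_cover cm_Ob[OF assms(1)] by metis
 have "fpd K" using fpd_kernel[OF K(1)] assms fpd_proj K by blast
 then obtain t where "t \<in> Hom X P" "p * t = idn X"
  using ext1z_lift[OF cm_fpd_ext1z[OF assms(1)] K(1) idn_Hom] assms cm_Ob by blast
 thus ?thesis using proj_retract[OF K(2)] ses_Hom2[OF K(1)] by blast
qed

end

text \<open>\<open>Reg_extz\<close> is the finite injective dimension of \<open>Reg\<close>, and
  \<open>cm_embed\<close> provides cosyzygies. The rest of the homological theory uses the
  Gorenstein property only through these two.\<close>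

locale gorenstein_category = exact_category_regular Ob Hom idn ses Reg
 for Ob :: "'o set" and Hom :: "'o => 'o => 'e::ring set" and idn ses Reg +
 assumes Reg_extz: "\<exists>d. \<forall>X\<in>Ob. \<forall>n\<ge>d. extz n X Reg"
  and cm_embed: "cm X ==> \<exists>P S i p. ses X P S i p & proj P & cm S"
begin

text \<open>Auslander-Buchweitz approximation, by induction on the degree from which Ext into
  \<open>Reg\<close> vanishes. An approximation \<open>C\<close> of the syzygy \<open>K\<close> is
  embedded in a projective \<open>Q\<close> with Cohen-Macaulay cokernel \<open>S\<close>, and the
  defect is moved from \<open>C\<close> to the other end by two pushouts.\<close>

lemma cm_approximation:
 assumes "M \<in> Ob"
 obtains Y C y c where "ses Y C M y c" "cm C" "fpd Y"
proof -
 obtain d where "\<forall>n\<ge>d. extz n M Reg" using Reg_extz assms by blast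
 hence "\<exists>Y C y c. ses Y C M y c & cm C & fpd Y" using assms
 proof (induction d arbitrary: M)
  case 0
  obtain T where T: "ses T M M 0 (idn M)" "idn T = 0" using ses_idn[OF 0(2)] by metis
  thus ?case using 0 fpd_proj zero_proj ses_Ob[OF T(1)] unfolding cm_def by blast
 next
  case (Suc d)
  obtain K P k p where K: "ses K P M k p" "proj P" using proj_cover[OF Suc.prems(2)] by metis
  have "\<forall>n\<ge>d. extz n K Reg" using Suc.prems(1) extz_syzygy[OF K] by (metis Suc_le_mono)
  then obtain Y C y c where C: "ses Y C K y c" "cm C" "fpd Y" using Suc.IH ses_Ob[OF K(1)] by blast
  obtain Q S i q where Q: "ses C Q S i q" "proj Q" "cm S" using cm_embed[OF C(2)] by blast
  \<comment> \<open>\<open>W = Q/Y\<close> has finite projective dimension. Pushing its subobject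
    \<open>K\<close> out along \<open>K -> P\<close> then gives \<open>Z\<close>, an extension of
    \<open>S\<close> by \<open>P\<close> and hence Cohen-Macaulay, which maps onto \<open>M\<close>
    with kernel \<open>W\<close>.\<close>
  obtain W v j w where W: "ses K W S v w" "ses Y Q W (i * y) j"
   using pushout[OF Q(1) ses_Hom2[OF C(1)]] C(1) by metis
  hence "fpd W" using fpd_cokernel[OF W(2) C(3)] fpd_proj Q by blast
  obtain Z v' j' w' where "ses P Z S v' w'" and "\<exists>q'. ses W Z M j' q'"
   using pushout[OF W(1) ses_Hom1[OF K(1)]] K(1) by metis
  thus ?case using cm_extension cm_proj K(2) Q(3) \<open>fpd W\<close> by blast
 qed
 thus ?thesis using that by blast
qed

end

section \<open>The stable category: suspensions and cones\<close>

context gorenstein_category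
begin

definition susp :: "'o => 'o => 'o => 'e => 'e => bool" where
 "susp X I S i p \<longleftrightarrow> ses X I S i p & proj I & cm S"

lemma suspD:
 assumes "susp X I S i p"
 shows "ses X I S i p" "proj I" "cm S" "cm X" "i \<in> Hom X I" "p \<in> Hom I S"
  "X \<in> Ob" "I \<in> Ob" "S \<in> Ob" using assms cm_kernel cm_proj ses_Hom ses_Ob unfolding susp_def by blast+

lemma cm_susp: assumes "cm X" obtains I S i p where "susp X I S i p"
 using cm_embed[OF assms] unfolding susp_def by blast

lemma cm_extend_proj:
 assumes "ses A B S i p" "cm S" "proj Q" "f \<in> Hom A Q"
 shows "\<exists>g\<in>Hom B Q. g * i = f"
 using ext1z_extend[OF cm_ext1z_proj[OF assms(2,3)] assms(1,4)] .

text \<open>Projectives are injective relative to sequences with Cohen-Macaulay end, so the first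
  half \<open>g\<close> of the factorization extends from \<open>A\<close> to
  \<open>B\<close>.\<close>

lemma pmaps_factor:
 assumes "f \<in> pmaps A Y" "ses A B S i p" "cm S"
 obtains Q g h where "g \<in> Hom B Q" "h \<in> Hom Q Y" "proj Q" "h * g * i = f"
proof -
 obtain Q g h where Q: "proj Q" "g \<in> Hom A Q" "h \<in> Hom Q Y" "f = h * g" using assms(1) by (rule pmapsE)
 obtain g' where "g' \<in> Hom B Q" "g' * i = g" using cm_extend_proj[OF assms(2,3) Q(1,2)] by blast
 thus ?thesis using that Q by (metis mult.assoc)
qed

text \<open>Because of that relative injectivity, the single embedding \<open>i\<close> into
  \<open>I\<close> decides whether an arrow out of \<open>X\<close> is stably zero.\<close>

lemma pmaps_susp: 
 assumes "susp X I S i p" 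
 shows "f \<in> pmaps X Y \<longleftrightarrow> (\<exists>h\<in>Hom I Y. f = h * i)"
 using pmaps_factor[of f X Y I S i p] pmapsI[of I i X _ Y] suspD[OF assms] Hom_comp by metis

text \<open>Both summands factor through the same \<open>i\<close>, so no direct sum of projectives
  has to be formed.\<close>

lemma pmaps_add: assumes "cm X" "f \<in> pmaps X Y" "g \<in> pmaps X Y" shows "f + g \<in> pmaps X Y"
proof -
 obtain I S i p where "susp X I S i p" using cm_susp assms by metis
 thus ?thesis using assms(2,3) unfolding pmaps_susp[OF \<open>susp X I S i p\<close>]
  by (metis Hom_add distrib_right)
qed

lemma pmaps_zero: assumes "X \<in> Ob" "Y \<in> Ob" shows "0 \<in> pmaps X Y"
proof -
 obtain K P k p where "ses K P X k p" "proj P" using proj_cover[OF assms(1)] by metis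
 thus ?thesis using pmapsI[of P 0 X 0 Y] assms Hom_zero proj_Ob by simp
qed

text \<open>\<open>cm X\<close> belongs to the relation because transitivity rests on
  \<open>pmaps_add\<close>, which needs an embedding of \<open>X\<close> into a projective.\<close>

definition eqv :: "'o => 'o => 'e => 'e => bool" where
 "eqv X Y f g \<longleftrightarrow> cm X & f \<in> Hom X Y & g \<in> Hom X Y & f - g \<in> pmaps X Y"

lemma eqvD: assumes "eqv X Y f g" shows "cm X" "f \<in> Hom X Y" "g \<in> Hom X Y" "f - g \<in> pmaps X Y"
 using assms unfolding eqv_def by auto

lemma eqv_refl: "cm X ==> f \<in> Hom X Y ==> eqv X Y f f"
 unfolding eqv_def using pmaps_zero Hom_Ob by force

lemma eqv_sym: "eqv X Y f g ==> eqv X Y g f"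
 unfolding eqv_def using pmaps_uminus by force

lemma eqv_trans [trans]: "eqv X Y f g ==> eqv X Y g h ==> eqv X Y f h"
 unfolding eqv_def using pmaps_add[of X "f - g" Y "g - h"] by simp

lemma eqv_left: "eqv X Y f g ==> h \<in> Hom Y Z ==> eqv X Z (h * f) (h * g)"
 unfolding eqv_def using pmaps_left[of "f - g" X Y h Z] Hom_comp by (auto simp: right_diff_distrib)

lemma eqv_right: "eqv X Y f g ==> cm W ==> h \<in> Hom W X ==> eqv W Y (f * h) (g * h)"
 unfolding eqv_def using pmaps_right[of "f - g" X Y h W] Hom_comp by (auto simp: left_diff_distrib)

lemma eqv_add: "eqv X Y f f' ==> eqv X Y g g' ==> eqv X Y (f + g) (f' + g')"
 unfolding eqv_def using pmaps_add[of X "f - f'" Y "g - g'"] Hom_add by (auto simp: algebra_simps)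

definition siso :: "'o => 'o => 'e => 'e => bool" where
 "siso X Y f g \<longleftrightarrow> f \<in> Hom X Y & g \<in> Hom Y X & eqv X X (g * f) (idn X) & eqv Y Y (f * g) (idn Y)"

lemma sisoD: assumes "siso X Y f g"
 shows "f \<in> Hom X Y" "g \<in> Hom Y X" "eqv X X (g * f) (idn X)" "eqv Y Y (f * g) (idn Y)" "cm X" "cm Y"
 using assms unfolding siso_def eqv_def by auto

lemma siso_sym: "siso X Y f g ==> siso Y X g f"
 unfolding siso_def by auto

lemma siso_idn: "cm X ==> siso X X (idn X) (idn X)"
 unfolding siso_def using eqv_refl[of X "idn X" X] by (simp add: cm_Ob idn_Hom idn_left[OF idn_Hom])

lemma siso_cancel_left:
 assumes "siso Y Z f g" "h \<in> Hom X Y" "cm X" shows "eqv X Y (g * (f * h)) h"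
 using eqv_right[OF sisoD(3)[OF assms(1)] assms(3,2)] idn_left[OF assms(2)] by (simp add: mult.assoc)

lemma siso_cancel_right:
 assumes "siso X Y f g" "h \<in> Hom X W" shows "eqv X W (h * (g * f)) h"
 using eqv_left[OF sisoD(3)[OF assms(1)] assms(2)] idn_right[OF assms(2)] by simp

lemma siso_comp:
 assumes "siso X Y f g" "siso Y Z f' g'" shows "siso X Z (f' * f) (g * g')"
proof -
 note a = sisoD[OF assms(1)] and b = sisoD[OF assms(2)]
 have "eqv X X (g * (g' * (f' * f))) (g * f)" by (rule eqv_left[OF siso_cancel_left[OF assms(2) a(1,5)] a(2)])
 also have "eqv X X (g * f) (idn X)" by fact
 finally have 1: "eqv X X (g * (g' * (f' * f))) (idn X)" .
 have "eqv Z Z (f' * (f * (g * g'))) (f' * g')"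
  by (rule eqv_left[OF siso_cancel_left[OF siso_sym[OF assms(1)] b(2,6)] b(1)])
 also have "eqv Z Z (f' * g') (idn Z)" by fact
 finally show ?thesis unfolding siso_def using 1 a b Hom_comp by (simp add: mult.assoc)
qed

text \<open>\<open>g\<close> represents the suspension of \<open>f\<close> for two given suspension
  sequences. The sequences are parameters so that a chosen one and the image of another under the
  left adjoint can be compared.\<close>

definition shifted :: "'o => 'o => 'e => 'e => 'o => 'o => 'e => 'e => 'e => 'e => bool" where
 "shifted I S i p I' S' i' p' f g \<longleftrightarrow>
   g \<in> Hom S S' & (\<exists>h\<in>Hom I I'. h * i = i' * f & g * p = p' * h)"

lemma shifted_exists:
 assumes "susp X I S i p" "susp X' I' S' i' p'" "f \<in> Hom X X'"
 obtains g where "shifted I S i p I' S' i' p' f g"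
proof -
 note a = suspD[OF assms(1)] and b = suspD[OF assms(2)]
 obtain h where h: "h \<in> Hom I I'" "h * i = i' * f"
  using cm_extend_proj[OF a(1,3) b(2) Hom_comp[OF assms(3) b(5)]] by blast
 have "p' * h * i = p' * i' * f" using h by (simp add: mult.assoc)
 hence "p' * h * i = 0" using ses_zero[OF b(1)] by simp
 thus ?thesis using ses_coker[OF a(1) Hom_comp[OF h(1) b(6)]] that h unfolding shifted_def by blast
qed

text \<open>If \<open>f - f' = t * i\<close>, then \<open>h - h' - i' * t\<close> kills
  \<open>i\<close> and so factors as \<open>r * p\<close>. Composing with \<open>p'\<close> gives
  \<open>g - g' = p' * r\<close>, an arrow through the projective \<open>I'\<close>.\<close>

lemma shifted_unique:
 assumes "susp X I S i p" "susp X' I' S' i' p'" "eqv X X' f f'"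
  and "shifted I S i p I' S' i' p' f g" "shifted I S i p I' S' i' p' f' g'"
 shows "eqv S S' g g'"
proof -
 note a = suspD[OF assms(1)] and b = suspD[OF assms(2)]
 obtain h h' where h: "h \<in> Hom I I'" "h * i = i' * f" "g * p = p' * h"
  and h': "h' \<in> Hom I I'" "h' * i = i' * f'" "g' * p = p' * h'"
  and g: "g \<in> Hom S S'" "g' \<in> Hom S S'" using assms unfolding shifted_def by blast
 obtain t where t: "t \<in> Hom I X'" "f - f' = t * i" using eqvD(4)[OF assms(3)] pmaps_susp[OF assms(1)] by blast
 have "i' * (t * i) = i' * f - i' * f'" using t(2) by (metis right_diff_distrib)
 hence "(h - h' - i' * t) * i = 0" using h h' by (simp add: left_diff_distrib mult.assoc)
 moreover have "h - h' - i' * t \<in> Hom I I'" using h h' Hom_comp[OF t(1) b(5)] Hom_diff by blast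
 ultimately obtain r where r: "r \<in> Hom S I'" "r * p = h - h' - i' * t" using ses_coker[OF a(1)] by blast
 have "p' * r * p = p' * h - p' * h' - p' * i' * t" using r by (simp add: right_diff_distrib mult.assoc)
 also have "\<dots> = (g - g') * p" using ses_zero[OF b(1)] h h' by (simp add: left_diff_distrib)
 finally have "p' * r = g - g'" using ses_epi_eq[OF a(1) Hom_comp[OF r(1) b(6)] Hom_diff[OF g]] by simp
 hence "g - g' \<in> pmaps S S'" using pmapsI[OF b(2) r(1) b(6)] by simp
 thus ?thesis unfolding eqv_def using a g by simp
qed

lemma shifted_comp:
 assumes "shifted I S i p I' S' i' p' f g" "shifted I' S' i' p' I'' S'' i'' p'' f' g'"
 shows "shifted I S i p I'' S'' i'' p'' (f' * f) (g' * g)"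
proof -
 obtain h h' where h: "h \<in> Hom I I'" "h * i = i' * f" "g * p = p' * h"
  and h': "h' \<in> Hom I' I''" "h' * i' = i'' * f'" "g' * p' = p'' * h'"
  and g: "g \<in> Hom S S'" "g' \<in> Hom S' S''" using assms unfolding shifted_def by blast
 have "h' * h * i = i'' * (f' * f)" "g' * g * p = p'' * (h' * h)" using h h' by (metis mult.assoc)+
 thus ?thesis unfolding shifted_def using g h(1) h'(1) Hom_comp by blast
qed

lemma shifted_idn: "susp X I S i p ==> shifted I S i p I S i p (idn X) (idn S)"
 unfolding shifted_def using suspD[of X I S i p] idn_Hom idn_left idn_right by (metis cm_Ob)

lemma shifted_siso:
 assumes "susp X I S i p" "susp X' I' S' i' p'" "siso X X' f f'"
  and "shifted I S i p I' S' i' p' f g" "shifted I' S' i' p' I S i p f' g'"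
 shows "siso S S' g g'"
proof -
 have "eqv S S (g' * g) (idn S)"
  by (rule shifted_unique[OF assms(1,1) sisoD(3)[OF assms(3)] shifted_comp[OF assms(4,5)] shifted_idn[OF assms(1)]])
 moreover have "eqv S' S' (g * g') (idn S')"
  by (rule shifted_unique[OF assms(2,2) sisoD(4)[OF assms(3)] shifted_comp[OF assms(5,4)] shifted_idn[OF assms(2)]])
 ultimately show ?thesis using assms unfolding siso_def shifted_def by blast
qed

text \<open>The pushout is recorded by its second row and two commutation rules instead of a
  universal property; \<open>pushout_universal\<close> and \<open>pushout_unique\<close> recover the
  latter. This form is preserved by functors that preserve the short exact sequences
  concerned.\<close>

definition cone :: "'o => 'o => 'o => 'e => 'e => 'o => 'e => 'o => 'e => 'e => 'e => bool" where
 "cone X I S i p Y u Z v j w \<longleftrightarrow> susp X I S i p & cm Y & u \<in> Hom X Y &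
   ses Y Z S v w & j \<in> Hom I Z & j * i = v * u & w * j = p"

lemma coneD:
 assumes "cone X I S i p Y u Z v j w"
 shows "susp X I S i p" "cm Y" "u \<in> Hom X Y" "ses Y Z S v w" "j \<in> Hom I Z" "j * i = v * u" "w * j = p"
  "v \<in> Hom Y Z" "w \<in> Hom Z S" "cm Z" "w * v = 0"
 using assms cm_extension ses_Hom ses_zero suspD(3) unfolding cone_def by blast+

lemma cone_exists:
 assumes "susp X I S i p" "cm Y" "u \<in> Hom X Y"
 obtains Z v j w where "cone X I S i p Y u Z v j w"
 using pushout[OF suspD(1)[OF assms(1)] assms(3)] assms unfolding cone_def by metis

lemma cone_universal:
 assumes "cone X I S i p Y u Z v j w" "g \<in> Hom I W" "h \<in> Hom Y W" "g * i = h * u"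
 shows "\<exists>t\<in>Hom Z W. t * j = g & t * v = h"
 using pushout_universal[of X I S i p Y Z v w j u] coneD[OF assms(1)] suspD assms by blast

lemma cone_unique:
 assumes "cone X I S i p Y u Z v j w" "t \<in> Hom Z W" "t' \<in> Hom Z W" "t * j = t' * j" "t * v = t' * v"
 shows "t = t'"
 using pushout_unique[of X I S i p Y Z v w j t W t'] coneD[OF assms(1)] suspD assms by blast

text \<open>The universal property is tested on Cohen-Macaulay objects alone, as for a pushout in
  \<open>CM_category\<close>. That is enough: the true pushout is an extension of Cohen-Macaulay
  objects, so it is among the test objects and is isomorphic to \<open>Z\<close>.\<close>

lemma coneI:
 assumes X: "susp X I S i p" and Y: "cm Y" and u: "u \<in> Hom X Y" and Z: "cm Z"
  and j: "j \<in> Hom I Z" and v: "v \<in> Hom Y Z" and e: "j * i = v * u"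
  and univ: "\<And>W g h. cm W ==> g \<in> Hom I W ==> h \<in> Hom Y W ==> g * i = h * u ==>
   \<exists>!t. t \<in> Hom Z W & t * j = g & t * v = h"
  and w: "w \<in> Hom Z S" "w * j = p" "w * v = 0"
 shows "cone X I S i p Y u Z v j w"
proof -
 obtain Z0 v0 j0 w0 where C: "cone X I S i p Y u Z0 v0 j0 w0" using cone_exists[OF X Y u] by metis
 note c = coneD[OF C]
 obtain z where z: "z \<in> Hom Z0 Z" "z * j0 = j" "z * v0 = v" using cone_universal[OF C j v e] by blast
 obtain z' where z': "z' \<in> Hom Z Z0" "z' * j = j0" "z' * v = v0" using univ[OF c(10,5,8,6)] by blast
 have zz: "z' * z = idn Z0"
  by (rule cone_unique[OF C]) (use z z' c cm_Ob in "auto simp: mult.assoc idn_left intro: Hom_comp idn_Hom")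
 have "z * z' \<in> Hom Z Z & z * z' * j = j & z * z' * v = v" "idn Z \<in> Hom Z Z & idn Z * j = j & idn Z * v = v"
  using z z' j v cm_Ob[OF Z] by (auto simp: mult.assoc idn_left intro: Hom_comp idn_Hom)
 hence zz': "z * z' = idn Z" using univ[OF Z j v e] by blast
 have "ses Y Z S (z * v0) (w0 * z')" by (rule ses_iso_mid[OF c(4) z(1) z'(1) zz zz'])
 moreover have "w0 * z' = w"
 proof -
  have "w0 * z' \<in> Hom Z S & w0 * z' * j = p & w0 * z' * v = 0" using c z' by (auto simp: mult.assoc intro: Hom_comp)
  moreover have "p * i = 0 * u" using ses_zero suspD(1)[OF X] by simp
  ultimately show ?thesis
   using univ[OF suspD(3)[OF X] suspD(6)[OF X], of 0] w Hom_zero cm_Ob[OF Y] suspD(9)[OF X] by blast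
 qed
 ultimately show ?thesis unfolding cone_def using X Y u j e w z by simp
qed

lemma cone_map:
 assumes c1: "cone X I S i p Y u Z v j w" and c2: "cone X' I' S' i' p' Y' u' Z' v' j' w'"
  and a: "a \<in> Hom X X'" and b: "b \<in> Hom Y Y'" and e: "eqv X Y' (b * u) (u' * a)"
 obtains c s where "c \<in> Hom Z Z'" "shifted I S i p I' S' i' p' a s" "c * v = v' * b" "w' * c = s * w"
proof -
 note c1' = coneD[OF c1] and c2' = coneD[OF c2]
 note s1 = suspD[OF c1'(1)] and s2 = suspD[OF c2'(1)]
 obtain s where s: "shifted I S i p I' S' i' p' a s" using shifted_exists[OF c1'(1) c2'(1) a] by metis
 then obtain h where h: "s \<in> Hom S S'" "h \<in> Hom I I'" "h * i = i' * a" "s * p = p' * h" unfolding shifted_def by blast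
 obtain t where t: "t \<in> Hom I Y'" "b * u - u' * a = t * i" using eqvD(4)[OF e] pmaps_susp[OF c1'(1)] by blast
 \<comment> \<open>The square commutes only stably, with error \<open>t * i\<close>. Adding
   \<open>v' * t\<close> to \<open>j' * h\<close> on \<open>I\<close> absorbs it, so the two arrows
   agree strictly on \<open>X\<close> and glue to \<open>c\<close>.\<close>
 have "v' * (t * i) = v' * (b * u) - v' * (u' * a)" using t(2) by (metis right_diff_distrib)
 moreover have "j' * (h * i) = v' * (u' * a)" using h(3) c2'(6) by (metis mult.assoc)
 ultimately have "(j' * h + v' * t) * i = v' * b * u" by (simp add: distrib_right mult.assoc)
 moreover have "j' * h + v' * t \<in> Hom I Z'" "v' * b \<in> Hom Y Z'"
  using h(2) t(1) b c2' Hom_comp Hom_add by blast+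
 ultimately obtain c where c: "c \<in> Hom Z Z'" "c * j = j' * h + v' * t" "c * v = v' * b"
  using cone_universal[OF c1, of "j' * h + v' * t" Z' "v' * b"] by blast
 have "w' * c = s * w"
 proof (rule cone_unique[OF c1])
  show "w' * c \<in> Hom Z S'" "s * w \<in> Hom Z S'" using c(1) h(1) c1' c2' Hom_comp by blast+
  have "w' * c * j = w' * j' * h + w' * v' * t" using c(2) by (simp add: mult.assoc distrib_left)
  thus "w' * c * j = s * w * j" using c1'(7) c2'(7,11) h(4) by (simp add: mult.assoc)
  have "w' * c * v = w' * v' * b" using c(3) by (simp add: mult.assoc)
  thus "w' * c * v = s * w * v" using c1'(11) c2'(11) by (simp add: mult.assoc)
 qed
 with c s that show ?thesis by blast
qed

text \<open>If \<open>\<gamma>\<close> is a stable endomorphism of a triangle over identities of \<open>Y\<close> and the shift, then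
 \<open>\<gamma> - 1\<close> factors through \<open>w\<close>, so it squares to zero.\<close>

lemma cone_endomorphism:
 assumes C: "cone X I S i p Y u Z v j w" and c: "c \<in> Hom Z Z"
  and e1: "eqv Y Z (c * v) v" and e2: "eqv Z S (w * c) w"
 obtains d where "siso Z Z c d"
proof -
 note c1 = coneD[OF C]
 have O: "Z \<in> Ob" and hi: "idn Z \<in> Hom Z Z" using c1 cm_Ob idn_Hom by blast+
 obtain Q g h where Q: "g \<in> Hom Z Q" "h \<in> Hom Q Z" "proj Q" "h * g * v = c * v - v"
  using pmaps_factor[OF eqvD(4)[OF e1] c1(4) suspD(3)[OF c1(1)]] by metis
 have hg: "h * g \<in> pmaps Z Z" using pmapsI Q by blast
 have "(c - idn Z - h * g) * v = 0" using Q(4) idn_left[OF c1(8)] by (simp add: left_diff_distrib)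
 moreover have "c - idn Z - h * g \<in> Hom Z Z" using c hi pmaps_Hom[OF hg] Hom_diff by blast
 ultimately obtain s where s: "s \<in> Hom S Z" "s * w = c - idn Z - h * g" using ses_coker[OF c1(4)] by blast
 \<comment> \<open>The inverse of \<open>1 + n\<close> with \<open>n * n = 0\<close> is
   \<open>1 - n\<close>; here \<open>n = c - idn Z\<close>, which squares to zero stably.\<close>
 define d where "d = idn Z + idn Z - c"
 have d: "d \<in> Hom Z Z" unfolding d_def using c hi Hom_add Hom_diff by blast
 have sq: "(c - idn Z) * (c - idn Z) \<in> pmaps Z Z"
 proof -
  have "c - idn Z = s * w + h * g" using s by simp
  hence "(c - idn Z) * (c - idn Z) = (s * w + h * g) * (c - idn Z)" by simp
  also have "\<dots> = s * (w * c - w) + h * g * (c - idn Z)"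
   using idn_right[OF c1(9)] by (simp add: distrib_right right_diff_distrib mult.assoc)
  also have "\<dots> \<in> pmaps Z Z"
   by (intro pmaps_add c1(10) pmaps_left[OF eqvD(4)[OF e2] s(1)] pmaps_right[OF hg Hom_diff[OF c hi]])
  finally show ?thesis .
 qed
 note ids = idn_left[OF c] idn_right[OF c] idn_left[OF hi]
 have "d * c - idn Z = - ((c - idn Z) * (c - idn Z))" "c * d - idn Z = - ((c - idn Z) * (c - idn Z))"
  unfolding d_def by (simp_all add: algebra_simps ids)
 hence "d * c - idn Z \<in> pmaps Z Z" "c * d - idn Z \<in> pmaps Z Z" using pmaps_uminus[OF sq] by simp_all
 thus ?thesis using that[of d] c d hi c1(10) Hom_comp unfolding siso_def eqv_def by blast
qed

text \<open>Fillers \<open>c\<close> and \<open>d\<close> in both directions need not be inverse to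
  each other, but both composites satisfy the conditions of \<open>cone_endomorphism\<close>. So
  \<open>c\<close> has a stable left inverse and a stable right inverse.\<close>

lemma cone_iso:
 assumes c1: "cone X I S i p Y u Z v j w" and c2: "cone X' I' S' i' p' Y' u' Z' v' j' w'"
  and a: "siso X X' a a'" and b: "siso Y Y' b b'" and e: "eqv X Y' (b * u) (u' * a)"
 obtains c c' s where "siso Z Z' c c'" "shifted I S i p I' S' i' p' a s" "c * v = v' * b" "w' * c = s * w"
proof -
 note d1 = coneD[OF c1] and d2 = coneD[OF c2] and a' = sisoD[OF a] and b' = sisoD[OF b]
 \<comment> \<open>The square is inverted by inserting \<open>a * a'\<close> on the right and
   cancelling \<open>b' * b\<close> on the left.\<close>
 have "eqv X' Y (b' * u') (b' * (u' * (a * a')))"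
  using eqv_sym[OF siso_cancel_right[OF siso_sym[OF a] Hom_comp[OF d2(3) b'(2)]]] by (simp add: mult.assoc)
 also have "eqv X' Y (b' * (u' * (a * a'))) (b' * (b * (u * a')))"
  using eqv_left[OF eqv_right[OF eqv_sym[OF e] a'(6,2)] b'(2)] by (simp add: mult.assoc)
 also have "eqv X' Y (b' * (b * (u * a'))) (u * a')"
  by (rule siso_cancel_left[OF b Hom_comp[OF a'(2) d1(3)] a'(6)])
 finally have e': "eqv X' Y (b' * u') (u * a')" .
 obtain c s where c: "c \<in> Hom Z Z'" "shifted I S i p I' S' i' p' a s" "c * v = v' * b" "w' * c = s * w"
  using cone_map[OF c1 c2 a'(1) b'(1) e] by metis
 obtain d t where d: "d \<in> Hom Z' Z" "shifted I' S' i' p' I S i p a' t" "d * v' = v * b'" "w * d = t * w'"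
  using cone_map[OF c2 c1 a'(2) b'(2) e'] by metis
 have st: "siso S S' s t" by (rule shifted_siso[OF d1(1) d2(1) a c(2) d(2)])
 have "d * c * v = v * (b' * b)" by (metis c(3) d(3) mult.assoc)
 hence 1: "eqv Y Z (d * c * v) v" using siso_cancel_right[OF b d1(8)] by simp
 have "w * (d * c) = t * (s * w)" by (metis c(4) d(4) mult.assoc)
 hence 2: "eqv Z S (w * (d * c)) w" using siso_cancel_left[OF st d1(9,10)] by simp
 obtain l where l: "siso Z Z (d * c) l" using cone_endomorphism[OF c1 Hom_comp[OF c(1) d(1)] 1 2] by metis
 have "c * d * v' = v' * (b * b')" by (metis c(3) d(3) mult.assoc)
 hence 3: "eqv Y' Z' (c * d * v') v'" using siso_cancel_right[OF siso_sym[OF b] d2(8)] by simp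
 have "w' * (c * d) = s * (t * w')" by (metis c(4) d(4) mult.assoc)
 hence 4: "eqv Z' S' (w' * (c * d)) w'" using siso_cancel_left[OF siso_sym[OF st] d2(9,10)] by simp
 obtain r where r: "siso Z' Z' (c * d) r" using cone_endomorphism[OF c2 Hom_comp[OF d(1) c(1)] 3 4] by metis
 note l' = sisoD[OF l] and r' = sisoD[OF r]
 \<comment> \<open>A left inverse of \<open>c\<close> by construction. The right inverse
   \<open>d * r\<close> of \<open>c\<close> shows in the next lines that it is also a right
   inverse.\<close>
 define c' where "c' = l * d"
 have hc': "c' \<in> Hom Z' Z" unfolding c'_def using d(1) l'(2) Hom_comp by blast
 have left: "eqv Z Z (c' * c) (idn Z)" using l'(3) unfolding c'_def by (simp add: mult.assoc)
 have "eqv Z' Z' (c * c') (c * c' * (c * d * r))"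
  using eqv_left[OF eqv_sym[OF r'(4)] Hom_comp[OF hc' c(1)]] idn_right[OF Hom_comp[OF hc' c(1)]] by simp
 also have "eqv Z' Z' (c * c' * (c * d * r)) (c * (idn Z * (d * r)))"
  using eqv_left[OF eqv_right[OF left d2(10) Hom_comp[OF r'(2) d(1)]] c(1)] by (simp add: mult.assoc)
 also have "c * (idn Z * (d * r)) = c * d * r" using idn_left[OF d(1)] by (simp add: mult.assoc flip: mult.assoc[of "idn Z" d])
 also have "eqv Z' Z' (c * d * r) (idn Z')" by (rule r'(4))
 finally have "siso Z Z' c c'" unfolding siso_def using left c(1) hc' by blast
 with c that show ?thesis by blast
qed

end

section \<open>Restriction and its left adjoint\<close>

text \<open>\<open>A\<close> stands for modules over the algebra and \<open>B\<close> for modules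
  over the corner. The left adjoint is given on objects only, by universal arrows \<open>un\<close>,
  with \<open>vn\<close> inverse to \<open>un\<close>. \<open>eventually_ext\<close> compares mere
  vanishing. \<open>B_embed\<close> concerns objects that already have a mono into a projective: it
  improves such a mono to one whose cokernel has no Ext^1 into \<open>RegB\<close>.\<close>

locale restriction_adjunction =
 A: gorenstein_category ObA HomA idA sesA RegA + B: exact_category_regular ObB HomB idB sesB RegB
 for ObA :: "'o set" and HomA :: "'o => 'o => 'e::ring set" and idA sesA RegA
  and ObB :: "'p set" and HomB :: "'p => 'p => 'f::ring set" and idB sesB RegB +
 fixes eo :: "'o => 'p" and em :: "'o => 'o => 'e => 'f"
  and lo :: "'p => 'o" and un vn :: "'p => 'f"
 assumes em_Hom: "f \<in> HomA X Y ==> em X Y f \<in> HomB (eo X) (eo Y)"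
  and em_comp: "f \<in> HomA X Y ==> g \<in> HomA Y Z ==> em X Z (g * f) = em Y Z g * em X Y f"
  and em_add: "f \<in> HomA X Y ==> g \<in> HomA X Y ==> em X Y (f + g) = em X Y f + em X Y g"
  and em_id: "X \<in> ObA ==> em X X (idA X) = idB (eo X)"
  and em_ses: "sesA X Y Z i p ==> sesB (eo X) (eo Y) (eo Z) (em X Y i) (em Y Z p)"
  and un_Hom: "N \<in> ObB ==> un N \<in> HomB N (eo (lo N))"
  and vn_Hom: "N \<in> ObB ==> vn N \<in> HomB (eo (lo N)) N"
  and vn_un: "N \<in> ObB ==> vn N * un N = idB N"
  and un_vn: "N \<in> ObB ==> un N * vn N = idB (eo (lo N))"
  and lo_Ob: "N \<in> ObB ==> lo N \<in> ObA"
  and lo_universal: "N \<in> ObB ==> Y \<in> ObA ==> h \<in> HomB N (eo Y) ==>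
    \<exists>!g. g \<in> HomA (lo N) Y & em (lo N) Y g * un N = h"
  and eventually_ext: "\<exists>t. \<forall>n\<ge>t. \<forall>X\<in>ObA. \<forall>Y\<in>ObA. A.extz n X Y \<longleftrightarrow> B.extz n (eo X) (eo Y)"
  and Reg_proj: "B.proj RegB"
  and B_embed: "B.cm N ==> B.proj Q ==> h \<in> HomB N Q ==>
    (\<And>D d. d \<in> HomB D N ==> h * d = 0 ==> d = 0) ==>
    \<exists>P S h k. sesB N P S h k & B.proj P & B.ext1z S RegB"
begin

lemma eo_Ob: "X \<in> ObA ==> eo X \<in> ObB"
 using em_Hom[OF A.idn_Hom] B.Hom_Ob by blast

lemma em_zero: "X \<in> ObA ==> Y \<in> ObA ==> em X Y 0 = 0"
 using em_add[OF A.Hom_zero A.Hom_zero, of X Y] by simp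

lemma lo_eqI:
 assumes "N \<in> ObB" "g \<in> HomA (lo N) Y" "h \<in> HomA (lo N) Y" "em (lo N) Y g * un N = em (lo N) Y h * un N"
 shows "g = h"
proof -
 have "Y \<in> ObA" using assms A.Hom_Ob by blast
 thus ?thesis
  using lo_universal[OF assms(1) _ B.Hom_comp[OF un_Hom[OF assms(1)] em_Hom[OF assms(3)]]] assms by blast
qed

lemma lo_ex:
 assumes "f \<in> HomB N (eo Y)" "Y \<in> ObA"
 obtains g where "g \<in> HomA (lo N) Y" "em (lo N) Y g * un N = f"
 using lo_universal[OF _ assms(2,1)] assms B.Hom_Ob by blast

section \<open>The left adjoint on arrows\<close>

definition lm :: "'p => 'p => 'f => 'e" where
 "lm X Y f = (THE g. g \<in> HomA (lo X) (lo Y) & em (lo X) (lo Y) g * un X = un Y * f)"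

lemma lm:
 assumes "f \<in> HomB X Y"
 shows lm_Hom: "lm X Y f \<in> HomA (lo X) (lo Y)"
  and lm_un: "em (lo X) (lo Y) (lm X Y f) * un X = un Y * f"
proof -
 have O: "X \<in> ObB" "Y \<in> ObB" using assms B.Hom_Ob by auto
 have "\<exists>!g. g \<in> HomA (lo X) (lo Y) & em (lo X) (lo Y) g * un X = un Y * f"
  using lo_universal[OF O(1) lo_Ob[OF O(2)]] B.Hom_comp[OF assms un_Hom[OF O(2)]] by blast
 from theI'[OF this] show "lm X Y f \<in> HomA (lo X) (lo Y)" "em (lo X) (lo Y) (lm X Y f) * un X = un Y * f"
  unfolding lm_def by auto
qed

lemma lm_eqI:
 assumes "f \<in> HomB X Y" "g \<in> HomA (lo X) (lo Y)" "em (lo X) (lo Y) g * un X = un Y * f"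
 shows "lm X Y f = g"
 using lo_eqI[OF _ lm_Hom[OF assms(1)] assms(2)] lm_un[OF assms(1)] assms B.Hom_Ob by metis

lemma lm_comp:
 assumes "f \<in> HomB X Y" "g \<in> HomB Y Z"
 shows "lm X Z (g * f) = lm Y Z g * lm X Y f"
proof (rule lm_eqI[OF B.Hom_comp[OF assms] A.Hom_comp[OF lm_Hom[OF assms(1)] lm_Hom[OF assms(2)]]])
 show "em (lo X) (lo Z) (lm Y Z g * lm X Y f) * un X = un Z * (g * f)"
  using em_comp[OF lm_Hom[OF assms(1)] lm_Hom[OF assms(2)]] lm_un[OF assms(1)] lm_un[OF assms(2)]
  by (metis mult.assoc)
qed

lemma lm_add:
 assumes "f \<in> HomB X Y" "g \<in> HomB X Y"
 shows "lm X Y (f + g) = lm X Y f + lm X Y g"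
 by (rule lm_eqI) (use assms in "auto simp: em_add lm_Hom lm_un algebra_simps intro: A.Hom_add B.Hom_add lm_Hom")

lemma lm_idn: assumes "X \<in> ObB" shows "lm X X (idB X) = idA (lo X)"
 by (rule lm_eqI)
  (use assms un_Hom[OF assms] in "auto simp: em_id lo_Ob B.idn_left B.idn_right[OF un_Hom] intro!: A.idn_Hom B.idn_Hom")

lemma lm_zero: "X \<in> ObB ==> Y \<in> ObB ==> lm X Y 0 = 0"
 using lm_add[OF B.Hom_zero B.Hom_zero, of X Y] by simp

lemma lm_diff:
 assumes "f \<in> HomB X Y" "g \<in> HomB X Y" shows "lm X Y (f - g) = lm X Y f - lm X Y g"
 using lm_add[OF B.Hom_diff[OF assms] assms(2)] by (simp add: algebra_simps)

text \<open>Restriction conjugated by the unit. As the unit is invertible, this is the two-sided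
  inverse of \<open>lm\<close> on hom-sets, that is, full faithfulness of the left adjoint.\<close>

definition linv :: "'p => 'p => 'e => 'f" where
 "linv X Y g = vn Y * em (lo X) (lo Y) g * un X"

lemma linv_Hom: "X \<in> ObB ==> Y \<in> ObB ==> g \<in> HomA (lo X) (lo Y) ==> linv X Y g \<in> HomB X Y"
 unfolding linv_def by (intro B.Hom_comp[OF un_Hom] B.Hom_comp[OF em_Hom] vn_Hom)

lemma lm_linv:
 assumes "X \<in> ObB" "Y \<in> ObB" "g \<in> HomA (lo X) (lo Y)" shows "lm X Y (linv X Y g) = g"
proof (rule lm_eqI[OF linv_Hom[OF assms] assms(3)])
 have "un Y * linv X Y g = (un Y * vn Y) * em (lo X) (lo Y) g * un X" unfolding linv_def by (simp add: mult.assoc)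
 thus "em (lo X) (lo Y) g * un X = un Y * linv X Y g"
  using un_vn[OF assms(2)] B.idn_left[OF em_Hom[OF assms(3)]] by simp
qed

lemma linv_lm: assumes "f \<in> HomB X Y" shows "linv X Y (lm X Y f) = f"
proof -
 have "linv X Y (lm X Y f) = (vn Y * un Y) * f" unfolding linv_def using lm_un[OF assms] by (simp add: mult.assoc)
 thus ?thesis using vn_un B.idn_left[OF assms] assms B.Hom_Ob by auto
qed

text \<open>A lifting problem out of \<open>lo Q\<close> is transposed to one out of
  \<open>Q\<close> over the restricted sequence, which is still exact.\<close>

lemma lo_proj: assumes "B.proj Q" shows "A.proj (lo Q)"
 unfolding A.proj_def
proof (intro conjI allI impI)
 have O: "Q \<in> ObB" using assms B.proj_Ob by auto
 thus "lo Q \<in> ObA" by (rule lo_Ob)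
 fix X Y Z i p f assume s: "sesA X Y Z i p" and f: "f \<in> HomA (lo Q) Z"
 have p: "p \<in> HomA Y Z" "Y \<in> ObA" using A.ses_Hom[OF s] A.ses_Ob[OF s] by auto
 obtain g where g: "g \<in> HomB Q (eo Y)" "em Y Z p * g = em (lo Q) Z f * un Q"
  using B.proj_lift[OF assms em_ses[OF s] B.Hom_comp[OF un_Hom[OF O] em_Hom[OF f]]] by blast
 obtain g' where g': "g' \<in> HomA (lo Q) Y" "em (lo Q) Y g' * un Q = g" using lo_ex[OF g(1) p(2)] by blast
 have "em (lo Q) Z (p * g') * un Q = em (lo Q) Z f * un Q"
  using em_comp[OF g'(1) p(1)] g g' by (simp add: mult.assoc)
 hence "p * g' = f" using lo_eqI[OF O A.Hom_comp[OF g'(1) p(1)] f] by simp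
 thus "\<exists>g\<in>HomA (lo Q) Y. p * g = f" using g' by blast
qed

lemma extz_eo_lo:
 assumes "N \<in> ObB" shows "B.extz n (eo (lo N)) Y \<longleftrightarrow> B.extz n N Y" "B.extz n Y (eo (lo N)) \<longleftrightarrow> B.extz n Y N"
proof -
 have "B.stable_retract (eo (lo N)) N" "B.stable_retract N (eo (lo N))"
  using B.stable_retract_iso un_Hom vn_Hom un_vn vn_un assms by blast+
 thus "B.extz n (eo (lo N)) Y \<longleftrightarrow> B.extz n N Y" using B.extz_stable_retract by blast
 show "B.extz n Y (eo (lo N)) \<longleftrightarrow> B.extz n Y N"
  using B.extz_retract_right[OF un_Hom vn_Hom vn_un] B.extz_retract_right[OF vn_Hom un_Hom un_vn] assms by blast
qed

text \<open>Up to isomorphism every object of \<open>B\<close> is some \<open>eo (lo N)\<close>, so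
  in high degrees Ext out of \<open>eo P\<close> is controlled by Ext out of \<open>P\<close>, which
  vanishes.\<close>

lemma fpd_eo_proj: assumes "A.proj P" shows "B.fpd (eo P)"
proof -
 obtain t where t: "\<forall>n\<ge>t. \<forall>X\<in>ObA. \<forall>Y\<in>ObA. A.extz n X Y \<longleftrightarrow> B.extz n (eo X) (eo Y)"
  using eventually_ext by blast
 have P: "P \<in> ObA" using assms A.proj_Ob by auto
 have "\<forall>n\<ge>t. \<forall>Y\<in>ObB. B.extz n (eo P) Y"
  using t P A.extz_proj[OF assms] lo_Ob extz_eo_lo(2) by blast
 thus ?thesis unfolding B.fpd_def using P eo_Ob by blast
qed

text \<open>A finite projective resolution of \<open>W\<close> restricts to a resolution by objects
  of finite projective dimension.\<close>

lemma fpd_eo: assumes "A.fpd W" shows "B.fpd (eo W)"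
proof -
 obtain m where "\<forall>n\<ge>m. \<forall>Y\<in>ObA. A.extz n W Y" "W \<in> ObA" using assms unfolding A.fpd_def by auto
 thus ?thesis
 proof (induction m arbitrary: W)
  case 0
  hence "A.proj W" unfolding A.proj_iff_ext1z by (metis A.extz.simps(1) le0)
  thus ?case by (rule fpd_eo_proj)
 next
  case (Suc m)
  obtain K P k p where K: "sesA K P W k p" "A.proj P" using A.proj_cover[OF Suc.prems(2)] by metis
  have "\<forall>n\<ge>m. \<forall>Y\<in>ObA. A.extz n K Y" using Suc.prems(1) A.extz_syzygy[OF K] by (metis Suc_le_mono)
  hence "B.fpd (eo K)" using Suc.IH A.ses_Ob[OF K(1)] by blast
  thus ?case using B.fpd_cokernel[OF em_ses[OF K(1)]] fpd_eo_proj[OF K(2)] by blast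
 qed
qed

lemma fpd_of_eo: assumes "B.fpd (eo W)" "W \<in> ObA" shows "A.fpd W"
proof -
 obtain t where t: "\<forall>n\<ge>t. \<forall>X\<in>ObA. \<forall>Y\<in>ObA. A.extz n X Y \<longleftrightarrow> B.extz n (eo X) (eo Y)"
  using eventually_ext by blast
 obtain m where "\<forall>n\<ge>m. \<forall>Y\<in>ObB. B.extz n (eo W) Y" using assms unfolding B.fpd_def by auto
 hence "\<forall>n\<ge>max t m. \<forall>Y\<in>ObA. A.extz n W Y" using t assms(2) eo_Ob by auto
 thus ?thesis unfolding A.fpd_def using assms(2) by blast
qed

text \<open>Half of the Gorenstein property of the corner: Ext into \<open>RegB\<close> agrees in
  high degrees with Ext from \<open>lo X\<close> into the projective \<open>lo RegB\<close>, and Ext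
  into projectives is bounded as Ext into \<open>RegA\<close> is.\<close>

lemma B_Reg_extz: "\<exists>d. \<forall>X\<in>ObB. \<forall>n\<ge>d. B.extz n X RegB"
proof -
 obtain t where t: "\<forall>n\<ge>t. \<forall>X\<in>ObA. \<forall>Y\<in>ObA. A.extz n X Y \<longleftrightarrow> B.extz n (eo X) (eo Y)"
  using eventually_ext by blast
 obtain d where d: "\<forall>X\<in>ObA. \<forall>n\<ge>d. A.extz n X RegA" using A.Reg_extz by blast
 have "B.extz n X RegB" if "X \<in> ObB" "n \<ge> max t d" for n X
 proof -
  have "A.extz n (lo X) (lo RegB)" using d that lo_Ob A.extz_Reg_proj[OF _ lo_proj[OF Reg_proj]] by simp
  hence "B.extz n (eo (lo X)) (eo (lo RegB))" using t that lo_Ob B.Reg_Ob by (metis max.bounded_iff)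
  thus ?thesis using extz_eo_lo that B.Reg_Ob by blast
 qed
 thus ?thesis by blast
qed

text \<open>A splitting over \<open>eo Z\<close> transfers along the adjunction, so \<open>Ext\<^sup>1\<close> out of \<open>lo N\<close> embeds into \<open>Ext\<^sup>1\<close> out of \<open>N\<close>.\<close>

lemma ext1z_lo:
 assumes "N \<in> ObB" "Y \<in> ObA" and E: "B.ext1z N (eo Y)"
 shows "A.ext1z (lo N) Y"
 unfolding A.ext1z_def
proof (intro allI impI)
 fix K M k m f assume s: "sesA K M (lo N) k m" and f: "f \<in> HomA K Y"
 obtain Z v j w where Z: "sesA Y Z (lo N) v w" "j \<in> HomA M Z" "j * k = v * f" using A.pushout[OF s f] by metis
 have h: "v \<in> HomA Y Z" "w \<in> HomA Z (lo N)" "Z \<in> ObA" "lo N \<in> ObA" using A.ses_Hom[OF Z(1)] A.ses_Ob[OF Z(1)] by auto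
 obtain s where s: "s \<in> HomB N (eo Z)" "em Z (lo N) w * s = un N"
  using B.ext1z_lift[OF E em_ses[OF Z(1)] un_Hom[OF assms(1)]] by blast
 obtain g where g: "g \<in> HomA (lo N) Z" "em (lo N) Z g * un N = s" using lo_ex[OF s(1) h(3)] by blast
 have wg: "w * g = idA (lo N)"
 proof (rule lo_eqI[OF assms(1)])
  show "w * g \<in> HomA (lo N) (lo N)" "idA (lo N) \<in> HomA (lo N) (lo N)"
   using h g(1) A.Hom_comp A.idn_Hom by blast+
  show "em (lo N) (lo N) (w * g) * un N = em (lo N) (lo N) (idA (lo N)) * un N"
   using em_comp[OF g(1) h(2)] s g em_id[OF h(4)] B.idn_left[OF un_Hom[OF assms(1)]] by (simp add: mult.assoc)
 qed
 have "w * (idA Z - g * w) = w * idA Z - (w * g) * w" by (simp add: right_diff_distrib mult.assoc)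
 hence "w * (idA Z - g * w) = 0" using A.idn_left[OF h(2)] A.idn_right[OF h(2)] wg by simp
 then obtain r where r: "r \<in> HomA Z Y" "v * r = idA Z - g * w"
  using A.ses_ker[OF Z(1) A.Hom_diff[OF A.idn_Hom[OF h(3)] A.Hom_comp[OF h(2) g(1)]]] by blast
 have "v * (r * v) = (idA Z - g * w) * v" using r(2) by (metis mult.assoc)
 also have "\<dots> = v * idA Y" using A.ses_zero[OF Z(1)] A.idn_left[OF h(1)] A.idn_right[OF h(1)]
  by (simp add: left_diff_distrib mult.assoc)
 finally have "r * v = idA Y" by (rule A.ses_mono_eq[OF Z(1) A.Hom_comp[OF h(1) r(1)] A.idn_Hom[OF assms(2)]])
 hence "(r * j) * k = f" using Z(3) A.idn_left[OF f] by (metis mult.assoc)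
 thus "\<exists>g\<in>HomA M Y. g * k = f" using A.Hom_comp[OF Z(2) r(1)] by blast
qed

text \<open>An approximation of \<open>lo X\<close> with kernel \<open>Y\<close> splits:
  \<open>eo Y\<close> has finite projective dimension, hence admits no extension by the
  Cohen-Macaulay \<open>X\<close>, and \<open>ext1z_lo\<close> moves this to \<open>lo X\<close> and
  \<open>Y\<close>.\<close>

lemma cm_lo: assumes "B.cm X" shows "A.cm (lo X)"
proof -
 have O: "X \<in> ObB" "lo X \<in> ObA" using assms B.cm_Ob lo_Ob by auto
 obtain Y C y c where C: "sesA Y C (lo X) y c" "A.cm C" "A.fpd Y" using A.cm_approximation[OF O(2)] by metis
 have "A.ext1z (lo X) Y" by (rule ext1z_lo[OF O(1) A.fpd_Ob[OF C(3)] B.cm_fpd_ext1z[OF assms fpd_eo[OF C(3)]]])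
 then obtain s where "s \<in> HomA (lo X) C" "c * s = idA (lo X)"
  using A.ext1z_lift[OF _ C(1) A.idn_Hom[OF O(2)]] by blast
 thus ?thesis using A.stable_retract_iso A.ses_Hom2[OF C(1)] A.cm_stable_retract C(2) by blast
qed

text \<open>The other half. \<open>X\<close> embeds into \<open>eo P\<close>, which is not known to
  be projective but has finite projective dimension, as has the kernel of its cover
  \<open>Q\<close>. So the embedding lifts to an arrow \<open>h\<close> into \<open>Q\<close>, still
  mono, and \<open>B_embed\<close> provides a cokernel without Ext^1 into
  \<open>RegB\<close>.\<close>

lemma B_cm_embed: assumes "B.cm X" shows "\<exists>P S i p. sesB X P S i p & B.proj P & B.cm S"
proof -
 have O: "X \<in> ObB" "lo X \<in> ObA" using assms B.cm_Ob lo_Ob by auto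
 obtain P S i p where P: "sesA (lo X) P S i p" "A.proj P" using A.cm_embed[OF cm_lo[OF assms]] by blast
 obtain K Q k q where Q: "sesB K Q (eo P) k q" "B.proj Q" using B.proj_cover[OF eo_Ob[OF A.proj_Ob[OF P(2)]]] by metis
 have "B.fpd K" using B.fpd_kernel[OF Q(1) B.fpd_proj[OF Q(2)] fpd_eo_proj[OF P(2)]] .
 note eP = em_ses[OF P(1)]
 obtain h where h: "h \<in> HomB X Q" "q * h = em (lo X) P i * un X"
  using B.ext1z_lift[OF B.cm_fpd_ext1z[OF assms \<open>B.fpd K\<close>] Q(1) B.Hom_comp[OF un_Hom[OF O(1)] B.ses_Hom1[OF eP]]] by blast
 have "g = 0" if g: "g \<in> HomB D X" "h * g = 0" for D g
 proof -
  have "em (lo X) P i * (un X * g) = 0" using h(2) g(2) by (metis mult.assoc mult_zero_right)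
  hence "un X * g = 0" using B.ses_mono[OF eP B.Hom_comp[OF g(1) un_Hom[OF O(1)]]] by simp
  hence "vn X * un X * g = 0" by (simp add: mult.assoc)
  thus "g = 0" using vn_un[OF O(1)] B.idn_left[OF g(1)] by simp
 qed
 thus ?thesis using B_embed[OF assms Q(2) h(1)] B.cm_cokernel assms B.cm_proj by blast
qed

end

sublocale restriction_adjunction \<subseteq> B: gorenstein_category ObB HomB idB sesB RegB
 by unfold_locales (rule B_Reg_extz, erule B_cm_embed)

section \<open>Exactness and stable full faithfulness of the left adjoint on Cohen-Macaulay
  objects\<close>

context restriction_adjunction
begin

lemma B_idn_zero: "T \<in> ObB ==> idB T = 0 ==> B.fpd T"
 using B.fpd_proj B.zero_proj by blast

text \<open>A left adjoint preserves cokernels, so the point is the kernel \<open>T\<close> of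
  \<open>lm X Q i\<close>. It restricts to zero, hence has finite projective dimension, while the
  image \<open>I\<close> is Cohen-Macaulay; so \<open>lo X\<close> splits as \<open>I\<close> plus
  \<open>T\<close>. The retraction to \<open>T\<close> vanishes because its restriction does, which
  forces \<open>T = 0\<close>.\<close>

lemma lm_ses:
 assumes s: "sesB X Q X' i p" and cm: "B.cm X" "B.cm Q" "B.cm X'"
 shows "sesA (lo X) (lo Q) (lo X') (lm X Q i) (lm Q X' p)"
proof -
 have O: "X \<in> ObB" "Q \<in> ObB" "X' \<in> ObB" using B.ses_Ob[OF s] by auto
 note OA = lo_Ob[OF O(1)] lo_Ob[OF O(2)] lo_Ob[OF O(3)]
 have h: "i \<in> HomB X Q" "p \<in> HomB Q X'" using B.ses_Hom[OF s] by auto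
 note li = lm_Hom[OF h(1)] and lp = lm_Hom[OF h(2)]
 obtain T I F t q m r where T: "sesA T (lo X) I t q" and F: "sesA I (lo Q) F m r" and mq: "lm X Q i = m * q"
  using A.image_factorization[OF li] by blast
 have hT: "t \<in> HomA T (lo X)" "q \<in> HomA (lo X) I" "m \<in> HomA I (lo Q)" "r \<in> HomA (lo Q) F"
  using A.ses_Hom[OF T] A.ses_Hom[OF F] by auto
 have OI: "T \<in> ObA" "I \<in> ObA" "F \<in> ObA" using hT A.Hom_Ob by auto
 have "lm Q X' p * lm X Q i = 0" using lm_comp[OF h] B.ses_zero[OF s] lm_zero[OF O(1,3)] by simp
 hence "lm Q X' p * m * q = 0" using mq by (simp add: mult.assoc)
 hence "lm Q X' p * m = 0" using A.ses_epi[OF T A.Hom_comp[OF hT(3) lp]] by simp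
 then obtain z where z: "z \<in> HomA F (lo X')" "z * r = lm Q X' p" using A.ses_coker[OF F lp] by blast
 \<comment> \<open>The transpose \<open>x'\<close> of the arrow that this induces on
   \<open>X'\<close> inverts \<open>z\<close>, so the cokernel \<open>F\<close> is
   \<open>lo X'\<close>.\<close>
 have er: "em (lo Q) F r * un Q \<in> HomB Q (eo F)" using em_Hom[OF hT(4)] un_Hom[OF O(2)] B.Hom_comp by blast
 have "em (lo Q) F r * un Q * i = em (lo Q) F r * (em (lo X) (lo Q) (lm X Q i) * un X)"
  using lm_un[OF h(1)] by (simp add: mult.assoc)
 also have "\<dots> = em (lo X) F (r * m * q) * un X" using em_comp[OF li hT(4)] mq by (simp add: mult.assoc)
 also have "\<dots> = 0" using A.ses_zero[OF F] em_zero[OF OA(1) OI(3)] by simp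
 finally obtain x where x: "x \<in> HomB X' (eo F)" "x * p = em (lo Q) F r * un Q" using B.ses_coker[OF s er] by blast
 obtain x' where x': "x' \<in> HomA (lo X') F" "em (lo X') F x' * un X' = x" using lo_ex[OF x(1) OI(3)] by blast
 have "x' * lm Q X' p = r"
 proof (rule lo_eqI[OF O(2) A.Hom_comp[OF lp x'(1)] hT(4)])
  have "em (lo Q) F (x' * lm Q X' p) * un Q = em (lo X') F x' * (em (lo Q) (lo X') (lm Q X' p) * un Q)"
   using em_comp[OF lp x'(1)] by (simp add: mult.assoc)
  also have "\<dots> = x * p" using lm_un[OF h(2)] x'(2) by (simp flip: mult.assoc)
  finally show "em (lo Q) F (x' * lm Q X' p) * un Q = em (lo Q) F r * un Q" using x by simp
 qed
 hence "x' * z * r = idA F * r" using z(2) A.idn_left[OF hT(4)] by (simp add: mult.assoc)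
 hence xz: "x' * z = idA F" using A.ses_epi_eq[OF F A.Hom_comp[OF z(1) x'(1)] A.idn_Hom[OF OI(3)]] by simp
 have "em F (lo X') z * x * p = em F (lo X') z * em (lo Q) F r * un Q" using x by (simp add: mult.assoc)
 also have "\<dots> = un X' * p" using em_comp[OF hT(4) z(1)] z(2) lm_un[OF h(2)] by simp
 finally have "em F (lo X') z * x = un X'"
  using B.ses_epi_eq[OF s B.Hom_comp[OF x(1) em_Hom[OF z(1)]] un_Hom[OF O(3)]] by simp
 hence "em (lo X') (lo X') (z * x') * un X' = em (lo X') (lo X') (idA (lo X')) * un X'"
  using em_comp[OF x'(1) z(1)] x'(2) em_id[OF OA(3)] B.idn_left[OF un_Hom[OF O(3)]] by (simp add: mult.assoc)
 hence zx: "z * x' = idA (lo X')" using lo_eqI[OF O(3) A.Hom_comp[OF x'(1) z(1)] A.idn_Hom[OF OA(3)]] by simp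
 have F': "sesA I (lo Q) (lo X') m (lm Q X' p)" using A.ses_iso_right[OF F z(1) x'(1) xz zx] z(2) by simp
 have "A.cm I" using A.cm_kernel[OF F'] cm_lo cm by blast
 have et: "em T (lo X) t \<in> HomB (eo T) (eo (lo X))" by (rule em_Hom[OF hT(1)])
 \<comment> \<open>Restricted along the unit, \<open>lm X Q i\<close> is \<open>i\<close>, which is
   mono; hence the restriction of the kernel arrow \<open>t\<close> is zero, and so is the identity
   of \<open>eo T\<close>.\<close>
 have "i * (vn X * em T (lo X) t) = 0"
 proof -
  have "un Q * (i * (vn X * em T (lo X) t)) = em (lo X) (lo Q) (lm X Q i) * (un X * vn X) * em T (lo X) t"
   using lm_un[OF h(1)] by (simp flip: mult.assoc)
  also have "\<dots> = em T (lo Q) (m * q * t)"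
   using un_vn[OF O(1)] B.idn_right[OF em_Hom[OF li]] em_comp[OF hT(1) li] mq by simp
  also have "\<dots> = 0" using A.ses_zero[OF T] em_zero[OF OI(1) OA(2)] by (simp add: mult.assoc)
  finally have "vn Q * un Q * (i * (vn X * em T (lo X) t)) = 0" by (simp add: mult.assoc)
  moreover have "i * (vn X * em T (lo X) t) \<in> HomB (eo T) Q" using B.Hom_comp h et vn_Hom[OF O(1)] by blast
  ultimately show ?thesis using vn_un[OF O(2)] B.idn_left by simp
 qed
 hence "vn X * em T (lo X) t = 0" using B.ses_mono[OF s B.Hom_comp[OF et vn_Hom[OF O(1)]]] by simp
 hence "un X * vn X * em T (lo X) t = 0" by (simp add: mult.assoc)
 hence "em T (lo X) t * idB (eo T) = 0" using un_vn[OF O(1)] B.idn_left[OF et] by simp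
 hence eT: "idB (eo T) = 0" using B.ses_mono[OF em_ses[OF T] B.idn_Hom[OF eo_Ob[OF OI(1)]]] by simp
 hence "A.fpd T" using fpd_of_eo B_idn_zero eo_Ob OI(1) by blast
 hence E: "A.ext1z I T" using A.cm_fpd_ext1z[OF \<open>A.cm I\<close>] by blast
 obtain ret where ret: "ret \<in> HomA (lo X) T" "ret * t = idA T"
  using A.ext1z_extend[OF E T A.idn_Hom[OF OI(1)]] by blast
 \<comment> \<open>An arrow out of \<open>lo X\<close> is determined by its restriction, and every
   arrow into \<open>eo T\<close> is zero.\<close>
 have "em (lo X) T ret = 0" using B.idn_left[OF em_Hom[OF ret(1)]] eT by simp
 hence "ret = 0" using lo_eqI[OF O(1) ret(1) A.Hom_zero[OF OA(1) OI(1)]] em_zero[OF OA(1) OI(1)] by simp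
 hence T0: "idA T = 0" using ret(2) by simp
 obtain sec where sec: "sec \<in> HomA I (lo X)" "q * sec = idA I"
  using A.ext1z_lift[OF E T A.idn_Hom[OF OI(2)]] by blast
 have d: "sec * q - idA (lo X) \<in> HomA (lo X) (lo X)"
  using A.Hom_diff[OF A.Hom_comp[OF hT(2) sec(1)] A.idn_Hom[OF OA(1)]] .
 have "q * (sec * q - idA (lo X)) = q * sec * q - q * idA (lo X)" by (simp add: right_diff_distrib mult.assoc)
 also have "\<dots> = 0" using sec(2) A.idn_left[OF hT(2)] A.idn_right[OF hT(2)] by simp
 finally obtain y where y: "y \<in> HomA (lo X) T" "t * y = sec * q - idA (lo X)" using A.ses_ker[OF T d] by blast
 have "y = 0" using A.idn_left[OF y(1)] T0 by simp
 hence "sec * q = idA (lo X)" using y(2) by simp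
 hence "sesA (lo X) (lo Q) (lo X') (m * q) (lm Q X' p)" using A.ses_iso_left[OF F' hT(2) sec(1) sec(2)] by simp
 thus ?thesis using mq by simp
qed

lemma lm_pmaps: assumes "f \<in> B.pmaps X Y" shows "lm X Y f \<in> A.pmaps (lo X) (lo Y)"
proof -
 obtain Q g h where "B.proj Q" "g \<in> HomB X Q" "h \<in> HomB Q Y" "f = h * g" using assms by (rule B.pmapsE)
 thus ?thesis using lm_comp lm_Hom A.pmapsI lo_proj by metis
qed

text \<open>A factorization of \<open>lm X Y f\<close> through a projective \<open>P\<close>
  restricts to one of \<open>f\<close> through \<open>eo P\<close>. The kernel of a cover
  \<open>Q\<close> of \<open>eo P\<close> has finite projective dimension, so the arrow from the
  Cohen-Macaulay \<open>X\<close> lifts to \<open>Q\<close>.\<close>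

lemma lm_pmaps_iff:
 assumes "B.cm X" "f \<in> HomB X Y"
 shows "lm X Y f \<in> A.pmaps (lo X) (lo Y) \<longleftrightarrow> f \<in> B.pmaps X Y"
proof
 assume "lm X Y f \<in> A.pmaps (lo X) (lo Y)"
 then obtain P g h where P: "A.proj P" "g \<in> HomA (lo X) P" "h \<in> HomA P (lo Y)" "lm X Y f = h * g"
  by (rule A.pmapsE)
 have O: "X \<in> ObB" "Y \<in> ObB" using assms B.Hom_Ob by auto
 obtain K Q k q where Q: "sesB K Q (eo P) k q" "B.proj Q" using B.proj_cover[OF eo_Ob[OF A.proj_Ob[OF P(1)]]] by metis
 have "B.fpd K" using B.fpd_kernel[OF Q(1) B.fpd_proj[OF Q(2)] fpd_eo_proj[OF P(1)]] .
 then obtain l where l: "l \<in> HomB X Q" "q * l = em (lo X) P g * un X"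
  using B.ext1z_lift[OF B.cm_fpd_ext1z[OF assms(1)] Q(1) B.Hom_comp[OF un_Hom[OF O(1)] em_Hom[OF P(2)]]] by blast
 have "f = vn Y * em (lo X) (lo Y) (h * g) * un X" using linv_lm[OF assms(2)] P(4) unfolding linv_def by simp
 also have "\<dots> = vn Y * em P (lo Y) h * (em (lo X) P g * un X)" using em_comp[OF P(2,3)] by (simp add: mult.assoc)
 also have "\<dots> = (vn Y * em P (lo Y) h * q) * l" using l(2) by (simp add: mult.assoc)
 finally have "f = (vn Y * em P (lo Y) h * q) * l" .
 moreover have "vn Y * em P (lo Y) h * q \<in> HomB Q Y"
  using vn_Hom[OF O(2)] em_Hom[OF P(3)] B.ses_Hom2[OF Q(1)] B.Hom_comp by blast
 ultimately show "f \<in> B.pmaps X Y" using B.pmapsI[OF Q(2) l(1)] by simp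
qed (rule lm_pmaps)

lemma lm_eqv: "B.eqv X Y f g ==> A.eqv (lo X) (lo Y) (lm X Y f) (lm X Y g)"
 unfolding A.eqv_def B.eqv_def using cm_lo lm_Hom lm_pmaps lm_diff[of f X Y g] by metis

lemma lm_eqv_iff:
 assumes "B.cm X" "f \<in> HomB X Y" "g \<in> HomB X Y"
 shows "A.eqv (lo X) (lo Y) (lm X Y f) (lm X Y g) \<longleftrightarrow> B.eqv X Y f g"
 unfolding A.eqv_def B.eqv_def
 using assms cm_lo lm_Hom lm_pmaps_iff[OF assms(1) B.Hom_diff[OF assms(2,3)]] lm_diff[OF assms(2,3)] by auto

lemma linv_eqv:
 assumes "B.cm X" "Y \<in> ObB" "A.eqv (lo X) (lo Y) f g"
 shows "B.eqv X Y (linv X Y f) (linv X Y g)"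
proof -
 have "X \<in> ObB" using assms B.cm_Ob by auto
 thus ?thesis using lm_eqv_iff[OF assms(1) linv_Hom linv_Hom, of Y f g] lm_linv A.eqvD[OF assms(3)] assms by simp
qed

lemma linv_add:
 assumes "X \<in> ObB" "Y \<in> ObB" "f \<in> HomA (lo X) (lo Y)" "g \<in> HomA (lo X) (lo Y)"
 shows "linv X Y (f + g) = linv X Y f + linv X Y g"
 unfolding linv_def using em_add[OF assms(3,4)] by (simp add: algebra_simps)

lemma linv_comp:
 assumes "X \<in> ObB" "Y \<in> ObB" "Z \<in> ObB" "f \<in> HomA (lo X) (lo Y)" "g \<in> HomA (lo Y) (lo Z)"
 shows "linv X Z (g * f) = linv Y Z g * linv X Y f"
proof -
 have "linv X Z (lm Y Z (linv Y Z g) * lm X Y (linv X Y f)) = linv Y Z g * linv X Y f"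
  using lm_comp[OF linv_Hom[OF assms(1,2,4)] linv_Hom[OF assms(2,3,5)]]
   linv_lm[OF B.Hom_comp[OF linv_Hom[OF assms(1,2,4)] linv_Hom[OF assms(2,3,5)]]] by simp
 thus ?thesis using lm_linv assms by simp
qed

lemma linv_idn: "X \<in> ObB ==> linv X X (idA (lo X)) = idB X"
 using linv_lm[OF B.idn_Hom] lm_idn by metis

lemma linv_siso:
 assumes "B.cm X" "B.cm Y" "A.siso (lo X) (lo Y) f g"
 shows "B.siso X Y (linv X Y f) (linv Y X g)"
proof -
 have O: "X \<in> ObB" "Y \<in> ObB" using assms B.cm_Ob by auto
 note d = A.sisoD[OF assms(3)]
 show ?thesis unfolding B.siso_def
  using linv_Hom[OF O d(1)] linv_Hom[OF O(2,1) d(2)] linv_eqv[OF assms(1) O(1) d(3)] linv_eqv[OF assms(2) O(2) d(4)]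
   linv_comp[OF O O(1) d(1,2)] linv_comp[OF O(2,1,2) d(2,1)] linv_idn O by simp
qed

lemma lm_susp:
 assumes "B.susp X I S i p"
 shows "A.susp (lo X) (lo I) (lo S) (lm X I i) (lm I S p)"
 using lm_ses B.suspD[OF assms] B.cm_proj lo_proj cm_lo unfolding A.susp_def by blast

lemma lm_shifted:
 assumes "B.susp X I S i p" "B.susp X' I' S' i' p'" "f \<in> HomB X X'" "B.shifted I S i p I' S' i' p' f g"
 shows "A.shifted (lo I) (lo S) (lm X I i) (lm I S p) (lo I') (lo S') (lm X' I' i') (lm I' S' p') (lm X X' f) (lm S S' g)"
proof -
 note a = B.suspD[OF assms(1)] and b = B.suspD[OF assms(2)]
 obtain h where h: "g \<in> HomB S S'" "h \<in> HomB I I'" "h * i = i' * f" "g * p = p' * h"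
  using assms(4) unfolding B.shifted_def by blast
 show ?thesis unfolding A.shifted_def
  using lm_Hom h(1,2) lm_comp[OF a(5) h(2)] lm_comp[OF assms(3) b(5)] lm_comp[OF a(6) h(1)] lm_comp[OF h(2) b(6)] h(3,4)
  by metis
qed

lemma lm_cone:
 assumes "B.cone X I S i p Y u Z v j w"
 shows "A.cone (lo X) (lo I) (lo S) (lm X I i) (lm I S p) (lo Y) (lm X Y u) (lo Z) (lm Y Z v) (lm I Z j) (lm Z S w)"
proof -
 note c = B.coneD[OF assms] and s = B.suspD[OF B.coneD(1)[OF assms]]
 show ?thesis unfolding A.cone_def
  using lm_susp[OF c(1)] cm_lo[OF c(2)] lm_Hom[OF c(3)] lm_Hom[OF c(5)] lm_ses[OF c(4,2,10) s(3)]
   lm_comp[OF s(5) c(5)] lm_comp[OF c(3,8)] lm_comp[OF c(5,9)] c(6,7) by simp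
qed

text \<open>Pushing \<open>lo C \<rightarrow> Z\<close> out along an embedding of \<open>lo C\<close> into a projective gives a cone \<open>W\<close> which is
 Cohen-Macaulay and, since \<open>eo W\<close> is a cokernel of modules of finite projective dimension, projective.\<close>

lemma lo_stably_dense:
 assumes "A.cm Z"
 obtains C f g where "B.cm C" "A.siso (lo C) Z f g"
proof -
 have O: "Z \<in> ObA" using assms A.cm_Ob by auto
 obtain Y C y c where C: "sesB Y C (eo Z) y c" "B.cm C" "B.fpd Y" using B.cm_approximation[OF eo_Ob[OF O]] by metis
 have OC: "C \<in> ObB" "lo C \<in> ObA" using C B.cm_Ob lo_Ob by auto
 obtain f where f: "f \<in> HomA (lo C) Z" "em (lo C) Z f * un C = c" using lo_ex[OF B.ses_Hom2[OF C(1)] O] by blast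
 obtain Q S i q where Q: "A.susp (lo C) Q S i q" using A.cm_susp[OF cm_lo[OF C(2)]] by metis
 note s = A.suspD[OF Q]
 obtain W v j w where W: "sesA Z W S v w" "j \<in> HomA Q W" "j * i = v * f" "w * j = q"
  using A.pushout[OF s(1) f(1)] by metis
 have h: "v \<in> HomA Z W" "w \<in> HomA W S" using A.ses_Hom[OF W(1)] by auto
 \<comment> \<open>After restriction \<open>f\<close> is the approximation \<open>c\<close> up to
   the unit, hence a deflation with kernel \<open>Y\<close>; \<open>pushout_deflation\<close> passes
   this on to the restriction of \<open>j\<close>.\<close>
 have "em (lo C) Z f = c * vn C"
 proof -
  have "em (lo C) Z f * (un C * vn C) = c * vn C" using f(2) by (simp flip: mult.assoc)
  thus ?thesis using un_vn[OF OC(1)] B.idn_right[OF em_Hom[OF f(1)]] by simp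
 qed
 hence "sesB Y (eo (lo C)) (eo Z) (un C * y) (em (lo C) Z f)"
  using B.ses_iso_mid[OF C(1) un_Hom[OF OC(1)] vn_Hom[OF OC(1)] vn_un[OF OC(1)] un_vn[OF OC(1)]] by simp
 moreover have "em Q W j * em (lo C) Q i = em Z W v * em (lo C) Z f"
  using em_comp[OF s(5) W(2)] em_comp[OF f(1) h(1)] W(3) by simp
 moreover have "em W S w * em Q W j = em Q S q" using em_comp[OF W(2) h(2)] W(4) by simp
 ultimately have "sesB Y (eo Q) (eo W) (em (lo C) Q i * (un C * y)) (em Q W j)"
  using B.pushout_deflation[OF em_ses[OF s(1)] em_ses[OF W(1)] em_Hom[OF W(2)] em_Hom[OF f(1)]] by blast
 hence "B.fpd (eo W)" using B.fpd_cokernel C(3) fpd_eo_proj[OF s(2)] by blast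
 hence "A.fpd W" using fpd_of_eo A.ses_Ob[OF W(1)] by blast
 moreover have "A.cm W" using A.cm_extension[OF W(1) assms s(3)] .
 ultimately have "A.proj W" using A.cm_fpd_proj by blast
 \<comment> \<open>now both \<open>lo C\<close> and \<open>Z\<close> are first syzygies of \<open>S\<close>\<close>
 hence Z: "A.susp Z W S v w" unfolding A.susp_def using W(1) s(3) by blast
 have idS: "idA S \<in> HomA S S" using A.idn_Hom s(9) by blast
 have qS: "q \<in> HomA Q S" "idA S * q = q" "idA S * w = w" using s(6) A.idn_left h by auto
 \<comment> \<open>\<open>j\<close> and \<open>b\<close> compare the two projective covers of
   \<open>S\<close> in both directions. They induce \<open>f\<close> and \<open>g\<close> on the
   kernels, and the errors of the composites lie in those kernels, so they factor through
   \<open>Q\<close> and \<open>W\<close>.\<close>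
 obtain b where b: "b \<in> HomA W Q" "q * b = w" using A.proj_lift[OF \<open>A.proj W\<close> s(1) h(2)] by blast
 have "q * (b * v) = 0" using b A.ses_zero[OF W(1)] by (simp flip: mult.assoc)
 then obtain g where g: "g \<in> HomA Z (lo C)" "i * g = b * v" using A.ses_ker[OF s(1) A.Hom_comp[OF h(1) b(1)]] by blast
 have OQ: "Q \<in> ObA" "W \<in> ObA" using s(8) A.ses_Ob[OF W(1)] by auto
 have "q * (b * j - idA Q) = 0" using b W(4) A.idn_right[OF s(6)] by (simp add: right_diff_distrib flip: mult.assoc)
 then obtain x where x: "x \<in> HomA Q (lo C)" "i * x = b * j - idA Q"
  using A.ses_ker[OF s(1) A.Hom_diff[OF A.Hom_comp[OF W(2) b(1)] A.idn_Hom[OF OQ(1)]]] by blast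
 have "i * (x * i) = (b * j - idA Q) * i" using x(2) by (metis mult.assoc)
 also have "\<dots> = b * v * f - i" using W(3) A.idn_left[OF s(5)] by (simp add: left_diff_distrib mult.assoc)
 also have "\<dots> = i * (g * f - idA (lo C))"
  using A.idn_right[OF s(5)] by (simp add: right_diff_distrib flip: mult.assoc g(2))
 finally have "x * i = g * f - idA (lo C)"
  by (rule A.ses_mono_eq[OF s(1) A.Hom_comp[OF s(5) x(1)] A.Hom_diff[OF A.Hom_comp[OF f(1) g(1)] A.idn_Hom[OF OC(2)]]])
 hence 1: "A.eqv (lo C) (lo C) (g * f) (idA (lo C))"
  unfolding A.eqv_def using A.pmapsI[OF s(2,5) x(1)] s(4) A.Hom_comp[OF f(1) g(1)] A.idn_Hom[OF OC(2)] by simp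
 have "w * (j * b - idA W) = 0" using b W(4) A.idn_right[OF h(2)] by (simp add: right_diff_distrib flip: mult.assoc)
 then obtain x' where x': "x' \<in> HomA W Z" "v * x' = j * b - idA W"
  using A.ses_ker[OF W(1) A.Hom_diff[OF A.Hom_comp[OF b(1) W(2)] A.idn_Hom[OF OQ(2)]]] by blast
 have "v * (x' * v) = (j * b - idA W) * v" using x'(2) by (metis mult.assoc)
 also have "\<dots> = j * i * g - v" using g(2) A.idn_left[OF h(1)] by (simp add: left_diff_distrib mult.assoc)
 also have "\<dots> = v * (f * g - idA Z)"
  using A.idn_right[OF h(1)] W(3) by (simp add: right_diff_distrib mult.assoc)
 finally have "x' * v = f * g - idA Z"
  by (rule A.ses_mono_eq[OF W(1) A.Hom_comp[OF h(1) x'(1)] A.Hom_diff[OF A.Hom_comp[OF g(1) f(1)] A.idn_Hom[OF O]]])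
 hence 2: "A.eqv Z Z (f * g) (idA Z)"
  unfolding A.eqv_def using A.pmapsI[OF \<open>A.proj W\<close> h(1) x'(1)] assms A.Hom_comp[OF g(1) f(1)] A.idn_Hom[OF O] by simp
 show ?thesis using that[OF C(2)] 1 2 f(1) g(1) unfolding A.siso_def by blast
qed

section \<open>The quasi-inverse and its compatibility with suspensions and cones\<close>

definition Fo :: "'o => 'p" where
 "Fo Z = (SOME C. B.cm C & (\<exists>f g. A.siso (lo C) Z f g))"

definition fz :: "'o => 'e" where "fz Z = (SOME f. \<exists>g. A.siso (lo (Fo Z)) Z f g)"

definition gz :: "'o => 'e" where "gz Z = (SOME g. A.siso (lo (Fo Z)) Z (fz Z) g)"

definition Fm :: "'o => 'o => 'e => 'f" where
 "Fm Z Z' h = linv (Fo Z) (Fo Z') (gz Z' * h * fz Z)"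

lemma Fo:
 assumes "A.cm Z"
 shows Fo_cm: "B.cm (Fo Z)" and Fo_siso: "A.siso (lo (Fo Z)) Z (fz Z) (gz Z)"
proof -
 have "\<exists>C. B.cm C & (\<exists>f g. A.siso (lo C) Z f g)" using lo_stably_dense[OF assms] by metis
 from someI_ex[OF this] have F: "B.cm (Fo Z)" "\<exists>f g. A.siso (lo (Fo Z)) Z f g" unfolding Fo_def by auto
 hence "\<exists>g. A.siso (lo (Fo Z)) Z (fz Z) g" using someI_ex[OF F(2)] unfolding fz_def by auto
 from someI_ex[OF this] show "A.siso (lo (Fo Z)) Z (fz Z) (gz Z)" unfolding gz_def .
 show "B.cm (Fo Z)" by fact
qed

lemma Fo_Ob: "A.cm Z ==> Fo Z \<in> ObB"
 using Fo_cm B.cm_Ob by blast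

lemma fz_Hom: "A.cm Z ==> fz Z \<in> HomA (lo (Fo Z)) Z"
 and gz_Hom: "A.cm Z ==> gz Z \<in> HomA Z (lo (Fo Z))" using Fo_siso A.sisoD by blast+

context
 fixes Z Z' :: 'o
 assumes Z: "A.cm Z" and Z': "A.cm Z'"
begin

lemma gz_fz_Hom: "h \<in> HomA Z Z' ==> gz Z' * h * fz Z \<in> HomA (lo (Fo Z)) (lo (Fo Z'))"
 by (rule A.Hom_comp[OF fz_Hom[OF Z] A.Hom_comp[OF _ gz_Hom[OF Z']]])

lemma Fm_Hom: "h \<in> HomA Z Z' ==> Fm Z Z' h \<in> HomB (Fo Z) (Fo Z')"
 unfolding Fm_def using linv_Hom gz_fz_Hom Fo_Ob Z Z' by blast

lemma lm_Fm: "h \<in> HomA Z Z' ==> lm (Fo Z) (Fo Z') (Fm Z Z' h) = gz Z' * h * fz Z"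
 unfolding Fm_def using lm_linv gz_fz_Hom Fo_Ob Z Z' by blast

lemma Fm_add: "h \<in> HomA Z Z' ==> k \<in> HomA Z Z' ==> Fm Z Z' (h + k) = Fm Z Z' h + Fm Z Z' k"
 unfolding Fm_def using linv_add[OF Fo_Ob[OF Z] Fo_Ob[OF Z'] gz_fz_Hom gz_fz_Hom] by (simp add: algebra_simps)

lemma Fm_eqv: "A.eqv Z Z' h k ==> B.eqv (Fo Z) (Fo Z') (Fm Z Z' h) (Fm Z Z' k)"
 unfolding Fm_def by (rule linv_eqv[OF Fo_cm[OF Z] Fo_Ob[OF Z']])
   (rule A.eqv_right[OF A.eqv_left[OF _ gz_Hom[OF Z']] cm_lo[OF Fo_cm[OF Z]] fz_Hom[OF Z]])

lemma fz_natural: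
 assumes "h \<in> HomA Z Z'"
 shows "A.eqv (lo (Fo Z)) Z' (fz Z' * lm (Fo Z) (Fo Z') (Fm Z Z' h)) (h * fz Z)"
 using A.siso_cancel_left[OF A.siso_sym[OF Fo_siso[OF Z']] A.Hom_comp[OF fz_Hom[OF Z] assms] cm_lo[OF Fo_cm[OF Z]]]
 unfolding lm_Fm[OF assms] by (simp add: mult.assoc)

end

lemma Fm_idn: assumes "A.cm Z" shows "B.eqv (Fo Z) (Fo Z) (Fm Z Z (idA Z)) (idB (Fo Z))"
proof -
 have "gz Z * idA Z * fz Z = gz Z * fz Z" using A.idn_right[OF gz_Hom[OF assms]] by simp
 hence "A.eqv (lo (Fo Z)) (lo (Fo Z)) (gz Z * idA Z * fz Z) (idA (lo (Fo Z)))"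
  using A.sisoD(3)[OF Fo_siso[OF assms]] by simp
 thus ?thesis unfolding Fm_def
  using linv_eqv[OF Fo_cm[OF assms] Fo_Ob[OF assms]] linv_idn[OF Fo_Ob[OF assms]] by metis
qed

lemma Fm_comp:
 assumes "A.cm X" "A.cm Y" "A.cm Z" "h \<in> HomA X Y" "k \<in> HomA Y Z"
 shows "B.eqv (Fo X) (Fo Z) (Fm X Z (k * h)) (Fm Y Z k * Fm X Y h)"
proof -
 have kf: "gz Z * k \<in> HomA Y (lo (Fo Z))" using A.Hom_comp[OF assms(5) gz_Hom[OF assms(3)]] .
 have hf: "h * fz X \<in> HomA (lo (Fo X)) Y" using A.Hom_comp[OF fz_Hom[OF assms(1)] assms(4)] .
 have "A.eqv (lo (Fo X)) (lo (Fo Z)) (gz Z * k * (h * fz X)) (gz Z * k * (fz Y * (gz Y * (h * fz X))))"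
  by (rule A.eqv_left[OF A.eqv_sym[OF A.siso_cancel_left[OF A.siso_sym[OF Fo_siso[OF assms(2)]] hf cm_lo[OF Fo_cm[OF assms(1)]]]] kf])
 hence "A.eqv (lo (Fo X)) (lo (Fo Z)) (gz Z * (k * h) * fz X) ((gz Z * k * fz Y) * (gz Y * h * fz X))"
  by (simp add: mult.assoc)
 from linv_eqv[OF Fo_cm[OF assms(1)] Fo_Ob[OF assms(3)] this] show ?thesis
  unfolding Fm_def using linv_comp[OF Fo_Ob[OF assms(1)] Fo_Ob[OF assms(2)] Fo_Ob[OF assms(3)]
   gz_fz_Hom[OF assms(1,2,4)] gz_fz_Hom[OF assms(2,3,5)]] by simp
qed

lemma Fo_lo_siso:
 assumes "B.cm X"
 shows "B.siso (Fo (lo X)) X (linv (Fo (lo X)) X (fz (lo X))) (linv X (Fo (lo X)) (gz (lo X)))"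
 by (rule linv_siso[OF Fo_cm[OF cm_lo[OF assms]] assms Fo_siso[OF cm_lo[OF assms]]])

lemma Fo_lo_natural:
 assumes "B.cm X" "B.cm Y" "h \<in> HomB X Y"
 shows "B.eqv (Fo (lo X)) Y (linv (Fo (lo Y)) Y (fz (lo Y)) * Fm (lo X) (lo Y) (lm X Y h))
  (h * linv (Fo (lo X)) X (fz (lo X)))"
proof -
 note X = cm_lo[OF assms(1)] and Y = cm_lo[OF assms(2)]
 note O = B.cm_Ob[OF assms(1)] B.cm_Ob[OF assms(2)]
 have "B.eqv (Fo (lo X)) Y (linv (Fo (lo X)) Y (fz (lo Y) * lm (Fo (lo X)) (Fo (lo Y)) (Fm (lo X) (lo Y) (lm X Y h))))
   (linv (Fo (lo X)) Y (lm X Y h * fz (lo X)))"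
  by (rule linv_eqv[OF Fo_cm[OF X] O(2) fz_natural[OF X Y lm_Hom[OF assms(3)]]])
 thus ?thesis
  using linv_comp[OF Fo_Ob[OF X] Fo_Ob[OF Y] O(2) lm_Hom[OF Fm_Hom[OF X Y lm_Hom[OF assms(3)]]] fz_Hom[OF Y]]
   linv_comp[OF Fo_Ob[OF X] O fz_Hom[OF X] lm_Hom[OF assms(3)]]
   linv_lm[OF Fm_Hom[OF X Y lm_Hom[OF assms(3)]]] linv_lm[OF assms(3)] by simp
qed

text \<open>The comparison from \<open>Fo S\<close> to \<open>S'\<close>, that is, from the image of
  a suspension of \<open>Z\<close> to a suspension of \<open>Fo Z\<close>. As \<open>lo\<close>
  carries the latter to a suspension of \<open>lo (Fo Z)\<close>, the arrow \<open>gz Z\<close> has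
  a shift \<open>s\<close> from \<open>S\<close> to \<open>lo S'\<close>; the comparison is the
  transpose of \<open>s * fz S\<close>.\<close>

definition eta :: "'o => 'o => 'o => 'e => 'e => 'p => 'p => 'f => 'f => 'f => bool" where
 "eta Z I S i p I' S' i' p' h \<longleftrightarrow>
   (\<exists>s. A.shifted I S i p (lo I') (lo S') (lm (Fo Z) I' i') (lm I' S' p') (gz Z) s & h = linv (Fo S) S' (s * fz S))"

context
 fixes Z I S :: 'o and i p :: 'e and I' S' :: 'p and i' p' h :: 'f
 assumes A: "A.susp Z I S i p" and B: "B.susp (Fo Z) I' S' i' p'"
begin

lemma eta_exists: "\<exists>h. eta Z I S i p I' S' i' p' h"
 using A.shifted_exists[OF A lm_susp[OF B] gz_Hom[OF A.suspD(4)[OF A]]] unfolding eta_def by metis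

lemma eta_lm:
 assumes "eta Z I S i p I' S' i' p' h"
 obtains s where "A.shifted I S i p (lo I') (lo S') (lm (Fo Z) I' i') (lm I' S' p') (gz Z) s"
  "s \<in> HomA S (lo S')" "lm (Fo S) S' h = s * fz S" "h = linv (Fo S) S' (s * fz S)" "h \<in> HomB (Fo S) S'"
proof -
 note a = A.suspD[OF A] and b = B.suspD[OF B]
 obtain s where s: "A.shifted I S i p (lo I') (lo S') (lm (Fo Z) I' i') (lm I' S' p') (gz Z) s"
  "h = linv (Fo S) S' (s * fz S)" using assms unfolding eta_def by blast
 have hs: "s \<in> HomA S (lo S')" using s(1) unfolding A.shifted_def by blast
 note c = A.Hom_comp[OF fz_Hom[OF a(3)] hs]
 show ?thesis using that[OF s(1) hs _ s(2)] s(2) lm_linv[OF Fo_Ob[OF a(3)] b(9) c] linv_Hom[OF Fo_Ob[OF a(3)] b(9) c] by simp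
qed

lemma eta_siso:
 assumes "eta Z I S i p I' S' i' p' h"
 shows "\<exists>h'. B.siso (Fo S) S' h h'"
proof -
 note a = A.suspD[OF A] and b = B.suspD[OF B]
 obtain s where s: "A.shifted I S i p (lo I') (lo S') (lm (Fo Z) I' i') (lm I' S' p') (gz Z) s"
  "h = linv (Fo S) S' (s * fz S)" using eta_lm[OF assms] by metis
 obtain t where t: "A.shifted (lo I') (lo S') (lm (Fo Z) I' i') (lm I' S' p') I S i p (fz Z) t"
  using A.shifted_exists[OF lm_susp[OF B] A fz_Hom[OF a(4)]] by metis
 have "A.siso S (lo S') s t" by (rule A.shifted_siso[OF A lm_susp[OF B] A.siso_sym[OF Fo_siso[OF a(4)]] s(1) t])
 thus ?thesis using linv_siso[OF Fo_cm[OF a(3)] b(3) A.siso_comp[OF Fo_siso[OF a(3)]]] s(2) by blast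
qed

text \<open>After \<open>lm\<close>, and up to \<open>fz\<close>, the two sides are shifts of
  \<open>gz Z2 * f\<close> and \<open>lm (Fo Z) (Fo Z2) (Fm Z Z2 f) * gz Z\<close>. These are stably
  equal, so \<open>shifted_unique\<close> applies, and \<open>lm_eqv_iff\<close> returns to the
  corner.\<close>

lemma eta_natural:
 assumes A2: "A.susp Z2 I2 S2 i2 p2" and B2: "B.susp (Fo Z2) I2' S2' i2' p2'"
  and h: "eta Z I S i p I' S' i' p' h" and h2: "eta Z2 I2 S2 i2 p2 I2' S2' i2' p2' h2"
  and f: "f \<in> HomA Z Z2" and g: "A.shifted I S i p I2 S2 i2 p2 f g"
  and t: "B.shifted I' S' i' p' I2' S2' i2' p2' (Fm Z Z2 f) t"
 shows "B.eqv (Fo S) S2' (h2 * Fm S S2 g) (t * h)"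
proof -
 note a = A.suspD[OF A] and b = B.suspD[OF B] and a2 = A.suspD[OF A2] and b2 = B.suspD[OF B2]
 obtain s where s: "A.shifted I S i p (lo I') (lo S') (lm (Fo Z) I' i') (lm I' S' p') (gz Z) s"
  "s \<in> HomA S (lo S')" "lm (Fo S) S' h = s * fz S" "h \<in> HomB (Fo S) S'" using eta_lm[OF h] by metis
 obtain s2 where s2: "A.shifted I2 S2 i2 p2 (lo I2') (lo S2') (lm (Fo Z2) I2' i2') (lm I2' S2' p2') (gz Z2) s2"
  "s2 \<in> HomA S2 (lo S2')" "lm (Fo S2) S2' h2 = s2 * fz S2" "h2 \<in> HomB (Fo S2) S2'"
  using restriction_adjunction.eta_lm[OF restriction_adjunction_axioms A2 B2 h2] by metis
 have gH: "g \<in> HomA S S2" using g unfolding A.shifted_def by blast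
 have tH: "t \<in> HomB S' S2'" using t unfolding B.shifted_def by blast
 note FH = Fm_Hom[OF a(4) a2(4) f]
 have "A.eqv Z (lo (Fo Z2)) (gz Z2 * f * (fz Z * gz Z)) (gz Z2 * f)"
  by (rule A.siso_cancel_right[OF A.siso_sym[OF Fo_siso[OF a(4)]] A.Hom_comp[OF f gz_Hom[OF a2(4)]]])
 hence "A.eqv Z (lo (Fo Z2)) (gz Z2 * f) (lm (Fo Z) (Fo Z2) (Fm Z Z2 f) * gz Z)"
  using A.eqv_sym unfolding lm_Fm[OF a(4) a2(4) f] by (simp add: mult.assoc)
 hence "A.eqv S (lo S2') (s2 * g) (lm S' S2' t * s)"
  using A.shifted_unique[OF A lm_susp[OF B2] _ A.shifted_comp[OF g s2(1)] A.shifted_comp[OF s(1) lm_shifted[OF B B2 FH t]]] by blast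
 from A.eqv_right[OF this cm_lo[OF Fo_cm[OF a(3)]] fz_Hom[OF a(3)]]
 have 1: "A.eqv (lo (Fo S)) (lo S2') (s2 * (g * fz S)) (lm S' S2' t * (s * fz S))" by (simp add: mult.assoc)
 have "A.eqv (lo (Fo S)) (lo S2') (s2 * (fz S2 * lm (Fo S) (Fo S2) (Fm S S2 g))) (s2 * (g * fz S))"
  by (rule A.eqv_left[OF fz_natural[OF a(3) a2(3) gH] s2(2)])
 also note 1
 finally have "A.eqv (lo (Fo S)) (lo S2') (lm (Fo S2) S2' h2 * lm (Fo S) (Fo S2) (Fm S S2 g)) (lm S' S2' t * lm (Fo S) S' h)"
  using s(3) s2(3) by (simp add: mult.assoc)
 hence "A.eqv (lo (Fo S)) (lo S2') (lm (Fo S) S2' (h2 * Fm S S2 g)) (lm (Fo S) S2' (t * h))"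
  using lm_comp[OF Fm_Hom[OF a(3) a2(3) gH] s2(4)] lm_comp[OF s(4) tH] by simp
 thus ?thesis
  using lm_eqv_iff[OF Fo_cm[OF a(3)] B.Hom_comp[OF Fm_Hom[OF a(3) a2(3) gH] s2(4)] B.Hom_comp[OF s(4) tH]] by blast
qed

text \<open>The left adjoint turns the cone \<open>D\<close> into a cone over a square that is
  stably isomorphic to \<open>u\<close>. So \<open>cone_iso\<close> compares the third vertices, and
  the transpose of that comparison is the required arrow.\<close>

lemma eta_cone:
 assumes h: "eta Z I S i p I' S' i' p' h" and c: "A.cone Z I S i p Y u X v j w"
  and d: "B.cone (Fo Z) I' S' i' p' (Fo Y) (Fm Z Y u) D v' j' w'"
 obtains d d' where "B.siso (Fo X) D d d'" "B.eqv (Fo Y) D (d * Fm Y X v) v'"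
  "B.eqv (Fo X) S' (w' * d) (h * Fm X S w)"
proof -
 note a = A.suspD[OF A] and b = B.suspD[OF B] and c' = A.coneD[OF c] and d' = B.coneD[OF d]
 obtain s where s: "A.shifted I S i p (lo I') (lo S') (lm (Fo Z) I' i') (lm I' S' p') (gz Z) s"
  "s \<in> HomA S (lo S')" "lm (Fo S) S' h = s * fz S" "h \<in> HomB (Fo S) S'" using eta_lm[OF h] by metis
 note l = lm_cone[OF d]
 have "A.eqv Z (lo (Fo Y)) (gz Y * u * (fz Z * gz Z)) (gz Y * u)"
  by (rule A.siso_cancel_right[OF A.siso_sym[OF Fo_siso[OF a(4)]] A.Hom_comp[OF c'(3) gz_Hom[OF c'(2)]]])
 hence e: "A.eqv Z (lo (Fo Y)) (gz Y * u) (lm (Fo Z) (Fo Y) (Fm Z Y u) * gz Z)"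
  using A.eqv_sym unfolding lm_Fm[OF a(4) c'(2,3)] by (simp add: mult.assoc)
 obtain q q' s' where q: "A.siso X (lo D) q q'" "q * v = lm (Fo Y) D v' * gz Y" "lm D S' w' * q = s' * w"
  and s': "A.shifted I S i p (lo I') (lo S') (lm (Fo Z) I' i') (lm I' S' p') (gz Z) s'"
  using A.cone_iso[OF c l A.siso_sym[OF Fo_siso[OF a(4)]] A.siso_sym[OF Fo_siso[OF c'(2)]] e] by metis
 note qd = A.sisoD[OF q(1)]
 note X = c'(10) and Y = c'(2)
 \<comment> \<open>The shift delivered by \<open>cone_iso\<close> need not be the one inside
   \<open>h\<close>, but both are shifts of \<open>gz Z\<close>.\<close>
 have ss: "A.eqv S (lo S') s' s" by (rule A.shifted_unique[OF A lm_susp[OF B] A.eqv_refl[OF a(4) gz_Hom[OF a(4)]] s' s(1)])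
 note O = Fo_Ob[OF X] B.cm_Ob[OF d'(10)] Fo_Ob[OF Y] 
 define e where "e = linv (Fo X) D (q * fz X)"
 note qf = A.Hom_comp[OF fz_Hom[OF X] qd(1)]
 have eH: "e \<in> HomB (Fo X) D" and le: "lm (Fo X) D e = q * fz X"
  unfolding e_def using linv_Hom[OF O(1,2) qf] lm_linv[OF O(1,2) qf] by auto
 have "B.siso (Fo X) D e (linv D (Fo X) (gz X * q'))"
  unfolding e_def by (rule linv_siso[OF Fo_cm[OF X] d'(10) A.siso_comp[OF Fo_siso[OF X] q(1)]])
 moreover have "B.eqv (Fo Y) D (e * Fm Y X v) v'"
 proof -
  note FH = Fm_Hom[OF Y X c'(8)]
  have "A.eqv (lo (Fo Y)) (lo D) (q * (fz X * lm (Fo Y) (Fo X) (Fm Y X v))) (q * (v * fz Y))"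
   by (rule A.eqv_left[OF fz_natural[OF Y X c'(8)] qd(1)])
  also have "q * (v * fz Y) = lm (Fo Y) D v' * (gz Y * fz Y)" using q(2) by (simp flip: mult.assoc)
  also have "A.eqv (lo (Fo Y)) (lo D) (lm (Fo Y) D v' * (gz Y * fz Y)) (lm (Fo Y) D v')"
   by (rule A.siso_cancel_right[OF Fo_siso[OF Y] lm_Hom[OF d'(8)]])
  finally have "A.eqv (lo (Fo Y)) (lo D) (lm (Fo Y) D (e * Fm Y X v)) (lm (Fo Y) D v')"
   using lm_comp[OF FH eH] le by (simp add: mult.assoc)
  thus ?thesis using lm_eqv_iff[OF Fo_cm[OF Y] B.Hom_comp[OF FH eH] d'(8)] by blast
 qed
 moreover have "B.eqv (Fo X) S' (w' * e) (h * Fm X S w)"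
 proof -
  note FH = Fm_Hom[OF X a(3) c'(9)]
  note cX = cm_lo[OF Fo_cm[OF X]]
  have 0: "lm D S' w' * (q * fz X) = s' * (w * fz X)" using q(3) by (simp flip: mult.assoc)
  have "A.eqv (lo (Fo X)) (lo S') (s' * (w * fz X)) (s * (w * fz X))"
   by (rule A.eqv_right[OF ss cX A.Hom_comp[OF fz_Hom[OF X] c'(9)]])
  also have "A.eqv (lo (Fo X)) (lo S') (s * (w * fz X)) (s * (fz S * lm (Fo X) (Fo S) (Fm X S w)))"
   by (rule A.eqv_sym[OF A.eqv_left[OF fz_natural[OF X a(3) c'(9)] s(2)]])
  finally have "A.eqv (lo (Fo X)) (lo S') (lm (Fo X) S' (w' * e)) (lm (Fo X) S' (h * Fm X S w))"
   using lm_comp[OF eH d'(9)] lm_comp[OF FH s(4)] le s(3) 0 by (simp add: mult.assoc)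
  thus ?thesis using lm_eqv_iff[OF Fo_cm[OF X] B.Hom_comp[OF eH d'(9)] B.Hom_comp[OF FH s(4)]] by blast
 qed
 ultimately show ?thesis by (rule that)
qed

end

end

section \<open>Modules\<close>

syntax (input) "_index" :: "logic => index" ("\<^sub>_" [1000] 1000)

section \<open>Submodules, spans and noetherian rings\<close>

context left_module
begin

lemma smult_zero_left: "x IN M ==> \<zero> \<odot>\<^sub>M x = \<zero>\<^sub>M"
 by (metis M.add.l_cancel_one M.zero_closed R.l_zero R.zero_closed lm_smult_closed lm_smult_l_distr)

lemma smult_zero_right: "r IN R ==> r \<odot>\<^sub>M \<zero>\<^sub>M = \<zero>\<^sub>M"
 by (metis M.add.l_cancel_one M.zero_closed M.l_zero lm_smult_closed lm_smult_r_distr)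

lemma smult_minus_left: "r IN R ==> x IN M ==> (\<ominus> r) \<odot>\<^sub>M x = \<ominus>\<^sub>M (r \<odot>\<^sub>M x)"
 by (metis M.minus_equality R.a_inv_closed R.l_neg lm_smult_closed lm_smult_l_distr smult_zero_left)

lemma smult_minus_right: "r IN R ==> x IN M ==> r \<odot>\<^sub>M (\<ominus>\<^sub>M x) = \<ominus>\<^sub>M (r \<odot>\<^sub>M x)"
 by (metis M.minus_equality M.a_inv_closed M.l_neg lm_smult_closed lm_smult_r_distr smult_zero_right)

lemma smult_minus_one: "x IN M ==> (\<ominus> \<one>) \<odot>\<^sub>M x = \<ominus>\<^sub>M x"
 by (simp add: smult_minus_left lm_smult_one)

lemma submodule_intro:
 assumes "H \<subseteq> carrier M" "\<zero>\<^sub>M \<in> H" "\<And>a b. a \<in> H ==> b \<in> H ==> a \<oplus>\<^sub>M b \<in> H"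
  "\<And>r x. r IN R ==> x \<in> H ==> r \<odot>\<^sub>M x \<in> H"
 shows "submodule H R M"
proof (intro submodule.intro subgroup.intro submodule_axioms.intro)
 fix x assume "x \<in> H"
 thus "inv\<^sub>(add_monoid M) x \<in> H"
  using assms(1) assms(4)[of "\<ominus> \<one>" x] smult_minus_one by (metis R.a_inv_closed R.one_closed a_inv_def subsetD)
qed (use assms in auto)

lemma submoduleD:
 assumes "submodule H R M"
 shows "H \<subseteq> carrier M" "\<zero>\<^sub>M \<in> H" "a \<in> H ==> b \<in> H ==> a \<oplus>\<^sub>M b \<in> H"
  "a \<in> H ==> \<ominus>\<^sub>M a \<in> H" "a \<in> H ==> b \<in> H ==> a \<ominus>\<^sub>M b \<in> H"
  "r IN R ==> a \<in> H ==> r \<odot>\<^sub>M a \<in> H" "a \<in> H ==> a IN M"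
proof -
 interpret H: submodule H R M by fact
 show "H \<subseteq> carrier M" "\<zero>\<^sub>M \<in> H" "a \<in> H ==> b \<in> H ==> a \<oplus>\<^sub>M b \<in> H"
  "r IN R ==> a \<in> H ==> r \<odot>\<^sub>M a \<in> H" "a \<in> H ==> a IN M"
  using H.subset H.one_closed H.m_closed by auto
 show "a \<in> H ==> \<ominus>\<^sub>M a \<in> H" using H.m_inv_closed by (simp add: a_inv_def)
 thus "a \<in> H ==> b \<in> H ==> a \<ominus>\<^sub>M b \<in> H"
  using H.m_closed[of a "\<ominus>\<^sub>M b"] H.m_inv_closed[of b] by (simp add: a_minus_def a_inv_def)
qed

lemma carrier_submodule: "submodule (carrier M) R M"
 by (rule submodule_intro) (auto intro: lm_smult_closed)

lemma submodule_Int: "submodule H R M ==> submodule K R M ==> submodule (H \<inter> K) R M"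
 by (rule submodule_intro) (auto dest: submoduleD(1) intro: submoduleD)

lemma a_minus_cancel: "x IN M ==> y IN M ==> (x \<ominus>\<^sub>M y) \<oplus>\<^sub>M y = x"
 by (simp add: a_minus_def M.a_assoc M.l_neg)

lemma a_minus_eq_zero: "x IN M ==> y IN M ==> x \<ominus>\<^sub>M y = \<zero>\<^sub>M \<longleftrightarrow> x = y"
 by (metis a_minus_cancel M.l_zero M.minus_eq M.r_neg)

lemma add_diff_add:
 assumes "a IN M" "b IN M" "c IN M" "d IN M"
 shows "(a \<oplus>\<^sub>M b) \<ominus>\<^sub>M (c \<oplus>\<^sub>M d) = (a \<ominus>\<^sub>M c) \<oplus>\<^sub>M (b \<ominus>\<^sub>M d)"
 using assms by (simp add: a_minus_def M.minus_add M.add.m_ac)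

lemma add_add_add:
 assumes "a IN M" "b IN M" "c IN M" "d IN M"
 shows "(a \<oplus>\<^sub>M b) \<oplus>\<^sub>M (c \<oplus>\<^sub>M d) = (a \<oplus>\<^sub>M c) \<oplus>\<^sub>M (b \<oplus>\<^sub>M d)"
 using assms by (simp add: M.add.m_ac)

lemma smult_diff: "r IN R ==> x IN M ==> y IN M ==>
  r \<odot>\<^sub>M (x \<ominus>\<^sub>M y) = r \<odot>\<^sub>M x \<ominus>\<^sub>M r \<odot>\<^sub>M y"
 by (simp add: a_minus_def lm_smult_r_distr smult_minus_right)

lemma smult_image_submodule:
 assumes "r IN R" "submodule H R M" "\<And>s. s IN R ==> s \<otimes> r = r \<otimes> s"
 shows "submodule ((%x. r \<odot>\<^sub>M x) ` H) R M"
proof (rule submodule_intro)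
 note h = submoduleD[OF assms(2)]
 show "(%x. r \<odot>\<^sub>M x) ` H \<subseteq> carrier M" using h(1) lm_smult_closed[OF assms(1)] by auto
 show "\<zero>\<^sub>M \<in> (%x. r \<odot>\<^sub>M x) ` H" using h(2) smult_zero_right[OF assms(1)] by force
 show "a \<oplus>\<^sub>M b \<in> (%x. r \<odot>\<^sub>M x) ` H" if "a \<in> (%x. r \<odot>\<^sub>M x) ` H" "b \<in> (%x. r \<odot>\<^sub>M x) ` H" for a b
  using that lm_smult_r_distr[OF assms(1)] h(3,7) by (smt (verit) image_iff)
 show "s \<odot>\<^sub>M x \<in> (%x. r \<odot>\<^sub>M x) ` H" if s: "s IN R" and x: "x \<in> (%x. r \<odot>\<^sub>M x) ` H" for s x
 proof -
  obtain y where y: "y \<in> H" "x = r \<odot>\<^sub>M y" using x by blast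
  have "s \<odot>\<^sub>M x = r \<odot>\<^sub>M (s \<odot>\<^sub>M y)"
   using lm_smult_assoc[OF s assms(1)] lm_smult_assoc[OF assms(1) s] assms(3)[OF s] y h(7) by metis
  thus ?thesis using h(6)[OF s y(1)] by blast
 qed
qed

end

text \<open>Finite generation of \<open>H\<close> is tested inside \<open>M\<close>, so
  \<open>H\<close> need not be made a module of its own; this also makes it comparable over two
  rings acting on the same additive group.\<close>

definition fg_sub :: "('a, 'r) ring_scheme => ('a, 'b, 'm) module_scheme => 'b set => bool" where
 "fg_sub R M H \<longleftrightarrow> (\<exists>A. finite A & A \<subseteq> H & (\<forall>K. submodule K R M --> A \<subseteq> K --> H \<subseteq> K))"

definition left_noetherian :: "('a, 'r) ring_scheme => bool" where
 "left_noetherian R \<longleftrightarrow> ring R & (\<forall>I. submodule I R (reg R) --> fg_sub R (reg R) I)"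

text \<open>Additive inverses come from the scalar -1, so the rule \<open>sz\<close> replaces their
  verification.\<close>

lemma left_moduleI:
 fixes R :: "('a, 'r) ring_scheme" (structure) and M :: "('a, 'b, 'm) module_scheme"
 assumes R: "ring R" and z: "\<zero>\<^sub>M IN M"
  and add: "\<And>x y. x IN M ==> y IN M ==> x \<oplus>\<^sub>M y IN M"
  and ass: "\<And>x y z. x IN M ==> y IN M ==> z IN M ==>
   x \<oplus>\<^sub>M y \<oplus>\<^sub>M z = x \<oplus>\<^sub>M (y \<oplus>\<^sub>M z)"
  and com: "\<And>x y. x IN M ==> y IN M ==> x \<oplus>\<^sub>M y = y \<oplus>\<^sub>M x"
  and lz: "\<And>x. x IN M ==> \<zero>\<^sub>M \<oplus>\<^sub>M x = x"
  and closed: "\<And>r x. r IN R ==> x IN M ==> r \<odot>\<^sub>M x IN M"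
  and sl: "\<And>r s x. r IN R ==> s IN R ==> x IN M ==>
   (r \<oplus> s) \<odot>\<^sub>M x = r \<odot>\<^sub>M x \<oplus>\<^sub>M s \<odot>\<^sub>M x"
  and sr: "\<And>r x y. r IN R ==> x IN M ==> y IN M ==>
   r \<odot>\<^sub>M (x \<oplus>\<^sub>M y) = r \<odot>\<^sub>M x \<oplus>\<^sub>M r \<odot>\<^sub>M y"
  and smult_assoc: "\<And>r s x. r IN R ==> s IN R ==> x IN M ==>
   (r \<otimes> s) \<odot>\<^sub>M x = r \<odot>\<^sub>M (s \<odot>\<^sub>M x)"
  and so: "\<And>x. x IN M ==> \<one> \<odot>\<^sub>M x = x"
  and sz: "\<And>x. x IN M ==> \<zero> \<odot>\<^sub>M x = \<zero>\<^sub>M"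
 shows "lmod R M"
proof -
 interpret ring R by fact
 have inv: "\<exists>y\<in>carrier M. y \<oplus>\<^sub>M x = \<zero>\<^sub>M" if x: "x IN M" for x
 proof
  show "(\<ominus> \<one>) \<odot>\<^sub>M x IN M" using x closed by simp
  have "(\<ominus> \<one> \<oplus> \<one>) \<odot>\<^sub>M x = \<zero>\<^sub>M" using sz[OF x] by (simp add: l_neg)
  thus "(\<ominus> \<one>) \<odot>\<^sub>M x \<oplus>\<^sub>M x = \<zero>\<^sub>M" using sl[of "\<ominus> \<one>" \<one> x] so[OF x] x by simp
 qed
 have "abelian_group M" by (rule abelian_groupI) (use z add ass com lz inv in auto)
 thus ?thesis by (intro left_module.intro R left_module_axioms.intro) (use closed sl sr smult_assoc so in auto)
qed

lemma reg_left_module: assumes "ring R" shows "lmod R (reg R)"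
proof -
 interpret ring R by fact
 show ?thesis
  by (rule left_moduleI[OF assms]) (auto simp: regular_module_def l_distr r_distr m_assoc a_assoc intro: a_comm)
qed

lemma fg_subE:
 assumes "fg_sub R M H"
 obtains A where "finite A" "A \<subseteq> H" "\<forall>K. submodule K R M --> A \<subseteq> K --> H \<subseteq> K"
 using assms unfolding fg_sub_def by blast

lemma regular_simps [simp]: "carrier (reg R) = carrier R" "\<zero>\<^sub>(reg R) = \<zero>\<^sub>R"
 "x \<oplus>\<^sub>(reg R) y = x \<oplus>\<^sub>R y" "r \<odot>\<^sub>(reg R) x = r \<otimes>\<^sub>R x"
 by (simp_all add: regular_module_def)

context left_module
begin

lemma sum_submodule:
 assumes H: "submodule H R M" and a: "a IN M"
 shows "submodule {r \<odot>\<^sub>M a \<oplus>\<^sub>M y | r y. r IN R & y \<in> H} R M"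
proof (rule submodule_intro)
 note h = submoduleD[OF H]
 show "{r \<odot>\<^sub>M a \<oplus>\<^sub>M y | r y. r IN R & y \<in> H} \<subseteq> carrier M" using a h(1) lm_smult_closed by auto
 have "\<zero>\<^sub>M = \<zero> \<odot>\<^sub>M a \<oplus>\<^sub>M \<zero>\<^sub>M" using smult_zero_left[OF a] by simp
 thus "\<zero>\<^sub>M \<in> {r \<odot>\<^sub>M a \<oplus>\<^sub>M y | r y. r IN R & y \<in> H}" using h(2) by blast
next
 note h = submoduleD[OF H]
 fix b c assume "b \<in> {r \<odot>\<^sub>M a \<oplus>\<^sub>M y | r y. r IN R & y \<in> H}" "c \<in> {r \<odot>\<^sub>M a \<oplus>\<^sub>M y | r y. r IN R & y \<in> H}"
 then obtain r y s z where e: "b = r \<odot>\<^sub>M a \<oplus>\<^sub>M y" "c = s \<odot>\<^sub>M a \<oplus>\<^sub>M z" "r IN R" "s IN R" "y \<in> H" "z \<in> H"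
  by blast
 have "b \<oplus>\<^sub>M c = (r \<oplus> s) \<odot>\<^sub>M a \<oplus>\<^sub>M (y \<oplus>\<^sub>M z)"
  using e a h(7) add_add_add lm_smult_closed lm_smult_l_distr by simp
 thus "b \<oplus>\<^sub>M c \<in> {r \<odot>\<^sub>M a \<oplus>\<^sub>M y | r y. r IN R & y \<in> H}" using e h(3) R.a_closed by blast
next
 note h = submoduleD[OF H]
 fix s b assume s: "s IN R" and "b \<in> {r \<odot>\<^sub>M a \<oplus>\<^sub>M y | r y. r IN R & y \<in> H}"
 then obtain r y where e: "b = r \<odot>\<^sub>M a \<oplus>\<^sub>M y" "r IN R" "y \<in> H" by blast
 have "s \<odot>\<^sub>M b = (s \<otimes> r) \<odot>\<^sub>M a \<oplus>\<^sub>M s \<odot>\<^sub>M y"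
  using e a s h(7) lm_smult_r_distr lm_smult_assoc lm_smult_closed by simp
 thus "s \<odot>\<^sub>M b \<in> {r \<odot>\<^sub>M a \<oplus>\<^sub>M y | r y. r IN R & y \<in> H}" using e s h(6) R.m_closed by blast
qed

definition span :: "'b set => 'b set" where
 "span A = \<Inter> {K. submodule K R M & A \<subseteq> K}"

lemma span_submodule: assumes "A \<subseteq> carrier M" shows "submodule (span A) R M"
proof (rule submodule_intro)
 show "span A \<subseteq> carrier M" unfolding span_def using carrier_submodule assms by blast
qed (auto simp: span_def submoduleD)

lemma span_superset: "A \<subseteq> span A"
 unfolding span_def by blast

lemma span_least: "submodule K R M ==> A \<subseteq> K ==> span A \<subseteq> K"
 unfolding span_def by blast

lemma span_insert:
 assumes "A \<subseteq> carrier M" "a IN M" "x \<in> span (insert a A)"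
 obtains r y where "r IN R" "y \<in> span A" "x = r \<odot>\<^sub>M a \<oplus>\<^sub>M y"
proof -
 let ?K = "{r \<odot>\<^sub>M a \<oplus>\<^sub>M y | r y. r IN R & y \<in> span A}"
 note s = span_submodule[OF assms(1)]
 have "a = \<one> \<odot>\<^sub>M a \<oplus>\<^sub>M \<zero>\<^sub>M" using assms lm_smult_one by simp
 hence "a \<in> ?K" using submoduleD(2)[OF s] by blast
 moreover have "A \<subseteq> ?K"
 proof
  fix y assume y: "y \<in> A"
  hence "y = \<zero> \<odot>\<^sub>M a \<oplus>\<^sub>M y" using smult_zero_left[OF assms(2)] assms(1) by auto
  moreover have "y \<in> span A" using span_superset[of A] y by blast
  ultimately show "y \<in> ?K" using R.zero_closed by blast
 qed
 ultimately have "span (insert a A) \<subseteq> ?K" using span_least[OF sum_submodule[OF s assms(2)], of "insert a A"] by simp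
 thus ?thesis using that assms(3) by blast
qed

text \<open>Multiplication by the central \<open>r\<close> has the two given submodules as image and
  kernel. Preimages of generators of the image together with generators of the kernel generate
  \<open>H\<close>.\<close>

lemma fg_sub_extension:
 assumes H: "submodule H R M" and r: "r IN R" "\<And>s. s IN R ==> s \<otimes> r = r \<otimes> s"
  and 1: "fg_sub R M ((%x. r \<odot>\<^sub>M x) ` H)" and 2: "fg_sub R M {x \<in> H. r \<odot>\<^sub>M x = \<zero>\<^sub>M}"
 shows "fg_sub R M H"
proof -
 note h = submoduleD[OF H]
 obtain A where A: "finite A" "A \<subseteq> (%x. r \<odot>\<^sub>M x) ` H"
  "\<forall>K. submodule K R M --> A \<subseteq> K --> (%x. r \<odot>\<^sub>M x) ` H \<subseteq> K" using 1 by (rule fg_subE)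
 obtain B where B: "finite B" "B \<subseteq> {x \<in> H. r \<odot>\<^sub>M x = \<zero>\<^sub>M}"
  "\<forall>K. submodule K R M --> B \<subseteq> K --> {x \<in> H. r \<odot>\<^sub>M x = \<zero>\<^sub>M} \<subseteq> K" using 2 by (rule fg_subE)
 obtain C where C: "C \<subseteq> H" "finite C" "A = (%x. r \<odot>\<^sub>M x) ` C" using finite_subset_image[OF A(1,2)] by metis
 show ?thesis unfolding fg_sub_def
 proof (intro exI[of _ "C \<union> B"] conjI allI impI subsetI)
  show "finite (C \<union> B)" using C B by simp
  show "x \<in> H" if "x \<in> C \<union> B" for x using C B that by blast
  fix K x assume K: "submodule K R M" "C \<union> B \<subseteq> K" and x: "x \<in> H"
  note k = submoduleD[OF K(1)]
  have "A \<subseteq> (%x. r \<odot>\<^sub>M x) ` (H \<inter> K)" using C K by blast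
  hence "(%x. r \<odot>\<^sub>M x) ` H \<subseteq> (%x. r \<odot>\<^sub>M x) ` (H \<inter> K)"
   using A(3)[rule_format, OF smult_image_submodule[OF r(1) submodule_Int[OF H K(1)] r(2)]] by blast
  then obtain y where y: "y \<in> H" "y \<in> K" "r \<odot>\<^sub>M x = r \<odot>\<^sub>M y" using x by auto
  have "r \<odot>\<^sub>M (x \<ominus>\<^sub>M y) = \<zero>\<^sub>M"
   using smult_diff[OF r(1)] y x h(7) a_minus_eq_zero lm_smult_closed[OF r(1)] by simp
  hence "x \<ominus>\<^sub>M y \<in> K" using B(3)[rule_format, OF K(1)] K(2) h(5)[OF x y(1)] by blast
  thus "x \<in> K" using k(3)[of "x \<ominus>\<^sub>M y" y] y a_minus_cancel h(7) x by simp
 qed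
qed

text \<open>Induction on the generators: the coefficients of \<open>a\<close> in elements of
  \<open>H\<close>, modulo \<open>span A\<close>, form a left ideal. Lifts of its finitely many
  generators together with generators of the intersection of \<open>H\<close> with
  \<open>span A\<close> generate \<open>H\<close>.\<close>

lemma fg_sub_noetherian_span:
 assumes N: "left_noetherian R"
 shows "finite A ==> A \<subseteq> carrier M ==> submodule H R M ==> H \<subseteq> span A ==> fg_sub R M H"
proof (induction A arbitrary: H rule: finite_induct)
 case empty
 have "submodule {\<zero>\<^sub>M} R M" by (rule submodule_intro) (auto simp: smult_zero_right)
 hence "span {} \<subseteq> {\<zero>\<^sub>M}" using span_least by blast
 thus ?case unfolding fg_sub_def using empty submoduleD(2) by (intro exI[of _ "{}"]) blast
next
 case (insert a A)
 have a: "a IN M" "A \<subseteq> carrier M" using insert by auto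
 note s = submoduleD[OF span_submodule[OF a(2)]] and h = submoduleD[OF insert.prems(2)]
 interpret RM: left_module R "reg R" by (rule reg_left_module[OF R.ring_axioms])
 have J: "submodule {r \<in> carrier R. \<exists>y\<in>span A. r \<odot>\<^sub>M a \<oplus>\<^sub>M y \<in> K} R (reg R)"
  if K: "submodule K R M" for K
 proof (rule RM.submodule_intro)
  note k = submoduleD[OF K]
  show "\<zero>\<^sub>(reg R) \<in> {r \<in> carrier R. \<exists>y\<in>span A. r \<odot>\<^sub>M a \<oplus>\<^sub>M y \<in> K}"
   using s(2) k(2) a smult_zero_left by (auto intro!: bexI[of _ "\<zero>\<^sub>M"])
 next
  note k = submoduleD[OF K]
  fix r r' assume "r \<in> {r \<in> carrier R. \<exists>y\<in>span A. r \<odot>\<^sub>M a \<oplus>\<^sub>M y \<in> K}" "r' \<in> {r \<in> carrier R. \<exists>y\<in>span A. r \<odot>\<^sub>M a \<oplus>\<^sub>M y \<in> K}"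
  then obtain y y' where y: "r IN R" "r' IN R" "y \<in> span A" "y' \<in> span A"
   "r \<odot>\<^sub>M a \<oplus>\<^sub>M y \<in> K" "r' \<odot>\<^sub>M a \<oplus>\<^sub>M y' \<in> K" by blast
  have "(r \<oplus> r') \<odot>\<^sub>M a \<oplus>\<^sub>M (y \<oplus>\<^sub>M y') = (r \<odot>\<^sub>M a \<oplus>\<^sub>M y) \<oplus>\<^sub>M (r' \<odot>\<^sub>M a \<oplus>\<^sub>M y')"
   using y a s(7) add_add_add lm_smult_closed lm_smult_l_distr by simp
  thus "r \<oplus>\<^sub>(reg R) r' \<in> {r \<in> carrier R. \<exists>y\<in>span A. r \<odot>\<^sub>M a \<oplus>\<^sub>M y \<in> K}"
   using k(3)[OF y(5,6)] s(3)[OF y(3,4)] y(1,2) by (auto intro!: bexI[of _ "y \<oplus>\<^sub>M y'"])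
 next
  note k = submoduleD[OF K]
  fix t r assume t: "t IN R" and "r \<in> {r \<in> carrier R. \<exists>y\<in>span A. r \<odot>\<^sub>M a \<oplus>\<^sub>M y \<in> K}"
  then obtain y where y: "r IN R" "y \<in> span A" "r \<odot>\<^sub>M a \<oplus>\<^sub>M y \<in> K" by blast
  have "(t \<otimes> r) \<odot>\<^sub>M a \<oplus>\<^sub>M (t \<odot>\<^sub>M y) = t \<odot>\<^sub>M (r \<odot>\<^sub>M a \<oplus>\<^sub>M y)"
   using y a t s(7) lm_smult_r_distr lm_smult_assoc lm_smult_closed by simp
  thus "t \<odot>\<^sub>(reg R) r \<in> {r \<in> carrier R. \<exists>y\<in>span A. r \<odot>\<^sub>M a \<oplus>\<^sub>M y \<in> K}"
   using k(6)[OF t y(3)] s(6)[OF t y(2)] y(1) t by (auto intro!: bexI[of _ "t \<odot>\<^sub>M y"])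
 qed auto
 have "fg_sub R (reg R) {r \<in> carrier R. \<exists>y\<in>span A. r \<odot>\<^sub>M a \<oplus>\<^sub>M y \<in> H}"
  using N J[OF insert.prems(2)] unfolding left_noetherian_def by blast
 then obtain B where B: "finite B" "B \<subseteq> {r \<in> carrier R. \<exists>y\<in>span A. r \<odot>\<^sub>M a \<oplus>\<^sub>M y \<in> H}"
  "\<forall>K. submodule K R (reg R) --> B \<subseteq> K --> {r \<in> carrier R. \<exists>y\<in>span A. r \<odot>\<^sub>M a \<oplus>\<^sub>M y \<in> H} \<subseteq> K"
  by (rule fg_subE)
 then obtain f where f: "\<And>r. r \<in> B ==> f r \<in> span A & r \<odot>\<^sub>M a \<oplus>\<^sub>M f r \<in> H" using bchoice[of B "%r y. y \<in> span A & r \<odot>\<^sub>M a \<oplus>\<^sub>M y \<in> H"] B(2) by blast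
 have "fg_sub R M (H \<inter> span A)"
  using insert.IH[OF a(2) submodule_Int[OF insert.prems(2) span_submodule[OF a(2)]]] by blast
 then obtain C where C: "finite C" "C \<subseteq> H \<inter> span A" "\<forall>K. submodule K R M --> C \<subseteq> K --> H \<inter> span A \<subseteq> K"
  by (rule fg_subE)
 show ?case unfolding fg_sub_def
 proof (intro exI[of _ "C \<union> (%r. r \<odot>\<^sub>M a \<oplus>\<^sub>M f r) ` B"] conjI allI impI subsetI)
  show "finite (C \<union> (%r. r \<odot>\<^sub>M a \<oplus>\<^sub>M f r) ` B)" using B C by simp
  show "x \<in> H" if "x \<in> C \<union> (%r. r \<odot>\<^sub>M a \<oplus>\<^sub>M f r) ` B" for x using that C f by auto
  fix K x assume K: "submodule K R M" "C \<union> (%r. r \<odot>\<^sub>M a \<oplus>\<^sub>M f r) ` B \<subseteq> K" and x: "x \<in> H"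
  note k = submoduleD[OF K(1)]
  obtain r y where y: "r IN R" "y \<in> span A" "x = r \<odot>\<^sub>M a \<oplus>\<^sub>M y"
   using span_insert[OF a(2,1)] insert.prems(3) x by blast
  have "B \<subseteq> {r \<in> carrier R. \<exists>y\<in>span A. r \<odot>\<^sub>M a \<oplus>\<^sub>M y \<in> H \<inter> K}" using f K(2) B(2) by blast
  hence "r \<in> {r \<in> carrier R. \<exists>y\<in>span A. r \<odot>\<^sub>M a \<oplus>\<^sub>M y \<in> H \<inter> K}"
   using B(3)[rule_format, OF J[OF submodule_Int[OF insert.prems(2) K(1)]]] y x by blast
  then obtain z where z: "z \<in> span A" "r \<odot>\<^sub>M a \<oplus>\<^sub>M z \<in> H" "r \<odot>\<^sub>M a \<oplus>\<^sub>M z \<in> K" by blast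
  have ra: "r \<odot>\<^sub>M a IN M" using y a lm_smult_closed by blast
  have "x \<ominus>\<^sub>M (r \<odot>\<^sub>M a \<oplus>\<^sub>M z) = y \<ominus>\<^sub>M z"
   unfolding y(3) using add_diff_add[OF ra _ ra] ra y(2) z(1) s(7) a_minus_eq_zero by simp
  hence "y \<ominus>\<^sub>M z \<in> H \<inter> span A" using h(5)[OF x z(2)] s(5)[OF y(2) z(1)] by simp
  hence "y \<ominus>\<^sub>M z \<in> K" using C(3)[rule_format, OF K(1)] K(2) by blast
  hence "(r \<odot>\<^sub>M a \<oplus>\<^sub>M z) \<oplus>\<^sub>M (y \<ominus>\<^sub>M z) \<in> K" using k(3) z(3) by blast
  moreover have "(r \<odot>\<^sub>M a \<oplus>\<^sub>M z) \<oplus>\<^sub>M (y \<ominus>\<^sub>M z) = x"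
  proof -
   have "(r \<odot>\<^sub>M a \<oplus>\<^sub>M z) \<oplus>\<^sub>M (y \<ominus>\<^sub>M z) = r \<odot>\<^sub>M a \<oplus>\<^sub>M ((y \<ominus>\<^sub>M z) \<oplus>\<^sub>M z)"
    using ra y(2) z(1) s(7) by (simp add: M.a_assoc M.a_comm[of z])
   thus ?thesis unfolding y(3) using a_minus_cancel y(2) z(1) s(7) by simp
  qed
  ultimately show "x \<in> K" by simp
 qed
qed

end

lemma finitely_generated_iff:
 "finitely_generated R M \<longleftrightarrow> (\<exists>A. finite A & A \<subseteq> carrier M & (\<forall>K. submodule K R M --> A \<subseteq> K --> carrier M \<subseteq> K))"
  if "lmod R M"
 using left_module.submoduleD(1)[OF that] unfolding finitely_generated_def by (metis subset_antisym subset_refl)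

lemma fg_sub_noetherian:
 assumes "left_noetherian R" "lmod R M" "finitely_generated R M" "submodule H R M"
 shows "fg_sub R M H"
proof -
 interpret left_module R M by fact
 obtain A where A: "finite A" "A \<subseteq> carrier M" "\<forall>K. submodule K R M --> A \<subseteq> K --> carrier M \<subseteq> K"
  using assms(3) unfolding finitely_generated_iff[OF assms(2)] by blast
 show ?thesis
  using fg_sub_noetherian_span[OF assms(1) A(1,2) assms(4)] A(3)[rule_format, OF span_submodule[OF A(2)] span_superset]
   submoduleD(1)[OF assms(4)] by blast
qed

lemma (in cring) smult_cancel_aux:
 assumes "s IN R" "r IN R" "y IN R" "z IN R" "(s \<otimes> r) \<otimes> y = y"
 shows "s \<otimes> (r \<otimes> y \<oplus> z) \<oplus> (\<ominus> s) \<otimes> z = y"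
 using assms by (simp add: r_distr l_minus a_assoc m_assoc r_neg)

text \<open>A minimal ideal \<open>I\<close> that is not finitely generated satisfies \<open>r I = I\<close> or \<open>r I = 0\<close> for all \<open>r\<close>,
 so it is a vector space over \<open>k / Ann I\<close>; a maximal submodule avoiding a given element then has
 codimension one.\<close>

lemma artinian_imp_noetherian:
 fixes k :: "'k ring" (structure)
 assumes k: "cring k" and artin: "artinian_ring k"
 shows "left_noetherian k"
proof (rule ccontr)
 interpret cring k by fact
 interpret left_module k "reg k" by (rule reg_left_module[OF ring_axioms])
 let ?M = "reg k"
 have ideal: "ideal I k" if "submodule I k ?M" for I
 proof (rule idealI[OF ring_axioms])
  note h = submoduleD[OF that]
  have "\<ominus> x \<in> I" if "x \<in> I" for x
   using h(6)[of "\<ominus> \<one>" x] h(7)[of x] that by (simp add: l_minus)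
  hence "inv\<^sub>(add_monoid k) x \<in> I" if "x \<in> I" for x using that by (simp only: a_inv_def)
  thus "subgroup I (add_monoid k)" using h(1,2,3) by (intro subgroup.intro) auto
  show "x \<otimes> a \<in> I" if "a \<in> I" "x IN k" for a x using h(6) that by simp
  thus "a \<otimes> x \<in> I" if "a \<in> I" "x IN k" for a x using h(7) that m_comm by (metis regular_simps(1))
 qed
 assume "\<not> left_noetherian k"
 then obtain I0 where I0: "submodule I0 k ?M" "\<not> fg_sub k ?M I0" unfolding left_noetherian_def using ring_axioms by blast
 define bad where "bad I \<longleftrightarrow> submodule I k ?M & \<not> fg_sub k ?M I" for I
 have "\<exists>I. bad I & (\<forall>J. bad J --> J \<subseteq> I --> J = I)"
 proof (rule ccontr)
  assume "\<nexists>I. bad I & (\<forall>J. bad J --> J \<subseteq> I --> J = I)"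
  hence "\<And>I. bad I ==> \<exists>J. bad J & J \<subset> I" by blast
  then obtain f where f: "\<And>n. bad (f n)" "\<And>n::nat. f (Suc n) \<subset> f n"
   using dependent_nat_choice[of "%_. bad" "%_ I J. J \<subset> I"] I0 bad_def by metis
  then obtain N where "\<forall>n\<ge>N. f n = f N"
   using artin ideal unfolding artinian_ring_def bad_def by (metis psubset_imp_subset)
  thus False using f(2)[of N] by (metis le_SucI order_refl psubset_eq)
 qed
 then obtain I where I: "bad I" and min: "\<And>J. bad J ==> J \<subseteq> I ==> J = I" by blast
 have IS: "submodule I k ?M" using I bad_def by auto
 note h = submoduleD[OF IS, simplified]
 have small: "fg_sub k ?M J" if "submodule J k ?M" "J \<subseteq> I" "J \<noteq> I" for J
  using min that bad_def by blast
 \<comment> \<open>Otherwise \<open>r I\<close> and the annihilator of \<open>r\<close> in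
   \<open>I\<close> are both proper, so both are finitely generated by minimality, and
   \<open>fg_sub_extension\<close> makes \<open>I\<close> finitely generated.\<close>
 have dich: "(%x. r \<otimes> x) ` I = I \<or> (\<forall>x\<in>I. r \<otimes> x = \<zero>)" if r: "r IN k" for r
 proof (rule ccontr)
  assume n: "\<not> ((%x. r \<otimes> x) ` I = I \<or> (\<forall>x\<in>I. r \<otimes> x = \<zero>))"
  have c: "s \<otimes> r = r \<otimes> s" if "s IN k" for s using r that m_comm by simp
  have "submodule ((%x. r \<otimes> x) ` I) k ?M" using smult_image_submodule[OF r IS c] by simp
  hence 1: "fg_sub k ?M ((%x. r \<odot>\<^sub>?M x) ` I)" using small n h(6)[OF r] by auto
  have "submodule {x \<in> I. r \<odot>\<^sub>?M x = \<zero>\<^sub>?M} k ?M"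
   by (rule submodule_intro) (use h r in "auto simp: r_distr m_lcomm[of r]")
  hence "fg_sub k ?M {x \<in> I. r \<odot>\<^sub>?M x = \<zero>\<^sub>?M}" using small n by auto
  thus False using fg_sub_extension[OF IS r c 1] I bad_def by simp
 qed
 \<comment> \<open>The ideals generated by the powers of \<open>r\<close> become stationary, so
   \<open>r^N = r^(N+1) s\<close> for some \<open>s\<close>. Since \<open>r^N I = I\<close>, the
   product \<open>s r\<close> acts as the identity on \<open>I\<close>.\<close>
 have inv: "\<exists>s\<in>carrier k. \<forall>y\<in>I. (s \<otimes> r) \<otimes> y = y" if r: "r IN k" and rI: "(%x. r \<otimes> x) ` I = I" for r
 proof -
  have c: "s \<otimes> (r [^] (n::nat)) = r [^] n \<otimes> s" if "s IN k" for s n using r that m_comm by simp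
  have S: "submodule ((%x. r [^] (n::nat) \<otimes> x) ` carrier k) k ?M" for n
   using smult_image_submodule[OF nat_pow_closed[OF r] carrier_submodule c] by simp
  define f where "f n = (%x. r [^] (n::nat) \<otimes> x) ` carrier k" for n
  have "f (Suc n) \<subseteq> f n" for n unfolding f_def using r by (auto simp: m_assoc)
  moreover have "ideal (f n) k" for n unfolding f_def by (rule ideal[OF S])
  ultimately obtain N where "\<forall>n\<ge>N. f n = f N" using artin unfolding artinian_ring_def by blast
  hence "(%x. r [^] Suc N \<otimes> x) ` carrier k = (%x. r [^] N \<otimes> x) ` carrier k"
   unfolding f_def by (meson le_SucI order_refl)
  moreover have "r [^] N \<in> (%x. r [^] N \<otimes> x) ` carrier k" using r by (auto intro!: image_eqI[of _ _ \<one>])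
  ultimately obtain s where s: "s IN k" "r [^] N = r [^] Suc N \<otimes> s" by (metis (no_types, lifting) imageE)
  have surj: "(%x. r [^] (n::nat) \<otimes> x) ` I = I" for n
  proof (induction n)
   case 0 show ?case using h(7) by force
  next
   case (Suc n)
   have "(%x. r [^] Suc n \<otimes> x) ` I = (%x. r [^] n \<otimes> x) ` ((%x. r \<otimes> x) ` I)"
    unfolding image_image using r h(7) by (intro image_cong) (auto simp: m_assoc)
   thus ?case using Suc rI by simp
  qed
  have "(s \<otimes> r) \<otimes> y = y" if "y \<in> I" for y
  proof -
   have "y \<in> (%x. r [^] N \<otimes> x) ` I" using that surj[of N] by simp
   then obtain z where z: "z \<in> I" "y = r [^] N \<otimes> z" by auto
   have zc: "z IN k" using z h(7) by simp
   have "(s \<otimes> r) \<otimes> y = (r [^] Suc N \<otimes> s) \<otimes> z" 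
    unfolding z(2) nat_pow_Suc by (simp add: m_ac s(1) r zc nat_pow_closed[OF r])
   thus ?thesis by (simp only: s(2)[symmetric] z(2)[symmetric])
  qed
  thus ?thesis using s(1) by blast
 qed
 have "I \<noteq> {\<zero>}"
 proof
  assume "I = {\<zero>}"
  hence "fg_sub k ?M I" unfolding fg_sub_def using submoduleD(2) by (intro exI[of _ "{}"]) auto
  thus False using I bad_def by simp
 qed
 then obtain x where x: "x \<in> I" "x \<noteq> \<zero>" using h(2) by auto
 define \<J> where "\<J> = {J. submodule J k ?M & J \<subseteq> I & x \<notin> J}"
 have "\<exists>J\<in>\<J>. \<forall>K\<in>\<J>. J \<subseteq> K --> K = J"
 proof (rule subset_Zorn_nonempty)
  have "submodule {\<zero>} k ?M" by (rule submodule_intro) auto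
  thus "\<J> \<noteq> {}" unfolding \<J>_def using x h(2) by auto
  fix \<C> assume C: "\<C> \<noteq> {}" "subset.chain \<J> \<C>"
  have sub: "\<And>J. J \<in> \<C> ==> submodule J k ?M & J \<subseteq> I & x \<notin> J" using C unfolding \<J>_def subset.chain_def by blast
  have "submodule (\<Union> \<C>) k ?M"
  proof (rule submodule_intro)
   show "\<Union> \<C> \<subseteq> carrier ?M" "\<zero>\<^sub>?M \<in> \<Union> \<C>" using sub submoduleD(1,2) C(1) by blast+
   show "a \<oplus>\<^sub>?M b \<in> \<Union> \<C>" if ab: "a \<in> \<Union> \<C>" "b \<in> \<Union> \<C>" for a b
   proof -
    obtain J K where JK: "a \<in> J" "b \<in> K" "J \<in> \<C>" "K \<in> \<C>" using ab by blast
    hence "J \<subseteq> K \<or> K \<subseteq> J" using C(2) unfolding subset.chain_def by blast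
    thus ?thesis using JK sub submoduleD(3) by blast
   qed
  qed (use sub submoduleD(6) in blast)
  thus "\<Union> \<C> \<in> \<J>" unfolding \<J>_def using sub by blast
 qed
 then obtain J where "J \<in> \<J>" and max: "\<And>K. K \<in> \<J> ==> J \<subseteq> K ==> K = J" by blast
 hence J: "submodule J k ?M" "J \<subseteq> I" "x \<notin> J" unfolding \<J>_def by blast+
 note hj = submoduleD[OF J(1), simplified]
 \<comment> \<open>By maximality of \<open>J\<close>, an element \<open>y\<close> outside
   \<open>K\<close> gives \<open>x = r y + z\<close> with \<open>z\<close> in \<open>J\<close>. Then
   \<open>r\<close> does not kill \<open>I\<close>, so it is invertible on \<open>I\<close>, and
   \<open>y\<close> is recovered from \<open>x\<close> and \<open>z\<close> inside
   \<open>K\<close>.\<close>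
 have main: "I \<subseteq> K" if K: "submodule K k ?M" "J \<subseteq> K" "x \<in> K" for K
 proof
  note hk = submoduleD[OF K(1), simplified]
  fix y assume y: "y \<in> I"
  have yc: "y IN k" "x IN k" using y x h(7) by auto
  show "y \<in> K"
  proof (rule ccontr)
   assume "y \<notin> K"
   hence False: "y \<notin> J" using K(2) by blast
   let ?L = "{r \<odot>\<^sub>?M y \<oplus>\<^sub>?M z | r z. r IN k & z \<in> J}"
   have L: "submodule ?L k ?M" using sum_submodule[OF J(1)] yc by simp
   have JL: "J \<subseteq> ?L"
   proof
    fix z assume z: "z \<in> J"
    hence "z = \<zero> \<odot>\<^sub>?M y \<oplus>\<^sub>?M z" using yc hj(7) by simp
    thus "z \<in> ?L" using z by blast
   qed
   have "y = \<one> \<odot>\<^sub>?M y \<oplus>\<^sub>?M \<zero>" using yc by simp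
   hence "y \<in> ?L" using hj(2) by blast
   hence "?L \<notin> \<J>" using max[of ?L] JL False by blast
   moreover have "?L \<subseteq> I" using y J(2) h(3,6) by auto
   ultimately have "x \<in> ?L" unfolding \<J>_def using L by blast
   then obtain r z where r: "r IN k" "z \<in> J" "x = r \<otimes> y \<oplus> z" by auto
   have rI: "(%x. r \<otimes> x) ` I = I" using dich[OF r(1)] r(2,3) y hj(7) J(3) by force
   then obtain s where s: "s IN k" "(s \<otimes> r) \<otimes> y = y" using inv[OF r(1) rI] y by blast
   have zc: "z IN k" using r hj(7) by simp
   have "s \<otimes> x \<oplus> (\<ominus> s) \<otimes> z = y"
    unfolding r(3) by (rule smult_cancel_aux) (use s r(1) yc zc in auto)
   moreover have "\<ominus> s IN k" using s(1) by simp
   ultimately show False using hk(3)[OF hk(6)[OF s(1) K(3)] hk(6)[OF _ subsetD[OF K(2) r(2)]]] \<open>y \<notin> K\<close> by metis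
  qed
 qed
 have "J \<noteq> I" using J x by blast
 then obtain A where A: "finite A" "A \<subseteq> J" "\<forall>K. submodule K k ?M --> A \<subseteq> K --> J \<subseteq> K"
  using small[OF J(1,2)] by (metis fg_subE)
 have "fg_sub k ?M I" unfolding fg_sub_def using A(1,2) J(2) x(1) main A(3) by (intro exI[of _ "insert x A"]) blast
 thus False using I bad_def by simp
qed

text \<open>Generators over \<open>k\<close> of a left ideal also generate it over \<open>R\<close>,
  because every left ideal of \<open>R\<close> is a \<open>k\<close>-submodule of
  \<open>M\<close>.\<close>

lemma left_noetherian_over:
 assumes k: "left_noetherian k" and M: "lmod k M" "finitely_generated k M"
  and R: "ring R" and sub: "\<And>I. submodule I R (reg R) ==> submodule I k M"
 shows "left_noetherian R"
 unfolding left_noetherian_def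
proof (intro conjI allI impI R)
 fix I assume I: "submodule I R (reg R)"
 obtain A where "finite A" "A \<subseteq> I" "\<forall>K. submodule K k M --> A \<subseteq> K --> I \<subseteq> K"
  using fg_sub_noetherian[OF k M sub[OF I]] by (rule fg_subE)
 thus "fg_sub R (reg R) I" unfolding fg_sub_def using sub by blast
qed

section \<open>Homomorphisms of modules\<close>

lemma mod_homI:
 assumes "f \<in> extensional (carrier M)" "\<And>x. x IN M ==> f x IN N"
  "\<And>x y. x IN M ==> y IN M ==> f (x \<oplus>\<^sub>M y) = f x \<oplus>\<^sub>N f y"
  "\<And>r x. r IN R ==> x IN M ==> f (r \<odot>\<^sub>M x) = r \<odot>\<^sub>N f x"
 shows "f \<in> mod_hom R M N"
 using assms unfolding mod_hom_def PiE_def by auto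

lemma mod_homD:
 assumes "f \<in> mod_hom R M N"
 shows "f \<in> extensional (carrier M)" "x IN M ==> f x IN N"
  "x IN M ==> y IN M ==> f (x \<oplus>\<^sub>M y) = f x \<oplus>\<^sub>N f y"
  "r IN R ==> x IN M ==> f (r \<odot>\<^sub>M x) = r \<odot>\<^sub>N f x"
 using assms unfolding mod_hom_def PiE_def by auto

lemma mod_hom_eqI:
 "f \<in> mod_hom R M N ==> g \<in> mod_hom R M N ==> (\<And>x. x IN M ==> f x = g x) ==> f = g"
 using mod_homD(1) extensionalityI by metis

lemma hom_restrict:
 assumes "lmod R M" "\<And>x. x IN M ==> f x IN N"
  "\<And>x y. x IN M ==> y IN M ==> f (x \<oplus>\<^sub>M y) = f x \<oplus>\<^sub>N f y"
  "\<And>r x. r IN R ==> x IN M ==> f (r \<odot>\<^sub>M x) = r \<odot>\<^sub>N f x"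
 shows "(\<lambda>x\<in>carrier M. f x) \<in> mod_hom R M N"
proof -
 interpret left_module R M by fact
 show ?thesis using assms(2-4) by (intro mod_homI) (auto simp: lm_smult_closed)
qed

lemma hom_compose:
 assumes "lmod R M" "f \<in> mod_hom R M N" "g \<in> mod_hom R N L"
 shows "cmp M g f \<in> mod_hom R M L"
 unfolding compose_def using assms by (intro hom_restrict) (auto simp: mod_homD)

lemma mod_hom_idn: "lmod R M ==> (\<lambda>x\<in>carrier M. x) \<in> mod_hom R M M"
 by (rule hom_restrict) auto

lemma mod_hom_zero_map: "lmod R M ==> lmod R N ==> zero_map M N \<in> mod_hom R M N"
 unfolding zero_map_def
proof (rule hom_restrict)
 assume "lmod R N"
 then interpret N: left_module R N .
 show "\<zero>\<^sub>N = \<zero>\<^sub>N \<oplus>\<^sub>N \<zero>\<^sub>N" "\<And>r. r IN R ==> \<zero>\<^sub>N = r \<odot>\<^sub>N \<zero>\<^sub>N" "\<zero>\<^sub>N IN N"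
  using N.smult_zero_right by auto
qed

lemma mod_hom_add:
 assumes "lmod R M" "lmod R N" "f \<in> mod_hom R M N" "g \<in> mod_hom R M N"
 shows "(\<lambda>x\<in>carrier M. f x \<oplus>\<^sub>N g x) \<in> mod_hom R M N"
proof (rule hom_restrict[OF assms(1)])
 interpret N: left_module R N by fact
 note f = mod_homD[OF assms(3)] and g = mod_homD[OF assms(4)]
 show "f x \<oplus>\<^sub>N g x IN N" if "x IN M" for x using f(2) g(2) that by simp
 show "f (x \<oplus>\<^sub>M y) \<oplus>\<^sub>N g (x \<oplus>\<^sub>M y) = (f x \<oplus>\<^sub>N g x) \<oplus>\<^sub>N (f y \<oplus>\<^sub>N g y)"
  if "x IN M" "y IN M" for x y using f(2,3) g(2,3) that N.add_add_add by simp
 show "f (r \<odot>\<^sub>M x) \<oplus>\<^sub>N g (r \<odot>\<^sub>M x) = r \<odot>\<^sub>N (f x \<oplus>\<^sub>N g x)"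
  if "r IN R" "x IN M" for r x using f(2,4) g(2,4) that N.lm_smult_r_distr by simp
qed

lemma mod_hom_minus:
 assumes "lmod R M" "lmod R N" "f \<in> mod_hom R M N"
 shows "(\<lambda>x\<in>carrier M. \<ominus>\<^sub>N f x) \<in> mod_hom R M N"
proof (rule hom_restrict[OF assms(1)])
 interpret N: left_module R N by fact
 note f = mod_homD[OF assms(3)]
 show "\<ominus>\<^sub>N f x IN N" if "x IN M" for x using f(2) that by simp
 show "\<ominus>\<^sub>N f (x \<oplus>\<^sub>M y) = \<ominus>\<^sub>N f x \<oplus>\<^sub>N \<ominus>\<^sub>N f y"
  if "x IN M" "y IN M" for x y using f(2,3) that N.M.minus_add by simp
 show "\<ominus>\<^sub>N f (r \<odot>\<^sub>M x) = r \<odot>\<^sub>N (\<ominus>\<^sub>N f x)"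
  if "r IN R" "x IN M" for r x using f(2,4) that N.smult_minus_right by simp
qed

lemma mod_hom_zero:
 assumes "lmod R M" "lmod R N" "f \<in> mod_hom R M N"
 shows "f \<zero>\<^sub>M = \<zero>\<^sub>N"
proof -
 interpret M: left_module R M by fact
 interpret N: left_module R N by fact
 have "f (\<zero>\<^sub>R \<odot>\<^sub>M \<zero>\<^sub>M) = \<zero>\<^sub>R \<odot>\<^sub>N f \<zero>\<^sub>M" using mod_homD(4)[OF assms(3)] by simp
 thus ?thesis using M.smult_zero_left N.smult_zero_left mod_homD(2)[OF assms(3)] by simp
qed

lemma mod_hom_diff:
 assumes "lmod R M" "lmod R N" "f \<in> mod_hom R M N" "x IN M" "y IN M"
 shows "f (x \<ominus>\<^sub>M y) = f x \<ominus>\<^sub>N f y"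
proof -
 interpret M: left_module R M by fact
 interpret N: left_module R N by fact
 note f = mod_homD[OF assms(3)]
 have "f (\<ominus>\<^sub>M y) = \<ominus>\<^sub>N f y"
  using M.smult_minus_one[OF assms(5)] N.smult_minus_one[OF f(2)[OF assms(5)]] f(4)[of "\<ominus>\<^sub>R \<one>\<^sub>R" y] assms(5)
  by simp
 thus ?thesis using f(3) assms(4,5) by (simp add: a_minus_def)
qed

lemma ker_submodule:
 assumes "lmod R M" "lmod R N" "f \<in> mod_hom R M N"
 shows "submodule (mod_ker M N f) R M"
proof -
 interpret M: left_module R M by fact
 interpret N: left_module R N by fact
 note f = mod_homD[OF assms(3)]
 show ?thesis by (rule M.submodule_intro)
   (auto simp: mod_ker_def f(3,4) mod_hom_zero[OF assms] M.lm_smult_closed N.smult_zero_right)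
qed

lemma image_submodule:
 assumes "lmod R M" "lmod R N" "f \<in> mod_hom R M N" "submodule H R M"
 shows "submodule (f ` H) R N"
proof -
 interpret M: left_module R M by fact
 interpret N: left_module R N by fact
 note f = mod_homD[OF assms(3)] and h = M.submoduleD[OF assms(4)]
 show ?thesis
 proof (rule N.submodule_intro)
  show "f ` H \<subseteq> carrier N" using f(2) h(1) by auto
  show "\<zero>\<^sub>N \<in> f ` H" using mod_hom_zero[OF assms(1-3)] h(2) by force
  fix a b assume "a \<in> f ` H" "b \<in> f ` H"
  then obtain x y where "a = f x" "b = f y" "x \<in> H" "y \<in> H" by auto
  thus "a \<oplus>\<^sub>N b \<in> f ` H" using f(3)[of x y] h(3,7) by (metis imageI)
 next
  fix r a assume "r IN R" "a \<in> f ` H"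
  then obtain x where "a = f x" "x \<in> H" by auto
  thus "r \<odot>\<^sub>N a \<in> f ` H" using f(4)[of r x] h(6,7) \<open>r IN R\<close> by (metis imageI)
 qed
qed

lemma vimage_submodule:
 assumes "lmod R M" "lmod R N" "f \<in> mod_hom R M N" "submodule K R N"
 shows "submodule {x \<in> carrier M. f x \<in> K} R M"
proof -
 interpret M: left_module R M by fact
 interpret N: left_module R N by fact
 note f = mod_homD[OF assms(3)] and k = N.submoduleD[OF assms(4)]
 show ?thesis by (rule M.submodule_intro)
   (use k(2,3,6) in "auto simp: f(3,4) mod_hom_zero[OF assms(1-3)] M.lm_smult_closed")
qed

lemma factor_surjective:
 assumes M: "lmod R M" "lmod R N" "lmod R L"
  and p: "p \<in> mod_hom R M N" "p ` carrier M = carrier N" and f: "f \<in> mod_hom R M L"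
  and k: "\<And>x. x IN M ==> p x = \<zero>\<^sub>N ==> f x = \<zero>\<^sub>L"
 shows "\<exists>g\<in>mod_hom R N L. \<forall>x\<in>carrier M. g (p x) = f x"
proof -
 interpret M: left_module R M by fact
 interpret N: left_module R N by fact
 interpret L: left_module R L by fact
 note pd = mod_homD[OF p(1)] and fd = mod_homD[OF f]
 define s where "s y = (SOME x. x IN M & p x = y)" for y
 have s: "s y IN M & p (s y) = y" if "y IN N" for y
  unfolding s_def by (rule someI_ex) (use that[folded p(2)] in auto)
 have eq: "f x = f x'" if "x IN M" "x' IN M" "p x = p x'" for x x'
 proof -
  have "p (x \<ominus>\<^sub>M x') = \<zero>\<^sub>N" using mod_hom_diff[OF M(1,2) p(1)] that N.a_minus_eq_zero pd(2) by simp
  hence "f (x \<ominus>\<^sub>M x') = \<zero>\<^sub>L" using k that by simp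
  thus ?thesis using mod_hom_diff[OF M(1,3) f] that L.a_minus_eq_zero fd(2) by simp
 qed
 let ?g = "\<lambda>y\<in>carrier N. f (s y)"
 have g: "?g (p x) = f x" if "x IN M" for x using that s[OF pd(2)[OF that]] pd(2) eq[of "s (p x)" x] by simp
 have "?g \<in> mod_hom R N L"
 proof (rule hom_restrict[OF M(2)])
  show "f (s y) IN L" if "y IN N" for y using fd(2) s that by simp
  show "f (s (x \<oplus>\<^sub>N y)) = f (s x) \<oplus>\<^sub>L f (s y)" if "x IN N" "y IN N" for x y
   using eq[of "s (x \<oplus>\<^sub>N y)" "s x \<oplus>\<^sub>M s y"] s that pd(3) fd(3) by simp
  show "f (s (r \<odot>\<^sub>N x)) = r \<odot>\<^sub>L f (s x)" if "r IN R" "x IN N" for r x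
   using eq[of "s (r \<odot>\<^sub>N x)" "r \<odot>\<^sub>M s x"] s that pd(4) fd(4) N.lm_smult_closed M.lm_smult_closed by simp
 qed
 thus ?thesis using g by blast
qed

lemma lift_injective:
 assumes M: "lmod R A" "lmod R B" "lmod R D"
  and i: "i \<in> mod_hom R A B" "inj_on i (carrier A)" and f: "f \<in> mod_hom R D B"
  and k: "f ` carrier D \<subseteq> i ` carrier A"
 shows "\<exists>g\<in>mod_hom R D A. \<forall>x\<in>carrier D. i (g x) = f x"
proof -
 interpret A: left_module R A by fact
 interpret D: left_module R D by fact
 note d = mod_homD[OF i(1)] and fd = mod_homD[OF f]
 define s where "s y = (SOME x. x IN A & i x = f y)" for y
 have s: "s y IN A & i (s y) = f y" if "y IN D" for y
  unfolding s_def by (rule someI_ex) (use subsetD[OF k imageI[OF that]] in auto)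
 have eq: "x = y" if "i x = i y" "x IN A" "y IN A" for x y using i(2) that by (rule inj_onD)
 have "(\<lambda>y\<in>carrier D. s y) \<in> mod_hom R D A"
 proof (rule hom_restrict[OF M(3)])
  show "s y IN A" if "y IN D" for y using s that by simp
  show "s (x \<oplus>\<^sub>D y) = s x \<oplus>\<^sub>A s y" if "x IN D" "y IN D" for x y
   using s that by (intro eq) (simp_all add: d(3) fd(3))
  show "s (r \<odot>\<^sub>D x) = r \<odot>\<^sub>A s x" if "r IN R" "x IN D" for r x
   using s that by (intro eq) (simp_all add: d(4) fd(4) A.lm_smult_closed D.lm_smult_closed)
 qed
 thus ?thesis using s by (intro bexI[of _ "\<lambda>y\<in>carrier D. s y"]) simp_all
qed

text \<open>Only operations are given on \<open>Q\<close>; each module law holds there as the image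
  of the same law in \<open>M\<close>. Quotients are built this way, without verifying the laws on
  cosets.\<close>

lemma left_module_image:
 assumes M: "lmod R M" and c: "c ` carrier M = carrier Q" "c \<zero>\<^sub>M = \<zero>\<^sub>Q"
  and add: "\<And>x y. x IN M ==> y IN M ==> c (x \<oplus>\<^sub>M y) = c x \<oplus>\<^sub>Q c y"
  and sm: "\<And>r x. r IN R ==> x IN M ==> c (r \<odot>\<^sub>M x) = r \<odot>\<^sub>Q c x"
 shows "lmod R Q"
proof -
 interpret M: left_module R M by fact
 have ex: "\<exists>x\<in>carrier M. y = c x" if "y IN Q" for y using c(1) that by auto
 have cl: "x IN M ==> c x IN Q" for x using c(1) by auto
 note closed = M.lm_smult_closed
 show ?thesis
 proof (rule left_moduleI[OF M.R.ring_axioms])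
  show "\<zero>\<^sub>Q IN Q" using cl[of "\<zero>\<^sub>M"] c(2) by simp
  fix x y z r s assume "x IN Q"
  then obtain x' where x: "x' IN M" "x = c x'" using ex by blast
  show "\<zero>\<^sub>Q \<oplus>\<^sub>Q x = x" using add[of "\<zero>\<^sub>M" x'] x c(2) by simp
  show "\<one>\<^sub>R \<odot>\<^sub>Q x = x" using sm[of "\<one>\<^sub>R" x'] x M.lm_smult_one by simp
  show "\<zero>\<^sub>R \<odot>\<^sub>Q x = \<zero>\<^sub>Q" using sm[of "\<zero>\<^sub>R" x'] x M.smult_zero_left c(2) by simp
  show "r \<odot>\<^sub>Q x IN Q" if "r IN R" using sm[OF that x(1)] x(2) cl closed[OF that x(1)] by metis
  show "(r \<oplus>\<^sub>R s) \<odot>\<^sub>Q x = r \<odot>\<^sub>Q x \<oplus>\<^sub>Q s \<odot>\<^sub>Q x" if "r IN R" "s IN R"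
   using that x by (simp add: sm[symmetric] add[symmetric] closed M.lm_smult_l_distr)
  show "(r \<otimes>\<^sub>R s) \<odot>\<^sub>Q x = r \<odot>\<^sub>Q (s \<odot>\<^sub>Q x)" if "r IN R" "s IN R"
   using that x by (simp add: sm[symmetric] closed M.lm_smult_assoc)
  assume "y IN Q"
  then obtain y' where y: "y' IN M" "y = c y'" using ex by blast
  show "x \<oplus>\<^sub>Q y IN Q" using add[OF x(1) y(1)] x y cl by (metis M.M.a_closed)
  show "x \<oplus>\<^sub>Q y = y \<oplus>\<^sub>Q x" using x y by (simp add: add[symmetric] M.M.a_comm)
  show "r \<odot>\<^sub>Q (x \<oplus>\<^sub>Q y) = r \<odot>\<^sub>Q x \<oplus>\<^sub>Q r \<odot>\<^sub>Q y" if "r IN R"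
   using that x y by (simp add: sm[symmetric] add[symmetric] closed M.lm_smult_r_distr)
  assume "z IN Q"
  then obtain z' where z: "z' IN M" "z = c z'" using ex by blast
  show "x \<oplus>\<^sub>Q y \<oplus>\<^sub>Q z = x \<oplus>\<^sub>Q (y \<oplus>\<^sub>Q z)" using x y z by (simp add: add[symmetric] M.M.a_assoc)
 qed
qed

lemma finitely_generated_image:
 assumes "lmod R M" "lmod R N" "f \<in> mod_hom R M N" "f ` carrier M = carrier N" "finitely_generated R M"
 shows "finitely_generated R N"
proof -
 obtain A where A: "finite A" "A \<subseteq> carrier M" "\<forall>K. submodule K R M --> A \<subseteq> K --> carrier M \<subseteq> K"
  using assms(5) unfolding finitely_generated_iff[OF assms(1)] by blast
 show ?thesis unfolding finitely_generated_iff[OF assms(2)]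
 proof (intro exI[of _ "f ` A"] conjI allI impI)
  show "finite (f ` A)" "f ` A \<subseteq> carrier N" using A assms(4) by auto
  fix K assume K: "submodule K R N" "f ` A \<subseteq> K"
  have "A \<subseteq> {x \<in> carrier M. f x \<in> K}" using K(2) A(2) by blast
  hence "carrier M \<subseteq> {x \<in> carrier M. f x \<in> K}" using A(3) vimage_submodule[OF assms(1-3) K(1)] by blast
  thus "carrier N \<subseteq> K" unfolding assms(4)[symmetric] by auto
 qed
qed

section \<open>Linear combinations, quotients and copies in the fixed carrier type\<close>

primrec lincomb :: "('a, 'b, 'm) module_scheme => nat => (nat => 'a) => (nat => 'b) => 'b" where
 "lincomb M 0 r x = \<zero>\<^sub>M"
| "lincomb M (Suc n) r x = lincomb M n r x \<oplus>\<^sub>M r n \<odot>\<^sub>M x n"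

lemma lincomb_cong:
 "(\<And>i. i < n ==> r i = s i) ==> (\<And>i. i < n ==> x i = y i) ==> lincomb M n r x = lincomb M n s y"
 by (induction n) auto

context left_module
begin

lemma lincomb_submodule:
 "submodule H R M ==> (\<And>i. i < n ==> r i IN R) ==> (\<And>i. i < n ==> x i \<in> H) ==> lincomb M n r x \<in> H"
 by (induction n) (auto simp: submoduleD(2,3,6))

lemma lincomb_closed:
 "(\<And>i. i < n ==> r i IN R) ==> (\<And>i. i < n ==> x i IN M) ==> lincomb M n r x IN M"
 by (rule lincomb_submodule[OF carrier_submodule])

lemma lincomb_add:
 "(\<And>i. i < n ==> r i IN R) ==> (\<And>i. i < n ==> s i IN R) ==> (\<And>i. i < n ==> x i IN M) ==>
  lincomb M n (%i. r i \<oplus> s i) x = lincomb M n r x \<oplus>\<^sub>M lincomb M n s x"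
 by (induction n) (auto simp: lincomb_closed lm_smult_closed lm_smult_l_distr add_add_add)

lemma lincomb_smult:
 "t IN R ==> (\<And>i. i < n ==> r i IN R) ==> (\<And>i. i < n ==> x i IN M) ==>
  lincomb M n (%i. t \<otimes> r i) x = t \<odot>\<^sub>M lincomb M n r x"
 by (induction n) (auto simp: lincomb_closed lm_smult_closed lm_smult_assoc lm_smult_r_distr smult_zero_right)

lemma lincomb_zero: "(\<And>i. i < n ==> r i = \<zero>) ==> (\<And>i. i < n ==> x i IN M) ==> lincomb M n r x = \<zero>\<^sub>M"
 by (induction n) (auto simp: smult_zero_left)

lemma lincomb_unit:
 assumes "j < n" "\<And>i. i < n ==> x i IN M"
 shows "lincomb M n (%i. if i = j then \<one> else \<zero>) x = x j"
 using assms
proof (induction n)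
 case (Suc n)
 show ?case
 proof (cases "j = n")
  case True
  hence "lincomb M n (%i. if i = j then \<one> else \<zero>) x = \<zero>\<^sub>M" using Suc.prems by (intro lincomb_zero) auto
  thus ?thesis using True Suc.prems lm_smult_one by simp
 next
  case False thus ?thesis using Suc smult_zero_left by simp
 qed
qed simp

end

lemma hom_lincomb:
 assumes "lmod R M" "lmod R N" "f \<in> mod_hom R M N"
 shows "(\<And>i. i < n ==> r i IN R) ==> (\<And>i. i < n ==> x i IN M) ==>
  f (lincomb M n r x) = lincomb N n r (%i. f (x i))"
proof (induction n)
 case (Suc n)
 interpret left_module R M by fact
 have "lincomb M n r x IN M" "r n \<odot>\<^sub>M x n IN M" using lincomb_closed lm_smult_closed Suc.prems by simp_all
 thus ?case using Suc mod_homD(3,4)[OF assms(3)] by simp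
qed (simp add: mod_hom_zero[OF assms])

lemma finitely_generated_lincomb:
 assumes M: "lmod R M" and "finitely_generated R M"
 obtains n x where "\<And>i. i < n ==> x i IN M"
  "\<And>m. m IN M ==> \<exists>r \<in> {..<n} \<rightarrow>\<^sub>E carrier R. m = lincomb M n r x"
proof -
 interpret left_module R M by fact
 obtain A where A: "finite A" "A \<subseteq> carrier M" "\<forall>K. submodule K R M --> A \<subseteq> K --> carrier M \<subseteq> K"
  using assms(2) unfolding finitely_generated_iff[OF assms(1)] by blast
 obtain n x where nx: "A = x ` {i. i < (n::nat)}" using finite_imp_nat_seg_image_inj_on[OF A(1)] by blast
 have x: "x i IN M" if "i < n" for i using A(2) nx that by auto
 let ?K = "{lincomb M n r x | r. r \<in> {..<n} \<rightarrow>\<^sub>E carrier R}"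
 have restr: "lincomb M n r x \<in> ?K" if "\<And>i. i < n ==> r i IN R" for r
  using lincomb_cong[of n r "restrict r {..<n}" x x M] that by (auto intro!: exI[of _ "restrict r {..<n}"] simp: PiE_iff extensional_def)
 have "submodule ?K R M"
 proof (rule submodule_intro)
  show "?K \<subseteq> carrier M" using lincomb_closed x by (auto simp: PiE_iff)
  show "\<zero>\<^sub>M \<in> ?K" using restr[of "%_. \<zero>\<^sub>R"] lincomb_zero[of n "%_. \<zero>\<^sub>R" x] x by simp
  fix a b assume "a \<in> ?K" "b \<in> ?K"
  then obtain r s where "a = lincomb M n r x" "b = lincomb M n s x" "r \<in> {..<n} \<rightarrow>\<^sub>E carrier R" "s \<in> {..<n} \<rightarrow>\<^sub>E carrier R"
   by blast
  thus "a \<oplus>\<^sub>M b \<in> ?K" using lincomb_add[of n r s x] restr[of "%i. r i \<oplus>\<^sub>R s i"] x by (auto simp: PiE_iff)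
 next
  fix t a assume "t IN R" "a \<in> ?K"
  then obtain r where "a = lincomb M n r x" "r \<in> {..<n} \<rightarrow>\<^sub>E carrier R" by blast
  thus "t \<odot>\<^sub>M a \<in> ?K" using lincomb_smult[of t n r x] restr[of "%i. t \<otimes>\<^sub>R r i"] x \<open>t IN R\<close> by (auto simp: PiE_iff)
 qed
 moreover have "A \<subseteq> ?K"
 proof
  fix a assume "a \<in> A"
  then obtain j where j: "j < n" "a = x j" using nx by auto
  thus "a \<in> ?K" using lincomb_unit[OF j(1), of x] restr[of "%i. if i = j then \<one>\<^sub>R else \<zero>\<^sub>R"] x by auto
 qed
 ultimately have "carrier M \<subseteq> ?K" using A(3) by blast
 thus ?thesis using that[of n x] x by blast
qed

lemma finitely_generated_lincombI:
 assumes M: "lmod R M" and x: "\<And>i. i < n ==> x i IN M"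
  and g: "\<And>m. m IN M ==> \<exists>r. (\<forall>i<n. r i IN R) & m = lincomb M n r x"
 shows "finitely_generated R M"
proof -
 interpret left_module R M by fact
 show ?thesis unfolding finitely_generated_iff[OF M]
 proof (intro exI[of _ "x ` {..<n}"] conjI allI impI subsetI)
  fix K m assume K: "submodule K R M" "x ` {..<n} \<subseteq> K" "m IN M"
  then obtain r where "\<forall>i<n. r i IN R" "m = lincomb M n r x" using g by blast
  thus "m \<in> K" using lincomb_submodule[OF K(1), of n r x] K(2) by auto
 qed (use x in auto)
qed

text \<open>A quotient has to live on sets of sequences in the ring. The class of \<open>m\<close>
  is encoded as the set \<open>c m\<close> of all coefficient sequences whose linear combination of
  fixed generators is congruent to \<open>m\<close> modulo \<open>H\<close>. Extensional sequences
  make this set well determined.\<close>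

lemma quotient_exists:
 fixes M :: "('a, 'b) module" and R :: "'a ring"
 assumes M: "lmod R M" and fg: "finitely_generated R M" and H: "submodule H R M"
 obtains Q p where "Q \<in> fgm R" "p \<in> mod_hom R M Q" "p ` carrier M = carrier Q"
  "\<forall>x\<in>carrier M. p x = \<zero>\<^sub>Q \<longleftrightarrow> x \<in> H"
proof -
 interpret left_module R M by fact
 note h = submoduleD[OF H]
 obtain n x where x: "\<And>i. i < n ==> x i IN M"
  and gen: "\<And>m. m IN M ==> \<exists>r \<in> {..<n} \<rightarrow>\<^sub>E carrier R. m = lincomb M n r x"
  using finitely_generated_lincomb[OF M fg] by blast
 define c where "c m = {r \<in> {..<n} \<rightarrow>\<^sub>E carrier R. m \<ominus>\<^sub>M lincomb M n r x \<in> H}" for m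
 have l: "lincomb M n r x IN M" if "r \<in> {..<n} \<rightarrow>\<^sub>E carrier R" for r
  using that x lincomb_closed by (auto simp: PiE_iff)
 have three: "(a \<ominus>\<^sub>M b) \<oplus>\<^sub>M (b \<ominus>\<^sub>M d) = a \<ominus>\<^sub>M d"
  if "a IN M" "b IN M" "d IN M" for a b d
 proof -
  have "(a \<ominus>\<^sub>M b) \<oplus>\<^sub>M (b \<ominus>\<^sub>M d) = ((a \<ominus>\<^sub>M b) \<oplus>\<^sub>M b) \<ominus>\<^sub>M d"
   using that by (simp add: a_minus_def M.a_assoc)
  thus ?thesis using a_minus_cancel that by simp
 qed
 have swap: "b \<ominus>\<^sub>M a \<in> H" if "a \<ominus>\<^sub>M b \<in> H" "a IN M" "b IN M" for a b
  using h(4)[OF that(1)] that by (simp add: a_minus_def M.minus_add M.a_comm)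
 have c_eq: "c m = c m' \<longleftrightarrow> m \<ominus>\<^sub>M m' \<in> H" if m: "m IN M" "m' IN M" for m m'
 proof
  assume e: "c m = c m'"
  obtain r where r: "r \<in> {..<n} \<rightarrow>\<^sub>E carrier R" "m = lincomb M n r x" using gen m by blast
  hence "m \<ominus>\<^sub>M lincomb M n r x = \<zero>\<^sub>M" using a_minus_eq_zero m by simp
  hence "r \<in> c m" unfolding c_def using r h(2) by simp
  hence "r \<in> c m'" using e by simp
  hence "m' \<ominus>\<^sub>M m \<in> H" unfolding c_def using r by simp
  thus "m \<ominus>\<^sub>M m' \<in> H" using swap m by blast
 next
  assume e: "m \<ominus>\<^sub>M m' \<in> H"
  show "c m = c m'" unfolding c_def
  proof (intro Collect_cong conj_cong refl iffI)
   fix r assume r: "r \<in> {..<n} \<rightarrow>\<^sub>E carrier R"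
   show "m' \<ominus>\<^sub>M lincomb M n r x \<in> H" if "m \<ominus>\<^sub>M lincomb M n r x \<in> H"
    using h(3)[OF swap[OF e m] that] three m l[OF r] by simp
   show "m \<ominus>\<^sub>M lincomb M n r x \<in> H" if "m' \<ominus>\<^sub>M lincomb M n r x \<in> H"
    using h(3)[OF e that] three m l[OF r] by simp
  qed
 qed
 define rep where "rep S = (SOME m. m IN M & c m = S)" for S
 have rep: "rep (c m) IN M & c (rep (c m)) = c m" if "m IN M" for m
  unfolding rep_def by (rule someI_ex) (use that in blast)
 define Q where "Q = \<lparr>carrier = c ` carrier M, monoid.mult = (%_ _. c \<zero>\<^sub>M), monoid.one = c \<zero>\<^sub>M,
   ring.zero = c \<zero>\<^sub>M, ring.add = (%S T. c (rep S \<oplus>\<^sub>M rep T)), smult = (%r S. c (r \<odot>\<^sub>M rep S))\<rparr>"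
 have add: "c (u \<oplus>\<^sub>M v) = c u \<oplus>\<^sub>Q c v" if "u IN M" "v IN M" for u v
 proof -
  have "u \<ominus>\<^sub>M rep (c u) \<in> H" "v \<ominus>\<^sub>M rep (c v) \<in> H" using c_eq rep that by metis+
  hence "(u \<oplus>\<^sub>M v) \<ominus>\<^sub>M (rep (c u) \<oplus>\<^sub>M rep (c v)) \<in> H" using add_diff_add h(3) rep that by simp
  thus ?thesis using c_eq rep that by (simp add: Q_def)
 qed
 have sm: "c (r \<odot>\<^sub>M u) = r \<odot>\<^sub>Q c u" if "r IN R" "u IN M" for r u
 proof -
  have "u \<ominus>\<^sub>M rep (c u) \<in> H" using c_eq rep that by metis
  hence "r \<odot>\<^sub>M u \<ominus>\<^sub>M r \<odot>\<^sub>M rep (c u) \<in> H" using smult_diff h(6) rep that by metis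
  thus ?thesis using c_eq rep that lm_smult_closed by (simp add: Q_def)
 qed
 have Qs: "c ` carrier M = carrier Q" "c \<zero>\<^sub>M = \<zero>\<^sub>Q" by (simp_all add: Q_def)
 have LQ: "lmod R Q" by (rule left_module_image[OF M Qs add sm])
 let ?p = "\<lambda>m\<in>carrier M. c m"
 have p: "?p \<in> mod_hom R M Q" by (rule hom_restrict[OF M]) (use Qs add sm in auto)
 have s: "?p ` carrier M = carrier Q" using Qs by auto
 have "Q \<in> fgm R" unfolding fg_modules_def using LQ finitely_generated_image[OF M LQ p s fg] by simp
 moreover have "?p m = \<zero>\<^sub>Q \<longleftrightarrow> m \<in> H" if "m IN M" for m
  using c_eq[OF that M.zero_closed] that Qs(2) a_minus_cancel[OF that M.zero_closed] by simp
 ultimately show ?thesis using that p s by blast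
qed

text \<open>The quotient by zero. Through it, modules with other carrier types, such as products,
  free modules and duals, are replaced by isomorphic objects of \<open>fg_modules\<close>.\<close>

lemma fg_copy:
 fixes M :: "('a, 'b) module" and R :: "'a ring"
 assumes M: "lmod R M" and fg: "finitely_generated R M"
 obtains Q p q where "Q \<in> fgm R" "p \<in> mod_hom R M Q" "q \<in> mod_hom R Q M" "bij_betw p (carrier M) (carrier Q)"
  "\<forall>x\<in>carrier M. q (p x) = x" "\<forall>y\<in>carrier Q. p (q y) = y"
proof -
 interpret left_module R M by fact
 have "submodule {\<zero>\<^sub>M} R M" by (rule submodule_intro) (auto simp: smult_zero_right)
 then obtain Q p where Q: "Q \<in> fgm R" "p \<in> mod_hom R M Q" "p ` carrier M = carrier Q"
  "\<forall>x\<in>carrier M. p x = \<zero>\<^sub>Q \<longleftrightarrow> x \<in> {\<zero>\<^sub>M}"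
  by (rule quotient_exists[OF M fg])
 hence LQ: "lmod R Q" unfolding fg_modules_def by simp
 have "\<exists>g\<in>mod_hom R Q M. \<forall>x\<in>carrier M. g (p x) = (\<lambda>x\<in>carrier M. x) x"
  by (rule factor_surjective[OF M LQ M Q(2,3) mod_hom_idn[OF M]]) (use Q(4) in auto)
 then obtain q where q: "q \<in> mod_hom R Q M" "\<forall>x\<in>carrier M. q (p x) = (\<lambda>x\<in>carrier M. x) x" by blast
 have qp: "q (p x) = x" if "x IN M" for x using q(2) that by simp
 have "bij_betw p (carrier M) (carrier Q)" unfolding bij_betw_def using Q(3) qp by (metis inj_onI)
 moreover have "p (q y) = y" if "y IN Q" for y using that[folded Q(3)] by (auto simp: qp)
 ultimately show ?thesis using qp by (intro that[OF Q(1,2) q(1)]) simp_all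
qed

lemma fgmD: "M \<in> fgm R ==> lmod R M" "M \<in> fgm R ==> finitely_generated R M"
 unfolding fg_modules_def by auto

lemma submodule_left_module:
 fixes M :: "('a, 'b) module"
 assumes "lmod R M" "submodule H R M"
 shows "lmod R (M\<lparr>carrier := H\<rparr>)"
proof -
 interpret left_module R M by fact
 note h = submoduleD[OF assms(2)]
 show ?thesis by (rule left_moduleI[OF R.ring_axioms])
   (auto simp: h(2,3,6,7) M.a_assoc lm_smult_l_distr lm_smult_r_distr lm_smult_assoc lm_smult_one
    smult_zero_left intro: M.a_comm)
qed

lemma submodule_submodule_iff:
 fixes M :: "('a, 'b) module"
 assumes "lmod R M" "submodule H R M"
 shows "submodule K R (M\<lparr>carrier := H\<rparr>) \<longleftrightarrow> submodule K R M & K \<subseteq> H"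
proof -
 interpret left_module R M by fact
 interpret N: left_module R "M\<lparr>carrier := H\<rparr>" by (rule submodule_left_module[OF assms])
 note h = submoduleD(1)[OF assms(2)]
 show ?thesis
 proof
  assume "submodule K R (M\<lparr>carrier := H\<rparr>)"
  note k = N.submoduleD[OF this]
  show "submodule K R M & K \<subseteq> H" using k(1,2,3,6) h by (auto intro!: submodule_intro)
 next
  assume a: "submodule K R M & K \<subseteq> H"
  hence "submodule K R M" by simp
  note k = submoduleD[OF this]
  show "submodule K R (M\<lparr>carrier := H\<rparr>)" using k(1,2,3,6) a by (auto intro!: N.submodule_intro)
 qed
qed

lemma submodule_finitely_generated:
 fixes M :: "('a, 'b) module"
 assumes "left_noetherian R" "lmod R M" "finitely_generated R M" "submodule H R M"
 shows "finitely_generated R (M\<lparr>carrier := H\<rparr>)"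
proof -
 obtain A where A: "finite A" "A \<subseteq> H" "\<forall>K. submodule K R M --> A \<subseteq> K --> H \<subseteq> K"
  using fg_sub_noetherian[OF assms] by (rule fg_subE)
 thus ?thesis
  unfolding finitely_generated_iff[OF submodule_left_module[OF assms(2,4)]] submodule_submodule_iff[OF assms(2,4)]
  by (intro exI[of _ A]) auto
qed

lemma submodule_fg:
 assumes "left_noetherian R" "M \<in> fgm R" "submodule H R M"
 shows "M\<lparr>carrier := H\<rparr> \<in> fgm R"
 using submodule_left_module submodule_finitely_generated[OF assms(1)] assms unfolding fg_modules_def by auto

lemma mod_hom_inclusion:
 fixes M :: "('a, 'b) module"
 assumes "lmod R M" "submodule H R M"
 shows "(\<lambda>x\<in>H. x) \<in> mod_hom R (M\<lparr>carrier := H\<rparr>) M"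
 using hom_restrict[OF submodule_left_module[OF assms], of "%x. x" M] left_module.submoduleD(7)[OF assms] by simp

section \<open>Biproducts, pullbacks and pushouts of modules\<close>

definition prod_module :: "('a, 'b) module => ('a, 'c) module => ('a, 'b \<times> 'c) module" where
 "prod_module M N = \<lparr>carrier = carrier M \<times> carrier N, monoid.mult = (%_ _. (\<zero>\<^sub>M, \<zero>\<^sub>N)), monoid.one = (\<zero>\<^sub>M, \<zero>\<^sub>N),
   ring.zero = (\<zero>\<^sub>M, \<zero>\<^sub>N), ring.add = (%x y. (fst x \<oplus>\<^sub>M fst y, snd x \<oplus>\<^sub>N snd y)),
   smult = (%r x. (r \<odot>\<^sub>M fst x, r \<odot>\<^sub>N snd x))\<rparr>"

lemma prod_module_simps [simp]:
 "carrier (prod_module M N) = carrier M \<times> carrier N" "\<zero>\<^sub>(prod_module M N) = (\<zero>\<^sub>M, \<zero>\<^sub>N)"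
 "x \<oplus>\<^sub>(prod_module M N) y = (fst x \<oplus>\<^sub>M fst y, snd x \<oplus>\<^sub>N snd y)"
 "r \<odot>\<^sub>(prod_module M N) x = (r \<odot>\<^sub>M fst x, r \<odot>\<^sub>N snd x)"
 by (simp_all add: prod_module_def)

lemma prod_left_module:
 assumes "lmod R M" "lmod R N" shows "lmod R (prod_module M N)"
proof -
 interpret M: left_module R M by fact
 interpret N: left_module R N by fact
 show ?thesis by (rule left_moduleI[OF M.R.ring_axioms])
   (auto simp: M.M.a_assoc N.M.a_assoc M.lm_smult_closed N.lm_smult_closed
    M.lm_smult_l_distr M.lm_smult_r_distr M.lm_smult_assoc M.lm_smult_one M.smult_zero_left
    N.lm_smult_l_distr N.lm_smult_r_distr N.lm_smult_assoc N.lm_smult_one N.smult_zero_left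
    intro: M.M.a_comm N.M.a_comm)
qed

lemma prod_finitely_generated:
 assumes "lmod R M" "lmod R N" "finitely_generated R M" "finitely_generated R N"
 shows "finitely_generated R (prod_module M N)"
proof -
 interpret M: left_module R M by fact
 interpret N: left_module R N by fact
 let ?P = "prod_module M N"
 interpret P: left_module R ?P by (rule prod_left_module[OF assms(1,2)])
 have i1: "(\<lambda>x\<in>carrier M. (x, \<zero>\<^sub>N)) \<in> mod_hom R M ?P" and i2: "(\<lambda>y\<in>carrier N. (\<zero>\<^sub>M, y)) \<in> mod_hom R N ?P"
  by (rule hom_restrict; simp add: assms M.smult_zero_right N.smult_zero_right)+
 obtain A where A: "finite A" "A \<subseteq> carrier M" "\<forall>K. submodule K R M --> A \<subseteq> K --> carrier M \<subseteq> K"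
  using assms(3) unfolding finitely_generated_iff[OF assms(1)] by blast
 obtain B where B: "finite B" "B \<subseteq> carrier N" "\<forall>K. submodule K R N --> B \<subseteq> K --> carrier N \<subseteq> K"
  using assms(4) unfolding finitely_generated_iff[OF assms(2)] by blast
 show ?thesis unfolding finitely_generated_iff[OF P.left_module_axioms]
 proof (intro exI[of _ "(%x. (x, \<zero>\<^sub>N)) ` A \<union> (%y. (\<zero>\<^sub>M, y)) ` B"] conjI allI impI subsetI)
  show "finite ((%x. (x, \<zero>\<^sub>N)) ` A \<union> (%y. (\<zero>\<^sub>M, y)) ` B)" using A B by simp
  show "z \<in> carrier ?P" if "z \<in> (%x. (x, \<zero>\<^sub>N)) ` A \<union> (%y. (\<zero>\<^sub>M, y)) ` B" for z using that A B by auto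
  fix K z assume K: "submodule K R ?P" "(%x. (x, \<zero>\<^sub>N)) ` A \<union> (%y. (\<zero>\<^sub>M, y)) ` B \<subseteq> K" and z: "z \<in> carrier ?P"
  have "A \<subseteq> {x \<in> carrier M. (\<lambda>x\<in>carrier M. (x, \<zero>\<^sub>N)) x \<in> K}" using K(2) A(2) by auto
  hence 1: "carrier M \<subseteq> {x \<in> carrier M. (\<lambda>x\<in>carrier M. (x, \<zero>\<^sub>N)) x \<in> K}"
   using A(3) vimage_submodule[OF assms(1) P.left_module_axioms i1 K(1)] by blast
  have "B \<subseteq> {x \<in> carrier N. (\<lambda>y\<in>carrier N. (\<zero>\<^sub>M, y)) x \<in> K}" using K(2) B(2) by auto
  hence 2: "carrier N \<subseteq> {x \<in> carrier N. (\<lambda>y\<in>carrier N. (\<zero>\<^sub>M, y)) x \<in> K}"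
   using B(3) vimage_submodule[OF assms(2) P.left_module_axioms i2 K(1)] by blast
  have "(fst z, \<zero>\<^sub>N) \<in> K" "(\<zero>\<^sub>M, snd z) \<in> K" using 1 2 z by auto
  hence "(fst z, \<zero>\<^sub>N) \<oplus>\<^sub>?P (\<zero>\<^sub>M, snd z) \<in> K" using P.submoduleD(3)[OF K(1)] by blast
  thus "z \<in> K" using z by auto
 qed
qed

lemma biproduct_exists:
 assumes "X \<in> fgm R" "Y \<in> fgm R"
 obtains S p q where "S \<in> fgm R" "p \<in> mod_hom R S X" "q \<in> mod_hom R S Y"
  "\<forall>x\<in>carrier X. \<forall>y\<in>carrier Y. \<exists>s\<in>carrier S. p s = x & q s = y"
  "\<forall>s\<in>carrier S. \<forall>t\<in>carrier S. p s = p t --> q s = q t --> s = t"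
proof -
 note X = fgmD[OF assms(1)] and Y = fgmD[OF assms(2)]
 let ?P = "prod_module X Y"
 note P = prod_left_module[OF X(1) Y(1)]
 obtain S f g where S: "S \<in> fgm R" "f \<in> mod_hom R ?P S" "g \<in> mod_hom R S ?P"
  "\<forall>x\<in>carrier ?P. g (f x) = x" "\<forall>y\<in>carrier S. f (g y) = y"
  by (rule fg_copy[OF P prod_finitely_generated[OF X(1) Y(1) X(2) Y(2)]])
 note LS = fgmD(1)[OF S(1)] and gd = mod_homD[OF S(3)] and fd = mod_homD[OF S(2)]
 have g2: "fst (g s) IN X" "snd (g s) IN Y" if "s IN S" for s using gd(2)[OF that] by (auto simp: mem_Times_iff)
 let ?p = "\<lambda>s\<in>carrier S. fst (g s)" and ?q = "\<lambda>s\<in>carrier S. snd (g s)"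
 have "?p \<in> mod_hom R S X" by (rule hom_restrict[OF LS]) (use g2 in "auto simp: gd(3,4)")
 moreover have "?q \<in> mod_hom R S Y" by (rule hom_restrict[OF LS]) (use g2 in "auto simp: gd(3,4)")
 moreover have "\<exists>s\<in>carrier S. ?p s = x & ?q s = y" if "x IN X" "y IN Y" for x y
  using S(4)[rule_format, of "(x, y)"] fd(2)[of "(x, y)"] that by (intro bexI[of _ "f (x, y)"]) auto
 moreover have "s = t" if "s IN S" "t IN S" "?p s = ?p t" "?q s = ?q t" for s t
 proof -
  have "g s = g t" using that by (simp add: prod_eq_iff)
  thus ?thesis using S(5) that by metis
 qed
 ultimately show ?thesis by (intro that[OF S(1)]) (assumption | blast)+
qed

lemma short_exactD:
 assumes "short_exact R X Y Z f g" "lmod R X" "lmod R Y"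
 shows "f \<in> mod_hom R X Y" "g \<in> mod_hom R Y Z" "x IN X ==> g (f x) = \<zero>\<^sub>Z"
  "y IN Y ==> g y = \<zero>\<^sub>Z ==> \<exists>x\<in>carrier X. f x = y"
  "z IN Z ==> \<exists>y\<in>carrier Y. g y = z"
  "x IN X ==> x' IN X ==> f x = f x' ==> x = x'"
  "x IN X ==> f x = \<zero>\<^sub>Y ==> x = \<zero>\<^sub>X"
proof -
 have a: "f \<in> mod_hom R X Y" "g \<in> mod_hom R Y Z" "inj_on f (carrier X)"
  "f ` carrier X = mod_ker Y Z g" "g ` carrier Y = carrier Z" using assms(1) unfolding short_exact_def by auto
 show "f \<in> mod_hom R X Y" "g \<in> mod_hom R Y Z" by fact+
 show "x IN X ==> g (f x) = \<zero>\<^sub>Z" using a(4) unfolding mod_ker_def by blast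
 show "y IN Y ==> g y = \<zero>\<^sub>Z ==> \<exists>x\<in>carrier X. f x = y" using a(4) unfolding mod_ker_def by (smt (verit) imageE mem_Collect_eq)
 show "z IN Z ==> \<exists>y\<in>carrier Y. g y = z" unfolding a(5)[symmetric] by blast
 show *: "x IN X ==> x' IN X ==> f x = f x' ==> x = x'" for x' using a(3) by (meson inj_onD)
 show "x IN X ==> f x = \<zero>\<^sub>Y ==> x = \<zero>\<^sub>X"
  using *[of "\<zero>\<^sub>X"] mod_hom_zero[OF assms(2,3) a(1)] left_module.submoduleD(2,7)[OF assms(2) left_module.carrier_submodule[OF assms(2)]]
  by simp
qed

lemma short_exactI:
 assumes "lmod R X" "lmod R Y" "f \<in> mod_hom R X Y" "g \<in> mod_hom R Y Z"
  "\<And>x. x IN X ==> g (f x) = \<zero>\<^sub>Z"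
  "\<And>y. y IN Y ==> g y = \<zero>\<^sub>Z ==> \<exists>x\<in>carrier X. f x = y"
  "\<And>z. z IN Z ==> \<exists>y\<in>carrier Y. g y = z"
  "\<And>x. x IN X ==> f x = \<zero>\<^sub>Y ==> x = \<zero>\<^sub>X"
 shows "short_exact R X Y Z f g"
 unfolding short_exact_def
proof (intro conjI assms(3,4))
 interpret X: left_module R X by fact
 interpret Y: left_module R Y by fact
 note f = mod_homD[OF assms(3)] and g = mod_homD[OF assms(4)]
 show "inj_on f (carrier X)"
 proof (rule inj_onI)
  fix x y assume "x IN X" "y IN X" "f x = f y"
  thus "x = y" using assms(8)[of "x \<ominus>\<^sub>X y"] mod_hom_diff[OF assms(1,2,3)] X.a_minus_eq_zero Y.a_minus_eq_zero f(2)
   by simp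
 qed
 show "f ` carrier X = mod_ker Y Z g" unfolding mod_ker_def using assms(5,6) f(2) by blast
 show "g ` carrier Y = carrier Z" using assms(7) g(2) by blast
qed

lemma pullback_modules:
 assumes N: "left_noetherian R" and O: "B \<in> fgm R" "C \<in> fgm R" "D \<in> fgm R"
  and p: "p \<in> mod_hom R B C" and f: "f \<in> mod_hom R D C"
 obtains E g h where "E \<in> fgm R" "g \<in> mod_hom R E B" "h \<in> mod_hom R E D"
  "\<forall>e\<in>carrier E. p (g e) = f (h e)"
  "\<forall>b\<in>carrier B. \<forall>d\<in>carrier D. p b = f d --> (\<exists>e\<in>carrier E. g e = b & h e = d)"
  "\<forall>e\<in>carrier E. \<forall>e'\<in>carrier E. g e = g e' --> h e = h e' --> e = e'"
proof -
 note LB = fgmD(1)[OF O(1)] and LC = fgmD(1)[OF O(2)] and LD = fgmD(1)[OF O(3)]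
 interpret C: left_module R C by fact
 obtain S a b where S: "S \<in> fgm R" "a \<in> mod_hom R S B" "b \<in> mod_hom R S D"
  "\<forall>x\<in>carrier B. \<forall>y\<in>carrier D. \<exists>s\<in>carrier S. a s = x & b s = y"
  "\<forall>s\<in>carrier S. \<forall>t\<in>carrier S. a s = a t --> b s = b t --> s = t"
  by (rule biproduct_exists[OF O(1,3)])
 note LS = fgmD(1)[OF S(1)]
 interpret S: left_module R S by fact
 note pd = mod_homD[OF p] and fd = mod_homD[OF f] and ad = mod_homD[OF S(2)] and bd = mod_homD[OF S(3)]
 let ?H = "{s \<in> carrier S. p (a s) = f (b s)}"
 have H: "submodule ?H R S" by (rule S.submodule_intro)
   (auto simp: pd(3,4) fd(3,4) ad(2,3,4) bd(2,3,4) S.lm_smult_closed mod_hom_zero[OF LS LB S(2)]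
    mod_hom_zero[OF LS LD S(3)] mod_hom_zero[OF LB LC p] mod_hom_zero[OF LD LC f])
 let ?E = "S\<lparr>carrier := ?H\<rparr>"
 have E: "?E \<in> fgm R" by (rule submodule_fg[OF N S(1) H])
 note LE = fgmD(1)[OF E]
 have "(\<lambda>s\<in>carrier ?E. a s) \<in> mod_hom R ?E B" "(\<lambda>s\<in>carrier ?E. b s) \<in> mod_hom R ?E D"
  by (rule hom_restrict[OF LE]; simp add: ad bd)+
 moreover have "\<exists>e\<in>carrier ?E. (\<lambda>s\<in>carrier ?E. a s) e = x & (\<lambda>s\<in>carrier ?E. b s) e = y"
  if x: "x IN B" "y IN D" "p x = f y" for x y
 proof -
  obtain s where "s IN S" "a s = x" "b s = y" using S(4)[rule_format, OF x(1,2)] by blast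
  thus ?thesis using x(3) by (intro bexI[of _ s]) auto
 qed
 moreover have "\<forall>e\<in>carrier ?E. \<forall>e'\<in>carrier ?E. (\<lambda>s\<in>carrier ?E. a s) e = (\<lambda>s\<in>carrier ?E. a s) e' -->
   (\<lambda>s\<in>carrier ?E. b s) e = (\<lambda>s\<in>carrier ?E. b s) e' --> e = e'"
 proof (intro ballI impI)
  fix e e' assume "e \<in> carrier ?E" "e' \<in> carrier ?E" "(\<lambda>s\<in>carrier ?E. a s) e = (\<lambda>s\<in>carrier ?E. a s) e'"
   "(\<lambda>s\<in>carrier ?E. b s) e = (\<lambda>s\<in>carrier ?E. b s) e'"
  hence "e IN S" "e' IN S" "a e = a e'" "b e = b e'" by (simp_all add: restrict_apply')
  thus "e = e'" using S(5) by blast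
 qed
 moreover have "\<forall>e\<in>carrier ?E. p ((\<lambda>s\<in>carrier ?E. a s) e) = f ((\<lambda>s\<in>carrier ?E. b s) e)" by simp
 ultimately show ?thesis by (intro that[OF E]) (assumption | blast)+
qed

lemma pushout_modules:
 assumes O: "A \<in> fgm R" "B \<in> fgm R" "D \<in> fgm R"
  and i: "i \<in> mod_hom R A B" and f: "f \<in> mod_hom R A D"
 obtains Z j v where "Z \<in> fgm R" "j \<in> mod_hom R B Z" "v \<in> mod_hom R D Z"
  "\<forall>a\<in>carrier A. j (i a) = v (f a)"
  "\<forall>z\<in>carrier Z. \<exists>b\<in>carrier B. \<exists>d\<in>carrier D. z = j b \<oplus>\<^sub>Z v d"
  "\<forall>b\<in>carrier B. \<forall>d\<in>carrier D. j b = v d --> (\<exists>a\<in>carrier A. b = i a & d = f a)"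
proof -
 note LA = fgmD(1)[OF O(1)] and LB = fgmD(1)[OF O(2)] and LD = fgmD(1)[OF O(3)]
 interpret A: left_module R A by fact
 interpret B: left_module R B by fact
 interpret D: left_module R D by fact
 let ?P = "prod_module B D"
 note LP = prod_left_module[OF LB LD]
 interpret P: left_module R ?P by fact
 note fd = mod_homD[OF f] and idd = mod_homD[OF i]
 let ?h = "\<lambda>a\<in>carrier A. (i a, \<ominus>\<^sub>D f a)"
 have h: "?h \<in> mod_hom R A ?P"
  by (rule hom_restrict[OF LA]) (simp_all add: fd idd D.M.minus_add D.smult_minus_right)
 obtain Z q where Z: "Z \<in> fgm R" "q \<in> mod_hom R ?P Z" "q ` carrier ?P = carrier Z"
  "\<forall>x\<in>carrier ?P. q x = \<zero>\<^sub>Z \<longleftrightarrow> x \<in> ?h ` carrier A"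
  by (rule quotient_exists[OF LP prod_finitely_generated[OF LB LD fgmD(2)[OF O(2)] fgmD(2)[OF O(3)]]
   image_submodule[OF LA LP h A.carrier_submodule]])
 note LZ = fgmD(1)[OF Z(1)]
 interpret Z: left_module R Z by fact
 note qd = mod_homD[OF Z(2)]
 have qd2: "q (b, d) IN Z" if "b IN B" "d IN D" for b d using qd(2)[of "(b, d)"] that by simp
 have qadd: "q (b, d) \<oplus>\<^sub>Z q (b', d') = q (b \<oplus>\<^sub>B b', d \<oplus>\<^sub>D d')"
  if "b IN B" "d IN D" "b' IN B" "d' IN D" for b d b' d' using qd(3)[of "(b, d)" "(b', d')"] that by simp
 have qsm: "r \<odot>\<^sub>Z q (b, d) = q (r \<odot>\<^sub>B b, r \<odot>\<^sub>D d)" if "r IN R" "b IN B" "d IN D" for b d r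
  using qd(4)[of r "(b, d)"] that by simp
 let ?j = "\<lambda>b\<in>carrier B. q (b, \<zero>\<^sub>D)" and ?v = "\<lambda>d\<in>carrier D. q (\<zero>\<^sub>B, d)"
 have j: "?j \<in> mod_hom R B Z" and v: "?v \<in> mod_hom R D Z"
  by (rule hom_restrict; simp add: LB LD qadd qsm qd2 B.smult_zero_right D.smult_zero_right)+
 have diff: "?j b \<ominus>\<^sub>Z ?v d = q (b, \<ominus>\<^sub>D d)" if "b IN B" "d IN D" for b d
 proof -
  have "q (b, \<ominus>\<^sub>D d) \<oplus>\<^sub>Z ?v d = ?j b" using that by (simp add: qadd D.M.l_neg)
  hence "?j b \<ominus>\<^sub>Z ?v d = (q (b, \<ominus>\<^sub>D d) \<oplus>\<^sub>Z ?v d) \<ominus>\<^sub>Z ?v d" by simp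
  thus ?thesis using that by (simp add: qd2 a_minus_def Z.M.a_assoc Z.M.r_neg)
 qed
 show ?thesis
 proof (rule that[OF Z(1) j v]; intro ballI impI)
  fix a assume a: "a IN A"
  have "q (i a, \<ominus>\<^sub>D f a) = \<zero>\<^sub>Z" using Z(4)[rule_format, of "(i a, \<ominus>\<^sub>D f a)"] a idd(2) fd(2) by auto
  hence "?j (i a) \<ominus>\<^sub>Z ?v (f a) = \<zero>\<^sub>Z" using diff a idd(2) fd(2) by simp
  thus "?j (i a) = ?v (f a)" using Z.a_minus_eq_zero[OF mod_homD(2)[OF j idd(2)[OF a]] mod_homD(2)[OF v fd(2)[OF a]]] by blast
 next
  fix z assume "z IN Z"
  then obtain x where x: "x \<in> carrier ?P" "q x = z" unfolding Z(3)[symmetric] by blast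
  thus "\<exists>b\<in>carrier B. \<exists>d\<in>carrier D. z = ?j b \<oplus>\<^sub>Z ?v d"
   using qadd[of "fst x" "\<zero>\<^sub>D" "\<zero>\<^sub>B" "snd x"] by (intro bexI[of _ "fst x"] bexI[of _ "snd x"]) auto
 next
  fix b d assume b: "b IN B" "d IN D" "?j b = ?v d"
  hence "q (b, \<ominus>\<^sub>D d) = \<zero>\<^sub>Z"
   using diff[OF b(1,2)] Z.a_minus_eq_zero[OF mod_homD(2)[OF j b(1)] mod_homD(2)[OF v b(2)]] by simp
  hence "(b, \<ominus>\<^sub>D d) \<in> ?h ` carrier A" using Z(4)[rule_format, of "(b, \<ominus>\<^sub>D d)"] b by simp
  then obtain a where "a IN A" "b = i a" "\<ominus>\<^sub>D d = \<ominus>\<^sub>D f a" by auto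
  thus "\<exists>a\<in>carrier A. b = i a & d = f a" using b fd(2) by (metis D.M.minus_minus)
 qed
qed

section \<open>Dual bases and projective modules\<close>

lemma lincomb_hom:
 assumes M: "lmod R M" and Y: "lmod R Y"
  and h: "\<And>i. i < n ==> h i \<in> mod_hom R M (reg R)" and y: "\<And>i. i < n ==> y i IN Y"
 shows "(\<lambda>x\<in>carrier M. lincomb Y n (%i. h i x) y) \<in> mod_hom R M Y"
proof (rule hom_restrict[OF M])
 interpret Y: left_module R Y by fact
 have hc: "h i x IN R" if "i < n" "x IN M" for i x using mod_homD(2)[OF h[OF that(1)] that(2)] by simp
 show "lincomb Y n (%i. h i x) y IN Y" if "x IN M" for x using Y.lincomb_closed hc y that by simp
 show "lincomb Y n (%i. h i (x \<oplus>\<^sub>M x')) y = lincomb Y n (%i. h i x) y \<oplus>\<^sub>Y lincomb Y n (%i. h i x') y"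
  if "x IN M" "x' IN M" for x x'
 proof -
  have "lincomb Y n (%i. h i (x \<oplus>\<^sub>M x')) y = lincomb Y n (%i. h i x \<oplus>\<^sub>R h i x') y"
   using mod_homD(3)[OF h] that by (intro lincomb_cong) auto
  thus ?thesis using Y.lincomb_add hc y that by simp
 qed
 show "lincomb Y n (%i. h i (r \<odot>\<^sub>M x)) y = r \<odot>\<^sub>Y lincomb Y n (%i. h i x) y"
  if "r IN R" "x IN M" for r x
 proof -
  have "lincomb Y n (%i. h i (r \<odot>\<^sub>M x)) y = lincomb Y n (%i. r \<otimes>\<^sub>R h i x) y"
   using mod_homD(4)[OF h] that by (intro lincomb_cong) auto
  thus ?thesis using Y.lincomb_smult hc y that by simp
 qed
qed

text \<open>Membership in \<open>projectives\<close> tests lifting only within one carrier type. A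
  dual basis characterizes the same modules by data that make sense for any carrier type and pass to
  retracts and to duals.\<close>

definition dual_basis :: "('a, 'r) ring_scheme => ('a, 'b) module => nat => (nat => 'b) => (nat => 'b => 'a) => bool" where
 "dual_basis R P n x h \<longleftrightarrow> (\<forall>i<n. x i IN P & h i \<in> mod_hom R P (reg R)) &
   (\<forall>p\<in>carrier P. p = lincomb P n (%i. h i p) x)"

lemma dual_basis_lift:
 assumes d: "dual_basis R P n x h" and L: "lmod R P" "lmod R M" "lmod R N"
  and g: "g \<in> mod_hom R M N" "g ` carrier M = carrier N" and f: "f \<in> mod_hom R P N"
 shows "\<exists>l\<in>mod_hom R P M. cmp P g l = f"
proof -
 have x: "x i IN P" "h i \<in> mod_hom R P (reg R)" if "i < n" for i using d that unfolding dual_basis_def by auto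
 have hc: "h i p IN R" if "i < n" "p IN P" for i p using mod_homD(2)[OF x(2)[OF that(1)] that(2)] by simp
 have "\<forall>i. \<exists>y. i < n --> y IN M & g y = f (x i)"
  using x(1) mod_homD(2)[OF f] unfolding g(2)[symmetric] by (metis imageE)
 then obtain y where y: "\<And>i. i < n ==> y i IN M & g (y i) = f (x i)" by metis
 let ?l = "\<lambda>p\<in>carrier P. lincomb M n (%i. h i p) y"
 have l: "?l \<in> mod_hom R P M" by (rule lincomb_hom[OF L(1,2)]) (use x y in auto)
 have "cmp P g ?l = f"
 proof (rule mod_hom_eqI[OF hom_compose[OF L(1) l g(1)] f])
  fix p assume p: "p IN P"
  have "g (lincomb M n (%i. h i p) y) = lincomb N n (%i. h i p) (%i. g (y i))"
   using hom_lincomb[OF L(2,3) g(1)] hc y p by simp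
  also have "\<dots> = lincomb N n (%i. h i p) (%i. f (x i))" using y by (intro lincomb_cong) auto
  also have "\<dots> = f (lincomb P n (%i. h i p) x)" using hom_lincomb[OF L(1,3) f] hc x p by simp
  also have "\<dots> = f p" using d p unfolding dual_basis_def by metis
  finally show "cmp P g ?l p = f p" using p by (simp add: compose_def)
 qed
 thus ?thesis using l by blast
qed

lemma dual_basis_projective:
 assumes "P \<in> fgm R" "dual_basis R P n x h"
 shows "P \<in> projectives R"
 unfolding projectives_def
proof (intro CollectI conjI ballI impI)
 fix M N g f assume "M \<in> fgm R" "N \<in> fgm R" "g \<in> mod_hom R M N" "f \<in> mod_hom R P N" "g ` carrier M = carrier N"
 thus "\<exists>l\<in>mod_hom R P M. cmp P g l = f"
  by (intro dual_basis_lift[OF assms(2) fgmD(1)[OF assms(1)]] fgmD(1))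
qed fact

definition free_module :: "('a, 'r) ring_scheme => nat => ('a, nat => 'a) module" where
 "free_module R n = \<lparr>carrier = {..<n} \<rightarrow>\<^sub>E carrier R, monoid.mult = (%_ _. \<lambda>i\<in>{..<n}. \<zero>\<^sub>R), monoid.one = (\<lambda>i\<in>{..<n}. \<zero>\<^sub>R),
   ring.zero = (\<lambda>i\<in>{..<n}. \<zero>\<^sub>R), ring.add = (%x y. \<lambda>i\<in>{..<n}. x i \<oplus>\<^sub>R y i),
   smult = (%r x. \<lambda>i\<in>{..<n}. r \<otimes>\<^sub>R x i)\<rparr>"

lemma free_module_simps [simp]:
 "carrier (free_module R n) = {..<n} \<rightarrow>\<^sub>E carrier R" "\<zero>\<^sub>(free_module R n) = (\<lambda>i\<in>{..<n}. \<zero>\<^sub>R)"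
 "x \<oplus>\<^sub>(free_module R n) y = (\<lambda>i\<in>{..<n}. x i \<oplus>\<^sub>R y i)"
 "r \<odot>\<^sub>(free_module R n) x = (\<lambda>i\<in>{..<n}. r \<otimes>\<^sub>R x i)"
 by (simp_all add: free_module_def)

lemma free_left_module: assumes "ring R" shows "lmod R (free_module R n)"
proof -
 interpret ring R by fact
 show ?thesis by (rule left_moduleI[OF assms])
   (auto simp: PiE_iff extensional_def fun_eq_iff l_distr r_distr m_assoc a_assoc intro: a_comm)
qed

definition free_unit :: "('a, 'r) ring_scheme => nat => nat => nat => 'a" where
 "free_unit R n i = (\<lambda>j\<in>{..<n}. if j = i then \<one>\<^sub>R else \<zero>\<^sub>R)"

lemma free_dual_basis:
 assumes "ring R" shows "dual_basis R (free_module R n) n (free_unit R n) (%i. \<lambda>x\<in>carrier (free_module R n). x i)"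
 unfolding dual_basis_def
proof (intro conjI allI impI ballI)
 interpret ring R by fact
 interpret F: left_module R "free_module R n" by (rule free_left_module[OF assms])
 show "free_unit R n i IN (free_module R n)" for i by (auto simp: free_unit_def)
 fix i assume "i < n"
 show "(\<lambda>x\<in>carrier (free_module R n). x i) \<in> mod_hom R (free_module R n) (reg R)"
  by (rule hom_restrict[OF F.left_module_axioms]) (use \<open>i < n\<close> in auto)
next
 interpret ring R by fact
 interpret F: left_module R "free_module R n" by (rule free_left_module[OF assms])
 fix p assume p: "p IN (free_module R n)"
 have "lincomb (free_module R n) m p (free_unit R n) = (\<lambda>i\<in>{..<n}. if i < m then p i else \<zero>\<^sub>R)" if "m \<le> n" for m
  using that
 proof (induction m)
  case (Suc m)
  thus ?case using p by (auto simp: free_unit_def fun_eq_iff less_Suc_eq PiE_iff)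
 qed (auto simp: fun_eq_iff)
 from this[of n] have "lincomb (free_module R n) n p (free_unit R n) = p"
  using p by (auto simp: fun_eq_iff PiE_iff extensional_def)
 thus "p = lincomb (free_module R n) n (%i. (\<lambda>x\<in>carrier (free_module R n). x i) p) (free_unit R n)" using p by simp
qed

lemma free_finitely_generated:
 assumes R: "ring R" shows "finitely_generated R (free_module R n)"
proof (rule finitely_generated_lincombI[OF free_left_module[OF R]])
 note d = free_dual_basis[OF R, of n, unfolded dual_basis_def]
 show "free_unit R n i IN (free_module R n)" if "i < n" for i using d that by blast
 show "\<exists>r. (\<forall>i<n. r i IN R) & p = lincomb (free_module R n) n r (free_unit R n)" if "p IN (free_module R n)" for p
  using d that by (intro exI[of _ "%i. (\<lambda>x\<in>carrier (free_module R n). x i) p"]) auto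
qed

lemma dual_basis_retract:
 assumes d: "dual_basis R P n x h" and L: "lmod R P" "lmod R Q"
  and r: "r \<in> mod_hom R P Q" and s: "s \<in> mod_hom R Q P" and rs: "\<forall>q\<in>carrier Q. r (s q) = q"
 shows "dual_basis R Q n (%i. r (x i)) (%i. cmp Q (h i) s)"
 unfolding dual_basis_def
proof (intro conjI allI impI ballI)
 have x: "x i IN P" "h i \<in> mod_hom R P (reg R)" if "i < n" for i using d that unfolding dual_basis_def by auto
 show "r (x i) IN Q" "cmp Q (h i) s \<in> mod_hom R Q (reg R)" if "i < n" for i
  using x[OF that] mod_homD(2)[OF r] hom_compose[OF L(2) s] by auto
 fix q assume q: "q IN Q"
 hence sq: "s q IN P" using mod_homD(2)[OF s] by simp
 have hc: "h i (s q) IN R" if "i < n" for i using mod_homD(2)[OF x(2)[OF that] sq] by simp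
 have "q = r (lincomb P n (%i. h i (s q)) x)" using rs[rule_format, OF q] d sq unfolding dual_basis_def by metis
 also have "\<dots> = lincomb Q n (%i. h i (s q)) (%i. r (x i))" using hom_lincomb[OF L r] hc x by simp
 finally show "q = lincomb Q n (%i. cmp Q (h i) s q) (%i. r (x i))" using q by (simp add: compose_def)
qed

lemma free_cover:
 fixes R :: "'a ring"
 assumes R: "ring R" and M: "lmod R M" "finitely_generated R M"
 obtains F n e h p where "F \<in> fgm R" "dual_basis R F n e h" "p \<in> mod_hom R F M" "p ` carrier F = carrier M"
proof -
 obtain n x where x: "\<And>i. i < n ==> x i IN M"
  and gen: "\<And>m. m IN M ==> \<exists>r \<in> {..<n} \<rightarrow>\<^sub>E carrier R. m = lincomb M n r x"
  using finitely_generated_lincomb[OF M] by blast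
 let ?F = "free_module R n"
 note LF = free_left_module[OF R, of n] and db = free_dual_basis[OF R, of n]
 obtain F a b where F: "F \<in> fgm R" "a \<in> mod_hom R ?F F" "b \<in> mod_hom R F ?F"
  "\<forall>x\<in>carrier ?F. b (a x) = x" "\<forall>y\<in>carrier F. a (b y) = y"
  by (rule fg_copy[OF LF free_finitely_generated[OF R]])
 note LF' = fgmD(1)[OF F(1)]
 let ?q = "\<lambda>r\<in>carrier ?F. lincomb M n (%i. (\<lambda>x\<in>carrier ?F. x i) r) x"
 have q: "?q \<in> mod_hom R ?F M" using db x unfolding dual_basis_def by (intro lincomb_hom[OF LF M(1)]) blast+
 have "cmp F ?q b ` carrier F = carrier M"
 proof
  show "cmp F ?q b ` carrier F \<subseteq> carrier M" using mod_homD(2)[OF hom_compose[OF LF' F(3) q]] by blast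
  show "carrier M \<subseteq> cmp F ?q b ` carrier F"
  proof
   fix m assume "m IN M"
   then obtain r where r: "r \<in> {..<n} \<rightarrow>\<^sub>E carrier R" "m = lincomb M n r x" using gen by blast
   have "a r IN F" using mod_homD(2)[OF F(2)] r by simp
   moreover have "cmp F ?q b (a r) = m" using F(4)[rule_format, of r] r calculation by (simp add: compose_def)
   ultimately show "m \<in> cmp F ?q b ` carrier F" by (intro image_eqI[of _ _ "a r"]) simp_all
  qed
 qed
 thus ?thesis
  using that[OF F(1) dual_basis_retract[where r = a and s = b, OF db LF LF' F(2,3,5)] hom_compose[OF LF' F(3) q]] by blast
qed

lemma projective_dual_basis:
 assumes R: "ring R" and P: "P \<in> projectives R"
 obtains n x h where "dual_basis R P n x h"
proof -
 have fg: "P \<in> fgm R" using P unfolding projectives_def by blast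
 note LP = fgmD[OF fg]
 obtain F n e h p where F: "F \<in> fgm R" "dual_basis R F n e h" "p \<in> mod_hom R F P" "p ` carrier F = carrier P"
  using free_cover[OF R LP] by metis
 obtain s where s: "s \<in> mod_hom R P F" "cmp P p s = (\<lambda>x\<in>carrier P. x)"
  using P F(1,3,4) fg mod_hom_idn[OF LP(1)] unfolding projectives_def by blast
 have "\<forall>q\<in>carrier P. p (s q) = q"
 proof
  fix q assume "q IN P"
  thus "p (s q) = q" using fun_cong[OF s(2), of q] by (simp add: compose_def)
 qed
 thus ?thesis using that[OF dual_basis_retract[where r = p and s = s, OF F(2) fgmD(1)[OF F(1)] LP(1) F(3) s(1)]] by blast
qed

text \<open>An element of the product of all abelian groups with this carrier type. Outside these
  the value is fixed as \<open>{}\<close>, so equality can be checked on abelian groups. The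
  additive endomorphisms of this product form the ring \<open>'a marr\<close>, which holds the
  homomorphisms between all modules at once, as \<open>exact_category\<close> requires.\<close>

typedef 'a melt = "{s :: 'a fg_module => 'a fg_carrier.
  \<forall>M. (abelian_group M --> s M IN M) & (\<not> abelian_group M --> s M = {})}"
 morphisms mval Abs_melt by (rule exI[of _ "%M. if abelian_group M then \<zero>\<^sub>M else {}"])
   (auto simp: abelian_group_def abelian_monoid.zero_closed)

lemma mval_carrier: "abelian_group M ==> mval s M IN M"
 and mval_empty: "\<not> abelian_group M ==> mval s M = {}" using mval[of s] by auto

lemma melt_eqI: "(\<And>M. abelian_group M ==> mval s M = mval t M) ==> s = t"
 by (metis ext mval_empty mval_inject)

definition mk_melt :: "('a fg_module => 'a fg_carrier) => 'a melt" where
 "mk_melt s = Abs_melt (%M. if abelian_group M then s M else {})"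

lemma mval_mk_melt:
 "(\<And>M. abelian_group M ==> s M IN M) ==> abelian_group M ==> mval (mk_melt s) M = s M"
 unfolding mk_melt_def by (subst Abs_melt_inverse) auto

instantiation melt :: (type) ab_group_add
begin

definition "0 = mk_melt (%M. \<zero>\<^sub>M)"
definition "s + t = mk_melt (%M. mval s M \<oplus>\<^sub>M mval t M)"
definition "- s = mk_melt (%M. \<ominus>\<^sub>M mval s M)"
definition "s - t = s + - (t :: 'a melt)"

lemma mval_zero: "abelian_group M ==> mval 0 M = \<zero>\<^sub>M"
 unfolding zero_melt_def by (rule mval_mk_melt) (auto simp: abelian_group_def abelian_monoid.zero_closed)

lemma mval_add: "abelian_group M ==> mval (s + t) M = mval s M \<oplus>\<^sub>M mval t M"
 unfolding plus_melt_def
 by (rule mval_mk_melt) (auto simp: mval_carrier abelian_group_def intro!: abelian_monoid.a_closed)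

lemma mval_uminus: "abelian_group M ==> mval (- s) M = \<ominus>\<^sub>M mval s M"
 unfolding uminus_melt_def by (rule mval_mk_melt) (auto simp: mval_carrier abelian_group.a_inv_closed)

instance
proof
 fix a b c :: "'a melt"
 show "a + b + c = a + (b + c)"
  by (rule melt_eqI) (auto simp: mval_add mval_carrier abelian_monoid.a_assoc abelian_group_def)
 show "a + b = b + a"
  by (rule melt_eqI) (simp only: mval_add abelian_monoid.a_comm[OF abelian_group.axioms(1) mval_carrier mval_carrier, of _ a b])
 show "0 + a = a"
  by (rule melt_eqI) (auto simp: mval_add mval_zero mval_carrier abelian_group_def abelian_monoid.l_zero)
 show "- a + a = 0" by (rule melt_eqI) (auto simp: mval_add mval_zero mval_uminus mval_carrier abelian_group.l_neg)
 show "a - b = a + - b" by (rule minus_melt_def)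
qed

end

typedef 'a marr = "{h :: 'a melt => 'a melt. \<forall>x y. h (x + y) = h x + h y}"
 morphisms app Abs_marr by (rule exI[of _ "%_. 0"]) simp

setup_lifting type_definition_marr

instantiation marr :: (type) ring
begin

lift_definition zero_marr :: "'a marr" is "%_. 0" by simp
lift_definition plus_marr :: "'a marr => 'a marr => 'a marr" is "%f g x. f x + g x" by (simp add: algebra_simps)
lift_definition uminus_marr :: "'a marr => 'a marr" is "%f x. - f x" by simp
lift_definition minus_marr :: "'a marr => 'a marr => 'a marr" is "%f g x. f x - g x" by (simp add: algebra_simps)
lift_definition times_marr :: "'a marr => 'a marr => 'a marr" is "%f g x. f (g x)" by simp

instance by standard (transfer; simp add: fun_eq_iff algebra_simps)+

end

definition mat :: "'a fg_module => 'a fg_carrier => 'a melt" where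
 "mat X x = mk_melt (%M. if M = X then x else \<zero>\<^sub>M)"

lemma mval_mat: "abelian_group X ==> x IN X ==> abelian_group M ==> mval (mat X x) M = (if M = X then x else \<zero>\<^sub>M)"
 unfolding mat_def by (rule mval_mk_melt) (auto simp: abelian_group_def abelian_monoid.zero_closed)

text \<open>The matrix with entry \<open>f\<close> at position \<open>(X, Y)\<close> and zero
  elsewhere. Multiplication of such matrices is composition when source and target match, and the
  identity of \<open>X\<close> becomes an idempotent.\<close>

definition arr :: "'a fg_module => 'a fg_module => 'a fg_map => 'a marr" where
 "arr X Y f = Abs_marr (%s. mat Y (f (mval s X)))"

lemma left_module_abelian: "lmod R M ==> abelian_group M"
 unfolding left_module_def by simp

context
 fixes R :: "('a, 'r) ring_scheme" and X Y :: "'a fg_module" and f :: "'a fg_map"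
 assumes X: "lmod R X" and Y: "lmod R Y" and f: "f \<in> mod_hom R X Y"
begin

lemma app_arr: "app (arr X Y f) s = mat Y (f (mval s X))"
proof -
 interpret X: left_module R X by (rule X)
 interpret Y: left_module R Y by (rule Y)
 note AX = left_module_abelian[OF X] and AY = left_module_abelian[OF Y]
 have c: "f (mval s X) IN Y" for s using mod_homD(2)[OF f] mval_carrier[OF AX] by blast
 have "mat Y (f (mval (s + t) X)) = mat Y (f (mval s X)) + mat Y (f (mval t X))" for s t
 proof (rule melt_eqI)
  fix M :: "'a fg_module" assume M: "abelian_group M"
  have e: "f (mval (s + t) X) = f (mval s X) \<oplus>\<^sub>Y f (mval t X)"
   using mod_homD(3)[OF f] mval_carrier[OF AX] mval_add[OF AX] by simp
  have z: "\<zero>\<^sub>M \<oplus>\<^sub>M \<zero>\<^sub>M = \<zero>\<^sub>M" using M by (simp add: abelian_group_def abelian_monoid.l_zero abelian_monoid.zero_closed)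
  show "mval (mat Y (f (mval (s + t) X))) M = mval (mat Y (f (mval s X)) + mat Y (f (mval t X))) M"
   using c e z M by (simp add: mval_add mval_mat[OF AY])
 qed
 thus ?thesis unfolding arr_def by (subst Abs_marr_inverse) auto
qed

lemma arr_apply: "x IN X ==> mval (app (arr X Y f) (mat X x)) Y = f x"
 using mod_homD(2)[OF f, of x] by (simp add: app_arr mval_mat left_module_abelian[OF X] left_module_abelian[OF Y])

end

lemma app_eqI: "(\<And>s. app h s = app k s) ==> h = k"
 by (metis app_inject ext)

lemma arr_inj:
 assumes "lmod R X" "lmod R Y" "f \<in> mod_hom R X Y" "g \<in> mod_hom R X Y" "arr X Y f = arr X Y g"
 shows "f = g"
 using arr_apply[OF assms(1,2,3)] arr_apply[OF assms(1,2,4)] assms(5) by (intro mod_hom_eqI[OF assms(3,4)]) simp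

lemma arr_mult:
 assumes "lmod R X" "lmod R Y" "lmod R Z" "f \<in> mod_hom R X Y" "g \<in> mod_hom R Y Z"
 shows "arr Y Z g * arr X Y f = arr X Z (cmp X g f)"
proof (rule app_eqI)
 fix s
 note A = left_module_abelian[OF assms(1)] left_module_abelian[OF assms(2)]
 have "f (mval s X) IN Y" using mod_homD(2)[OF assms(4)] mval_carrier[OF A(1)] by blast
 thus "app (arr Y Z g * arr X Y f) s = app (arr X Z (cmp X g f)) s"
  using app_arr[OF assms(1,2,4)] app_arr[OF assms(2,3,5)] app_arr[OF assms(1,3) hom_compose[OF assms(1,4,5)]]
   mval_carrier[OF A(1)] by (simp add: times_marr.rep_eq mval_mat A compose_def)
qed

lemma arr_add:
 assumes "lmod R X" "lmod R Y" "f \<in> mod_hom R X Y" "g \<in> mod_hom R X Y"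
 shows "arr X Y f + arr X Y g = arr X Y (\<lambda>x\<in>carrier X. f x \<oplus>\<^sub>Y g x)"
proof (rule app_eqI, rule melt_eqI)
 fix s :: "'a melt" and M :: "'a fg_module" assume M: "abelian_group M"
 note A = left_module_abelian[OF assms(1)] left_module_abelian[OF assms(2)]
 have x: "mval s X IN X" using mval_carrier[OF A(1)] .
 have z: "\<zero>\<^sub>M \<oplus>\<^sub>M \<zero>\<^sub>M = \<zero>\<^sub>M" using M by (simp add: abelian_group_def abelian_monoid.l_zero abelian_monoid.zero_closed)
 have h: "f (mval s X) IN Y" "g (mval s X) IN Y" using mod_homD(2)[OF assms(3) x] mod_homD(2)[OF assms(4) x] .
 hence "f (mval s X) \<oplus>\<^sub>Y g (mval s X) IN Y" using A(2) by (simp add: abelian_group_def abelian_monoid.a_closed)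
 thus "mval (app (arr X Y f + arr X Y g) s) M = mval (app (arr X Y (\<lambda>x\<in>carrier X. f x \<oplus>\<^sub>Y g x)) s) M"
  using app_arr[OF assms(1,2,3)] app_arr[OF assms(1,2,4)] app_arr[OF assms(1,2) mod_hom_add[OF assms]] x h z M
  by (simp add: plus_marr.rep_eq mval_add mval_mat A)
qed

lemma arr_uminus:
 assumes "lmod R X" "lmod R Y" "f \<in> mod_hom R X Y"
 shows "- arr X Y f = arr X Y (\<lambda>x\<in>carrier X. \<ominus>\<^sub>Y f x)"
proof (rule app_eqI, rule melt_eqI)
 fix s :: "'a melt" and M :: "'a fg_module" assume M: "abelian_group M"
 note A = left_module_abelian[OF assms(1)] left_module_abelian[OF assms(2)]
 have x: "mval s X IN X" using mval_carrier[OF A(1)] .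
 have z: "\<ominus>\<^sub>M \<zero>\<^sub>M = \<zero>\<^sub>M" 
  using M by (intro abelian_group.minus_equality[OF M]) (simp_all add: abelian_group_def abelian_monoid.l_zero abelian_monoid.zero_closed)
 have h: "f (mval s X) IN Y" using mod_homD(2)[OF assms(3) x] .
 hence "\<ominus>\<^sub>Y f (mval s X) IN Y" using A(2) by (simp add: abelian_group.a_inv_closed)
 thus "mval (app (- arr X Y f) s) M = mval (app (arr X Y (\<lambda>x\<in>carrier X. \<ominus>\<^sub>Y f x)) s) M"
  using app_arr[OF assms(1,2,3)] app_arr[OF assms(1,2) mod_hom_minus[OF assms]] x h z M
  by (simp add: uminus_marr.rep_eq mval_uminus mval_mat A)
qed

lemma arr_zero:
 assumes "lmod R X" "lmod R Y"
 shows "arr X Y (zero_map X Y) = 0"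
proof (rule app_eqI, rule melt_eqI)
 fix s :: "'a melt" and M :: "'a fg_module" assume M: "abelian_group M"
 note A = left_module_abelian[OF assms(1)] left_module_abelian[OF assms(2)]
 have "\<zero>\<^sub>Y IN Y" using A(2) by (simp add: abelian_group_def abelian_monoid.zero_closed)
 thus "mval (app (arr X Y (zero_map X Y)) s) M = mval (app 0 s) M"
  using app_arr[OF assms mod_hom_zero_map[OF assms]] mval_carrier[OF A(1)] M
  by (simp add: zero_map_def zero_marr.rep_eq mval_zero mval_mat A)
qed

section \<open>Arrows and short exact sequences of modules\<close>

definition Homs :: "'a ring => 'a fg_module => 'a fg_module => 'a marr set" where
 "Homs R X Y = {arr X Y f | f. f \<in> mod_hom R X Y & X \<in> fgm R & Y \<in> fgm R}"

definition idm :: "'a fg_module => 'a marr" where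
 "idm X = arr X X (\<lambda>x\<in>carrier X. x)"

definition exact_seq :: "'a ring => 'a fg_module => 'a fg_module => 'a fg_module => 'a marr => 'a marr => bool" where
 "exact_seq R A B C i p \<longleftrightarrow> A \<in> fgm R & B \<in> fgm R & C \<in> fgm R &
   (\<exists>f g. i = arr A B f & p = arr B C g & short_exact R A B C f g)"

lemma HomsI: "X \<in> fgm R ==> Y \<in> fgm R ==> f \<in> mod_hom R X Y ==> arr X Y f \<in> Homs R X Y"
 unfolding Homs_def by blast

lemma HomsE:
 assumes "h \<in> Homs R X Y"
 obtains f where "h = arr X Y f" "f \<in> mod_hom R X Y" "X \<in> fgm R" "Y \<in> fgm R"
  "lmod R X" "lmod R Y"
proof -
 from assms obtain f where f: "h = arr X Y f" "f \<in> mod_hom R X Y" "X \<in> fgm R" "Y \<in> fgm R"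
  unfolding Homs_def by blast
 show ?thesis by (rule that[OF f fgmD(1)[OF f(3)] fgmD(1)[OF f(4)]])
qed

lemma exact_seqE:
 assumes "exact_seq R A B C i p"
 obtains f g where "i = arr A B f" "p = arr B C g" "short_exact R A B C f g" "f \<in> mod_hom R A B" "g \<in> mod_hom R B C"
  "A \<in> fgm R" "B \<in> fgm R" "C \<in> fgm R" "lmod R A" "lmod R B" "lmod R C"
proof -
 from assms obtain f g where f: "i = arr A B f" "p = arr B C g" "short_exact R A B C f g"
  and O: "A \<in> fgm R" "B \<in> fgm R" "C \<in> fgm R" unfolding exact_seq_def by blast
 have "f \<in> mod_hom R A B" "g \<in> mod_hom R B C" using f(3) unfolding short_exact_def by auto
 thus ?thesis by (rule that[OF f _ _ O fgmD(1)[OF O(1)] fgmD(1)[OF O(2)] fgmD(1)[OF O(3)]])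
qed

lemma exact_seqI:
 "A \<in> fgm R ==> B \<in> fgm R ==> C \<in> fgm R ==> short_exact R A B C f g ==>
  exact_seq R A B C (arr A B f) (arr B C g)" unfolding exact_seq_def by blast

context
 fixes R :: "('a, 'r) ring_scheme" and X Y Z :: "'a fg_module" and f g :: "'a fg_map"
 assumes X: "lmod R X" and Y: "lmod R Y" and Z: "lmod R Z"
  and f: "f \<in> mod_hom R X Y" and g: "g \<in> mod_hom R Y Z"
begin

lemma arr_mult_eq_iff:
 assumes "h \<in> mod_hom R X Z"
 shows "arr Y Z g * arr X Y f = arr X Z h \<longleftrightarrow> (\<forall>x\<in>carrier X. g (f x) = h x)"
proof -
 have c: "cmp X g f \<in> mod_hom R X Z" by (rule hom_compose[OF X f g])
 have "arr X Z (cmp X g f) = arr X Z h \<longleftrightarrow> cmp X g f = h" using arr_inj[OF X Z c assms] by auto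
 also have "\<dots> \<longleftrightarrow> (\<forall>x\<in>carrier X. g (f x) = h x)"
  using mod_hom_eqI[OF c assms] by (auto simp: compose_def)
 finally show ?thesis using arr_mult[OF X Y Z f g] by simp
qed

end

section \<open>The exact category of finitely generated modules\<close>

text \<open>Reads the matrix entry back; on \<open>Homs R X Y\<close> it is inverse to
  \<open>arr X Y\<close>, so equations of arrows can be checked on elements.\<close>

definition ev :: "'a fg_module => 'a fg_module => 'a marr => 'a fg_carrier => 'a fg_carrier" where
 "ev X Y h = (\<lambda>x\<in>carrier X. mval (app h (mat X x)) Y)"

lemma ev_arr:
 assumes "X \<in> fgm R" "Y \<in> fgm R" "f \<in> mod_hom R X Y" shows "ev X Y (arr X Y f) = f"
 using arr_apply[OF fgmD(1)[OF assms(1)] fgmD(1)[OF assms(2)] assms(3)] mod_homD(1)[OF assms(3)]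
 unfolding ev_def by (intro extensionalityI[of _ "carrier X"]) auto

lemma ev_hom: assumes "h \<in> Homs R X Y" shows "ev X Y h \<in> mod_hom R X Y" "arr X Y (ev X Y h) = h"
 using assms ev_arr by (metis HomsE)+

lemma HomsD: assumes "h \<in> Homs R X Y"
 shows "X \<in> fgm R" "Y \<in> fgm R" "lmod R X" "lmod R Y"
 using assms by (auto elim: HomsE)

lemma ev_eqI:
 assumes "h \<in> Homs R X Y" "k \<in> Homs R X Y" "\<And>x. x IN X ==> ev X Y h x = ev X Y k x"
 shows "h = k"
 using mod_hom_eqI[OF ev_hom(1)[OF assms(1)] ev_hom(1)[OF assms(2)] assms(3)] ev_hom(2) assms(1,2) by metis

lemma Homs_comp: assumes "h \<in> Homs R X Y" "k \<in> Homs R Y Z" shows "k * h \<in> Homs R X Z"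
 using arr_mult[OF HomsD(3,4)[OF assms(1)] HomsD(4)[OF assms(2)] ev_hom(1)[OF assms(1)] ev_hom(1)[OF assms(2)]]
  HomsI[OF HomsD(1)[OF assms(1)] HomsD(2)[OF assms(2)] hom_compose[OF HomsD(3)[OF assms(1)] ev_hom(1)[OF assms(1)] ev_hom(1)[OF assms(2)]]]
  ev_hom(2)[OF assms(1)] ev_hom(2)[OF assms(2)] by simp

lemma ev_comp:
 assumes "h \<in> Homs R X Y" "k \<in> Homs R Y Z" "x IN X" shows "ev X Z (k * h) x = ev Y Z k (ev X Y h x)"
 using arr_mult_eq_iff[OF HomsD(3,4)[OF assms(1)] HomsD(4)[OF assms(2)] ev_hom(1)[OF assms(1)] ev_hom(1)[OF assms(2)]
  ev_hom(1)[OF Homs_comp[OF assms(1,2)]]] ev_hom(2)[OF assms(1)] ev_hom(2)[OF assms(2)] ev_hom(2)[OF Homs_comp[OF assms(1,2)]] assms(3)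
 by simp

lemma
 assumes "h \<in> Homs R X Y" "k \<in> Homs R X Y"
 shows Homs_add: "h + k \<in> Homs R X Y" and ev_add: "x IN X ==> ev X Y (h + k) x = ev X Y h x \<oplus>\<^sub>Y ev X Y k x"
proof -
 note d = HomsD[OF assms(1)] and m = mod_hom_add[OF HomsD(3,4)[OF assms(1)] ev_hom(1)[OF assms(1)] ev_hom(1)[OF assms(2)]]
 have e: "h + k = arr X Y (\<lambda>x\<in>carrier X. ev X Y h x \<oplus>\<^sub>Y ev X Y k x)"
  using arr_add[OF d(3,4) ev_hom(1)[OF assms(1)] ev_hom(1)[OF assms(2)]] ev_hom(2) assms by metis
 thus "h + k \<in> Homs R X Y" using HomsI[OF d(1,2) m] by simp
 show "x IN X ==> ev X Y (h + k) x = ev X Y h x \<oplus>\<^sub>Y ev X Y k x" using ev_arr[OF d(1,2) m] e by simp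
qed

lemma Homs_uminus: assumes "h \<in> Homs R X Y" shows "- h \<in> Homs R X Y"
proof -
 note d = HomsD[OF assms(1)] and m = mod_hom_minus[OF HomsD(3,4)[OF assms(1)] ev_hom(1)[OF assms(1)]]
 have "- h = arr X Y (\<lambda>x\<in>carrier X. \<ominus>\<^sub>Y ev X Y h x)"
  using arr_uminus[OF d(3,4) ev_hom(1)[OF assms(1)]] ev_hom(2) assms by metis
 thus "- h \<in> Homs R X Y" using HomsI[OF d(1,2) m] by simp
qed

lemma
 assumes "X \<in> fgm R" "Y \<in> fgm R"
 shows Homs_zero: "0 \<in> Homs R X Y" and ev_zero: "x IN X ==> ev X Y 0 x = \<zero>\<^sub>Y"
proof -
 note m = mod_hom_zero_map[OF fgmD(1)[OF assms(1)] fgmD(1)[OF assms(2)]]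
 have e: "0 = arr X Y (zero_map X Y)" using arr_zero[OF fgmD(1)[OF assms(1)] fgmD(1)[OF assms(2)]] by simp
 show "0 \<in> Homs R X Y" unfolding e by (rule HomsI[OF assms m])
 show "x IN X ==> ev X Y 0 x = \<zero>\<^sub>Y" unfolding e ev_arr[OF assms m] by (simp add: zero_map_def)
qed

lemma
 assumes "X \<in> fgm R"
 shows Homs_idm: "idm X \<in> Homs R X X" and ev_idm: "x IN X ==> ev X X (idm X) x = x"
 unfolding idm_def using HomsI[OF assms assms mod_hom_idn[OF fgmD(1)[OF assms]]]
  ev_arr[OF assms assms mod_hom_idn[OF fgmD(1)[OF assms]]] by auto

lemma ev_closed: "h \<in> Homs R X Y ==> x IN X ==> ev X Y h x IN Y"
 using mod_homD(2)[OF ev_hom(1)] .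

lemma ev_at_zero: "h \<in> Homs R X Y ==> ev X Y h \<zero>\<^sub>X = \<zero>\<^sub>Y"
 using mod_hom_zero[OF HomsD(3,4) ev_hom(1)] by blast

lemma ev_at_add: "h \<in> Homs R X Y ==> x IN X ==> y IN X ==> ev X Y h (x \<oplus>\<^sub>X y) = ev X Y h x \<oplus>\<^sub>Y ev X Y h y"
 using mod_homD(3)[OF ev_hom(1)] by blast

lemma ev_at_diff: "h \<in> Homs R X Y ==> x IN X ==> y IN X ==> ev X Y h (x \<ominus>\<^sub>X y) = ev X Y h x \<ominus>\<^sub>Y ev X Y h y"
 using mod_hom_diff[OF HomsD(3,4) ev_hom(1)] by blast

lemma zero_in: "X \<in> fgm R ==> \<zero>\<^sub>X IN X"
 by (rule abelian_monoid.zero_closed[OF abelian_group.axioms(1)[OF left_module_abelian[OF fgmD(1)]]])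

lemma exact_seqD:
 assumes "exact_seq R A B C i p"
 shows "i \<in> Homs R A B" "p \<in> Homs R B C" "\<forall>x\<in>carrier A. ev B C p (ev A B i x) = \<zero>\<^sub>C"
  "\<forall>y\<in>carrier B. ev B C p y = \<zero>\<^sub>C --> (\<exists>x\<in>carrier A. ev A B i x = y)"
  "\<forall>z\<in>carrier C. \<exists>y\<in>carrier B. ev B C p y = z" "\<forall>x\<in>carrier A. ev A B i x = \<zero>\<^sub>B --> x = \<zero>\<^sub>A"
  "A \<in> fgm R" "B \<in> fgm R" "C \<in> fgm R" "lmod R A" "lmod R B" "lmod R C"
  "short_exact R A B C (ev A B i) (ev B C p)"
proof -
 obtain f g where f: "i = arr A B f" "p = arr B C g" "short_exact R A B C f g" "f \<in> mod_hom R A B" "g \<in> mod_hom R B C"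
  and O: "A \<in> fgm R" "B \<in> fgm R" "C \<in> fgm R" "lmod R A" "lmod R B" "lmod R C"
  using assms by (rule exact_seqE)
 have e: "ev A B i = f" "ev B C p = g" using f ev_arr O by auto
 note d = short_exactD[OF f(3) O(4,5)]
 show "i \<in> Homs R A B" "p \<in> Homs R B C" using f O HomsI by auto
 show "\<forall>x\<in>carrier A. ev B C p (ev A B i x) = \<zero>\<^sub>C" unfolding e using d(3) by blast
 show "\<forall>y\<in>carrier B. ev B C p y = \<zero>\<^sub>C --> (\<exists>x\<in>carrier A. ev A B i x = y)" unfolding e using d(4) by blast
 show "\<forall>z\<in>carrier C. \<exists>y\<in>carrier B. ev B C p y = z" unfolding e using d(5) by blast
 show "\<forall>x\<in>carrier A. ev A B i x = \<zero>\<^sub>B --> x = \<zero>\<^sub>A" unfolding e using d(7) by blast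
 show "short_exact R A B C (ev A B i) (ev B C p)" unfolding e by fact
qed (use assms in "auto elim: exact_seqE")

lemma exact_seqI_ev:
 assumes "i \<in> Homs R A B" "p \<in> Homs R B C" "\<And>x. x IN A ==> ev B C p (ev A B i x) = \<zero>\<^sub>C"
  "\<And>y. y IN B ==> ev B C p y = \<zero>\<^sub>C ==> \<exists>x\<in>carrier A. ev A B i x = y"
  "\<And>z. z IN C ==> \<exists>y\<in>carrier B. ev B C p y = z"
  "\<And>x. x IN A ==> ev A B i x = \<zero>\<^sub>B ==> x = \<zero>\<^sub>A"
 shows "exact_seq R A B C i p"
 using exact_seqI[OF HomsD(1)[OF assms(1)] HomsD(1,2)[OF assms(2)]
   short_exactI[OF HomsD(3)[OF assms(1)] HomsD(3)[OF assms(2)] ev_hom(1)[OF assms(1)] ev_hom(1)[OF assms(2)] assms(3-6)]]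
  ev_hom(2)[OF assms(1)] ev_hom(2)[OF assms(2)] by (simp only:)

lemma Homs_factor:
 assumes p: "p \<in> Homs R M N" "\<forall>y\<in>carrier N. \<exists>x\<in>carrier M. ev M N p x = y" and f: "f \<in> Homs R M L"
  and k: "\<And>x. x IN M ==> ev M N p x = \<zero>\<^sub>N ==> ev M L f x = \<zero>\<^sub>L"
 shows "\<exists>g\<in>Homs R N L. g * p = f"
proof -
 note dp = HomsD[OF p(1)] and df = HomsD[OF f]
 have im: "ev M N p ` carrier M = carrier N"
 proof
  show "ev M N p ` carrier M \<subseteq> carrier N" using ev_closed[OF p(1)] by auto
  show "carrier N \<subseteq> ev M N p ` carrier M" using p(2) by (metis image_eqI subsetI)
 qed
 have "\<exists>g\<in>mod_hom R N L. \<forall>x\<in>carrier M. g (ev M N p x) = ev M L f x"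
  by (rule factor_surjective[OF dp(3,4) df(4) ev_hom(1)[OF p(1)] im ev_hom(1)[OF f]]) (rule k)
 then obtain g where g: "g \<in> mod_hom R N L" "\<forall>x\<in>carrier M. g (ev M N p x) = ev M L f x" by blast
 have G: "arr N L g \<in> Homs R N L" by (rule HomsI[OF dp(2) df(2) g(1)])
 have "arr N L g * p = f"
  by (rule ev_eqI[OF Homs_comp[OF p(1) G] f]) (simp add: ev_comp[OF p(1) G] ev_arr[OF dp(2) df(2) g(1)] g(2))
 thus ?thesis using G by blast
qed

lemma Homs_lift:
 assumes i: "i \<in> Homs R A B" "\<forall>x\<in>carrier A. ev A B i x = \<zero>\<^sub>B --> x = \<zero>\<^sub>A" and f: "f \<in> Homs R D B"
  and k: "\<And>x. x IN D ==> \<exists>a\<in>carrier A. ev A B i a = ev D B f x"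
 shows "\<exists>g\<in>Homs R D A. i * g = f"
proof -
 note di = HomsD[OF i(1)] and df = HomsD[OF f]
 interpret A: left_module R A by (rule di(3))
 interpret B: left_module R B by (rule di(4))
 have "inj_on (ev A B i) (carrier A)"
 proof (rule inj_onI)
  fix x y assume a: "x IN A" "y IN A" "ev A B i x = ev A B i y"
  hence "ev A B i (x \<ominus>\<^sub>A y) = \<zero>\<^sub>B"
   using ev_at_diff[OF i(1)] B.a_minus_eq_zero ev_closed[OF i(1)] by simp
  hence "x \<ominus>\<^sub>A y = \<zero>\<^sub>A" using i(2) a by simp
  thus "x = y" using a A.a_minus_eq_zero by blast
 qed
 moreover have "ev D B f ` carrier D \<subseteq> ev A B i ` carrier A" using k by force
 ultimately obtain g where g: "g \<in> mod_hom R D A" "\<forall>x\<in>carrier D. ev A B i (g x) = ev D B f x"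
  using lift_injective[OF di(3,4) df(3) ev_hom(1)[OF i(1)] _ ev_hom(1)[OF f]] by blast
 have G: "arr D A g \<in> Homs R D A" by (rule HomsI[OF df(1) di(1) g(1)])
 have "i * arr D A g = f"
  by (rule ev_eqI[OF Homs_comp[OF G i(1)] f]) (simp add: ev_comp[OF G i(1)] ev_arr[OF df(1) di(1) g(1)] g(2))
 thus ?thesis using G by blast
qed

lemma idm_left: assumes "h \<in> Homs R X Y" shows "idm Y * h = h"
 using ev_eqI[OF Homs_comp[OF assms Homs_idm[OF HomsD(2)[OF assms]]] assms]
  ev_comp[OF assms Homs_idm[OF HomsD(2)[OF assms]]] ev_idm[OF HomsD(2)[OF assms]] ev_closed[OF assms] by simp

lemma idm_right: assumes "h \<in> Homs R X Y" shows "h * idm X = h"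
 using ev_eqI[OF Homs_comp[OF Homs_idm[OF HomsD(1)[OF assms]] assms] assms]
  ev_comp[OF Homs_idm[OF HomsD(1)[OF assms]] assms] ev_idm[OF HomsD(1)[OF assms]] by simp

lemma exact_seq_zero: assumes "exact_seq R A B C i p" shows "p * i = 0"
proof -
 note d = exact_seqD[OF assms]
 show ?thesis
  by (rule ev_eqI[OF Homs_comp[OF d(1,2)] Homs_zero[OF d(7,9)]]) (simp add: ev_comp[OF d(1,2)] d(3) ev_zero[OF d(7,9)])
qed

lemma exact_seq_mono:
 assumes "exact_seq R A B C i p" "g \<in> Homs R D A" "i * g = 0" shows "g = 0"
proof -
 note d = exact_seqD[OF assms(1)]
 show ?thesis
 proof (rule ev_eqI[OF assms(2) Homs_zero[OF HomsD(1,2)[OF assms(2)]]])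
  fix x assume x: "x IN D"
  have "ev A B i (ev D A g x) = \<zero>\<^sub>B"
   using ev_comp[OF assms(2) d(1) x] assms(3) ev_zero[OF HomsD(1)[OF assms(2)] d(8) x] by simp
  thus "ev D A g x = ev D A 0 x" using d(6) ev_closed[OF assms(2) x] ev_zero[OF HomsD(1,2)[OF assms(2)] x] by simp
 qed
qed

lemma exact_seq_epi:
 assumes "exact_seq R A B C i p" "g \<in> Homs R C D" "g * p = 0" shows "g = 0"
proof -
 note d = exact_seqD[OF assms(1)]
 show ?thesis
 proof (rule ev_eqI[OF assms(2) Homs_zero[OF HomsD(1,2)[OF assms(2)]]])
  fix z assume z: "z IN C"
  then obtain y where y: "y IN B" "ev B C p y = z" using d(5) by blast
  show "ev C D g z = ev C D 0 z"
   using ev_comp[OF d(2) assms(2) y(1)] y(2) assms(3) ev_zero[OF d(8) HomsD(2)[OF assms(2)] y(1)]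
    ev_zero[OF HomsD(1,2)[OF assms(2)] z] by simp
 qed
qed

lemma exact_seq_iso:
 assumes s: "exact_seq R A B C i p"
  and a: "a \<in> Homs R A' A" "a' \<in> Homs R A A'" "a * a' = idm A" "a' * a = idm A'"
  and b: "b \<in> Homs R B B'" "b' \<in> Homs R B' B" "b' * b = idm B" "b * b' = idm B'"
  and c: "c \<in> Homs R C C'" "c' \<in> Homs R C' C" "c' * c = idm C" "c * c' = idm C'"
 shows "exact_seq R A' B' C' (b * i * a) (c * p * b')"
proof -
 note d = exact_seqD[OF s]
 have inv: "ev Y X k (ev X Y h x) = x" if "h \<in> Homs R X Y" "k \<in> Homs R Y X" "k * h = idm X" "x IN X" for X Y h k x
  using ev_comp[OF that(1,2,4)] that(3) ev_idm[OF HomsD(1)[OF that(1)] that(4)] by simp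
 have bi: "b * i \<in> Homs R A B'" and cp: "c * p \<in> Homs R B C'" using Homs_comp d b c by blast+
 have I: "ev A' B' (b * i * a) x = ev B B' b (ev A B i (ev A' A a x))" if "x IN A'" for x
  using ev_comp[OF a(1) bi that] ev_comp[OF d(1) b(1) ev_closed[OF a(1) that]] by simp
 have P: "ev B' C' (c * p * b') y = ev C C' c (ev B C p (ev B' B b' y))" if "y IN B'" for y
  using ev_comp[OF b(2) cp that] ev_comp[OF d(2) c(1) ev_closed[OF b(2) that]] by simp
 show ?thesis
 proof (rule exact_seqI_ev[OF Homs_comp[OF a(1) bi] Homs_comp[OF b(2) cp]])
  fix x assume x: "x IN A'"
  note ax = ev_closed[OF a(1) x]
  note iax = ev_closed[OF d(1) ax]
  show "ev B' C' (c * p * b') (ev A' B' (b * i * a) x) = \<zero>\<^sub>C'"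
   using I[OF x] P[OF ev_closed[OF b(1) iax]] inv[OF b(1,2,3) iax] d(3) ax ev_at_zero[OF c(1)] by simp
  assume "ev A' B' (b * i * a) x = \<zero>\<^sub>B'"
  hence "ev A B i (ev A' A a x) = \<zero>\<^sub>B" using I[OF x] inv[OF b(1,2,3) iax] ev_at_zero[OF b(2)] by metis
  hence "ev A' A a x = \<zero>\<^sub>A" using d(6) ax by blast
  thus "x = \<zero>\<^sub>A'" using inv[OF a(1,2,4) x] ev_at_zero[OF a(2)] by metis
 next
  fix y assume y: "y IN B'" "ev B' C' (c * p * b') y = \<zero>\<^sub>C'"
  note by' = ev_closed[OF b(2) y(1)]
  have "ev B C p (ev B' B b' y) = \<zero>\<^sub>C"
   using P[OF y(1)] y(2) inv[OF c(1,2,3) ev_closed[OF d(2) by']] ev_at_zero[OF c(2)] by metis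
  then obtain x where x: "x IN A" "ev A B i x = ev B' B b' y" using d(4) by' by blast
  have "ev A' B' (b * i * a) (ev A A' a' x) = y"
   using I[OF ev_closed[OF a(2) x(1)]] inv[OF a(2,1,3) x(1)] x(2) inv[OF b(2,1,4) y(1)] by simp
  thus "\<exists>x\<in>carrier A'. ev A' B' (b * i * a) x = y" using ev_closed[OF a(2) x(1)] by blast
 next
  fix z assume z: "z IN C'"
  then obtain y where y: "y IN B" "ev B C p y = ev C' C c' z" using d(5) ev_closed[OF c(2)] by blast
  have "ev B' C' (c * p * b') (ev B B' b y) = z"
   using P[OF ev_closed[OF b(1) y(1)]] inv[OF b(1,2,3) y(1)] y(2) inv[OF c(2,1,4) z] by simp
  thus "\<exists>y\<in>carrier B'. ev B' C' (c * p * b') y = z" using ev_closed[OF b(1) y(1)] by blast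
 qed
qed

lemma exact_seq_short_five:
 assumes s: "exact_seq R A B C i p" and s': "exact_seq R A B' C i' p'"
  and z: "z \<in> Homs R B B'" "z * i = i'" "p' * z = p"
 shows "\<exists>z'\<in>Homs R B' B. z' * z = idm B & z * z' = idm B'"
proof -
 note d = exact_seqD[OF s] and d' = exact_seqD[OF s']
 interpret B': left_module R B' by (rule d'(11))
 interpret C: left_module R C by (rule d(12))
 have zi: "ev B B' z (ev A B i x) = ev A B' i' x" if "x IN A" for x using ev_comp[OF d(1) z(1) that] z(2) by simp
 have pz: "ev B' C p' (ev B B' z y) = ev B C p y" if "y IN B" for y using ev_comp[OF z(1) d'(2) that] z(3) by simp
 have inj: "y = \<zero>\<^sub>B" if y: "y IN B" "ev B B' z y = \<zero>\<^sub>B'" for y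
 proof -
  have "ev B C p y = \<zero>\<^sub>C" using pz[OF y(1)] y(2) ev_at_zero[OF d'(2)] by simp
  then obtain x where x: "x IN A" "ev A B i x = y" using d(4) y(1) by blast
  hence "x = \<zero>\<^sub>A" using zi[OF x(1)] y(2) d'(6) by simp
  thus ?thesis using x ev_at_zero[OF d(1)] by simp
 qed
 have surj: "\<exists>y\<in>carrier B. ev B B' z y = y'" if y': "y' IN B'" for y'
 proof -
  obtain y where y: "y IN B" "ev B C p y = ev B' C p' y'" using d(5) ev_closed[OF d'(2) y'] by blast
  note zy = ev_closed[OF z(1) y(1)]
  have "ev B' C p' (y' \<ominus>\<^sub>B' ev B B' z y) = \<zero>\<^sub>C"
   using ev_at_diff[OF d'(2) y' zy] pz[OF y(1)] y(2) C.a_minus_eq_zero ev_closed[OF d'(2) y'] by simp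
  then obtain x where x: "x IN A" "ev A B' i' x = y' \<ominus>\<^sub>B' ev B B' z y" using d'(4) y' zy by auto
  interpret B: left_module R B by (rule d(11))
  have "ev B B' z (ev A B i x \<oplus>\<^sub>B y) = y'"
   using ev_at_add[OF z(1) ev_closed[OF d(1) x(1)] y(1)] zi[OF x(1)] x(2) B'.a_minus_cancel[OF y' zy] by simp
  thus ?thesis using y(1) ev_closed[OF d(1) x(1)] by blast
 qed
 obtain z' where z': "z' \<in> Homs R B' B" "z' * z = idm B"
  using Homs_factor[OF z(1) _ Homs_idm[OF d(8)]] surj inj ev_idm[OF d(8)] zero_in[OF d(8)] by metis
 have "z * z' = idm B'"
 proof (rule ev_eqI[OF Homs_comp[OF z'(1) z(1)] Homs_idm[OF d'(8)]])
  fix y' assume y': "y' IN B'"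
  then obtain y where y: "y IN B" "ev B B' z y = y'" using surj by blast
  hence "ev B' B z' y' = y" using ev_comp[OF z(1) z'(1) y(1)] z'(2) ev_idm[OF d(8) y(1)] by simp
  thus "ev B' B' (z * z') y' = ev B' B' (idm B') y'"
   using ev_comp[OF z'(1) z(1) y'] y(2) ev_idm[OF d'(8) y'] by simp
 qed
 thus ?thesis using z' by blast
qed

lemma exact_seq_ker:
 assumes "exact_seq R A B C i p" "f \<in> Homs R D B" "p * f = 0" shows "\<exists>g\<in>Homs R D A. i * g = f"
proof -
 note d = exact_seqD[OF assms(1)]
 show ?thesis
 proof (rule Homs_lift[OF d(1,6) assms(2)])
  fix x assume x: "x IN D"
  have "ev B C p (ev D B f x) = \<zero>\<^sub>C"
   using ev_comp[OF assms(2) d(2) x] assms(3) ev_zero[OF HomsD(1)[OF assms(2)] d(9) x] by simp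
  thus "\<exists>a\<in>carrier A. ev A B i a = ev D B f x" using d(4) ev_closed[OF assms(2) x] by blast
 qed
qed

lemma exact_seq_coker:
 assumes "exact_seq R A B C i p" "f \<in> Homs R B D" "f * i = 0" shows "\<exists>g\<in>Homs R C D. g * p = f"
proof -
 note d = exact_seqD[OF assms(1)]
 show ?thesis
 proof (rule Homs_factor[OF d(2,5) assms(2)])
  fix y assume "y IN B" "ev B C p y = \<zero>\<^sub>C"
  then obtain x where x: "x IN A" "ev A B i x = y" using d(4) by blast
  thus "ev B D f y = \<zero>\<^sub>D"
   using ev_comp[OF d(1) assms(2) x(1)] assms(3) ev_zero[OF d(7) HomsD(2)[OF assms(2)] x(1)] by simp
 qed
qed

text \<open>Noetherianity keeps the kernel among the finitely generated modules.\<close>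

lemma kernel_exists:
 assumes N: "left_noetherian R" and p: "p \<in> Homs R B C" "\<forall>z\<in>carrier C. \<exists>y\<in>carrier B. ev B C p y = z"
 obtains A i where "exact_seq R A B C i p"
proof -
 note d = HomsD[OF p(1)]
 note H = ker_submodule[OF d(3,4) ev_hom(1)[OF p(1)]]
 let ?H = "mod_ker B C (ev B C p)" 
 let ?A = "B\<lparr>carrier := ?H\<rparr>"
 have A: "?A \<in> fgm R" by (rule submodule_fg[OF N d(1) H])
 note I = mod_hom_inclusion[OF d(3) H]
 note e = ev_arr[OF A d(1) I]
 have "exact_seq R ?A B C (arr ?A B (\<lambda>x\<in>?H. x)) p"
 proof (rule exact_seqI_ev[OF HomsI[OF A d(1) I] p(1)], unfold e)
  show "\<exists>y\<in>carrier B. ev B C p y = z" if "z IN C" for z using p(2) that by blast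
 qed (auto simp: mod_ker_def)
 thus ?thesis using that by blast
qed

lemma image_exists:
 assumes N: "left_noetherian R" and f: "f \<in> Homs R A B"
 shows "\<exists>T I F t q m r. exact_seq R T A I t q & exact_seq R I B F m r & f = m * q"
proof -
 note d = HomsD[OF f]
 interpret A: left_module R A by (rule d(3))
 let ?H = "ev A B f ` carrier A" 
 let ?I = "B\<lparr>carrier := ?H\<rparr>"
 note H = image_submodule[OF d(3,4) ev_hom(1)[OF f] A.carrier_submodule]
 have I: "?I \<in> fgm R" by (rule submodule_fg[OF N d(2) H])
 note inc = mod_hom_inclusion[OF d(4) H]
 obtain F r where F: "F \<in> fgm R" "r \<in> mod_hom R B F" "r ` carrier B = carrier F"
  "\<forall>x\<in>carrier B. r x = \<zero>\<^sub>F \<longleftrightarrow> x \<in> ?H"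
  by (rule quotient_exists[OF fgmD[OF d(2)] H])
 have HB: "?H \<subseteq> carrier B" using ev_closed[OF f] by blast
 have m: "arr ?I B (\<lambda>x\<in>?H. x) \<in> Homs R ?I B" by (rule HomsI[OF I d(2) inc])
 note em = ev_arr[OF I d(2) inc] and er = ev_arr[OF d(2) F(1,2)]
 have 2: "exact_seq R ?I B F (arr ?I B (\<lambda>x\<in>?H. x)) (arr B F r)"
 proof (rule exact_seqI_ev[OF m HomsI[OF d(2) F(1,2)]], unfold em er)
  show "\<And>z. z IN F ==> \<exists>y\<in>carrier B. r y = z" unfolding F(3)[symmetric] by blast
 qed (use F(4) HB in auto)
 obtain q where q: "q \<in> Homs R A ?I" "arr ?I B (\<lambda>x\<in>?H. x) * q = f"
  using Homs_lift[OF m _ f] unfolding em by auto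
 have qe: "ev A ?I q x = ev A B f x" if "x IN A" for x
  using ev_comp[OF q(1) m that] q(2) em ev_closed[OF q(1) that] by simp
 obtain T t where "exact_seq R T A ?I t q" using kernel_exists[OF N q(1)] qe by auto
 thus ?thesis using 2 q(2) by metis
qed

lemma pullback_exists:
 assumes N: "left_noetherian R" and s: "exact_seq R A B C i p" and f: "f \<in> Homs R D C"
 shows "\<exists>E g i' p'. exact_seq R A E D i' p' & g \<in> Homs R E B & g * i' = i & f * p' = p * g &
     (\<forall>K k. exact_seq R K D C k f --> (\<exists>k'. exact_seq R K E B k' g)) &
     (\<forall>F q. exact_seq R D C F f q --> exact_seq R E B F g (q * p))"
proof -
 note d = exact_seqD[OF s] and df = HomsD[OF f]
 obtain E g0 h0 where E: "E \<in> fgm R" and g0: "g0 \<in> mod_hom R E B" and h0: "h0 \<in> mod_hom R E D"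
  and E1': "\<forall>e\<in>carrier E. ev B C p (g0 e) = ev D C f (h0 e)"
  and E2': "\<forall>b\<in>carrier B. \<forall>d\<in>carrier D. ev B C p b = ev D C f d --> (\<exists>e\<in>carrier E. g0 e = b & h0 e = d)"
  and E3': "\<forall>e\<in>carrier E. \<forall>e'\<in>carrier E. g0 e = g0 e' --> h0 e = h0 e' --> e = e'"
  by (rule pullback_modules[OF N d(8,9) df(1) ev_hom(1)[OF d(2)] ev_hom(1)[OF f]])
 define g h where "g = arr E B g0" and "h = arr E D h0"
 have g: "g \<in> Homs R E B" and h: "h \<in> Homs R E D" unfolding g_def h_def using HomsI E d df g0 h0 by blast+
 have eg: "ev E B g = g0" "ev E D h = h0" unfolding g_def h_def using ev_arr E d(8) df(1) g0 h0 by blast+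
 note E1 = E1'[folded eg] and E2 = E2'[folded eg] and E3 = E3'[folded eg]
 note LE = fgmD(1)[OF E]
 interpret E: left_module R E by (rule LE)
 have E0: "e = \<zero>\<^sub>E" if "e IN E" "ev E B g e = \<zero>\<^sub>B" "ev E D h e = \<zero>\<^sub>D" for e
  using E3 that zero_in[OF E] ev_at_zero[OF g] ev_at_zero[OF h] by metis
 \<comment> \<open>The kernel arrows of both projections of the pullback are obtained from this by
   prescribing one coordinate and taking zero for the other.\<close>
 have univ: "\<exists>t\<in>Homs R W E. g * t = u & h * t = w"
  if u: "u \<in> Homs R W B" and w: "w \<in> Homs R W D" and e: "\<And>x. x IN W ==> ev B C p (ev W B u x) = ev D C f (ev W D w x)"
  for W u w
 proof -
  note dW = HomsD[OF u]
  interpret W: left_module R W by (rule dW(3))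
  define t where "t x = (SOME y. y IN E & ev E B g y = ev W B u x & ev E D h y = ev W D w x)" for x
  have t: "t x IN E & ev E B g (t x) = ev W B u x & ev E D h (t x) = ev W D w x" if "x IN W" for x
   unfolding t_def by (rule someI_ex) (use E2 e[OF that] ev_closed[OF u that] ev_closed[OF w that] in blast)
  have T: "(\<lambda>x\<in>carrier W. t x) \<in> mod_hom R W E"
  proof (rule hom_restrict[OF dW(3)])
   show "t x IN E" if "x IN W" for x using t that by blast
   show "t (x \<oplus>\<^sub>W y) = t x \<oplus>\<^sub>E t y" if "x IN W" "y IN W" for x y
    using t that E3[rule_format, of "t (x \<oplus>\<^sub>W y)" "t x \<oplus>\<^sub>E t y"]
    by (simp add: ev_at_add[OF g] ev_at_add[OF h] ev_at_add[OF u] ev_at_add[OF w])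
   show "t (r \<odot>\<^sub>W x) = r \<odot>\<^sub>E t x" if "r IN R" "x IN W" for r x
    using t that E3[rule_format, of "t (r \<odot>\<^sub>W x)" "r \<odot>\<^sub>E t x"] W.lm_smult_closed[OF that] E.lm_smult_closed[of r "t x"]
     mod_homD(4)[OF ev_hom(1)[OF g]] mod_homD(4)[OF ev_hom(1)[OF h]] mod_homD(4)[OF ev_hom(1)[OF u]] mod_homD(4)[OF ev_hom(1)[OF w]]
    by simp
  qed
  have TH: "arr W E (\<lambda>x\<in>carrier W. t x) \<in> Homs R W E" by (rule HomsI[OF dW(1) E T])
  note et = ev_arr[OF dW(1) E T]
  have "g * arr W E (\<lambda>x\<in>carrier W. t x) = u"
   by (rule ev_eqI[OF Homs_comp[OF TH g] u]) (simp add: ev_comp[OF TH g] et t)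
  moreover have "h * arr W E (\<lambda>x\<in>carrier W. t x) = w"
   by (rule ev_eqI[OF Homs_comp[OF TH h] w]) (simp add: ev_comp[OF TH h] et t)
  ultimately show ?thesis using TH by blast
 qed
 have zAD: "0 \<in> Homs R A D" using Homs_zero d(7) df(1) by blast
 obtain i' where i': "i' \<in> Homs R A E" "g * i' = i" "h * i' = 0"
  using univ[OF d(1) zAD] d(3) ev_zero[OF d(7) df(1)] ev_at_zero[OF f] by auto
 have gi: "ev E B g (ev A E i' x) = ev A B i x" "ev E D h (ev A E i' x) = \<zero>\<^sub>D" if "x IN A" for x
  using ev_comp[OF i'(1) g that] ev_comp[OF i'(1) h that] i' ev_zero[OF d(7) df(1) that] by simp_all
 have 1: "exact_seq R A E D i' h"
 proof (rule exact_seqI_ev[OF i'(1) h])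
  show "ev E D h (ev A E i' x) = \<zero>\<^sub>D" if "x IN A" for x using gi that by simp
  show "x = \<zero>\<^sub>A" if "x IN A" "ev A E i' x = \<zero>\<^sub>E" for x using d(6) gi(1)[OF that(1)] that ev_at_zero[OF g] by simp
  show "\<exists>y\<in>carrier E. ev E D h y = z" if "z IN D" for z using E2 d(5) ev_closed[OF f that] that by metis
  fix e assume e: "e IN E" "ev E D h e = \<zero>\<^sub>D"
  hence "ev B C p (ev E B g e) = \<zero>\<^sub>C" using E1 ev_at_zero[OF f] by simp
  then obtain x where x: "x IN A" "ev A B i x = ev E B g e" using d(4) ev_closed[OF g e(1)] by blast
  hence "ev A E i' x = e" using E3 gi[OF x(1)] e ev_closed[OF i'(1) x(1)] by simp
  thus "\<exists>x\<in>carrier A. ev A E i' x = e" using x by blast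
 qed
 have fh: "f * h = p * g"
  by (rule ev_eqI[OF Homs_comp[OF h f] Homs_comp[OF g d(2)]]) (simp add: ev_comp[OF h f] ev_comp[OF g d(2)] E1)
 have 2: "\<exists>k'. exact_seq R K E B k' g" if k: "exact_seq R K D C k f" for K k
 proof -
  note dk = exact_seqD[OF k]
  have zKB: "0 \<in> Homs R K B" using Homs_zero dk(7) d(8) by blast
  obtain k' where k': "k' \<in> Homs R K E" "g * k' = 0" "h * k' = k"
   using univ[OF zKB dk(1)] dk(3) ev_zero[OF dk(7) d(8)] ev_at_zero[OF d(2)] by auto
  have gk: "ev E B g (ev K E k' x) = \<zero>\<^sub>B" "ev E D h (ev K E k' x) = ev K D k x" if "x IN K" for x
   using ev_comp[OF k'(1) g that] ev_comp[OF k'(1) h that] k' ev_zero[OF dk(7) d(8) that] by simp_all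
  have "exact_seq R K E B k' g"
  proof (rule exact_seqI_ev[OF k'(1) g])
   show "ev E B g (ev K E k' x) = \<zero>\<^sub>B" if "x IN K" for x using gk that by simp
   show "x = \<zero>\<^sub>K" if "x IN K" "ev K E k' x = \<zero>\<^sub>E" for x using dk(6) gk(2)[OF that(1)] that ev_at_zero[OF h] by simp
   show "\<exists>y\<in>carrier E. ev E B g y = z" if "z IN B" for z using E2 dk(5) ev_closed[OF d(2) that] that by metis
   fix e assume e: "e IN E" "ev E B g e = \<zero>\<^sub>B"
   hence "ev D C f (ev E D h e) = \<zero>\<^sub>C" using E1 ev_at_zero[OF d(2)] by metis
   then obtain x where x: "x IN K" "ev K D k x = ev E D h e" using dk(4) ev_closed[OF h e(1)] by blast
   hence "ev K E k' x = e" using E3 gk[OF x(1)] e ev_closed[OF k'(1) x(1)] by simp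
   thus "\<exists>x\<in>carrier K. ev K E k' x = e" using x by blast
  qed
  thus ?thesis by blast
 qed
 have 3: "exact_seq R E B F g (q * p)" if q: "exact_seq R D C F f q" for F q
 proof -
  note dq = exact_seqD[OF q]
  have qp: "ev B F (q * p) y = ev C F q (ev B C p y)" if "y IN B" for y using ev_comp[OF d(2) dq(2) that] .
  show ?thesis
  proof (rule exact_seqI_ev[OF g Homs_comp[OF d(2) dq(2)]])
   show "ev B F (q * p) (ev E B g x) = \<zero>\<^sub>F" if "x IN E" for x
    using qp[OF ev_closed[OF g that]] E1 dq(3) ev_closed[OF h that] that by simp
   show "\<exists>y\<in>carrier B. ev B F (q * p) y = z" if "z IN F" for z using dq(5) d(5) qp that by metis
   show "e = \<zero>\<^sub>E" if e: "e IN E" "ev E B g e = \<zero>\<^sub>B" for e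
   proof -
    have "ev D C f (ev E D h e) = \<zero>\<^sub>C" using E1 e ev_at_zero[OF d(2)] by metis
    hence "ev E D h e = \<zero>\<^sub>D" using dq(6) ev_closed[OF h e(1)] by blast
    thus ?thesis by (rule E0[OF e])
   qed
   fix y assume y: "y IN B" "ev B F (q * p) y = \<zero>\<^sub>F"
   then obtain x where "x IN D" "ev D C f x = ev B C p y" using dq(4) ev_closed[OF d(2) y(1)] qp by metis
   thus "\<exists>x\<in>carrier E. ev E B g x = y" using E2 y(1) by metis
  qed
 qed
 show ?thesis using 1 g i'(2) fh 2 3 by blast
qed

lemma pushout_exists:
 assumes s: "exact_seq R A B C i p" and f: "f \<in> Homs R A D"
 shows "\<exists>Z v j w. exact_seq R D Z C v w & j \<in> Homs R B Z & j * i = v * f & w * j = p &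
     (\<forall>F q. exact_seq R A D F f q --> (\<exists>q'. exact_seq R B Z F j q')) &
     (\<forall>K k. exact_seq R K A D k f --> exact_seq R K B Z (i * k) j) &
     (\<forall>W. \<forall>g\<in>Homs R B W. \<forall>h\<in>Homs R D W. g * i = h * f --> (\<exists>t\<in>Homs R Z W. t * j = g & t * v = h))"
proof -
 note d = exact_seqD[OF s] and df = HomsD[OF f]
 obtain Z j0 v0 where Z: "Z \<in> fgm R" and j0: "j0 \<in> mod_hom R B Z" and v0: "v0 \<in> mod_hom R D Z"
  and Z1': "\<forall>a\<in>carrier A. j0 (ev A B i a) = v0 (ev A D f a)"
  and Z2': "\<forall>z\<in>carrier Z. \<exists>b\<in>carrier B. \<exists>d\<in>carrier D. z = j0 b \<oplus>\<^sub>Z v0 d"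
  and Z3': "\<forall>b\<in>carrier B. \<forall>d\<in>carrier D. j0 b = v0 d --> (\<exists>a\<in>carrier A. b = ev A B i a & d = ev A D f a)"
  by (rule pushout_modules[OF d(7,8) df(2) ev_hom(1)[OF d(1)] ev_hom(1)[OF f]])
 define j v where "j = arr B Z j0" and "v = arr D Z v0"
 have j: "j \<in> Homs R B Z" and v: "v \<in> Homs R D Z" unfolding j_def v_def using HomsI Z d df j0 v0 by blast+
 have ejv: "ev B Z j = j0" "ev D Z v = v0" unfolding j_def v_def using ev_arr Z d(8) df(2) j0 v0 by blast+
 note Z1 = Z1'[folded ejv] and Z2 = Z2'[folded ejv] and Z3 = Z3'[folded ejv]
 note LZ = fgmD(1)[OF Z]
 interpret Z: left_module R Z by (rule LZ)
 interpret B: left_module R B by (rule d(11))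
 interpret D: left_module R D by (rule df(4))
 note jc = ev_closed[OF j] and vc = ev_closed[OF v]
 \<comment> \<open>\<open>Z\<close> is the quotient of the product of \<open>B\<close> and
   \<open>D\<close> by the arrow \<open>j + v\<close>. The arrow \<open>g + h\<close> factors
   through it since, by \<open>Z3\<close>, the elements killed by \<open>j + v\<close> come from
   \<open>A\<close>.\<close>
 have univ: "\<exists>t\<in>Homs R Z W. t * j = g & t * v = h"
  if g: "g \<in> Homs R B W" and h: "h \<in> Homs R D W" and e: "g * i = h * f" for W g h
 proof -
  note dW = HomsD[OF g]
  interpret W: left_module R W by (rule dW(4))
  have e': "ev B W g (ev A B i x) = ev D W h (ev A D f x)" if "x IN A" for x
   using ev_comp[OF d(1) g that] ev_comp[OF f h that] e by simp
  note gc = ev_closed[OF g] and hc = ev_closed[OF h]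
  let ?P = "prod_module B D"
  note LP = prod_left_module[OF d(11) df(4)]
  let ?q = "\<lambda>x\<in>carrier ?P. ev B Z j (fst x) \<oplus>\<^sub>Z ev D Z v (snd x)"
  let ?r = "\<lambda>x\<in>carrier ?P. ev B W g (fst x) \<oplus>\<^sub>W ev D W h (snd x)"
  have q: "?q \<in> mod_hom R ?P Z" by (rule hom_restrict[OF LP])
    (auto simp: ev_at_add[OF j] ev_at_add[OF v] jc vc Z.add_add_add Z.lm_smult_r_distr
     mod_homD(4)[OF ev_hom(1)[OF j]] mod_homD(4)[OF ev_hom(1)[OF v]])
  have r: "?r \<in> mod_hom R ?P W" by (rule hom_restrict[OF LP])
    (auto simp: ev_at_add[OF g] ev_at_add[OF h] gc hc W.add_add_add W.lm_smult_r_distr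
     mod_homD(4)[OF ev_hom(1)[OF g]] mod_homD(4)[OF ev_hom(1)[OF h]])
  have qs: "?q ` carrier ?P = carrier Z"
  proof
   show "?q ` carrier ?P \<subseteq> carrier Z" using mod_homD(2)[OF q] by blast
   show "carrier Z \<subseteq> ?q ` carrier ?P"
   proof
    fix z assume "z IN Z"
    then obtain b d where "b IN B" "d IN D" "z = ev B Z j b \<oplus>\<^sub>Z ev D Z v d" using Z2 by blast
    thus "z \<in> ?q ` carrier ?P" by (intro image_eqI[of _ _ "(b, d)"]) auto
   qed
  qed
  have k: "?r x = \<zero>\<^sub>W" if x: "x \<in> carrier ?P" "?q x = \<zero>\<^sub>Z" for x
  proof -
   obtain b d where bd: "x = (b, d)" "b IN B" "d IN D" using x(1) by auto
   have md: "\<ominus>\<^sub>D d IN D" using bd by simp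
   have "ev D Z v (\<ominus>\<^sub>D d) \<oplus>\<^sub>Z ev D Z v d = \<zero>\<^sub>Z"
    using ev_at_add[OF v md bd(3)] ev_at_zero[OF v] bd D.M.l_neg by simp
   moreover have "ev B Z j b \<oplus>\<^sub>Z ev D Z v d = \<zero>\<^sub>Z" using x bd by simp
   ultimately have "ev B Z j b = ev D Z v (\<ominus>\<^sub>D d)"
    using Z.M.minus_equality[OF _ vc[OF bd(3)] jc[OF bd(2)]] Z.M.minus_equality[OF _ vc[OF bd(3)] vc[OF md]] by metis
   then obtain a where a: "a IN A" "b = ev A B i a" "\<ominus>\<^sub>D d = ev A D f a" using Z3 bd md by blast
   have "ev B W g b = ev D W h (\<ominus>\<^sub>D d)" using e'[OF a(1)] a by simp
   thus ?thesis using ev_at_add[OF h md bd(3)] ev_at_zero[OF h] bd D.M.l_neg by simp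
  qed
  obtain t where t': "t \<in> mod_hom R Z W" "\<forall>x\<in>carrier ?P. t (?q x) = ?r x"
   using factor_surjective[OF LP LZ dW(4) q qs r] k by blast
  note t = t'(1) t'(2)[rule_format]
  have T: "arr Z W t \<in> Homs R Z W" by (rule HomsI[OF Z dW(2) t(1)])
  note et = ev_arr[OF Z dW(2) t(1)]
  have "arr Z W t * j = g" by (rule ev_eqI[OF Homs_comp[OF j T] g])
    (use t(2)[of "(_, \<zero>\<^sub>D)"] in "simp add: ev_comp[OF j T] et ev_at_zero[OF v] ev_at_zero[OF h] jc gc")
  moreover have "arr Z W t * v = h" by (rule ev_eqI[OF Homs_comp[OF v T] h])
    (use t(2)[of "(\<zero>\<^sub>B, _)"] in "simp add: ev_comp[OF v T] et ev_at_zero[OF j] ev_at_zero[OF g] vc hc")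
  ultimately show ?thesis using T by blast
 qed
 have ji: "j * i = v * f"
  by (rule ev_eqI[OF Homs_comp[OF d(1) j] Homs_comp[OF f v]]) (simp add: ev_comp[OF d(1) j] ev_comp[OF f v] Z1)
 have zDC: "0 \<in> Homs R D C" using Homs_zero df(2) d(9) by blast
 obtain w where w: "w \<in> Homs R Z C" "w * j = p" "w * v = 0" using univ[OF d(2) zDC] exact_seq_zero[OF s] by auto
 have wj: "ev Z C w (ev B Z j x) = ev B C p x" if "x IN B" for x using ev_comp[OF j w(1) that] w by simp
 have wv: "ev Z C w (ev D Z v x) = \<zero>\<^sub>C" if "x IN D" for x
  using ev_comp[OF v w(1) that] w ev_zero[OF df(2) d(9) that] by simp
 interpret C: left_module R C by (rule d(12))
 have 1: "exact_seq R D Z C v w"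
 proof (rule exact_seqI_ev[OF v w(1)])
  show "ev Z C w (ev D Z v x) = \<zero>\<^sub>C" if "x IN D" for x using wv that .
  show "\<exists>y\<in>carrier Z. ev Z C w y = z" if "z IN C" for z using d(5) wj jc that by metis
  show "x = \<zero>\<^sub>D" if x: "x IN D" "ev D Z v x = \<zero>\<^sub>Z" for x
  proof -
   obtain a where "a IN A" "\<zero>\<^sub>B = ev A B i a" "x = ev A D f a" using Z3 x zero_in[OF d(8)] ev_at_zero[OF j] by metis
   thus ?thesis using d(6) ev_at_zero[OF f] by metis
  qed
  fix z assume z: "z IN Z" "ev Z C w z = \<zero>\<^sub>C"
  then obtain b y where b: "b IN B" "y IN D" "z = ev B Z j b \<oplus>\<^sub>Z ev D Z v y" using Z2 by blast
  have "ev B C p b = \<zero>\<^sub>C"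
   using z(2) b ev_at_add[OF w(1) jc[OF b(1)] vc[OF b(2)]] wj wv ev_closed[OF d(2) b(1)] by simp
  then obtain a where a: "a IN A" "ev A B i a = b" using d(4) b by blast
  have "ev D Z v (ev A D f a \<oplus>\<^sub>D y) = z" using ev_at_add[OF v ev_closed[OF f a(1)] b(2)] Z1 a b(3) by auto
  thus "\<exists>x\<in>carrier D. ev D Z v x = z" using ev_closed[OF f a(1)] b(2) by blast
 qed
 have sum: "z = ev B Z j (b \<oplus>\<^sub>B ev A B i a)" if "b IN B" "a IN A" "z = ev B Z j b \<oplus>\<^sub>Z ev D Z v (ev A D f a)" for z b a
  using ev_at_add[OF j that(1) ev_closed[OF d(1) that(2)]] Z1 that by simp
 have 2: "\<exists>q'. exact_seq R B Z F j q'" if q: "exact_seq R A D F f q" for F q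
 proof -
  note dq = exact_seqD[OF q]
  have zBF: "0 \<in> Homs R B F" using Homs_zero d(8) dq(9) by blast
  obtain q' where q': "q' \<in> Homs R Z F" "q' * j = 0" "q' * v = q" using univ[OF zBF dq(2)] exact_seq_zero[OF q] by auto
  have qj: "ev Z F q' (ev B Z j x) = \<zero>\<^sub>F" if "x IN B" for x
   using ev_comp[OF j q'(1) that] q' ev_zero[OF d(8) dq(9) that] by simp
  have qv: "ev Z F q' (ev D Z v x) = ev D F q x" if "x IN D" for x using ev_comp[OF v q'(1) that] q' by simp
  interpret F: left_module R F by (rule dq(12))
  have "exact_seq R B Z F j q'"
  proof (rule exact_seqI_ev[OF j q'(1)])
   show "ev Z F q' (ev B Z j x) = \<zero>\<^sub>F" if "x IN B" for x using qj that .
   show "\<exists>y\<in>carrier Z. ev Z F q' y = z" if "z IN F" for z using dq(5) qv vc that by metis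
   show "x = \<zero>\<^sub>B" if x: "x IN B" "ev B Z j x = \<zero>\<^sub>Z" for x
   proof -
    obtain a where "a IN A" "x = ev A B i a" "\<zero>\<^sub>D = ev A D f a" using Z3 x zero_in[OF df(2)] ev_at_zero[OF v] by metis
    thus ?thesis using dq(6) ev_at_zero[OF d(1)] by metis
   qed
   fix z assume z: "z IN Z" "ev Z F q' z = \<zero>\<^sub>F"
   then obtain b y where b: "b IN B" "y IN D" "z = ev B Z j b \<oplus>\<^sub>Z ev D Z v y" using Z2 by blast
   have "ev D F q y = \<zero>\<^sub>F"
    using z(2) b ev_at_add[OF q'(1) jc[OF b(1)] vc[OF b(2)]] qj qv ev_closed[OF dq(2) b(2)] by simp
   then obtain a where a: "a IN A" "ev A D f a = y" using dq(4) b by blast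
   thus "\<exists>x\<in>carrier B. ev B Z j x = z" using sum[OF b(1) a(1)] b ev_closed[OF d(1) a(1)] by (metis B.M.a_closed)
  qed
  thus ?thesis by blast
 qed
 have 3: "exact_seq R K B Z (i * k) j" if k: "exact_seq R K A D k f" for K k
 proof -
  note dk = exact_seqD[OF k]
  have ik: "ev K B (i * k) x = ev A B i (ev K A k x)" if "x IN K" for x using ev_comp[OF dk(1) d(1) that] .
  show ?thesis
  proof (rule exact_seqI_ev[OF Homs_comp[OF dk(1) d(1)] j])
   show "ev B Z j (ev K B (i * k) x) = \<zero>\<^sub>Z" if "x IN K" for x
    using ik[OF that] Z1 ev_closed[OF dk(1) that] dk(3) that ev_at_zero[OF v] by simp
   show "x = \<zero>\<^sub>K" if "x IN K" "ev K B (i * k) x = \<zero>\<^sub>B" for x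
    using ik[OF that(1)] that d(6) dk(6) ev_closed[OF dk(1) that(1)] by simp
   show "\<exists>y\<in>carrier B. ev B Z j y = z" if z: "z IN Z" for z
   proof -
    obtain b y where b: "b IN B" "y IN D" "z = ev B Z j b \<oplus>\<^sub>Z ev D Z v y" using Z2 z by blast
    obtain a where a: "a IN A" "ev A D f a = y" using dk(5) b by blast
    thus ?thesis using sum[OF b(1) a(1)] b ev_closed[OF d(1) a(1)] by (metis B.M.a_closed)
   qed
   fix y assume y: "y IN B" "ev B Z j y = \<zero>\<^sub>Z"
   then obtain a where a: "a IN A" "y = ev A B i a" "\<zero>\<^sub>D = ev A D f a" using Z3 zero_in[OF df(2)] ev_at_zero[OF v] by metis
   then obtain x where "x IN K" "ev K A k x = a" using dk(4) by metis
   thus "\<exists>x\<in>carrier K. ev K B (i * k) x = y" using ik a by metis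
  qed
 qed
 show ?thesis using 1 j ji w(2) 2 3 univ by blast
qed

lemma exact_category_modules:
 assumes N: "left_noetherian R" shows "exact_category (fgm R) (Homs R) idm (exact_seq R)"
proof
 show "f \<in> Homs R X Y ==> X \<in> fgm R & Y \<in> fgm R" for f X Y using HomsD by blast
 show "X \<in> fgm R ==> Y \<in> fgm R ==> 0 \<in> Homs R X Y" for X Y by (rule Homs_zero)
 show "f \<in> Homs R X Y ==> g \<in> Homs R X Y ==> f + g \<in> Homs R X Y" for f g X Y by (rule Homs_add)
 show "f \<in> Homs R X Y ==> - f \<in> Homs R X Y" for f X Y by (rule Homs_uminus)
 show "f \<in> Homs R X Y ==> g \<in> Homs R Y Z ==> g * f \<in> Homs R X Z" for f g X Y Z by (rule Homs_comp)
 show "X \<in> fgm R ==> idm X \<in> Homs R X X" for X by (rule Homs_idm)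
 show "f \<in> Homs R X Y ==> idm Y * f = f" "f \<in> Homs R X Y ==> f * idm X = f" for f X Y
  by (rule idm_left idm_right; assumption)+
 show "exact_seq R A B C i p ==> i \<in> Homs R A B & p \<in> Homs R B C" for A B C i p using exact_seqD(1,2) by blast
 show "exact_seq R A B C i p ==> p * i = 0" for A B C i p by (rule exact_seq_zero)
 show "exact_seq R A B C i p ==> g \<in> Homs R D A ==> i * g = 0 ==> g = 0" for A B C i p g D by (rule exact_seq_mono)
 show "exact_seq R A B C i p ==> g \<in> Homs R C D ==> g * p = 0 ==> g = 0" for A B C i p g D by (rule exact_seq_epi)
qed (fact exact_seq_ker exact_seq_coker exact_seq_iso exact_seq_short_five pullback_exists[OF N] pushout_exists image_exists[OF N])+

section \<open>Modules over a left noetherian ring\<close>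

locale noetherian_modules =
 fixes R :: "'a ring"
 assumes noeth: "left_noetherian R"

sublocale noetherian_modules \<subseteq> exact_category "fgm R" "Homs R" idm "exact_seq R"
 by (rule exact_category_modules[OF noeth])

lemma regular_finitely_generated:
 assumes "ring R" shows "finitely_generated R (reg R)"
proof -
 interpret ring R by fact
 interpret L: left_module R "reg R" by (rule reg_left_module[OF assms])
 show ?thesis by (rule finitely_generated_lincombI[OF L.left_module_axioms, of 1 "%_. \<one>\<^sub>R"])
   (auto intro: exI[of _ "%_. _"])
qed

text \<open>The carrier of \<open>regular_module R\<close> has the wrong type for an object, so an
  isomorphic copy plays the part of the regular object.\<close>

definition rcopy :: "'a ring => 'a fg_module" where
 "rcopy R = (SOME Q. Q \<in> fgm R & (\<exists>p\<in>mod_hom R (reg R) Q. \<exists>q\<in>mod_hom R Q (reg R).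
   (\<forall>x\<in>carrier R. q (p x) = x) & (\<forall>y\<in>carrier Q. p (q y) = y)))"

lemma rcopy:
 assumes "ring R"
 shows "rcopy R \<in> fgm R"
  and "\<exists>p\<in>mod_hom R (reg R) (rcopy R). \<exists>q\<in>mod_hom R (rcopy R) (reg R).
   (\<forall>x\<in>carrier R. q (p x) = x) & (\<forall>y\<in>carrier (rcopy R). p (q y) = y)"
proof -
 have "\<exists>Q. Q \<in> fgm R & (\<exists>p\<in>mod_hom R (reg R) Q. \<exists>q\<in>mod_hom R Q (reg R).
   (\<forall>x\<in>carrier R. q (p x) = x) & (\<forall>y\<in>carrier Q. p (q y) = y))"
  using fg_copy[OF reg_left_module[OF assms] regular_finitely_generated[OF assms]] by (metis regular_simps(1))
 from someI_ex[OF this] show "rcopy R \<in> fgm R"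
  "\<exists>p\<in>mod_hom R (reg R) (rcopy R). \<exists>q\<in>mod_hom R (rcopy R) (reg R).
   (\<forall>x\<in>carrier R. q (p x) = x) & (\<forall>y\<in>carrier (rcopy R). p (q y) = y)"
  unfolding rcopy_def by blast+
qed

context noetherian_modules
begin

lemma R_ring: "ring R"
 using noeth unfolding left_noetherian_def by blast

text \<open>Extension problems into \<open>Y\<close> are conjugated by \<open>a\<close> and
  \<open>b\<close> into extension problems into its copy \<open>Y'\<close>. This links Ext into
  modules of other carrier types, such as the ring itself, to \<open>ext1z\<close>.\<close>

lemma copy_extension_iff:
 assumes k: "k \<in> Homs R K M" and Y': "Y' \<in> fgm R" and a: "a \<in> mod_hom R Y Y'" and b: "b \<in> mod_hom R Y' Y"
  and ba: "\<forall>y\<in>carrier Y. b (a y) = y" and ab: "\<forall>y\<in>carrier Y'. a (b y) = y"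
 shows "(\<forall>f\<in>Homs R K Y'. \<exists>g\<in>Homs R M Y'. g * k = f) \<longleftrightarrow>
  (\<forall>f\<in>mod_hom R K Y. \<exists>g\<in>mod_hom R M Y. \<forall>x\<in>carrier K. g (ev K M k x) = f x)"
proof (intro iffI ballI)
 note K = HomsD(1)[OF k] and M = HomsD(2)[OF k] and LK = HomsD(3)[OF k] and LM = HomsD(4)[OF k]
 fix f
 {
  assume E: "\<forall>f\<in>Homs R K Y'. \<exists>g\<in>Homs R M Y'. g * k = f" and f: "f \<in> mod_hom R K Y"
  note F = hom_compose[OF LK f a]
  obtain g where g: "g \<in> Homs R M Y'" "g * k = arr K Y' (cmp K a f)" using E HomsI[OF K Y' F] by blast
  have "cmp M b (ev M Y' g) (ev K M k x) = f x" if x: "x IN K" for x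
   using ev_comp[OF k g(1) x, symmetric] g(2) ev_arr[OF K Y' F] x ba mod_homD(2)[OF f x] ev_closed[OF k x] by (simp add: compose_def)
  thus "\<exists>g\<in>mod_hom R M Y. \<forall>x\<in>carrier K. g (ev K M k x) = f x"
   using hom_compose[OF LM ev_hom(1)[OF g(1)] b] by blast
 }
 assume E: "\<forall>f\<in>mod_hom R K Y. \<exists>g\<in>mod_hom R M Y. \<forall>x\<in>carrier K. g (ev K M k x) = f x" and f: "f \<in> Homs R K Y'"
 obtain g where g: "g \<in> mod_hom R M Y" "\<forall>x\<in>carrier K. g (ev K M k x) = cmp K b (ev K Y' f) x"
  using E hom_compose[OF LK ev_hom(1)[OF f] b] by blast
 note G = hom_compose[OF LM g(1) a]
 note GH = HomsI[OF M Y' G]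
 have "arr M Y' (cmp M a g) * k = f" by (rule ev_eqI[OF Homs_comp[OF k GH] f])
   (use ev_comp[OF k GH] ev_arr[OF M Y' G] g(2) ev_closed[OF k] ab ev_closed[OF f] in "simp add: compose_def")
 thus "\<exists>g\<in>Homs R M Y'. g * k = f" using GH by blast
qed

lemma regular_extension_iff:
 assumes "k \<in> Homs R K M"
 shows "(\<forall>f\<in>Homs R K (rcopy R). \<exists>g\<in>Homs R M (rcopy R). g * k = f) \<longleftrightarrow>
  (\<forall>f\<in>mod_hom R K (reg R). \<exists>g\<in>mod_hom R M (reg R). \<forall>x\<in>carrier K. g (ev K M k x) = f x)"
proof -
 obtain a b where "a \<in> mod_hom R (reg R) (rcopy R)" "b \<in> mod_hom R (rcopy R) (reg R)"
  "\<forall>x\<in>carrier (reg R). b (a x) = x" "\<forall>y\<in>carrier (rcopy R). a (b y) = y"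
  using rcopy(2)[OF R_ring] by auto
 thus ?thesis by (rule copy_extension_iff[OF assms rcopy(1)[OF R_ring]])
qed

lemma proj_iff: "proj P \<longleftrightarrow> P \<in> projectives R"
proof
 assume P: "proj P"
 show "P \<in> projectives R" unfolding projectives_def
 proof (intro CollectI conjI ballI impI)
  show O: "P \<in> fgm R" using P by (rule proj_Ob)
  fix M N g f assume MN: "M \<in> fgm R" "N \<in> fgm R" "g \<in> mod_hom R M N" "f \<in> mod_hom R P N"
   and s: "g ` carrier M = carrier N"
  note g = HomsI[OF MN(1,2,3)] and f = HomsI[OF O MN(2,4)]
  have "\<forall>z\<in>carrier N. \<exists>y\<in>carrier M. ev M N (arr M N g) y = z"
   unfolding ev_arr[OF MN(1,2,3)] s[symmetric] by blast
  then obtain A i where "exact_seq R A M N i (arr M N g)" using kernel_exists[OF noeth g] by metis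
  then obtain l where l: "l \<in> Homs R P M" "arr M N g * l = arr P N f" using proj_lift[OF P _ f] by blast
  have "cmp P g (ev P M l) = f"
  proof (rule mod_hom_eqI[OF hom_compose[OF fgmD(1)[OF O] ev_hom(1)[OF l(1)] MN(3)] MN(4)])
   fix x assume x: "x IN P"
   show "cmp P g (ev P M l) x = f x"
    using ev_comp[OF l(1) g x] l(2) ev_arr[OF MN(1,2,3)] ev_arr[OF O MN(2,4)] x by (simp add: compose_def)
  qed
  thus "\<exists>h\<in>mod_hom R P M. cmp P g h = f" using ev_hom(1)[OF l(1)] by blast
 qed
next
 assume P: "P \<in> projectives R"
 hence O: "P \<in> fgm R" unfolding projectives_def by blast
 show "proj P" unfolding proj_def
 proof (intro conjI allI impI O)
  fix A B C i p f assume s: "exact_seq R A B C i p" and f: "f \<in> Homs R P C"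
  note d = exact_seqD[OF s]
  have "ev B C p ` carrier B = carrier C" using d(13) unfolding short_exact_def by blast
  then obtain h where h: "h \<in> mod_hom R P B" "cmp P (ev B C p) h = ev P C f"
   using P d(8,9) ev_hom(1)[OF d(2)] ev_hom(1)[OF f] unfolding projectives_def by blast
  note H = HomsI[OF O d(8) h(1)]
  have "p * arr P B h = f"
  proof (rule ev_eqI[OF Homs_comp[OF H d(2)] f])
   fix x assume x: "x IN P"
   show "ev P C (p * arr P B h) x = ev P C f x"
    using ev_comp[OF H d(2) x] ev_arr[OF O d(8) h(1)] fun_cong[OF h(2), of x] x by (simp add: compose_def)
  qed
  thus "\<exists>g\<in>Homs R P B. p * g = f" using H by blast
 qed
qed

lemma free_resolution_step:
 assumes "X \<in> fgm R"
 obtains K P k p n x h where "exact_seq R K P X k p" "dual_basis R P n x h" "proj P"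
proof -
 obtain P n x h p where P: "P \<in> fgm R" "dual_basis R P n x h" "p \<in> mod_hom R P X" "p ` carrier P = carrier X"
  using free_cover[OF R_ring fgmD[OF assms]] by metis
 have "\<forall>z\<in>carrier X. \<exists>y\<in>carrier P. ev P X (arr P X p) y = z"
  unfolding ev_arr[OF P(1) assms P(3)] P(4)[symmetric] by blast
 then obtain K k where "exact_seq R K P X k (arr P X p)" using kernel_exists[OF noeth HomsI[OF P(1) assms P(3)]] by metis
 moreover have "proj P" unfolding proj_iff by (rule dual_basis_projective[OF P(1,2)])
 ultimately show ?thesis using that P by blast
qed

end

sublocale noetherian_modules \<subseteq> exact_category_projectives "fgm R" "Homs R" idm "exact_seq R"
 by unfold_locales (metis free_resolution_step)

context noetherian_modules
begin

lemma proj_rcopy: "proj (rcopy R)"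
proof -
 interpret left_module R "reg R" by (rule reg_left_module[OF R_ring])
 obtain p q where p: "p \<in> mod_hom R (reg R) (rcopy R)" "q \<in> mod_hom R (rcopy R) (reg R)"
   "\<forall>y\<in>carrier (rcopy R). p (q y) = y" using rcopy(2)[OF R_ring] by blast
 have "dual_basis R (reg R) 1 (%_. \<one>\<^sub>R) (%_. \<lambda>x\<in>carrier (reg R). x)"
  unfolding dual_basis_def using mod_hom_idn[OF left_module_axioms] by simp
 from dual_basis_projective[OF rcopy(1)[OF R_ring]
   dual_basis_retract[where r = p and s = q, OF this left_module_axioms fgmD(1)[OF rcopy(1)[OF R_ring]] p]]
 show ?thesis unfolding proj_iff .
qed

text \<open>The coordinates of \<open>f\<close> in a dual basis of \<open>P\<close> are functionals
  on \<open>K\<close>; each extends to \<open>M\<close>, and the extensions are reassembled with the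
  dual basis.\<close>

lemma ext1z_rcopy_proj:
 assumes E: "ext1z X (rcopy R)" and P: "proj P"
 shows "ext1z X P"
 unfolding ext1z_def
proof (intro allI impI)
 fix K M k m f assume s: "exact_seq R K M X k m" and f: "f \<in> Homs R K P"
 note d = exact_seqD[OF s]
 have O: "P \<in> fgm R" using P proj_Ob by auto
 note LP = fgmD(1)[OF O]
 obtain n x h where db: "dual_basis R P n x h" using projective_dual_basis[OF R_ring] P proj_iff by blast
 have xh: "x i IN P" "h i \<in> mod_hom R P (reg R)" if "i < n" for i using db that unfolding dual_basis_def by auto
 have E': "\<forall>f\<in>mod_hom R K (reg R). \<exists>g\<in>mod_hom R M (reg R). \<forall>y\<in>carrier K. g (ev K M k y) = f y"
  using ext1z_extend[OF E s] regular_extension_iff[OF d(1)] by blast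
 have "\<exists>G. G \<in> mod_hom R M (reg R) & (\<forall>y\<in>carrier K. G (ev K M k y) = h i (ev K P f y))" if i: "i < n" for i
  using E'[rule_format, OF hom_compose[OF d(10) ev_hom(1)[OF f] xh(2)[OF i]]] by (auto simp: compose_def)
 then obtain G where G: "\<And>i. i < n ==> G i \<in> mod_hom R M (reg R)"
  "\<And>i y. i < n ==> y IN K ==> G i (ev K M k y) = h i (ev K P f y)" by metis
 let ?g = "\<lambda>m\<in>carrier M. lincomb P n (%i. G i m) x"
 have g: "?g \<in> mod_hom R M P" by (rule lincomb_hom[OF d(11) LP]) (use G xh in auto)
 note gH = HomsI[OF d(8) O g]
 have "arr M P ?g * k = f"
 proof (rule ev_eqI[OF Homs_comp[OF d(1) gH] f])
  fix y assume y: "y IN K"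
  have "ev K P (arr M P ?g * k) y = lincomb P n (%i. G i (ev K M k y)) x"
   using ev_comp[OF d(1) gH y] ev_arr[OF d(8) O g] ev_closed[OF d(1) y] by simp
  also have "\<dots> = lincomb P n (%i. h i (ev K P f y)) x" using G(2)[OF _ y] by (intro lincomb_cong) auto
  also have "\<dots> = ev K P f y" using db ev_closed[OF f y] unfolding dual_basis_def by metis
  finally show "ev K P (arr M P ?g * k) y = ev K P f y" .
 qed
 thus "\<exists>g\<in>Homs R M P. g * k = f" using gH by blast
qed

end

sublocale noetherian_modules \<subseteq> exact_category_regular "fgm R" "Homs R" idm "exact_seq R" "rcopy R"
 by unfold_locales (auto intro: rcopy(1) R_ring ext1z_rcopy_proj)

section \<open>Ext groups and the abstract vanishing predicate\<close>

context noetherian_modules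
begin

text \<open>\<open>ext_group\<close> takes its resolution from \<open>SOME\<close>, so existence is
  what makes the chosen triple a resolution. It is found by covering successive kernels, each
  realized as a submodule of the preceding cover.\<close>

lemma projective_resolution_exists:
 assumes X: "X \<in> fgm R"
 shows "\<exists>P d e. projective_resolution R X P d e"
proof -
 define cov where "cov K = (SOME q. fst q \<in> projectives R & snd q \<in> mod_hom R (fst q) K & snd q ` carrier (fst q) = carrier K)" for K :: "'a fg_module"
 have cov: "fst (cov K) \<in> projectives R & snd (cov K) \<in> mod_hom R (fst (cov K)) K & snd (cov K) ` carrier (fst (cov K)) = carrier K"
  if K: "K \<in> fgm R" for K
 proof -
  obtain F n e h p where "F \<in> fgm R" "dual_basis R F n e h" "p \<in> mod_hom R F K" "p ` carrier F = carrier K"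
   using free_cover[OF R_ring fgmD[OF K]] by metis
  hence "\<exists>q. fst q \<in> projectives R & snd q \<in> mod_hom R (fst q) K & snd q ` carrier (fst q) = carrier K"
   using dual_basis_projective[of F R n e h] by (intro exI[of _ "(F, p)"]) simp
  from someI_ex[OF this] show ?thesis unfolding cov_def .
 qed
 define nxt where "nxt K = (fst (cov K))\<lparr>carrier := mod_ker (fst (cov K)) K (snd (cov K))\<rparr>" for K
 have nxt: "nxt K \<in> fgm R" if K: "K \<in> fgm R" for K
 proof -
  have P: "fst (cov K) \<in> fgm R" using cov[OF K] unfolding projectives_def by blast
  show ?thesis unfolding nxt_def
   by (rule submodule_fg[OF noeth P ker_submodule[OF fgmD(1)[OF P] fgmD(1)[OF K]]]) (use cov[OF K] in blast)
 qed
 define K where "K n = (nxt ^^ n) X" for n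
 have K: "K n \<in> fgm R" for n by (induction n) (simp_all add: K_def X nxt)
 let ?P = "%n. fst (cov (K n))" and ?d = "%n. snd (cov (K (Suc n)))"
 have KS: "K (Suc n) = (?P n)\<lparr>carrier := mod_ker (?P n) (K n) (snd (cov (K n)))\<rparr>" for n
  unfolding K_def by (simp add: nxt_def)
 \<comment> \<open>The cover of the kernel \<open>K (Suc n)\<close> serves directly as differential,
   because that kernel shares its operations with \<open>?P n\<close>.\<close>
 have d: "?d n \<in> mod_hom R (?P (Suc n)) (?P n)" for n
 proof -
  have "?d n \<in> mod_hom R (?P (Suc n)) (K (Suc n))" using cov[OF K] by blast
  thus ?thesis unfolding mod_hom_def KS[of n] by (auto simp: mod_ker_def PiE_iff)
 qed
 have im: "?d n ` carrier (?P (Suc n)) = mod_ker (?P n) (K n) (snd (cov (K n)))" for n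
  using cov[OF K[of "Suc n"]] KS[of n] by simp
 have z: "\<zero>\<^sub>(K (Suc n)) = \<zero>\<^sub>(?P n)" for n unfolding KS by simp
 have "projective_resolution R X ?P ?d (snd (cov (K 0)))" unfolding projective_resolution_def
 proof (intro conjI allI)
  show "?P n \<in> projectives R" for n using cov[OF K] by blast
  have "K 0 = X" by (simp add: K_def)
  thus "snd (cov (K 0)) \<in> mod_hom R (?P 0) X" "snd (cov (K 0)) ` carrier (?P 0) = carrier X"
   "?d 0 ` carrier (?P 1) = mod_ker (?P 0) X (snd (cov (K 0)))" using cov[OF K[of 0]] im[of 0] by simp_all
  show "?d (Suc n) ` carrier (?P (Suc (Suc n))) = mod_ker (?P (Suc n)) (?P n) (?d n)" for n
   using im[of "Suc n"] z[of n] by (simp add: mod_ker_def)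
 qed (rule d)
 thus ?thesis by blast
qed

text \<open>The cosets of the quotient record are computed by hand. The key is \<open>cB\<close>,
  that translation by a coboundary permutes the coboundaries, and conversely a cocycle whose coset
  is trivial is seen to be a coboundary by adding it to zero.\<close>

lemma
 fixes Y :: "('a, 'c) module" and n :: nat
 assumes P: "projective_resolution R X P d e" and Y: "lmod R Y"
 defines "G \<equiv> (hom_group R (P (Suc n)) Y)\<lparr>carrier := cocycles R P d Y (Suc n)\<rparr> Mod coboundaries R P d Y (Suc n)"
 shows ext_group_trivial: "carrier G = {\<one>\<^sub>G} \<longleftrightarrow> cocycles R P d Y (Suc n) \<subseteq> coboundaries R P d Y (Suc n)"
  and ext_group_one: "\<one>\<^sub>G IN G"
proof -
 interpret Y: left_module R Y by (rule Y)
 let ?Z = "cocycles R P d Y (Suc n)" and ?B = "coboundaries R P d Y (Suc n)"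
 let ?X = "carrier (P (Suc n))"
 have Pn: "P m \<in> fgm R" "d m \<in> mod_hom R (P (Suc m)) (P m)" for m
  using P unfolding projective_resolution_def projectives_def by auto
 note L = fgmD(1)[OF Pn(1)]
 have B: "?B = (%f. compose ?X f (d n)) ` mod_hom R (P n) Y" by (simp add: coboundaries_def)
 have zB: "zero_map (P (Suc n)) Y \<in> ?B" unfolding B by (rule image_eqI[of _ _ "zero_map (P n) Y"])
   (use mod_homD(2)[OF Pn(2)] mod_hom_zero_map[OF L Y] in "auto simp: compose_def zero_map_def fun_eq_iff")
 have Zh: "f \<in> mod_hom R (P (Suc n)) Y" if "f \<in> ?Z" for f using that unfolding cocycles_def by blast
 have zZ: "zero_map (P (Suc n)) Y \<in> ?Z" unfolding cocycles_def
  using mod_hom_zero_map[OF L Y] mod_homD(2)[OF Pn(2)] by (auto simp: compose_def zero_map_def fun_eq_iff)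
 have car: "carrier G = (%z. (%b. \<lambda>x\<in>?X. b x \<oplus>\<^sub>Y z x) ` ?B) ` ?Z" and one: "\<one>\<^sub>G = ?B"
  unfolding G_def FactGroup_def RCOSETS_def r_coset_def by (auto simp: hom_group_def)
 have cB: "(%b. \<lambda>x\<in>?X. b x \<oplus>\<^sub>Y z x) ` ?B = ?B" if z: "z \<in> ?B" for z
 proof -
  have add: "(\<lambda>x\<in>?X. compose ?X f (d n) x \<oplus>\<^sub>Y compose ?X g (d n) x) \<in> ?B"
   if fg: "f \<in> mod_hom R (P n) Y" "g \<in> mod_hom R (P n) Y" for f g
   unfolding B by (rule image_eqI[OF _ mod_hom_add[OF L Y fg]]) (use mod_homD(2)[OF Pn(2)] in "auto simp: compose_def fun_eq_iff")
  obtain f where f: "f \<in> mod_hom R (P n) Y" "z = compose ?X f (d n)" using z unfolding B by blast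
  show ?thesis
  proof
   show "(%b. \<lambda>x\<in>?X. b x \<oplus>\<^sub>Y z x) ` ?B \<subseteq> ?B" using add f unfolding B by auto
   show "?B \<subseteq> (%b. \<lambda>x\<in>?X. b x \<oplus>\<^sub>Y z x) ` ?B"
   proof
    fix b assume "b \<in> ?B"
    then obtain g where g: "g \<in> mod_hom R (P n) Y" "b = compose ?X g (d n)" unfolding B by blast
    have m: "(\<lambda>x\<in>carrier (P n). \<ominus>\<^sub>Y f x) \<in> mod_hom R (P n) Y" by (rule mod_hom_minus[OF L Y f(1)])
    let ?c = "\<lambda>x\<in>?X. compose ?X g (d n) x \<oplus>\<^sub>Y compose ?X (\<lambda>x\<in>carrier (P n). \<ominus>\<^sub>Y f x) (d n) x"
    have "b = (\<lambda>x\<in>?X. ?c x \<oplus>\<^sub>Y z x)"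
     using mod_homD(2)[OF Pn(2), of _ n] mod_homD(2)[OF f(1)] mod_homD(2)[OF g(1)]
     by (auto simp: g(2) f(2) compose_def fun_eq_iff Y.M.a_assoc Y.M.l_neg)
    thus "b \<in> (%b. \<lambda>x\<in>?X. b x \<oplus>\<^sub>Y z x) ` ?B" using add[OF g(1) m] by blast
   qed
  qed
 qed
 show "\<one>\<^sub>G IN G" unfolding car one using cB[OF zB] zZ by (intro image_eqI[OF sym])
 show "carrier G = {\<one>\<^sub>G} \<longleftrightarrow> ?Z \<subseteq> ?B"
 proof
  assume t: "carrier G = {\<one>\<^sub>G}"
  show "?Z \<subseteq> ?B"
  proof
   fix z assume z: "z \<in> ?Z"
   have "(%b. \<lambda>x\<in>?X. b x \<oplus>\<^sub>Y z x) ` ?B \<in> {?B}"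
    unfolding t[unfolded one, symmetric] car using z by (rule imageI)
   hence "(%b. \<lambda>x\<in>?X. b x \<oplus>\<^sub>Y z x) ` ?B = ?B" by simp
   moreover have "(\<lambda>x\<in>?X. zero_map (P (Suc n)) Y x \<oplus>\<^sub>Y z x) = z"
    using mod_homD(2)[OF Zh[OF z]] by (intro extensionalityI[OF restrict_extensional mod_homD(1)[OF Zh[OF z]]]) (simp add: zero_map_def)
   ultimately show "z \<in> ?B" using zB imageI[of "zero_map (P (Suc n)) Y" ?B "%b. \<lambda>x\<in>?X. b x \<oplus>\<^sub>Y z x"] by simp
  qed
 next
  assume "?Z \<subseteq> ?B"
  hence "(%b. \<lambda>x\<in>?X. b x \<oplus>\<^sub>Y z x) ` ?B = ?B" if "z \<in> ?Z" for z using cB that by blast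
  hence "(%z. (%b. \<lambda>x\<in>?X. b x \<oplus>\<^sub>Y z x) ` ?B) ` ?Z = (%z. ?B) ` ?Z" by (rule image_cong[OF refl])
  also have "\<dots> = {?B}" using zZ by (rule image_constant)
  finally have "(%z. (%b. \<lambda>x\<in>?X. b x \<oplus>\<^sub>Y z x) ` ?B) ` ?Z = {?B}" .
  thus "carrier G = {\<one>\<^sub>G}" using car one by simp
 qed
qed

text \<open>Cocycles on \<open>P (Suc n)\<close> are the functions induced by homomorphisms out of
  the image of \<open>d n\<close>, and coboundaries are those that extend to \<open>P n\<close>. So
  the Ext group of degree \<open>Suc n\<close> is trivial exactly if homomorphisms extend from the
  (n+1)-st syzygy to \<open>P n\<close>, which is \<open>ext1z\<close> of the n-th syzygy.\<close>

lemma ext_vanishes_iff: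
 fixes Y :: "('a, 'c) module"
 assumes X: "X \<in> fgm R" and Y: "lmod R Y" and Y': "Y' \<in> fgm R"
  and a: "a \<in> mod_hom R Y Y'" and b: "b \<in> mod_hom R Y' Y"
  and ba: "\<forall>y\<in>carrier Y. b (a y) = y" and ab: "\<forall>y\<in>carrier Y'. a (b y) = y"
 shows "ext_vanishes R (Suc n) X Y \<longleftrightarrow> extz n X Y'"
proof -
 obtain P d e where e: "(SOME (P, d, e). projective_resolution R X P d e) = (P, d, e)" by (metis prod_cases3)
 have ex: "\<exists>q. case q of (P, d, e) => projective_resolution R X P d e" using projective_resolution_exists[OF X] by auto
 have PR: "projective_resolution R X P d e" using someI_ex[OF ex] e by simp
 have Pn: "P m \<in> projectives R" "P m \<in> fgm R" "d m \<in> mod_hom R (P (Suc m)) (P m)" for m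
  using PR unfolding projective_resolution_def projectives_def by auto
 have ed: "e \<in> mod_hom R (P 0) X" "e ` carrier (P 0) = carrier X" "d 0 ` carrier (P 1) = mod_ker (P 0) X e"
  "\<And>n. d (Suc n) ` carrier (P (Suc (Suc n))) = mod_ker (P (Suc n)) (P n) (d n)"
  using PR unfolding projective_resolution_def by auto
 note L = fgmD(1)[OF Pn(2)] and LX = fgmD(1)[OF X] and LY' = fgmD(1)[OF Y']
 have sub: "submodule (d m ` carrier (P (Suc m))) R (P m)" for m
  by (rule image_submodule[OF L L Pn(3) left_module.carrier_submodule[OF L]])
 \<comment> \<open>\<open>K m\<close> is the m-th syzygy of the chosen resolution, with
   \<open>K 0 = X\<close>, and \<open>q m\<close> is the cover of it by \<open>P m\<close>.\<close>
 define K where "K m = (case m of 0 => X | Suc j => (P j)\<lparr>carrier := d j ` carrier (P (Suc j))\<rparr>)" for m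
 define q where "q m = (case m of 0 => e | Suc j => d j)" for m
 have K0: "K 0 = X" and KS: "\<And>j. K (Suc j) = (P j)\<lparr>carrier := d j ` carrier (P (Suc j))\<rparr>" by (simp_all add: K_def)
 have q0: "q 0 = e" and qS: "\<And>j. q (Suc j) = d j" by (simp_all add: q_def)
 have K: "K m \<in> fgm R" for m by (cases m) (use X submodule_fg[OF noeth Pn(2) sub] in "simp_all add: K0 KS")
 note LK = fgmD(1)[OF K]
 have q: "q m \<in> mod_hom R (P m) (K m)" "q m ` carrier (P m) = carrier (K m)" for m
 proof -
  show "q m ` carrier (P m) = carrier (K m)" by (cases m) (simp_all add: K0 KS q0 qS ed)
  show "q m \<in> mod_hom R (P m) (K m)"
  proof (cases m)
   case (Suc j)
   show ?thesis unfolding Suc qS KS by (rule mod_homI) (use mod_homD[OF Pn(3)[of j]] in auto)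
  qed (simp add: K0 q0 ed)
 qed
 have inc: "(\<lambda>x\<in>carrier (K (Suc m)). x) \<in> mod_hom R (K (Suc m)) (P m)" for m
  using mod_hom_inclusion[OF L sub[of m]] unfolding KS by simp
 have ker: "d m ` carrier (P (Suc m)) = mod_ker (P m) (K m) (q m)" for m
 proof (cases m)
  case 0 thus ?thesis using ed(3) by (simp add: K0 q0)
 next
  case (Suc j) thus ?thesis using ed(4)[of j] by (simp add: KS qS mod_ker_def)
 qed
 have ses: "exact_seq R (K (Suc m)) (P m) (K m) (arr (K (Suc m)) (P m) (\<lambda>x\<in>carrier (K (Suc m)). x)) (arr (P m) (K m) (q m))" for m
 proof (rule exact_seqI[OF K Pn(2) K])
  show "short_exact R (K (Suc m)) (P m) (K m) (\<lambda>x\<in>carrier (K (Suc m)). x) (q m)"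
   unfolding short_exact_def
   using inc[of m] q[of m] ker[of m, symmetric] by (simp add: KS inj_on_def image_restrict_eq)
 qed
 have pr: "proj (P m)" for m using Pn(1) proj_iff by blast
 have "extz n X Y' \<longleftrightarrow> extz (n - m) (K m) Y'" if "m \<le> n" for m using that
 proof (induction m)
  case 0 thus ?case by (simp add: K0)
 next
  case (Suc m)
  have "extz (Suc (n - Suc m)) (K m) Y' \<longleftrightarrow> extz (n - Suc m) (K (Suc m)) Y'" by (rule extz_syzygy[OF ses pr])
  thus ?case using Suc by (simp add: Suc_diff_Suc)
 qed
 from this[of n] have 1: "extz n X Y' \<longleftrightarrow> ext1z (K n) Y'" by simp
 let ?K = "K (Suc n)" and ?k = "arr (K (Suc n)) (P n) (\<lambda>x\<in>carrier (K (Suc n)). x)"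
 note kH = HomsI[OF K Pn(2) inc[of n]] and ke = ev_arr[OF K Pn(2) inc[of n]]
 have 2: "ext1z (K n) Y' \<longleftrightarrow> (\<forall>f\<in>mod_hom R ?K Y. \<exists>g\<in>mod_hom R (P n) Y. \<forall>x\<in>carrier ?K. g x = f x)"
  using ext1z_extend[OF _ ses] ext1z_proj_test[OF ses pr] copy_extension_iff[OF kH Y' a b ba ab] ke by auto
 have dK: "d n x \<in> carrier ?K" if "x IN (P (Suc n))" for x using that by (simp add: KS)
 have 3: "(\<forall>f\<in>mod_hom R ?K Y. \<exists>g\<in>mod_hom R (P n) Y. \<forall>x\<in>carrier ?K. g x = f x) \<longleftrightarrow> cocycles R P d Y (Suc n) \<subseteq> coboundaries R P d Y (Suc n)"
 proof
  assume E: "\<forall>f\<in>mod_hom R ?K Y. \<exists>g\<in>mod_hom R (P n) Y. \<forall>x\<in>carrier ?K. g x = f x"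
  show "cocycles R P d Y (Suc n) \<subseteq> coboundaries R P d Y (Suc n)"
  proof
   fix z assume "z \<in> cocycles R P d Y (Suc n)"
   hence z: "z \<in> mod_hom R (P (Suc n)) Y" "cmp (P (Suc (Suc n))) z (d (Suc n)) = zero_map (P (Suc (Suc n))) Y"
    unfolding cocycles_def by auto
   have zk: "z x = \<zero>\<^sub>Y" if x: "x IN (P (Suc n))" "q (Suc n) x = \<zero>\<^sub>?K" for x
   proof -
    have "x \<in> d (Suc n) ` carrier (P (Suc (Suc n)))" unfolding ker[of "Suc n"] mod_ker_def using x by blast
    then obtain y where y: "y IN (P (Suc (Suc n)))" "x = d (Suc n) y" by blast
    thus ?thesis using fun_cong[OF z(2), of y] by (simp add: compose_def zero_map_def)
   qed
   have "\<exists>f\<in>mod_hom R ?K Y. \<forall>x\<in>carrier (P (Suc n)). f (q (Suc n) x) = z x"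
    by (rule factor_surjective[OF L LK Y q(1) q(2) z(1)]) (rule zk)
   then obtain f where f: "f \<in> mod_hom R ?K Y" "\<forall>x\<in>carrier (P (Suc n)). f (d n x) = z x" unfolding qS by blast
   obtain g where g: "g \<in> mod_hom R (P n) Y" "\<forall>x\<in>carrier ?K. g x = f x" using E f(1) by blast
   have "z = cmp (P (Suc n)) g (d n)"
    by (rule mod_hom_eqI[OF z(1) hom_compose[OF L Pn(3) g(1)]]) (use g(2) dK f(2) in "simp add: compose_def")
   thus "z \<in> coboundaries R P d Y (Suc n)" using g(1) by (auto simp: coboundaries_def)
  qed
 next
  assume ZB: "cocycles R P d Y (Suc n) \<subseteq> coboundaries R P d Y (Suc n)"
  show "\<forall>f\<in>mod_hom R ?K Y. \<exists>g\<in>mod_hom R (P n) Y. \<forall>x\<in>carrier ?K. g x = f x"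
  proof
   fix f assume f: "f \<in> mod_hom R ?K Y"
   let ?z = "cmp (P (Suc n)) f (q (Suc n))"
   have z: "?z \<in> mod_hom R (P (Suc n)) Y" by (rule hom_compose[OF L q(1) f])
   have "?z \<in> cocycles R P d Y (Suc n)" unfolding cocycles_def
   proof (intro CollectI conjI z mod_hom_eqI[OF hom_compose[OF L Pn(3) z] mod_hom_zero_map[OF L Y]])
    fix x assume x: "x IN (P (Suc (Suc n)))"
    have dx: "d (Suc n) x IN (P (Suc n))" using mod_homD(2)[OF Pn(3) x] .
    have "d (Suc n) x \<in> mod_ker (P (Suc n)) ?K (q (Suc n))" unfolding ker[symmetric] using x by blast
    hence "q (Suc n) (d (Suc n) x) = \<zero>\<^sub>?K" unfolding mod_ker_def by blast
    thus "cmp (P (Suc (Suc n))) ?z (d (Suc n)) x = zero_map (P (Suc (Suc n))) Y x"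
     using x dx mod_hom_zero[OF LK Y f] by (simp add: compose_def zero_map_def)
   qed
   then obtain g where g: "g \<in> mod_hom R (P n) Y" "?z = cmp (P (Suc n)) g (d n)"
    using ZB by (auto simp: coboundaries_def)
   have "g y = f y" if y: "y \<in> carrier ?K" for y
   proof -
    obtain x where x: "x IN (P (Suc n))" "y = d n x" using y by (auto simp: KS)
    show ?thesis using fun_cong[OF g(2), of x] x by (simp add: compose_def qS)
   qed
   thus "\<exists>g\<in>mod_hom R (P n) Y. \<forall>x\<in>carrier ?K. g x = f x" using g(1) by blast
  qed
 qed
 have "ext_vanishes R (Suc n) X Y \<longleftrightarrow> cocycles R P d Y (Suc n) \<subseteq> coboundaries R P d Y (Suc n)"
  using ext_group_trivial[OF PR Y, of n] unfolding ext_vanishes_def ext_group_def e by (simp add: Let_def)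
 thus ?thesis using 1 2 3 by blast
qed

lemma ext_one_closed:
 fixes Y :: "('a, 'c) module"
 assumes X: "X \<in> fgm R" and Y: "lmod R Y"
 shows "\<one>\<^sub>(ext_group R (Suc n) X Y) IN (ext_group R (Suc n) X Y)"
proof -
 obtain P d e where e: "(SOME (P, d, e). projective_resolution R X P d e) = (P, d, e)" by (metis prod_cases3)
 have ex: "\<exists>q. case q of (P, d, e) => projective_resolution R X P d e" using projective_resolution_exists[OF X] by auto
 have PR: "projective_resolution R X P d e" using someI_ex[OF ex] e by simp
 show ?thesis using ext_group_one[OF PR Y, of n] unfolding ext_group_def e by (simp add: Let_def)
qed

lemma CM_iff: "X \<in> CM R \<longleftrightarrow> cm X"
proof -
 obtain a b where ab: "a \<in> mod_hom R (reg R) (rcopy R)" "b \<in> mod_hom R (rcopy R) (reg R)"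
  "\<forall>x\<in>carrier (reg R). b (a x) = x" "\<forall>y\<in>carrier (rcopy R). a (b y) = y" using rcopy(2)[OF R_ring] by auto
 have "ext_vanishes R (Suc n) X (reg R) \<longleftrightarrow> extz n X (rcopy R)" if "X \<in> fgm R" for n
  by (rule ext_vanishes_iff[OF that reg_left_module[OF R_ring] rcopy(1)[OF R_ring] ab])
 thus ?thesis unfolding CM_def cm_def by (auto simp: Suc_le_eq gr0_conv_Suc)
qed

section \<open>Bounded Ext from finite injective dimension\<close>

lemma extz_funpow: "extz n X Y \<longleftrightarrow> ext1z ((syz ^^ n) X) Y"
 by (induction n arbitrary: X) (simp_all add: funpow_swap1)

lemma ext1z_injective:
 assumes "I \<in> injectives R" shows "ext1z X I" unfolding ext1z_def
proof (intro allI impI)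
 fix K M k m f assume s: "exact_seq R K M X k m" and f: "f \<in> Homs R K I"
 note d = exact_seqD[OF s]
 have O: "I \<in> fgm R" using assms unfolding injectives_def by blast
 have "inj_on (ev K M k) (carrier K)" using d(13) unfolding short_exact_def by blast
 then obtain h where h: "h \<in> mod_hom R M I" "cmp K h (ev K M k) = ev K I f"
  using assms d(7,8) ev_hom(1)[OF d(1)] ev_hom(1)[OF f] unfolding injectives_def by blast
 note H = HomsI[OF d(8) O h(1)]
 have "arr M I h * k = f"
 proof (rule ev_eqI[OF Homs_comp[OF d(1) H] f])
  fix x assume x: "x IN K"
  show "ev K I (arr M I h * k) x = ev K I f x"
   using ev_comp[OF d(1) H x] ev_arr[OF d(8) O h(1)] fun_cong[OF h(2), of x] x by (simp add: compose_def)
 qed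
 thus "\<exists>g\<in>Homs R M I. g * k = f" using H by blast
qed

text \<open>Dimension shift in the second variable: with \<open>Z i\<close> the kernel of
  \<open>d i\<close>, the ring is a retract of \<open>Z 0\<close>, the module
  \<open>Z (Suc n)\<close> is zero, and \<open>ext1z_right_kernel\<close> passes from
  \<open>Z (Suc i)\<close> to \<open>Z i\<close> at the cost of one degree.\<close>

lemma Reg_extz_of_injective_dimension:
 assumes "finite_injective_dimension R (reg R)"
 shows "\<exists>d. \<forall>X\<in>fgm R. \<forall>n\<ge>d. extz n X (rcopy R)"
proof -
 obtain n and I :: "nat => 'a fg_module" and d e where
  *: "(\<forall>i. I i \<in> injectives R & d i \<in> mod_hom R (I i) (I (Suc i))) &
    e \<in> mod_hom R (reg R) (I 0) & inj_on e (carrier (reg R)) &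
    e ` carrier (reg R) = mod_ker (I 0) (I 1) (d 0) &
    (\<forall>i. d i ` carrier (I i) = mod_ker (I (Suc i)) (I (Suc (Suc i))) (d (Suc i))) &
    (\<forall>i>n. carrier (I i) = {\<zero>\<^sub>(I i)})"
  using assms unfolding finite_injective_dimension_def injective_dimension_le_def by (elim exE)
 note * = *[THEN conjunct1, rule_format] *[THEN conjunct2]
 note c = *(2)[THEN conjunct2, THEN conjunct2]
 have I: "\<And>i. I i \<in> injectives R" "\<And>i. d i \<in> mod_hom R (I i) (I (Suc i))"
  and e: "e \<in> mod_hom R (reg R) (I 0)" "inj_on e (carrier (reg R))"
   "e ` carrier (reg R) = mod_ker (I 0) (I 1) (d 0)"
  using *(1) *(2)[THEN conjunct1] *(2)[THEN conjunct2, THEN conjunct1] c[THEN conjunct1] by blast+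
 note ex = c[THEN conjunct2, THEN conjunct1, rule_format]
 note z = c[THEN conjunct2, THEN conjunct2, rule_format]
 have fg: "I i \<in> fgm R" for i using I(1) unfolding injectives_def by blast
 note L = fgmD(1)[OF fg]
 define Z where "Z i = (I i)\<lparr>carrier := mod_ker (I i) (I (Suc i)) (d i)\<rparr>" for i
 note sub = ker_submodule[OF L L I(2)]
 have Z: "Z i \<in> fgm R" for i unfolding Z_def by (rule submodule_fg[OF noeth fg sub])
 note LZ = fgmD(1)[OF Z]
 have inc: "(\<lambda>x\<in>carrier (Z i). x) \<in> mod_hom R (Z i) (I i)" for i
  using mod_hom_inclusion[OF L sub] unfolding Z_def by simp
 have dZ: "d i \<in> mod_hom R (I i) (Z (Suc i))" for i
 proof (rule mod_homI)
  show "d i x IN (Z (Suc i))" if "x IN (I i)" for x using ex[of i] that by (auto simp: Z_def)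
 qed (use mod_homD[OF I(2)[of i]] in "auto simp: Z_def")
 have ses: "exact_seq R (Z i) (I i) (Z (Suc i)) (arr (Z i) (I i) (\<lambda>x\<in>carrier (Z i). x)) (arr (I i) (Z (Suc i)) (d i))" for i
 proof (rule exact_seqI[OF Z fg Z])
  show "short_exact R (Z i) (I i) (Z (Suc i)) (\<lambda>x\<in>carrier (Z i). x) (d i)"
   unfolding short_exact_def using inc dZ ex[of i] by (auto simp: Z_def inj_on_def mod_ker_def)
 qed
 \<comment> \<open>\<open>j\<close> counts the steps back from the zero module
   \<open>Z (Suc n)\<close>; at \<open>j = Suc n\<close> the induction reaches
   \<open>Z 0\<close>.\<close>
 have main: "j \<le> Suc n ==> X \<in> fgm R ==> m \<ge> j ==> extz m X (Z (Suc n - j))" for j X m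
 proof (induction j arbitrary: X m)
  case 0
  have c: "carrier (Z (Suc n)) = {\<zero>\<^sub>(Z (Suc n))}"
   using z[of "Suc n"] mod_hom_zero[OF L L I(2)] by (auto simp: Z_def mod_ker_def)
  have "ext1z W (Z (Suc n))" for W unfolding ext1z_def
  proof (intro allI impI)
   fix K M k m f assume s: "exact_seq R K M W k m" and f: "f \<in> Homs R K (Z (Suc n))"
   note dd = exact_seqD[OF s]
   have "f = 0" using ev_closed[OF f] c ev_zero[OF dd(7) Z] by (intro ev_eqI[OF f Homs_zero[OF dd(7) Z]]) auto
   thus "\<exists>g\<in>Homs R M (Z (Suc n)). g * k = f" using Homs_zero[OF dd(8) Z] by (intro bexI[of _ 0]) auto
  qed
  thus ?case by (simp add: extz_funpow)
 next
  case (Suc j)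
  then obtain m' where m': "m = Suc m'" by (cases m) auto
  let ?i = "Suc n - Suc j"
  have i: "Suc ?i = Suc n - j" using Suc.prems(1) by simp
  let ?X = "(syz ^^ m') X"
  have OX: "?X \<in> fgm R" using Suc.prems(2) by (induction m') (auto intro: syz_Ob)
  obtain P k p where P: "exact_seq R (syz ?X) P ?X k p" "proj P" using syz_ses[OF OX] by metis
  have "extz m' X (Z (Suc ?i))" unfolding i using Suc.IH[OF _ Suc.prems(2)] Suc.prems m' by simp
  hence "ext1z ?X (Z (Suc ?i))" unfolding extz_funpow .
  hence "ext1z (syz ?X) (Z ?i)" using ext1z_right_kernel[OF ses P] ext1z_injective[OF I(1)] by blast
  thus ?case unfolding m' extz_funpow by simp
 qed
 obtain a b where a: "a \<in> mod_hom R (reg R) (rcopy R)" and b: "b \<in> mod_hom R (rcopy R) (reg R)"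
  and ab: "\<forall>x\<in>carrier (reg R). b (a x) = x" "\<forall>y\<in>carrier (rcopy R). a (b y) = y"
  using rcopy(2)[OF R_ring] by auto
 note RC = rcopy(1)[OF R_ring] and LR = reg_left_module[OF R_ring]
 have eZ: "e \<in> mod_hom R (reg R) (Z 0)"
 proof (rule mod_homI)
  show "e x IN (Z 0)" if "x IN (reg R)" for x using e(3) that by (simp add: Z_def) blast
 qed (use mod_homD[OF e(1)] in "auto simp: Z_def")
 have eZs: "e ` carrier (reg R) = carrier (Z 0)" using e(3) by (simp add: Z_def)
 have "\<exists>g\<in>mod_hom R (Z 0) (reg R). \<forall>x\<in>carrier (reg R). g (e x) = (\<lambda>x\<in>carrier (reg R). x) x"
 proof (rule factor_surjective[OF LR LZ LR eZ eZs mod_hom_idn[OF LR]])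
  fix x assume x: "x IN (reg R)" "e x = \<zero>\<^sub>(Z 0)"
  have "e \<zero>\<^sub>(reg R) = \<zero>\<^sub>(Z 0)" by (rule mod_hom_zero[OF LR LZ eZ])
  hence "x = \<zero>\<^sub>(reg R)" using x e(2) left_module.submoduleD(2)[OF LR left_module.carrier_submodule[OF LR]]
   by (metis inj_onD)
  thus "(\<lambda>x\<in>carrier (reg R). x) x = \<zero>\<^sub>(reg R)" using x by simp
 qed
 then obtain g where g: "g \<in> mod_hom R (Z 0) (reg R)" "\<forall>x\<in>carrier (reg R). g (e x) = x" by auto
 let ?s = "cmp (rcopy R) e b" and ?r = "cmp (Z 0) a g"
 have s: "?s \<in> mod_hom R (rcopy R) (Z 0)" by (rule hom_compose[OF fgmD(1)[OF RC] b eZ])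
 have r: "?r \<in> mod_hom R (Z 0) (rcopy R)" by (rule hom_compose[OF LZ g(1) a])
 have bc: "b y IN (reg R)" if "y IN (rcopy R)" for y using mod_homD(2)[OF b that] .
 note sH = HomsI[OF RC Z s] and rH = HomsI[OF Z RC r]
 have rs: "arr (Z 0) (rcopy R) ?r * arr (rcopy R) (Z 0) ?s = idm (rcopy R)"
 proof (rule ev_eqI[OF Homs_comp[OF sH rH] Homs_idm[OF RC]])
  fix y assume y: "y IN (rcopy R)"
  show "ev (rcopy R) (rcopy R) (arr (Z 0) (rcopy R) ?r * arr (rcopy R) (Z 0) ?s) y = ev (rcopy R) (rcopy R) (idm (rcopy R)) y"
   using ev_comp[OF sH rH y] ev_arr[OF RC Z s] ev_arr[OF Z RC r] ev_idm[OF RC y] y g(2) bc[OF y] ab(2)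
    mod_homD(2)[OF eZ bc[OF y]] by (simp add: compose_def del: regular_simps)
 qed
 have "extz m X (rcopy R)" if "X \<in> fgm R" "m \<ge> Suc n" for X m
  using extz_retract_right[OF sH rH rs] main[of "Suc n" X m] that by simp
 thus ?thesis by blast
qed

end

section \<open>Duality over Gorenstein rings\<close>

lemma opposite_simps [simp]:
 "carrier (opposite_ring R) = carrier R" "\<zero>\<^sub>(opposite_ring R) = \<zero>\<^sub>R" "\<one>\<^sub>(opposite_ring R) = \<one>\<^sub>R"
 "x \<oplus>\<^sub>(opposite_ring R) y = x \<oplus>\<^sub>R y" "x \<otimes>\<^sub>(opposite_ring R) y = y \<otimes>\<^sub>R x"
 by (simp_all add: opposite_ring_def)

lemma opposite_ring: assumes "ring R" shows "ring (opposite_ring R)"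
proof -
 interpret ring R by fact
 have "abelian_group (opposite_ring R)"
  by (rule abelian_groupI) (auto simp: a_assoc intro: a_comm l_neg add.m_comm exI[of _ "\<ominus>\<^sub>R _"] bexI[of _ "\<ominus>\<^sub>R _"])
 moreover have "Group.monoid (opposite_ring R)" by (rule monoidI) (auto simp: m_assoc)
 ultimately show ?thesis by (rule ringI) (auto simp: l_distr r_distr)
qed

lemma lincomb_carrier_update: "lincomb (M\<lparr>carrier := H\<rparr>) n r x = lincomb M n r x"
 by (induction n) auto

definition dual :: "'a ring => ('a, 'b) module => ('a, 'b => 'a) module" where
 "dual R X = \<lparr>carrier = mod_hom R X (reg R), monoid.mult = (%_ _. zero_map X (reg R)),
   monoid.one = zero_map X (reg R), ring.zero = zero_map X (reg R),
   ring.add = (%f g. \<lambda>x\<in>carrier X. f x \<oplus>\<^sub>R g x), smult = (%c f. \<lambda>x\<in>carrier X. f x \<otimes>\<^sub>R c)\<rparr>"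

lemma dual_simps [simp]:
 "carrier (dual R X) = mod_hom R X (reg R)" "\<zero>\<^sub>(dual R X) = zero_map X (reg R)"
 "f \<oplus>\<^sub>(dual R X) g = (\<lambda>x\<in>carrier X. f x \<oplus>\<^sub>R g x)" "c \<odot>\<^sub>(dual R X) f = (\<lambda>x\<in>carrier X. f x \<otimes>\<^sub>R c)"
 by (simp_all add: dual_def)

context
 fixes R :: "'a ring" and X :: "('a, 'b) module"
 assumes R: "ring R" and X: "lmod R X"
begin

interpretation R: ring R by (rule R)

lemma functional_closed: "f \<in> mod_hom R X (reg R) ==> x IN X ==> f x IN R"
 using mod_homD(2) by fastforce

lemma dual_smult_closed:
 assumes c: "c IN R" and f: "f \<in> mod_hom R X (reg R)"
 shows "(\<lambda>x\<in>carrier X. f x \<otimes>\<^sub>R c) \<in> mod_hom R X (reg R)"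
 by (rule hom_restrict[OF X])
  (simp_all add: c functional_closed[OF f] mod_homD(3,4)[OF f] R.l_distr R.m_assoc)

lemma dual_left_module: "lmod (opposite_ring R) (dual R X)"
proof (rule left_moduleI[OF opposite_ring[OF R]])
 note RM = reg_left_module[OF R]
 show "\<zero>\<^sub>(dual R X) IN (dual R X)" using mod_hom_zero_map[OF X RM] by simp
 show "f \<oplus>\<^sub>(dual R X) g IN (dual R X)" if "f IN (dual R X)" "g IN (dual R X)" for f g
  using mod_hom_add[OF X RM] that by simp
 show "\<zero>\<^sub>(dual R X) \<oplus>\<^sub>(dual R X) f = f" if "f IN (dual R X)" for f
  using that mod_homD(1)[of f R X] functional_closed
  by (intro extensionalityI[of _ "carrier X"]) (auto simp: zero_map_def)
 show "\<one>\<^sub>(opposite_ring R) \<odot>\<^sub>(dual R X) f = f" if "f IN (dual R X)" for f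
  using that mod_homD(1)[of f R X] functional_closed by (intro extensionalityI[of _ "carrier X"]) auto
qed (auto simp: fun_eq_iff functional_closed dual_smult_closed R.a_assoc R.l_distr R.r_distr R.m_assoc zero_map_def
   intro: R.a_comm)

lemma dual_lincomb:
 assumes "\<And>i. i < n ==> f i \<in> mod_hom R X (reg R)" "\<And>i. i < n ==> c i IN R"
 shows "lincomb (dual R X) n c f = (\<lambda>x\<in>carrier X. lincomb (reg R) n (%i. f i x) c)"
 using assms by (induction n) (auto simp: zero_map_def fun_eq_iff)

text \<open>The dual embeds into a free right module by evaluation at generators.\<close>

lemma dual_generators:
 assumes fg: "finitely_generated R X" and N: "left_noetherian (opposite_ring R)"
 shows "\<exists>m \<phi>. (\<forall>j<m. \<phi> j \<in> mod_hom R X (reg R)) &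
  (\<forall>f\<in>mod_hom R X (reg R). \<exists>c. (\<forall>j<m. c j IN R) & f = lincomb (dual R X) m c \<phi>)"
proof -
 let ?S = "opposite_ring R"
 interpret D: left_module ?S "dual R X" by (rule dual_left_module)
 obtain n x where x: "\<And>i. i < n ==> x i IN X"
  and gen: "\<And>m. m IN X ==> \<exists>r \<in> {..<n} \<rightarrow>\<^sub>E carrier R. m = lincomb X n r x"
  using finitely_generated_lincomb[OF X fg] by blast
 let ?F = "free_module ?S n"
 note LF = free_left_module[OF opposite_ring[OF R], of n]
 interpret F: left_module ?S ?F by (rule LF)
 let ?e = "\<lambda>f\<in>carrier (dual R X). \<lambda>i\<in>{..<n}. f (x i)"
 have e: "?e \<in> mod_hom ?S (dual R X) ?F"
  by (rule hom_restrict[OF dual_left_module]) (use functional_closed x in "auto simp: fun_eq_iff")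
 have inj: "f = g" if fg: "f IN (dual R X)" "g IN (dual R X)" "?e f = ?e g" for f g
 proof (rule mod_hom_eqI)
  show f: "f \<in> mod_hom R X (reg R)" "g \<in> mod_hom R X (reg R)" using fg by auto
  fix z assume "z IN X"
  then obtain r where r: "r \<in> {..<n} \<rightarrow>\<^sub>E carrier R" "z = lincomb X n r x" using gen by blast
  have "f (x i) = g (x i)" if "i < n" for i using fun_cong[OF fg(3), of i] fg(1,2) that by simp
  hence "lincomb (reg R) n r (%i. f (x i)) = lincomb (reg R) n r (%i. g (x i))" by (intro lincomb_cong) auto
  moreover have "r i IN R" if "i < n" for i using r(1) that by auto
  ultimately show "f z = g z" unfolding r(2)
   using hom_lincomb[OF X reg_left_module[OF R] f(1), of n r x] hom_lincomb[OF X reg_left_module[OF R] f(2), of n r x] x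
   by simp
 qed
 let ?H = "?e ` carrier (dual R X)"
 have H: "submodule ?H ?S ?F" by (rule image_submodule[OF dual_left_module LF e D.carrier_submodule])
 note LH = submodule_left_module[OF LF H]
 note fgH = submodule_finitely_generated[OF N LF free_finitely_generated[OF opposite_ring[OF R]] H]
 obtain m y where y: "\<And>j. j < m ==> y j IN (?F\<lparr>carrier := ?H\<rparr>)"
  and geny: "\<And>v. v IN (?F\<lparr>carrier := ?H\<rparr>) ==> \<exists>c \<in> {..<m} \<rightarrow>\<^sub>E carrier ?S. v = lincomb (?F\<lparr>carrier := ?H\<rparr>) m c y"
  using finitely_generated_lincomb[OF LH fgH] by blast
 note geny = geny[unfolded lincomb_carrier_update]
 have "\<forall>j. \<exists>f. j < m --> f IN (dual R X) & y j = ?e f"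
 proof
  fix j show "\<exists>f. j < m --> f IN (dual R X) & y j = ?e f"
  proof (cases "j < m")
   case True
   hence "y j \<in> ?H" using y by simp
   thus ?thesis by (elim imageE) (intro exI impI conjI)
  qed simp
 qed
 then obtain \<phi> where \<phi>: "\<And>j. j < m ==> \<phi> j IN (dual R X)" "\<And>j. j < m ==> y j = ?e (\<phi> j)" by metis
 show ?thesis
 proof (intro exI[of _ m] exI[of _ \<phi>] conjI allI impI ballI)
  show "\<phi> j \<in> mod_hom R X (reg R)" if "j < m" for j using \<phi>(1)[OF that] by simp
  fix f assume f: "f \<in> mod_hom R X (reg R)"
  hence "?e f IN (?F\<lparr>carrier := ?H\<rparr>)" by simp
  from geny[OF this] obtain c where c: "c \<in> {..<m} \<rightarrow>\<^sub>E carrier ?S" "?e f = lincomb ?F m c y" by (rule bexE)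
  have cc: "c j \<in> carrier ?S" if "j < m" for j using c(1) that by auto
  have "?e (lincomb (dual R X) m c \<phi>) = lincomb ?F m c (%j. ?e (\<phi> j))"
   by (rule hom_lincomb[OF dual_left_module LF e cc \<phi>(1)])
  also have "\<dots> = lincomb ?F m c y" using \<phi>(2) by (intro lincomb_cong) auto
  also have "\<dots> = ?e f" using c(2) by simp
  finally have "lincomb (dual R X) m c \<phi> = f" using inj D.lincomb_closed[OF cc \<phi>(1)] f by simp
  thus "\<exists>c. (\<forall>j<m. c j IN R) & f = lincomb (dual R X) m c \<phi>" using cc by (intro exI[of _ c]) auto
 qed
qed

lemma dual_finitely_generated:
 assumes fg: "finitely_generated R X" and N: "left_noetherian (opposite_ring R)"
 shows "finitely_generated (opposite_ring R) (dual R X)"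
proof -
 obtain m \<phi> where "\<forall>j<m. \<phi> j \<in> mod_hom R X (reg R)"
  "\<forall>f\<in>mod_hom R X (reg R). \<exists>c. (\<forall>j<m. c j IN R) & f = lincomb (dual R X) m c \<phi>"
  using dual_generators[OF assms] by blast
 thus ?thesis by (intro finitely_generated_lincombI[OF dual_left_module, of m \<phi>]) auto
qed

lemma functional_dual_basis:
 assumes d: "dual_basis R X n x h" and f: "f \<in> mod_hom R X (reg R)"
 shows "f = lincomb (dual R X) n (%i. f (x i)) h"
proof -
 have x: "x i IN X" "h i \<in> mod_hom R X (reg R)" if "i < n" for i using d that unfolding dual_basis_def by auto
 have hc: "h i p IN R" if "i < n" "p IN X" for i p by (rule functional_closed[OF x(2)[OF that(1)] that(2)])
 have "lincomb (dual R X) n (%i. f (x i)) h = (\<lambda>p\<in>carrier X. lincomb (reg R) n (%i. h i p) (%i. f (x i)))"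
  by (rule dual_lincomb) (use x functional_closed[OF f] in auto)
 also have "\<dots> = f"
 proof (rule extensionalityI[OF restrict_extensional mod_homD(1)[OF f]])
  fix p assume p: "p IN X"
  have "lincomb (reg R) n (%i. h i p) (%i. f (x i)) = f (lincomb X n (%i. h i p) x)"
   using hom_lincomb[OF X reg_left_module[OF R] f, of n "%i. h i p" x] hc x p by simp
  thus "(\<lambda>p\<in>carrier X. lincomb (reg R) n (%i. h i p) (%i. f (x i))) p = f p"
   using d p unfolding dual_basis_def by simp
 qed
 finally show ?thesis by simp
qed

lemma dual_dual_basis:
 assumes d: "dual_basis R X n x h"
 shows "dual_basis (opposite_ring R) (dual R X) n h (%i. \<lambda>f\<in>carrier (dual R X). f (x i))"
 unfolding dual_basis_def
proof (intro conjI allI impI ballI)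
 have x: "x i IN X" "h i \<in> mod_hom R X (reg R)" if "i < n" for i using d that unfolding dual_basis_def by auto
 show "h i IN (dual R X)" if "i < n" for i using x that by simp
 show "(\<lambda>f\<in>carrier (dual R X). f (x i)) \<in> mod_hom (opposite_ring R) (dual R X) (reg (opposite_ring R))" if "i < n" for i
  by (rule hom_restrict[OF dual_left_module]) (use x that functional_closed in auto)
 show "f = lincomb (dual R X) n (%i. (\<lambda>f\<in>carrier (dual R X). f (x i)) f) h" if "f IN (dual R X)" for f
  using functional_dual_basis[OF d] that by simp
qed

text \<open>Expanding \<open>f\<close> in the dual basis shows that the point is the combination of
  the \<open>x i\<close> with coefficients the values of the functional at the
  \<open>h i\<close>.\<close>

lemma dual_basis_reflexive:
 assumes d: "dual_basis R X n x h" and s: "\<psi> \<in> mod_hom (opposite_ring R) (dual R X) (reg (opposite_ring R))"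
 shows "\<exists>p\<in>carrier X. \<forall>f\<in>mod_hom R X (reg R). \<psi> f = f p"
proof (intro bexI ballI)
 interpret X: left_module R X by (rule X)
 have x: "x i IN X" "h i \<in> mod_hom R X (reg R)" if "i < n" for i using d that unfolding dual_basis_def by auto
 have sc: "\<psi> (h i) IN R" if "i < n" for i using mod_homD(2)[OF s, of "h i"] x that by simp
 show "lincomb X n (%i. \<psi> (h i)) x IN X" by (rule X.lincomb_closed) (use x sc in auto)
 fix f assume f: "f \<in> mod_hom R X (reg R)"
 have "\<psi> f = \<psi> (lincomb (dual R X) n (%i. f (x i)) h)" using functional_dual_basis[OF d f] by simp
 also have "\<dots> = lincomb (reg (opposite_ring R)) n (%i. f (x i)) (%i. \<psi> (h i))"
  by (rule hom_lincomb[OF dual_left_module reg_left_module[OF opposite_ring[OF R]] s])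
   (use x functional_closed[OF f] in auto)
 also have "\<dots> = lincomb (reg R) n (%i. \<psi> (h i)) (%i. f (x i))" by (induction n) auto
 also have "\<dots> = f (lincomb X n (%i. \<psi> (h i)) x)"
  by (rule hom_lincomb[OF X reg_left_module[OF R] f, symmetric]) (use x sc in auto)
 finally show "\<psi> f = f (lincomb X n (%i. \<psi> (h i)) x)" .
qed

end

section \<open>Torsionless modules and duality over a two-sided noetherian ring\<close>

locale bi_noetherian =
 fixes R :: "'a ring"
 assumes noeth: "left_noetherian R" and noeth_op: "left_noetherian (opposite_ring R)"

sublocale bi_noetherian \<subseteq> noetherian_modules R by unfold_locales (rule noeth)

sublocale bi_noetherian \<subseteq> op: noetherian_modules "opposite_ring R" by unfold_locales (rule noeth_op)

context bi_noetherian
begin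

abbreviation "Rop \<equiv> opposite_ring R"

definition torsionless :: "'a fg_module => bool" where
 "torsionless X \<longleftrightarrow> (\<forall>x\<in>carrier X. (\<forall>f\<in>mod_hom R X (reg R). f x = \<zero>\<^sub>R) --> x = \<zero>\<^sub>X)"

text \<open>Generators \<open>\<phi> j\<close> of the dual serve as coordinates. Separation of
  points makes the resulting homomorphism into a free module injective, and since the coordinates
  generate the dual, every functional on \<open>X\<close> extends along it; this is the vanishing of
  Ext^1 from the cokernel to the ring.\<close>

lemma torsionless_embed:
 assumes X: "X \<in> fgm R" and t: "torsionless X"
 shows "\<exists>P S i p. exact_seq R X P S i p & proj P & ext1z S (rcopy R)"
proof -
 note LX = fgmD[OF X] and LR = reg_left_module[OF R_ring]
 interpret R: ring R by (rule R_ring)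
 obtain m \<phi> where f: "\<forall>j<m. \<phi> j \<in> mod_hom R X (reg R)"
  and gen: "\<forall>f\<in>mod_hom R X (reg R). \<exists>c. (\<forall>j<m. c j IN R) & f = lincomb (dual R X) m c \<phi>"
  using dual_generators[OF R_ring LX(1,2) noeth_op] by blast
 let ?F = "free_module R m"
 note LF = free_left_module[OF R_ring, of m] and Ffg = free_finitely_generated[OF R_ring, of m]
 obtain P a b where P: "P \<in> fgm R" "a \<in> mod_hom R ?F P" "b \<in> mod_hom R P ?F"
   "\<forall>x\<in>carrier ?F. b (a x) = x" "\<forall>y\<in>carrier P. a (b y) = y"
  using fg_copy[OF LF Ffg] by metis
 note LP = fgmD(1)[OF P(1)]
 have "proj P" unfolding proj_iff
  by (rule dual_basis_projective[OF P(1) dual_basis_retract[where r = a and s = b, OF free_dual_basis[OF R_ring] LF LP P(2,3,5)]])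
 let ?i = "\<lambda>x\<in>carrier X. \<lambda>j\<in>{..<m}. \<phi> j x"
 have fc: "\<phi> j x IN R" if "j < m" "x IN X" for j x using functional_closed[OF R_ring LX(1)] f that by blast
 have i: "?i \<in> mod_hom R X ?F" by (rule hom_restrict[OF LX(1)]) (use fc f in "auto simp: fun_eq_iff mod_homD")
 let ?j = "cmp X a ?i"
 have j: "?j \<in> mod_hom R X P" by (rule hom_compose[OF LX(1) i P(2)])
 have bj: "b (?j x) = ?i x" if "x IN X" for x using P(4) mod_homD(2)[OF i that] that by (simp add: compose_def)
 obtain S p where S: "S \<in> fgm R" "p \<in> mod_hom R P S" "p ` carrier P = carrier S"
  "\<forall>x\<in>carrier P. p x = \<zero>\<^sub>S \<longleftrightarrow> x \<in> ?j ` carrier X"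
  by (rule quotient_exists[OF fgmD[OF P(1)] image_submodule[OF LX(1) LP j left_module.carrier_submodule[OF LX(1)]]])
 have "short_exact R X P S ?j p"
 proof (rule short_exactI[OF LX(1) LP j S(2)])
  show "p (?j x) = \<zero>\<^sub>S" if "x IN X" for x using S(4) mod_homD(2)[OF j that] that by blast
  show "\<exists>x\<in>carrier X. ?j x = y" if y: "y IN P" "p y = \<zero>\<^sub>S" for y
  proof -
   have "y \<in> ?j ` carrier X" using S(4)[rule_format, OF y(1)] y(2) by (rule iffD1)
   thus ?thesis unfolding image_iff by (elim bexE) (rule bexI, rule sym)
  qed
  show "\<exists>y\<in>carrier P. p y = z" if "z IN S" for z
   using that unfolding S(3)[symmetric] by (elim imageE) (rule bexI, rule sym)
  fix x assume x: "x IN X" "?j x = \<zero>\<^sub>P"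
  hence "?i x = \<zero>\<^sub>?F" using bj[OF x(1)] mod_hom_zero[OF LP LF P(3)] by simp
  hence z: "\<phi> j x = \<zero>\<^sub>R" if "j < m" for j using x(1) that by (simp add: fun_eq_iff) metis
  have "f x = \<zero>\<^sub>R" if ff: "f \<in> mod_hom R X (reg R)" for f
  proof -
   obtain c where c: "\<forall>j<m. c j IN R" "f = lincomb (dual R X) m c \<phi>" using gen ff by blast
   have "f x = lincomb (reg R) m (%i. \<phi> i x) c"
    using dual_lincomb[OF R_ring LX(1), of m \<phi> c] f c x(1) by simp
   also have "\<dots> = \<zero>\<^sub>R" using left_module.lincomb_zero[OF LR, of m "%i. \<phi> i x" c] z c by simp
   finally show ?thesis .
  qed
  thus "x = \<zero>\<^sub>X" using t x(1) unfolding torsionless_def by blast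
 qed
 hence s: "exact_seq R X P S (arr X P ?j) (arr P S p)" by (rule exact_seqI[OF X P(1) S(1)])
 have "\<exists>g\<in>mod_hom R P (reg R). \<forall>x\<in>carrier X. g (ev X P (arr X P ?j) x) = f x"
  if ff: "f \<in> mod_hom R X (reg R)" for f
 proof -
  obtain c where c: "\<forall>j<m. c j IN R" "f = lincomb (dual R X) m c \<phi>" using gen ff by blast
  let ?g = "\<lambda>y\<in>carrier P. lincomb (reg R) m (%j. (\<lambda>y\<in>carrier P. b y j) y) c"
  have bp: "(\<lambda>y\<in>carrier P. b y j) \<in> mod_hom R P (reg R)" if "j < m" for j
  proof (rule hom_restrict[OF LP])
   show "b y j IN (reg R)" if "y IN P" for y using mod_homD(2)[OF P(3) that] \<open>j < m\<close> by auto
  qed (use mod_homD(3,4)[OF P(3)] that in auto)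
  have g: "?g \<in> mod_hom R P (reg R)" by (rule lincomb_hom[OF LP LR]) (rule bp, assumption, use c in simp)
  have "?g (?j x) = f x" if x: "x IN X" for x
  proof -
   have "?g (?j x) = lincomb (reg R) m (%j. \<phi> j x) c"
    using mod_homD(2)[OF j x] bj[OF x] x by (simp cong: lincomb_cong)
   also have "\<dots> = f x" using dual_lincomb[OF R_ring LX(1), of m \<phi> c] f c x by simp
   finally show ?thesis .
  qed
  thus ?thesis using g unfolding ev_arr[OF X P(1) j] by blast
 qed
 hence "ext1z S (rcopy R)"
  using ext1z_proj_test[OF s \<open>proj P\<close>] regular_extension_iff[OF HomsI[OF X P(1) j]] by blast
 thus ?thesis using s \<open>proj P\<close> by blast
qed

text \<open>Functionals have a carrier type of their own, so the dual is replaced by a copy among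
  the modules over the opposite ring.\<close>

definition dcopy :: "'a fg_module => 'a fg_module" where
 "dcopy X = (SOME Q. Q \<in> fgm Rop & (\<exists>p\<in>mod_hom Rop (dual R X) Q. \<exists>q\<in>mod_hom Rop Q (dual R X).
   (\<forall>f\<in>carrier (dual R X). q (p f) = f) & (\<forall>y\<in>carrier Q. p (q y) = y)))"

lemma dcopy:
 assumes X: "X \<in> fgm R"
 shows "dcopy X \<in> fgm Rop"
  and "\<exists>p\<in>mod_hom Rop (dual R X) (dcopy X). \<exists>q\<in>mod_hom Rop (dcopy X) (dual R X).
   (\<forall>f\<in>carrier (dual R X). q (p f) = f) & (\<forall>y\<in>carrier (dcopy X). p (q y) = y)"
proof -
 have "\<exists>Q. Q \<in> fgm Rop & (\<exists>p\<in>mod_hom Rop (dual R X) Q. \<exists>q\<in>mod_hom Rop Q (dual R X).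
   (\<forall>f\<in>carrier (dual R X). q (p f) = f) & (\<forall>y\<in>carrier Q. p (q y) = y))"
  using fg_copy[OF dual_left_module[OF R_ring fgmD(1)[OF X]]
    dual_finitely_generated[OF R_ring fgmD(1,2)[OF X] noeth_op]] by metis
 note * = someI_ex[OF this, folded dcopy_def]
 show "dcopy X \<in> fgm Rop" by (rule *[THEN conjunct1])
 show "\<exists>p\<in>mod_hom Rop (dual R X) (dcopy X). \<exists>q\<in>mod_hom Rop (dcopy X) (dual R X).
   (\<forall>f\<in>carrier (dual R X). q (p f) = f) & (\<forall>y\<in>carrier (dcopy X). p (q y) = y)" by (rule *[THEN conjunct2])
qed

lemma dual_mono:
 assumes s: "exact_seq R K P X k \<pi>" and f: "f \<in> mod_hom R X (reg R)"
  and z: "\<And>p. p IN P ==> f (ev P X \<pi> p) = \<zero>\<^sub>R"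
 shows "f = zero_map X (reg R)"
proof (rule mod_hom_eqI[OF f mod_hom_zero_map[OF exact_seqD(12)[OF s] reg_left_module[OF R_ring]]])
 fix x assume x: "x IN X"
 then obtain p where "p IN P" "ev P X \<pi> p = x" using exact_seqD(5)[OF s] by blast
 thus "f x = zero_map X (reg R) x" using z x by (auto simp: zero_map_def)
qed

lemma dual_factor:
 assumes s: "exact_seq R K P X k \<pi>" and f: "f \<in> mod_hom R P (reg R)"
  and z: "\<And>x. x IN K ==> f (ev K P k x) = \<zero>\<^sub>R"
 shows "\<exists>g\<in>mod_hom R X (reg R). cmp P g (ev P X \<pi>) = f"
proof -
 note d = exact_seqD[OF s] and LR = reg_left_module[OF R_ring]
 have "ev P X \<pi> ` carrier P = carrier X" using d(13) unfolding short_exact_def by blast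
 hence "\<exists>g\<in>mod_hom R X (reg R). \<forall>x\<in>carrier P. g (ev P X \<pi> x) = f x"
  by (rule factor_surjective[OF d(11,12) LR ev_hom(1)[OF d(2)] _ f]) (use d(4) z in force)
 then obtain g where g: "g \<in> mod_hom R X (reg R)" "\<forall>x\<in>carrier P. g (ev P X \<pi> x) = f x" by blast
 have "cmp P g (ev P X \<pi>) = f"
  by (rule mod_hom_eqI[OF hom_compose[OF d(11) ev_hom(1)[OF d(2)] g(1)] f]) (use g(2) in "simp add: compose_def")
 thus ?thesis using g(1) by blast
qed

lemma dual_extend:
 assumes s: "exact_seq R K P X k \<pi>" and E: "ext1z X (rcopy R)" and f: "f \<in> mod_hom R K (reg R)"
 shows "\<exists>g\<in>mod_hom R P (reg R). cmp K g (ev K P k) = f"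
proof -
 note d = exact_seqD[OF s]
 obtain g where g: "g \<in> mod_hom R P (reg R)" "\<forall>x\<in>carrier K. g (ev K P k x) = f x"
  using ext1z_extend[OF E s] regular_extension_iff[OF d(1)] f by blast
 have "cmp K g (ev K P k) = f"
  by (rule mod_hom_eqI[OF hom_compose[OF d(10) ev_hom(1)[OF d(1)] g(1)] f]) (use g(2) in "simp add: compose_def")
 thus ?thesis using g(1) by blast
qed

lemma precompose_hom:
 assumes X: "lmod R X" and Y: "lmod R Y" and h: "h \<in> mod_hom R X Y"
 shows "(\<lambda>f\<in>carrier (dual R Y). cmp X f h) \<in> mod_hom Rop (dual R Y) (dual R X)"
 by (rule hom_restrict[OF dual_left_module[OF R_ring Y]])
  (use hom_compose[OF X h] mod_homD(2)[OF h] in "auto simp: compose_def fun_eq_iff")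

text \<open>Exactness on the left and in the middle is factorization through the cokernel;
  surjectivity on the right is extension of functionals from \<open>K\<close> to \<open>P\<close>,
  which is what vanishing of Ext^1 from \<open>X\<close> to the ring says.\<close>

lemma dual_exact:
 assumes s: "exact_seq R K P X k \<pi>" and E: "ext1z X (rcopy R)"
 shows "short_exact Rop (dual R X) (dual R P) (dual R K)
  (\<lambda>f\<in>carrier (dual R X). cmp P f (ev P X \<pi>)) (\<lambda>f\<in>carrier (dual R P). cmp K f (ev K P k))"
proof -
 note d = exact_seqD[OF s] and D = dual_left_module[OF R_ring] and LR = reg_left_module[OF R_ring]
 show ?thesis
 proof (rule short_exactI[OF D[OF d(12)] D[OF d(11)] precompose_hom[OF d(11,12) ev_hom(1)[OF d(2)]] precompose_hom[OF d(10,11) ev_hom(1)[OF d(1)]]])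
  fix f assume f: "f IN (dual R X)"
  have c: "cmp P f (ev P X \<pi>) IN (dual R P)" using hom_compose[OF d(11) ev_hom(1)[OF d(2)]] f by simp
  have "f \<zero>\<^sub>X = \<zero>\<^sub>R" using mod_hom_zero[OF d(12) LR, of f] f by simp
  thus "(\<lambda>f\<in>carrier (dual R P). cmp K f (ev K P k))
    ((\<lambda>f\<in>carrier (dual R X). cmp P f (ev P X \<pi>)) f) = \<zero>\<^sub>(dual R K)"
   using f c d(3) ev_closed[OF d(1)] by (auto simp: compose_def zero_map_def fun_eq_iff)
 next
  fix f assume f: "f IN (dual R P)"
   "(\<lambda>f\<in>carrier (dual R P). cmp K f (ev K P k)) f = \<zero>\<^sub>(dual R K)"
  have "f (ev K P k x) = \<zero>\<^sub>R" if "x IN K" for x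
   using fun_cong[OF f(2), of x] f(1) that by (simp add: compose_def zero_map_def)
  thus "\<exists>x\<in>carrier (dual R X). (\<lambda>f\<in>carrier (dual R X). cmp P f (ev P X \<pi>)) x = f"
   using dual_factor[OF s, of f] f(1) by auto
 next
  fix f assume f: "f IN (dual R K)"
  thus "\<exists>y\<in>carrier (dual R P). (\<lambda>f\<in>carrier (dual R P). cmp K f (ev K P k)) y = f"
   using dual_extend[OF s E, of f] by auto
 next
  fix f assume f: "f IN (dual R X)"
   "(\<lambda>f\<in>carrier (dual R X). cmp P f (ev P X \<pi>)) f = \<zero>\<^sub>(dual R P)"
  have "f (ev P X \<pi> p) = \<zero>\<^sub>R" if "p IN P" for p
   using fun_cong[OF f(2), of p] f(1) that by (simp add: compose_def zero_map_def)
  thus "f = \<zero>\<^sub>(dual R X)" using dual_mono[OF s] f(1) by simp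
 qed
qed

text \<open>Conjugates an exact sequence of modules of arbitrary carrier types by isomorphisms with
  objects; applied to dual sequences and their copies.\<close>

lemma exact_seq_transport:
 fixes A :: "('a, 'b) module" and B :: "('a, 'c) module" and C :: "('a, 'd) module"
 assumes s: "short_exact S A B C f g" and L: "lmod S A" "lmod S B" "lmod S C"
  and O: "A' \<in> fgm S" "B' \<in> fgm S" "C' \<in> fgm S"
  and a: "a \<in> mod_hom S A' A" "a' \<in> mod_hom S A A'" "\<forall>x\<in>carrier A. a (a' x) = x" "\<forall>x\<in>carrier A'. a' (a x) = x"
  and b: "b \<in> mod_hom S B B'" "b' \<in> mod_hom S B' B" "\<forall>x\<in>carrier B. b' (b x) = x" "\<forall>x\<in>carrier B'. b (b' x) = x"
  and c: "c \<in> mod_hom S C C'" "c' \<in> mod_hom S C' C" "\<forall>x\<in>carrier C. c' (c x) = x" "\<forall>x\<in>carrier C'. c (c' x) = x"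
 shows "exact_seq S A' B' C' (arr A' B' (cmp A' b (cmp A' f a)))
  (arr B' C' (cmp B' c (cmp B' g b')))"
  (is "exact_seq _ _ _ _ (arr _ _ ?f) (arr _ _ ?g)")
proof (rule exact_seqI[OF O])
 note L' = fgmD(1)[OF O(1)] fgmD(1)[OF O(2)] fgmD(1)[OF O(3)]
 note d = short_exactD[OF s L(1,2)]
 have z: "a \<zero>\<^sub>A' = \<zero>\<^sub>A" "a' \<zero>\<^sub>A = \<zero>\<^sub>A'" "b' \<zero>\<^sub>B' = \<zero>\<^sub>B" "c \<zero>\<^sub>C = \<zero>\<^sub>C'" "c' \<zero>\<^sub>C' = \<zero>\<^sub>C"
  using mod_hom_zero[OF L'(1) L(1) a(1)] mod_hom_zero[OF L(1) L'(1) a(2)] mod_hom_zero[OF L'(2) L(2) b(2)]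
   mod_hom_zero[OF L(3) L'(3) c(1)] mod_hom_zero[OF L'(3) L(3) c(2)] by auto
 note cl = mod_homD(2)[OF a(1)] mod_homD(2)[OF a(2)] mod_homD(2)[OF b(1)] mod_homD(2)[OF b(2)] mod_homD(2)[OF c(1)] mod_homD(2)[OF c(2)]
  mod_homD(2)[OF d(1)] mod_homD(2)[OF d(2)]
 show "short_exact S A' B' C' ?f ?g"
 proof (rule short_exactI[OF L'(1,2)])
  show "?f \<in> mod_hom S A' B'" by (rule hom_compose[OF L'(1) hom_compose[OF L'(1) a(1) d(1)] b(1)])
  show "?g \<in> mod_hom S B' C'" by (rule hom_compose[OF L'(2) hom_compose[OF L'(2) b(2) d(2)] c(1)])
  show "?g (?f x) = \<zero>\<^sub>C'"
   if "x IN A'" for x using that cl d(3) z b(3) by (simp add: compose_def)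
  show "\<exists>x\<in>carrier A'. ?f x = y"
   if y: "y IN B'" "?g y = \<zero>\<^sub>C'" for y
  proof -
   have "c (g (b' y)) = \<zero>\<^sub>C'" using y cl by (simp add: compose_def)
   hence "g (b' y) = \<zero>\<^sub>C" using c(3) cl(8)[OF cl(4)[OF y(1)]] z(5) by metis
   then obtain x where "x IN A" "f x = b' y" using d(4) cl(4)[OF y(1)] by blast
   thus ?thesis using y(1) cl a(3) b(4) by (intro bexI[of _ "a' x"]) (auto simp: compose_def)
  qed
  show "\<exists>y\<in>carrier B'. ?g y = x" if x: "x IN C'" for x
  proof -
   obtain y where "y IN B" "g y = c' x" using d(5) cl(6)[OF x] by blast
   thus ?thesis using x cl b(3) c(4) by (intro bexI[of _ "b y"]) (auto simp: compose_def)
  qed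
  show "x = \<zero>\<^sub>A'" if x: "x IN A'" "?f x = \<zero>\<^sub>B'" for x
  proof -
   have "b (f (a x)) = \<zero>\<^sub>B'" using x cl by (simp add: compose_def)
   hence "f (a x) = \<zero>\<^sub>B" using b(3) cl(7)[OF cl(1)[OF x(1)]] z(3) by metis
   hence "a x = \<zero>\<^sub>A" using d(7) cl(1)[OF x(1)] by blast
   thus ?thesis using a(4) x(1) z(2) by metis
  qed
 qed
qed

lemma dcopy_exact:
 assumes s: "exact_seq R K P X k \<pi>" and E: "ext1z X (rcopy R)"
 shows "\<exists>i p. exact_seq Rop (dcopy X) (dcopy P) (dcopy K) i p"
proof -
 note d = exact_seqD[OF s] and D = dual_left_module[OF R_ring]
 obtain a a' where a: "a' \<in> mod_hom Rop (dual R X) (dcopy X)" "a \<in> mod_hom Rop (dcopy X) (dual R X)"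
  "\<forall>f\<in>carrier (dual R X). a (a' f) = f" "\<forall>y\<in>carrier (dcopy X). a' (a y) = y" using dcopy(2)[OF d(9)] by blast
 obtain b b' where b: "b \<in> mod_hom Rop (dual R P) (dcopy P)" "b' \<in> mod_hom Rop (dcopy P) (dual R P)"
  "\<forall>f\<in>carrier (dual R P). b' (b f) = f" "\<forall>y\<in>carrier (dcopy P). b (b' y) = y" using dcopy(2)[OF d(8)] by blast
 obtain c c' where c: "c \<in> mod_hom Rop (dual R K) (dcopy K)" "c' \<in> mod_hom Rop (dcopy K) (dual R K)"
  "\<forall>f\<in>carrier (dual R K). c' (c f) = f" "\<forall>y\<in>carrier (dcopy K). c (c' y) = y" using dcopy(2)[OF d(7)] by blast
 show ?thesis
  using exact_seq_transport[where a = a and a' = a' and b = b and b' = b' and c = c and c' = c', OF dual_exact[OF s E] D[OF d(12)] D[OF d(11)] D[OF d(10)] dcopy(1)[OF d(9)] dcopy(1)[OF d(8)] dcopy(1)[OF d(7)]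
   a(2,1,3,4) b c] by blast
qed

lemma dcopy_proj:
 assumes "proj P" shows "op.proj (dcopy P)"
proof -
 have O: "P \<in> fgm R" using assms by (rule proj_Ob)
 note LP = fgmD(1)[OF O]
 obtain n x h where db: "dual_basis R P n x h" using projective_dual_basis[OF R_ring] assms proj_iff by blast
 obtain b b' where b: "b \<in> mod_hom Rop (dual R P) (dcopy P)" "b' \<in> mod_hom Rop (dcopy P) (dual R P)"
  "\<forall>f\<in>carrier (dual R P). b' (b f) = f" "\<forall>y\<in>carrier (dcopy P). b (b' y) = y" using dcopy(2)[OF O] by blast
 show ?thesis unfolding op.proj_iff
  by (rule dual_basis_projective[OF dcopy(1)[OF O] dual_basis_retract[where r = b and s = b', OF dual_dual_basis[OF R_ring LP db]
    dual_left_module[OF R_ring LP] fgmD(1)[OF dcopy(1)[OF O]] b(1,2,4)]])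
qed

lemma cm_syz: "cm X ==> cm (syz X)"
 unfolding cm_def using syz_Ob extz.simps(2) by metis

text \<open>Dualizing a projective cover of a Cohen-Macaulay \<open>X\<close> makes the dual of
  \<open>X\<close> a syzygy of the dual of \<open>syz X\<close>. Hence Ext^1 out of the dual of
  \<open>X\<close> is Ext^(d+1) out of the dual of the d-th syzygy, and this vanishes for large
  \<open>d\<close> by the bound over the opposite ring.\<close>

lemma dcopy_ext1z:
 assumes id: "\<exists>d. \<forall>X\<in>fgm Rop. \<forall>n\<ge>d. op.extz n X (rcopy Rop)" and X: "cm X"
 shows "op.ext1z (dcopy X) (rcopy Rop)"
proof -
 have step: "op.extz n (dcopy X) Y \<longleftrightarrow> op.extz (Suc n) (dcopy (syz X)) Y" if X: "cm X" for n X Y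
 proof -
  obtain P k p where s: "exact_seq R (syz X) P X k p" "proj P" using syz_ses cm_Ob[OF X] by metis
  have "ext1z X (rcopy R)" using X unfolding cm_def by (metis extz.simps(1))
  then obtain i q where "exact_seq Rop (dcopy X) (dcopy P) (dcopy (syz X)) i q" using dcopy_exact[OF s(1)] by blast
  thus ?thesis using op.extz_syzygy dcopy_proj[OF s(2)] by blast
 qed
 have c: "cm ((syz ^^ n) X)" for n by (induction n) (use X cm_syz in auto)
 have "op.extz 0 (dcopy X) Y \<longleftrightarrow> op.extz n (dcopy ((syz ^^ n) X)) Y" for n Y
 proof (induction n)
  case (Suc n)
  thus ?case using step[OF c, of n n Y] by simp
 qed simp
 moreover obtain d where d: "\<forall>X\<in>fgm Rop. \<forall>n\<ge>d. op.extz n X (rcopy Rop)" using id by blast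
 moreover have "dcopy ((syz ^^ d) X) \<in> fgm Rop" using dcopy(1) cm_Ob c by blast
 ultimately show ?thesis by (metis op.extz.simps(1) order_refl)
qed

text \<open>An element of \<open>P\<close> in the kernel of all functionals vanishing on \<open>K\<close> induces a functional on
 \<open>K\<^sup>*\<close>, which extends to the reflexive module \<open>Q\<^sup>*\<close> and is therefore evaluation at an element of \<open>K\<close>.\<close>

lemma cm_torsionless:
 assumes id: "\<exists>d. \<forall>X\<in>fgm Rop. \<forall>n\<ge>d. op.extz n X (rcopy Rop)" and X: "cm X"
 shows "torsionless X"
 unfolding torsionless_def
proof (intro ballI impI)
 fix x assume x: "x IN X" and zx: "\<forall>f\<in>mod_hom R X (reg R). f x = \<zero>\<^sub>R"
 have O: "X \<in> fgm R" using cm_Ob X by blast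
 obtain K P k \<pi> n e h where s: "exact_seq R K P X k \<pi>" and db: "dual_basis R P n e h" and P: "proj P"
  using free_resolution_step[OF O] by metis
 note d = exact_seqD[OF s]
 obtain L Q l \<rho> m e' h' where s': "exact_seq R L Q K l \<rho>" and db': "dual_basis R Q m e' h'" and Q: "proj Q"
  using free_resolution_step[OF d(7)] by metis
 note d' = exact_seqD[OF s']
 have K: "cm K" using cm_kernel[OF s cm_proj[OF P] X] .
 have L: "cm L" using cm_kernel[OF s' cm_proj[OF Q] K] .
 have EX: "ext1z X (rcopy R)" and EK: "ext1z K (rcopy R)" using X K unfolding cm_def by (metis extz.simps(1))+
 note D = dual_left_module[OF R_ring] and LR = reg_left_module[OF R_ring] and LRop = reg_left_module[OF op.R_ring]
 obtain p where p: "p IN P" "ev P X \<pi> p = x" using d(5) x by blast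
 let ?S = "reg R"
 let ?k = "\<lambda>f\<in>carrier (dual R P). cmp K f (ev K P k)"
 let ?r = "\<lambda>f\<in>carrier (dual R K). cmp Q f (ev Q K \<rho>)"
 have "\<exists>\<psi>\<in>mod_hom Rop (dual R K) (reg Rop). \<forall>f\<in>carrier (dual R P). \<psi> (?k f) = (\<lambda>f\<in>carrier (dual R P). f p) f"
 proof (rule factor_surjective[OF D[OF d(11)] D[OF d(10)] LRop precompose_hom[OF d(10,11) ev_hom(1)[OF d(1)]]])
  show "?k ` carrier (dual R P) = carrier (dual R K)" using dual_exact[OF s EX] unfolding short_exact_def by blast
  show "(\<lambda>f\<in>carrier (dual R P). f p) \<in> mod_hom Rop (dual R P) (reg Rop)"
   by (rule hom_restrict[OF D[OF d(11)]]) (use p functional_closed[OF R_ring d(11)] in auto)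
  fix f assume f: "f IN (dual R P)" "?k f = \<zero>\<^sub>(dual R K)"
  have "f (ev K P k y) = \<zero>\<^sub>R" if "y IN K" for y
   using fun_cong[OF f(2), of y] f(1) that by (simp add: compose_def zero_map_def)
  then obtain g where g: "g \<in> mod_hom R X ?S" "cmp P g (ev P X \<pi>) = f" using dual_factor[OF s, of f] f(1) by auto
  have "f p = g x" using fun_cong[OF g(2), of p] p by (simp add: compose_def)
  thus "(\<lambda>f\<in>carrier (dual R P). f p) f = \<zero>\<^sub>(reg Rop)" using f zx g(1) by simp
 qed
 then obtain \<psi> where \<psi>: "\<psi> \<in> mod_hom Rop (dual R K) (reg Rop)" "\<forall>f\<in>mod_hom R P ?S. \<psi> (?k f) = f p" by auto
 \<comment> \<open>The dual of \<open>K\<close> sits in the dual of \<open>Q\<close> with quotient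
   the dual of \<open>L\<close>. As \<open>L\<close> is Cohen-Macaulay, \<open>dcopy_ext1z\<close>
   lets \<open>\<psi>\<close> extend; the extension is computed on the copies and carried
   back.\<close>
 have "\<exists>\<Psi>\<in>mod_hom Rop (dual R Q) (reg Rop). \<forall>f\<in>carrier (dual R K). \<Psi> (?r f) = \<psi> f"
 proof -
  obtain a a' where a: "a' \<in> mod_hom Rop (dual R K) (dcopy K)" "a \<in> mod_hom Rop (dcopy K) (dual R K)"
   "\<forall>f\<in>carrier (dual R K). a (a' f) = f" "\<forall>y\<in>carrier (dcopy K). a' (a y) = y" using dcopy(2)[OF d(7)] by blast
  obtain b b' where b: "b \<in> mod_hom Rop (dual R Q) (dcopy Q)" "b' \<in> mod_hom Rop (dcopy Q) (dual R Q)"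
   "\<forall>f\<in>carrier (dual R Q). b' (b f) = f" "\<forall>y\<in>carrier (dcopy Q). b (b' y) = y" using dcopy(2)[OF d'(8)] by blast
  obtain c c' where c: "c \<in> mod_hom Rop (dual R L) (dcopy L)" "c' \<in> mod_hom Rop (dcopy L) (dual R L)"
   "\<forall>f\<in>carrier (dual R L). c' (c f) = f" "\<forall>y\<in>carrier (dcopy L). c (c' y) = y" using dcopy(2)[OF d'(7)] by blast
  obtain u v where u: "u \<in> mod_hom Rop (reg Rop) (rcopy Rop)" and v: "v \<in> mod_hom Rop (rcopy Rop) (reg Rop)"
   and vu: "\<forall>x\<in>carrier Rop. v (u x) = x" using rcopy(2)[OF op.R_ring] by blast
  note OK = dcopy(1)[OF d(7)] and OQ = dcopy(1)[OF d'(8)] and OR = rcopy(1)[OF op.R_ring]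
  note LK = fgmD(1)[OF OK] and LQ = fgmD(1)[OF OQ]
  let ?i = "cmp (dcopy K) b (cmp (dcopy K) ?r a)"
  let ?f = "cmp (dcopy K) u (cmp (dcopy K) \<psi> a)"
  have r: "?r \<in> mod_hom Rop (dual R K) (dual R Q)" by (rule precompose_hom[OF d'(11,12) ev_hom(1)[OF d'(2)]])
  have i: "?i \<in> mod_hom Rop (dcopy K) (dcopy Q)" by (rule hom_compose[OF LK hom_compose[OF LK a(2) r] b(1)])
  have f: "?f \<in> mod_hom Rop (dcopy K) (rcopy Rop)" by (rule hom_compose[OF LK hom_compose[OF LK a(2) \<psi>(1)] u])
  have "\<exists>q. exact_seq Rop (dcopy K) (dcopy Q) (dcopy L) (arr (dcopy K) (dcopy Q) ?i) q"
   using exact_seq_transport[where a = a and a' = a' and b = b and b' = b' and c = c and c' = c', OF dual_exact[OF s' EK] D[OF d'(12)] D[OF d'(11)] D[OF d'(10)] OK OQ dcopy(1)[OF d'(7)] a(2,1,3,4) b c] by blast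
  then obtain g where g: "g \<in> Homs Rop (dcopy Q) (rcopy Rop)" "g * arr (dcopy K) (dcopy Q) ?i = arr (dcopy K) (rcopy Rop) ?f"
   using op.ext1z_extend[OF dcopy_ext1z[OF id L] _ HomsI[OF OK OR f]] by blast
  let ?g = "cmp (dual R Q) v (cmp (dual R Q) (ev (dcopy Q) (rcopy Rop) g) b)"
  have "?g \<in> mod_hom Rop (dual R Q) (reg Rop)"
   by (rule hom_compose[OF D[OF d'(11)] hom_compose[OF D[OF d'(11)] b(1) ev_hom(1)[OF g(1)]] v])
  moreover have "?g (?r y) = \<psi> y" if y: "y IN (dual R K)" for y
  proof -
   have ay: "a' y IN (dcopy K)" "a (a' y) = y" and ry: "?r y IN (dual R Q)"
    using mod_homD(2)[OF a(1) y] a(3) y mod_homD(2)[OF r y] by auto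
   have py: "\<psi> y IN Rop" using mod_homD(2)[OF \<psi>(1) y] by simp
   have iy: "?i (a' y) = b (?r y)" using ay by (simp add: compose_def)
   have "ev (dcopy Q) (rcopy Rop) g (?i (a' y)) = ?f (a' y)"
    using ev_comp[OF HomsI[OF OK OQ i] g(1) ay(1)] g(2) ev_arr[OF OK OQ i] ev_arr[OF OK OR f] by simp
   also have "?f (a' y) = u (\<psi> y)" using ay by (simp add: compose_def)
   finally have "v (ev (dcopy Q) (rcopy Rop) g (b (?r y))) = \<psi> y" unfolding iy using vu py by simp
   thus ?thesis using compose_eq[OF ry] by metis
  qed
  ultimately show ?thesis by blast
 qed
 then obtain \<Psi> where \<Psi>: "\<Psi> \<in> mod_hom Rop (dual R Q) (reg Rop)" "\<forall>f\<in>carrier (dual R K). \<Psi> (?r f) = \<psi> f" by blast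
 obtain q where q: "q IN Q" "\<forall>f\<in>mod_hom R Q ?S. \<Psi> f = f q" using dual_basis_reflexive[OF R_ring d'(11) db' \<Psi>(1)] by blast
 let ?y = "ev Q K \<rho> q"
 have y: "?y IN K" by (rule ev_closed[OF d'(2) q(1)])
 have yP: "ev K P k ?y IN P" by (rule ev_closed[OF d(1) y])
 have fp: "f p = f (ev K P k ?y)" if f: "f \<in> mod_hom R P ?S" for f
 proof -
  have kf: "?k f \<in> mod_hom R K ?S" using hom_compose[OF d(10) ev_hom(1)[OF d(1)] f] f by simp
  have rk: "?r (?k f) \<in> mod_hom R Q ?S" using hom_compose[OF d'(11) ev_hom(1)[OF d'(2)] kf] kf by simp
  have "f p = \<Psi> (?r (?k f))" using \<psi>(2) \<Psi>(2) f kf by simp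
  also have "\<dots> = ?r (?k f) q" using q(2) rk by blast
  also have "\<dots> = f (ev K P k ?y)" using kf f q(1) y by (simp add: compose_def)
  finally show ?thesis .
 qed
 \<comment> \<open>All functionals on \<open>P\<close> agree at \<open>p\<close> and at the image of
   \<open>?y\<close>, in particular the dual basis coordinates; so \<open>p\<close> lies in the
   image of \<open>K\<close> and its class \<open>x\<close> is zero.\<close>
 have "p = lincomb P n (%i. h i p) e" using db p(1) unfolding dual_basis_def by blast
 also have "\<dots> = lincomb P n (%i. h i (ev K P k ?y)) e"
  using fp db unfolding dual_basis_def by (intro lincomb_cong) auto
 also have "\<dots> = ev K P k ?y" using db yP unfolding dual_basis_def by simp
 finally show "x = \<zero>\<^sub>X" using p(2) d(3) y by simp
qed

lemma cm_embed_of_injective_dimension: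
 assumes id: "\<exists>d. \<forall>X\<in>fgm Rop. \<forall>n\<ge>d. op.extz n X (rcopy Rop)" and X: "cm X"
 shows "\<exists>P S i p. exact_seq R X P S i p & proj P & cm S"
proof -
 obtain P S i p where "exact_seq R X P S i p" "proj P" "ext1z S (rcopy R)"
  using torsionless_embed[OF cm_Ob[OF X] cm_torsionless[OF assms]] by blast
 thus ?thesis using cm_cokernel[OF _ X cm_proj] by blast
qed

end

section \<open>Corner rings\<close>

locale idempotent = ring R for R :: "'a ring" (structure) +
 fixes a
 assumes a_closed [simp]: "a IN R" and aa: "a \<otimes> a = a"
begin

abbreviation "G \<equiv> corner_ring R a"

lemma corner_simps [simp]:
 "\<zero>\<^sub>G = \<zero>" "\<one>\<^sub>G = a" "x \<oplus>\<^sub>G y = x \<oplus> y" "x \<otimes>\<^sub>G y = x \<otimes> y"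
 by (simp_all add: corner_ring_def)

lemma aax: "x IN R ==> a \<otimes> (a \<otimes> x) = a \<otimes> x"
 by (metis a_closed aa m_assoc)

lemma corner_iff: "x IN G \<longleftrightarrow> x IN R & a \<otimes> x = x & x \<otimes> a = x"
proof
 assume "x IN G"
 then obtain y where y: "y IN R" "x = a \<otimes> y \<otimes> a" unfolding corner_ring_def by auto
 thus "x IN R & a \<otimes> x = x & x \<otimes> a = x" by (simp add: m_assoc aa aax)
next
 assume "x IN R & a \<otimes> x = x & x \<otimes> a = x"
 thus "x IN G" unfolding corner_ring_def by (auto intro: exI[of _ x])
qed

lemma corner_carrier: "x IN G ==> x IN R" by (simp add: corner_iff)

lemma corner_is_ring: "ring G"
proof (rule ringI)
 show "abelian_group G" by (rule abelian_groupI)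
   (auto simp: corner_iff r_distr l_distr a_assoc r_minus l_minus intro: a_comm l_neg intro!: bexI[of _ "\<ominus> _"])
 show "Group.monoid G" by (rule monoidI) (auto simp: corner_iff m_assoc[symmetric] aa, auto simp: m_assoc)
qed (auto simp: corner_iff l_distr r_distr)

lemma corner_module_simps [simp]:
 "\<zero>\<^sub>(corner_module a M) = \<zero>\<^sub>M" "x \<oplus>\<^sub>(corner_module a M) y = x \<oplus>\<^sub>M y" "r \<odot>\<^sub>(corner_module a M) x = r \<odot>\<^sub>M x"
 by (simp_all add: corner_module_def)

lemma corner_module_iff:
 fixes M :: "('a, 'b) module"
 assumes "lmod R M"
 shows "x IN (corner_module a M) \<longleftrightarrow> x IN M & a \<odot>\<^sub>M x = x"
proof -
 interpret M: left_module R M by fact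
 have "a \<odot>\<^sub>M (a \<odot>\<^sub>M y) = a \<odot>\<^sub>M y" if "y IN M" for y
  using M.lm_smult_assoc[OF a_closed a_closed that] aa by simp
 thus ?thesis unfolding corner_module_def by (auto simp: M.lm_smult_closed) (metis)
qed

lemma corner_module_smult:
 fixes M :: "('a, 'b) module"
 assumes "lmod R M" "x IN M"
 shows "a \<odot>\<^sub>M x IN (corner_module a M)"
 using assms unfolding corner_module_def by auto

lemma corner_mod_hom:
 fixes M :: "('a, 'b) module" and N :: "('a, 'c) module"
 assumes M: "lmod R M" and N: "lmod R N" and f: "f \<in> mod_hom R M N" and L: "lmod G (corner_module a M)"
 shows "restrict f (carrier (corner_module a M)) \<in> mod_hom G (corner_module a M) (corner_module a N)"
 by (rule hom_restrict[OF L]) (use mod_homD[OF f] in \<open>auto simp: corner_module_iff[OF M] corner_module_iff[OF N] corner_iff\<close>, metis a_closed)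

end

text \<open>\<open>corner_fg\<close> is extracted from the hypothesis of the theorem: a functor
  between the module categories sends finitely generated modules to finitely generated ones.\<close>

locale corner_restriction =
 fixes R :: "'a ring" and a :: 'a
 assumes bi: "bi_noetherian R" and a: "a IN R" "a \<otimes>\<^sub>R a = a"
  and corner_bi: "bi_noetherian (corner_ring R a)"
  and corner_fg: "X \<in> fgm R ==> corner_module a X \<in> fgm (corner_ring R a)"

sublocale corner_restriction \<subseteq> A: bi_noetherian R by (rule bi)
sublocale corner_restriction \<subseteq> B: bi_noetherian "corner_ring R a" by (rule corner_bi)
sublocale corner_restriction \<subseteq> idempotent R a
 by (intro idempotent.intro idempotent_axioms.intro A.R_ring a)

context corner_restriction
begin

abbreviation eo :: "'a fg_module => 'a fg_module" where "eo X \<equiv> corner_module a X"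

definition em :: "'a fg_module => 'a fg_module => 'a marr => 'a marr" where
 "em X Y h = arr (eo X) (eo Y) (restrict (ev X Y h) (carrier (eo X)))"

lemma eo_iff: "X \<in> fgm R ==> x IN (eo X) \<longleftrightarrow> x IN X & a \<odot>\<^sub>X x = x"
 by (rule corner_module_iff[OF fgmD(1)])

lemma
 assumes h: "h \<in> Homs R X Y"
 shows em_Hom: "em X Y h \<in> Homs G (eo X) (eo Y)"
  and em_ev: "x IN (eo X) ==> ev (eo X) (eo Y) (em X Y h) x = ev X Y h x"
proof -
 note d = HomsD[OF h]
 have m: "restrict (ev X Y h) (carrier (eo X)) \<in> mod_hom G (eo X) (eo Y)"
  by (rule corner_mod_hom[OF d(3,4) ev_hom(1)[OF h] fgmD(1)[OF corner_fg[OF d(1)]]])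
 show "em X Y h \<in> Homs G (eo X) (eo Y)" unfolding em_def by (rule HomsI[OF corner_fg[OF d(1)] corner_fg[OF d(2)] m])
 show "x IN (eo X) ==> ev (eo X) (eo Y) (em X Y h) x = ev X Y h x"
  unfolding em_def ev_arr[OF corner_fg[OF d(1)] corner_fg[OF d(2)] m] by simp
qed

lemma em_comp:
 assumes h: "h \<in> Homs R X Y" and k: "k \<in> Homs R Y Z"
 shows "em X Z (k * h) = em Y Z k * em X Y h"
proof (rule ev_eqI[OF em_Hom[OF Homs_comp[OF h k]] Homs_comp[OF em_Hom[OF h] em_Hom[OF k]]])
 fix x assume x: "x IN (eo X)"
 have "x IN X" using x eo_iff[OF HomsD(1)[OF h]] by simp
 thus "ev (eo X) (eo Z) (em X Z (k * h)) x = ev (eo X) (eo Z) (em Y Z k * em X Y h) x"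
  using x ev_comp[OF h k] ev_comp[OF em_Hom[OF h] em_Hom[OF k] x] em_ev[OF h x] em_ev[OF Homs_comp[OF h k] x]
   em_ev[OF k] ev_closed[OF em_Hom[OF h] x] by simp
qed

lemma em_add:
 assumes h: "h \<in> Homs R X Y" and k: "k \<in> Homs R X Y"
 shows "em X Y (h + k) = em X Y h + em X Y k"
proof (rule ev_eqI[OF em_Hom[OF Homs_add[OF h k]] Homs_add[OF em_Hom[OF h] em_Hom[OF k]]])
 fix x assume x: "x IN (eo X)"
 have "x IN X" using x eo_iff[OF HomsD(1)[OF h]] by simp
 thus "ev (eo X) (eo Y) (em X Y (h + k)) x = ev (eo X) (eo Y) (em X Y h + em X Y k) x"
  using x ev_add[OF h k] ev_add[OF em_Hom[OF h] em_Hom[OF k] x] em_ev[OF h x] em_ev[OF Homs_add[OF h k] x] em_ev[OF k x]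
  by simp
qed

lemma em_id:
 assumes X: "X \<in> fgm R" shows "em X X (idm X) = idm (eo X)"
proof (rule ev_eqI[OF em_Hom[OF Homs_idm[OF X]] Homs_idm[OF corner_fg[OF X]]])
 fix x assume x: "x IN (eo X)"
 have "x IN X" using x eo_iff[OF X] by simp
 thus "ev (eo X) (eo X) (em X X (idm X)) x = ev (eo X) (eo X) (idm (eo X)) x"
  using em_ev[OF Homs_idm[OF X] x] ev_idm[OF X] ev_idm[OF corner_fg[OF X] x] by simp
qed

text \<open>Preimages found in the big modules are multiplied by \<open>a\<close>; since
  \<open>a\<close> fixes the element to be reached, the product is still a preimage and lies in the
  corner.\<close>

lemma em_ses:
 assumes s: "exact_seq R X Y Z i p"
 shows "exact_seq G (eo X) (eo Y) (eo Z) (em X Y i) (em Y Z p)"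
proof (rule exact_seqI_ev[OF em_Hom em_Hom])
 note d = exact_seqD[OF s]
 show i: "i \<in> Homs R X Y" and p: "p \<in> Homs R Y Z" by (rule d)+
 note ie = em_ev[OF i] and pe = em_ev[OF p] and X = eo_iff[OF d(7)] and Y = eo_iff[OF d(8)] and Z = eo_iff[OF d(9)]
 show "ev (eo Y) (eo Z) (em Y Z p) (ev (eo X) (eo Y) (em X Y i) x) = \<zero>\<^sub>(eo Z)" if x: "x IN (eo X)" for x
  using x X d(3) ie pe[OF ev_closed[OF em_Hom[OF i] x]] by simp
 show "\<exists>x\<in>carrier (eo X). ev (eo X) (eo Y) (em X Y i) x = y"
  if y: "y IN (eo Y)" "ev (eo Y) (eo Z) (em Y Z p) y = \<zero>\<^sub>(eo Z)" for y
 proof -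
  have "ev Y Z p y = \<zero>\<^sub>Z" "y IN Y" using y pe Y by auto
  then obtain x where x: "x IN X" "ev X Y i x = y" using d(4) by blast
  have ax: "a \<odot>\<^sub>X x IN (eo X)" by (rule corner_module_smult[OF d(10) x(1)])
  have "ev X Y i (a \<odot>\<^sub>X x) = y" using mod_homD(4)[OF ev_hom(1)[OF i] a_closed x(1)] x(2) y Y by simp
  thus ?thesis by (metis ie ax)
 qed
 show "\<exists>y\<in>carrier (eo Y). ev (eo Y) (eo Z) (em Y Z p) y = z" if z: "z IN (eo Z)" for z
 proof -
  have "z IN Z" by (metis z Z)
  then obtain x where x: "x IN Y" "ev Y Z p x = z" using d(5) by blast
  have ax: "a \<odot>\<^sub>Y x IN (eo Y)" by (rule corner_module_smult[OF d(11) x(1)])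
  have "ev Y Z p (a \<odot>\<^sub>Y x) = z" using mod_homD(4)[OF ev_hom(1)[OF p] a_closed x(1)] x(2) z Z by simp
  thus ?thesis by (metis pe ax)
 qed
 show "x = \<zero>\<^sub>(eo X)" if x: "x IN (eo X)" "ev (eo X) (eo Y) (em X Y i) x = \<zero>\<^sub>(eo Y)" for x
  using x ie X d(6) by simp
qed

text \<open>A mono into a projective gives enough functionals on \<open>N\<close>, namely dual basis
  coordinates composed with \<open>h\<close>. So \<open>N\<close> is torsionless, and
  \<open>torsionless_embed\<close> applies.\<close>

lemma B_embed:
 assumes N: "B.cm N" and Q: "B.proj Q" and h: "h \<in> Homs G N Q"
  and mono: "\<And>D d. d \<in> Homs G D N ==> h * d = 0 ==> d = 0"
 shows "\<exists>P S h k. exact_seq G N P S h k & B.proj P & B.ext1z S (rcopy G)"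
proof -
 note d = HomsD[OF h]
 interpret N: left_module G N by (rule d(3))
 obtain n e f where db: "dual_basis G Q n e f" using projective_dual_basis[OF B.R_ring] Q B.proj_iff by blast
 have "B.torsionless N" unfolding B.torsionless_def
 proof (intro ballI impI)
  fix x assume x: "x IN N" and z: "\<forall>f\<in>mod_hom G N (reg G). f x = \<zero>\<^sub>G"
  have ef: "e i IN Q" "f i \<in> mod_hom G Q (reg G)" if "i < n" for i using db that unfolding dual_basis_def by auto
  have hx: "ev N Q h x IN Q" by (rule ev_closed[OF h x])
  have "f i (ev N Q h x) = \<zero>\<^sub>G" if "i < n" for i
   using z[rule_format, OF hom_compose[OF d(3) ev_hom(1)[OF h] ef(2)[OF that]]] x by (simp add: compose_def)
  hence "lincomb Q n (%i. f i (ev N Q h x)) e = \<zero>\<^sub>Q" using left_module.lincomb_zero[OF d(4)] ef(1) by simp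
  hence hx0: "ev N Q h x = \<zero>\<^sub>Q" using db hx unfolding dual_basis_def by metis
  note OG = rcopy(1)[OF B.R_ring] and LG = fgmD(1)[OF rcopy(1)[OF B.R_ring]]
  obtain p q where p: "p \<in> mod_hom G (reg G) (rcopy G)" and q: "q \<in> mod_hom G (rcopy G) (reg G)"
   and qp: "\<forall>y\<in>carrier G. q (p y) = y" using rcopy(2)[OF B.R_ring] by blast
  have qc: "q y IN G" if "y IN (rcopy G)" for y using mod_homD(2)[OF q that] by simp
  \<comment> \<open>\<open>h\<close> is mono only in the categorical sense, so the element
    \<open>x\<close> is turned into the homomorphism from the corner ring that sends 1 to
    \<open>x\<close>.\<close>
  let ?d = "\<lambda>y\<in>carrier (rcopy G). q y \<odot>\<^sub>N x"
  have dh: "?d \<in> mod_hom G (rcopy G) N" by (rule hom_restrict[OF LG])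
    (use mod_homD(3,4)[OF q] qc x N.lm_smult_closed N.lm_smult_l_distr N.lm_smult_assoc in auto)
  note H = HomsI[OF OG d(1) dh]
  have "h * arr (rcopy G) N ?d = 0"
  proof (rule ev_eqI[OF Homs_comp[OF H h] Homs_zero[OF OG d(2)]])
   fix y assume y: "y IN (rcopy G)"
   show "ev (rcopy G) Q (h * arr (rcopy G) N ?d) y = ev (rcopy G) Q 0 y"
    using ev_comp[OF H h y] ev_arr[OF OG d(1) dh] ev_zero[OF OG d(2) y] y mod_homD(4)[OF ev_hom(1)[OF h] qc[OF y] x] hx0
     left_module.smult_zero_right[OF d(4) qc[OF y]] by simp
  qed
  hence z0: "arr (rcopy G) N ?d = 0" by (rule mono[OF H])
  have 1: "\<one>\<^sub>G IN G" using N.R.one_closed .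
  have p1: "p \<one>\<^sub>G IN (rcopy G)" using mod_homD(2)[OF p, of "\<one>\<^sub>G"] 1 by simp
  have "?d (p \<one>\<^sub>G) = \<zero>\<^sub>N" using ev_arr[OF OG d(1) dh] ev_zero[OF OG d(1) p1] z0 by metis
  thus "x = \<zero>\<^sub>N" using p1 qp 1 N.lm_smult_one[OF x] by simp
 qed
 thus ?thesis using B.torsionless_embed[OF d(1)] by blast
qed

end

section \<open>The left adjoint of restriction to the corner\<close>

context corner_restriction
begin

lemma free_corner_simps: "\<zero>\<^sub>(free_module G n) = \<zero>\<^sub>(free_module R n)"
 "x \<oplus>\<^sub>(free_module G n) y = x \<oplus>\<^sub>(free_module R n) y" "r \<odot>\<^sub>(free_module G n) x = r \<odot>\<^sub>(free_module R n) x"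
 by simp_all

text \<open>The module induced by \<open>N = \<Sum>i<n. G x\<^sub>i\<close> is the quotient of \<open>(R a)\<^sup>n\<close> by the \<open>R\<close>-span \<open>H\<close> of the
 relations between the generators. The restricted unit is injective since every \<open>r \<in> H\<close> satisfies
 \<open>\<Sum>i<n. a l r\<^sub>i x\<^sub>i = 0\<close> for all \<open>l \<in> R\<close>.\<close>

lemma induced_module_exists:
 assumes N: "N \<in> fgm G"
 shows "\<exists>T u v. T \<in> fgm R & u \<in> Homs G N (eo T) & v \<in> Homs G (eo T) N & v * u = idm N & u * v = idm (eo T) &
  (\<forall>Y\<in>fgm R. \<forall>h\<in>Homs G N (eo Y). \<exists>!g. g \<in> Homs R T Y & em T Y g * u = h)"
proof -
 interpret N: left_module G N by (rule fgmD(1)[OF N])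
 obtain n x where x: "\<And>i. i < n ==> x i IN N"
  and gen: "\<And>m. m IN N ==> \<exists>r \<in> {..<n} \<rightarrow>\<^sub>E carrier G. m = lincomb N n r x"
  using finitely_generated_lincomb[OF fgmD[OF N]] by blast
 let ?F = "free_module R n" and ?C = "free_module G n"
 note LF = free_left_module[OF A.R_ring, of n] and LC = free_left_module[OF B.R_ring, of n]
 interpret F: left_module R ?F by (rule LF)
 \<comment> \<open>The carrier of \<open>(R a)^n\<close>: an element of \<open>R\<close> lies in
   \<open>R a\<close> exactly if right multiplication by \<open>a\<close> fixes it.\<close>
 define Ec where "Ec = {r \<in> {..<n} \<rightarrow>\<^sub>E carrier R. \<forall>i<n. r i \<otimes>\<^sub>R a = r i}"
 have Ecsub: "submodule Ec R ?F"
 proof (rule F.submodule_intro)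
  show "r \<oplus>\<^sub>?F s \<in> Ec" if rs: "r \<in> Ec" "s \<in> Ec" for r s unfolding Ec_def
  proof (intro CollectI conjI allI impI)
   show "r \<oplus>\<^sub>?F s \<in> {..<n} \<rightarrow>\<^sub>E carrier R" using rs unfolding Ec_def by auto
   fix i assume i: "i < n"
   have "r i IN R" "s i IN R" using rs i unfolding Ec_def by auto
   thus "(r \<oplus>\<^sub>?F s) i \<otimes>\<^sub>R a = (r \<oplus>\<^sub>?F s) i" using rs i unfolding Ec_def by (simp add: l_distr)
  qed
  show "t \<odot>\<^sub>?F r \<in> Ec" if t: "t IN R" and r: "r \<in> Ec" for t r unfolding Ec_def
  proof (intro CollectI conjI allI impI)
   show "t \<odot>\<^sub>?F r \<in> {..<n} \<rightarrow>\<^sub>E carrier R" using r t unfolding Ec_def by auto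
   fix i assume i: "i < n"
   have "r i IN R" using r i unfolding Ec_def by auto
   thus "(t \<odot>\<^sub>?F r) i \<otimes>\<^sub>R a = (t \<odot>\<^sub>?F r) i" using r t i unfolding Ec_def by (simp add: m_assoc)
  qed
 qed (auto simp: Ec_def)
 let ?E = "?F\<lparr>carrier := Ec\<rparr>"
 note LE = submodule_left_module[OF LF Ecsub]
 interpret E: left_module R ?E by (rule LE)
 have EcI: "r \<in> Ec" if "r \<in> {..<n} \<rightarrow>\<^sub>E carrier R" "\<And>i. i < n ==> r i \<otimes>\<^sub>R a = r i" for r using that unfolding Ec_def by simp
 have Ec1: "r i IN R" "r i \<otimes>\<^sub>R a = r i" if "r \<in> Ec" "i < n" for r i using that unfolding Ec_def by auto
 have GE: "r \<in> Ec" if "r \<in> carrier ?C" for r using that by (intro EcI) (auto simp: PiE_iff corner_iff)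
 define ae where "ae j = (\<lambda>i\<in>{..<n}. if i = j then a else \<zero>\<^sub>R)" for j
 have aeC: "ae j \<in> carrier ?C" for j by (auto simp: ae_def corner_iff aa)
 have aeE: "ae j \<in> carrier ?E" for j using GE[OF aeC] by simp
 have aegen: "r = lincomb ?E n r ae" if r: "r \<in> Ec" for r
 proof -
  have "lincomb ?F m r ae = (\<lambda>i\<in>{..<n}. if i < m then r i else \<zero>\<^sub>R)" if "m \<le> n" for m
   using that
  proof (induction m)
   case (Suc m)
   thus ?case using Ec1[OF r] by (auto simp: ae_def fun_eq_iff less_Suc_eq)
  qed (auto simp: fun_eq_iff)
  from this[of n] have "lincomb ?F n r ae = r"
   using r unfolding Ec_def by (auto simp: fun_eq_iff PiE_iff extensional_def)
  thus ?thesis by (simp add: lincomb_carrier_update)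
 qed
 have Efg: "finitely_generated R ?E"
 proof (rule finitely_generated_lincombI[OF LE, of n ae])
  show "\<exists>r. (\<forall>i<n. r i IN R) & m = lincomb ?E n r ae" if "m \<in> carrier ?E" for m
   using aegen[of m] Ec1[of m] that by (intro exI[of _ m]) auto
 qed (rule aeE)
 define K where "K = {r \<in> carrier ?C. lincomb N n r x = \<zero>\<^sub>N}"
 have KE: "K \<subseteq> carrier ?E" using GE unfolding K_def by auto
 define H where "H = E.span K"
 have H: "submodule H R ?E" unfolding H_def by (rule E.span_submodule[OF KE])
 have KH: "K \<subseteq> H" unfolding H_def by (rule E.span_superset)
 have alr: "a \<otimes>\<^sub>R l \<otimes>\<^sub>R r i IN G" if "r \<in> Ec" "l IN R" "i < n" for r l i
  using Ec1[OF that(1,3)] that(2) by (simp add: corner_iff m_assoc aax)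
 \<comment> \<open>Quantifying over all \<open>l\<close> makes the condition stable under
   \<open>R\<close>: for \<open>t r\<close> the multiplier \<open>l\<close> is replaced by
   \<open>l t\<close>. So \<open>H'\<close> is a submodule containing the relations
   \<open>K\<close>, and hence contains their span \<open>H\<close>.\<close>
 define H' where "H' = {r \<in> Ec. \<forall>l\<in>carrier R. lincomb N n (%i. a \<otimes>\<^sub>R l \<otimes>\<^sub>R r i) x = \<zero>\<^sub>N}"
 have "submodule H' R ?E"
 proof (rule E.submodule_intro)
  show "H' \<subseteq> carrier ?E" unfolding H'_def by auto
  show "\<zero>\<^sub>?E \<in> H'" unfolding H'_def using E.submoduleD(2)[OF E.carrier_submodule] x
   by (auto intro!: N.lincomb_zero)
  show "r \<oplus>\<^sub>?E s \<in> H'" if rs: "r \<in> H'" "s \<in> H'" for r s unfolding H'_def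
  proof (intro CollectI conjI ballI)
   have e: "r \<in> Ec" "s \<in> Ec" using rs unfolding H'_def by auto
   show "r \<oplus>\<^sub>?E s \<in> Ec" using E.submoduleD(3)[OF E.carrier_submodule, of r s] e by simp
   fix l assume l: "l IN R"
   have "lincomb N n (%i. a \<otimes>\<^sub>R l \<otimes>\<^sub>R (r \<oplus>\<^sub>?E s) i) x =
    lincomb N n (%i. (a \<otimes>\<^sub>R l \<otimes>\<^sub>R r i) \<oplus>\<^sub>G (a \<otimes>\<^sub>R l \<otimes>\<^sub>R s i)) x"
    using Ec1[OF e(1)] Ec1[OF e(2)] l by (intro lincomb_cong) (auto simp: r_distr)
   also have "\<dots> = \<zero>\<^sub>N \<oplus>\<^sub>N \<zero>\<^sub>N"
    using N.lincomb_add[of n "%i. a \<otimes>\<^sub>R l \<otimes>\<^sub>R r i" "%i. a \<otimes>\<^sub>R l \<otimes>\<^sub>R s i" x] alr[OF e(1) l] alr[OF e(2) l] x rs l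
    unfolding H'_def by simp
   finally show "lincomb N n (%i. a \<otimes>\<^sub>R l \<otimes>\<^sub>R (r \<oplus>\<^sub>?E s) i) x = \<zero>\<^sub>N" by simp
  qed
  show "t \<odot>\<^sub>?E r \<in> H'" if t: "t IN R" and r: "r \<in> H'" for t r unfolding H'_def
  proof (intro CollectI conjI ballI)
   have e: "r \<in> Ec" using r unfolding H'_def by auto
   show "t \<odot>\<^sub>?E r \<in> Ec" using E.lm_smult_closed[OF t, of r] e by simp
   fix l assume l: "l IN R"
   have "lincomb N n (%i. a \<otimes>\<^sub>R l \<otimes>\<^sub>R (t \<odot>\<^sub>?E r) i) x = lincomb N n (%i. a \<otimes>\<^sub>R (l \<otimes>\<^sub>R t) \<otimes>\<^sub>R r i) x"
    using Ec1[OF e] l t by (intro lincomb_cong) (auto simp: m_assoc)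
   thus "lincomb N n (%i. a \<otimes>\<^sub>R l \<otimes>\<^sub>R (t \<odot>\<^sub>?E r) i) x = \<zero>\<^sub>N"
    using r l t unfolding H'_def by simp
  qed
 qed
 moreover have "K \<subseteq> H'"
 proof
  fix r assume r: "r \<in> K"
  hence rC: "r \<in> carrier ?C" and z: "lincomb N n r x = \<zero>\<^sub>N" unfolding K_def by auto
  have ri: "r i IN G" if "i < n" for i using rC that by auto
  show "r \<in> H'" unfolding H'_def
  proof (intro CollectI conjI ballI GE[OF rC])
   fix l assume l: "l IN R"
   have g: "a \<otimes>\<^sub>R l \<otimes>\<^sub>R a IN G" using l by (simp add: corner_iff m_assoc aax aa)
   have "lincomb N n (%i. a \<otimes>\<^sub>R l \<otimes>\<^sub>R r i) x = lincomb N n (%i. (a \<otimes>\<^sub>R l \<otimes>\<^sub>R a) \<otimes>\<^sub>G r i) x"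
    using ri l by (intro lincomb_cong) (auto simp: corner_iff m_assoc)
   also have "\<dots> = \<zero>\<^sub>N" using N.lincomb_smult[OF g, of n r x] ri x z N.smult_zero_right[OF g] by simp
   finally show "lincomb N n (%i. a \<otimes>\<^sub>R l \<otimes>\<^sub>R r i) x = \<zero>\<^sub>N" .
  qed
 qed
 ultimately have HH': "H \<subseteq> H'" unfolding H_def by (rule E.span_least)
 obtain T q where T: "T \<in> fgm R" and q: "q \<in> mod_hom R ?E T" and qs: "q ` carrier ?E = carrier T"
  and qk: "\<forall>x\<in>carrier ?E. q x = \<zero>\<^sub>T \<longleftrightarrow> x \<in> H"
  by (rule quotient_exists[OF LE Efg H])
 interpret T: left_module R T by (rule fgmD(1)[OF T])
 note OT = corner_fg[OF T] and Ti = eo_iff[OF T]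
 note LT = fgmD(1)[OF OT]
 have qE: "q r IN T" if "r \<in> Ec" for r using mod_homD(2)[OF q, of r] that by simp
 have qadd: "q (r \<oplus>\<^sub>?F s) = q r \<oplus>\<^sub>T q s" if "r \<in> Ec" "s \<in> Ec" for r s using mod_homD(3)[OF q, of r s] that by simp
 have qsm: "q (t \<odot>\<^sub>?F r) = t \<odot>\<^sub>T q r" if "t IN R" "r \<in> Ec" for t r using mod_homD(4)[OF q, of t r] that by simp
 have aC: "a \<odot>\<^sub>?F r \<in> carrier ?C" if r: "r \<in> Ec" for r
  using Ec1[OF r] by (auto simp: corner_iff aax m_assoc)
 have aCid: "a \<odot>\<^sub>?F r = r" if r: "r \<in> carrier ?C" for r
  using r by (auto simp: fun_eq_iff PiE_iff extensional_def corner_iff)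
 let ?p = "\<lambda>r\<in>carrier ?C. lincomb N n r x" and ?q = "\<lambda>r\<in>carrier ?C. q r"
 have rG: "r i IN G" if "r \<in> carrier ?C" "i < n" for r i using that by auto
 have p: "?p \<in> mod_hom G ?C N"
 proof (rule hom_restrict[OF LC])
  show "lincomb N n r x IN N" if "r \<in> carrier ?C" for r by (rule N.lincomb_closed[OF rG[OF that] x])
  show "lincomb N n (r \<oplus>\<^sub>?C s) x = lincomb N n r x \<oplus>\<^sub>N lincomb N n s x" if "r \<in> carrier ?C" "s \<in> carrier ?C" for r s
   using N.lincomb_add[OF rG[OF that(1)] rG[OF that(2)] x] lincomb_cong[of n "r \<oplus>\<^sub>?C s" "%i. r i \<oplus>\<^sub>G s i" x x N] by simp
  show "lincomb N n (t \<odot>\<^sub>?C r) x = t \<odot>\<^sub>N lincomb N n r x" if "t IN G" "r \<in> carrier ?C" for t r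
   using N.lincomb_smult[OF that(1) rG[OF that(2)] x] lincomb_cong[of n "t \<odot>\<^sub>?C r" "%i. t \<otimes>\<^sub>G r i" x x N] by simp
 qed
 have ps: "?p ` carrier ?C = carrier N"
 proof
  show "?p ` carrier ?C \<subseteq> carrier N" using mod_homD(2)[OF p] by auto
  show "carrier N \<subseteq> ?p ` carrier ?C"
  proof
   fix m assume "m IN N"
   then obtain r where "r \<in> {..<n} \<rightarrow>\<^sub>E carrier G" "m = lincomb N n r x" using gen by blast
   thus "m \<in> ?p ` carrier ?C" by (intro image_eqI[of _ _ r]) auto
  qed
 qed
 have qC: "?q \<in> mod_hom G ?C (eo T)"
 proof (rule hom_restrict[OF LC])
  show "q r IN (eo T)" if r: "r \<in> carrier ?C" for r
   unfolding Ti using qE[OF GE[OF r]] qsm[OF a_closed GE[OF r]] aCid[OF r] by simp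
  show "q (r \<oplus>\<^sub>?C s) = q r \<oplus>\<^sub>(eo T) q s" if "r \<in> carrier ?C" "s \<in> carrier ?C" for r s
   unfolding free_corner_simps using qadd[OF GE[OF that(1)] GE[OF that(2)]] by simp
  show "q (t \<odot>\<^sub>?C r) = t \<odot>\<^sub>(eo T) q r" if "t IN G" "r \<in> carrier ?C" for t r
   unfolding free_corner_simps using qsm[OF corner_carrier[OF that(1)] GE[OF that(2)]] by simp
 qed
 have "\<exists>u\<in>mod_hom G N (eo T). \<forall>r\<in>carrier ?C. u (?p r) = ?q r"
 proof (rule factor_surjective[OF LC N.left_module_axioms LT p ps qC])
  fix r assume r: "r \<in> carrier ?C" "?p r = \<zero>\<^sub>N"
  hence "r \<in> H" using KH unfolding K_def by auto
  hence "q r = \<zero>\<^sub>T" using qk[rule_format, of r] GE[OF r(1)] by simp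
  thus "?q r = \<zero>\<^sub>(eo T)" using r(1) by simp
 qed
 then obtain u where u: "u \<in> mod_hom G N (eo T)" and up: "\<forall>r\<in>carrier ?C. u (?p r) = ?q r" by blast
 have uq: "u (lincomb N n r x) = q r" if "r \<in> carrier ?C" for r using up that by auto
 \<comment> \<open>The condition of \<open>H'\<close> is used with \<open>l = a\<close>; on entries
   of the corner, multiplication by \<open>a a\<close> is the identity.\<close>
 have uinj: "z = \<zero>\<^sub>N" if z: "z IN N" "u z = \<zero>\<^sub>T" for z
 proof -
  obtain r where r: "r \<in> carrier ?C" "z = lincomb N n r x" using gen[OF z(1)] by auto
  have "r \<in> H'" using HH' qk[rule_format, of r] GE[OF r(1)] z(2) uq[OF r(1)] r(2) by auto
  hence "lincomb N n (%i. a \<otimes>\<^sub>R a \<otimes>\<^sub>R r i) x = \<zero>\<^sub>N" unfolding H'_def by simp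
  moreover have "lincomb N n (%i. a \<otimes>\<^sub>R a \<otimes>\<^sub>R r i) x = lincomb N n r x"
   using rG[OF r(1)] by (intro lincomb_cong) (auto simp: aa corner_iff)
  ultimately show ?thesis using r(2) by simp
 qed
 \<comment> \<open>An element \<open>q r\<close> fixed by \<open>a\<close> equals \<open>q\<close>
   of \<open>a r\<close>, whose entries lie in the corner.\<close>
 have usurj: "\<exists>z\<in>carrier N. u z = y" if y: "y IN (eo T)" for y
 proof -
  have y': "y IN T" "a \<odot>\<^sub>T y = y" using y Ti by auto
  have "y \<in> q ` carrier ?E" using y'(1) qs by simp
  then obtain r where r: "r \<in> Ec" "y = q r" by auto
  have "u (lincomb N n (a \<odot>\<^sub>?F r) x) = y" unfolding uq[OF aC[OF r(1)]] using qsm[OF a_closed r(1)] r(2) y'(2) by simp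
  moreover have "lincomb N n (a \<odot>\<^sub>?F r) x IN N" by (rule N.lincomb_closed[OF rG[OF aC[OF r(1)]] x])
  ultimately show ?thesis by blast
 qed
 note uH = HomsI[OF N OT u] and ue = ev_arr[OF N OT u]
 have "\<exists>g\<in>Homs G (eo T) N. arr N (eo T) u * g = idm (eo T)"
  by (rule Homs_lift[OF uH _ Homs_idm[OF OT]]) (use uinj usurj ev_idm[OF OT] in "auto simp: ue")
 then obtain v where v: "v \<in> Homs G (eo T) N" "arr N (eo T) u * v = idm (eo T)" by blast
 have vu: "v * arr N (eo T) u = idm N"
 proof (rule ev_eqI[OF Homs_comp[OF uH v(1)] Homs_idm[OF N]])
  fix z assume z: "z IN N"
  have uz: "u z IN (eo T)" by (rule mod_homD(2)[OF u z])
  let ?z = "ev (eo T) N v (u z)"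
  have vz: "?z IN N" by (rule ev_closed[OF v(1) uz])
  have "u ?z = u z" using ev_comp[OF v(1) uH uz] v(2) ev_idm[OF OT uz] ue by simp
  hence "u (?z \<ominus>\<^sub>N z) = \<zero>\<^sub>T"
   using mod_hom_diff[OF N.left_module_axioms LT u vz z] left_module.a_minus_eq_zero[OF LT uz uz] by simp
  hence "?z = z" using uinj[of "?z \<ominus>\<^sub>N z"] N.a_minus_eq_zero[OF vz z] vz z by simp
  thus "ev N N (v * arr N (eo T) u) z = ev N N (idm N) z" unfolding ev_comp[OF uH v(1) z] ue ev_idm[OF N z] .
 qed
 \<comment> \<open>The transpose sends the class of \<open>r\<close> to the combination of the
   elements \<open>h (x i)\<close> with coefficients \<open>r i\<close>. It is determined by the
   classes of the \<open>ae i\<close>, which are the images of the \<open>x i\<close> under the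
   unit.\<close>
 have univ: "\<exists>!g. g \<in> Homs R T Y & em T Y g * arr N (eo T) u = h" if Y: "Y \<in> fgm R" and h: "h \<in> Homs G N (eo Y)" for Y h
 proof -
  interpret Y: left_module R Y by (rule fgmD(1)[OF Y])
  let ?y = "%i. ev N (eo Y) h (x i)"
  have yc: "?y i IN (eo Y)" if "i < n" for i by (rule ev_closed[OF h x[OF that]])
  have yY: "?y i IN Y" "a \<odot>\<^sub>Y ?y i = ?y i" if "i < n" for i using yc[OF that] eo_iff[OF Y] by auto
  let ?g = "\<lambda>r\<in>carrier ?E. lincomb Y n r ?y"
  have g: "?g \<in> mod_hom R ?E Y"
  proof (rule hom_restrict[OF LE])
   show "lincomb Y n r ?y IN Y" if "r \<in> carrier ?E" for r by (rule Y.lincomb_closed) (use that Ec1 yY in auto)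
   show "lincomb Y n (r \<oplus>\<^sub>?E s) ?y = lincomb Y n r ?y \<oplus>\<^sub>Y lincomb Y n s ?y" if "r \<in> carrier ?E" "s \<in> carrier ?E" for r s
    using Y.lincomb_add[of n r s ?y] lincomb_cong[of n "r \<oplus>\<^sub>?E s" "%i. r i \<oplus>\<^sub>R s i" ?y ?y Y] Ec1 that yY by simp
   show "lincomb Y n (t \<odot>\<^sub>?E r) ?y = t \<odot>\<^sub>Y lincomb Y n r ?y" if "t IN R" "r \<in> carrier ?E" for t r
    using Y.lincomb_smult[OF that(1), of n r ?y] lincomb_cong[of n "t \<odot>\<^sub>?E r" "%i. t \<otimes>\<^sub>R r i" ?y ?y Y] Ec1 that yY by simp
  qed
  have hl: "lincomb Y n r ?y = ev N (eo Y) h (lincomb N n r x)" if r: "r \<in> carrier ?C" for r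
  proof -
   have "lincomb (eo Y) m r ?y = lincomb Y m r ?y" for m by (induction m) auto
   thus ?thesis using hom_lincomb[OF N.left_module_axioms HomsD(4)[OF h] ev_hom(1)[OF h] rG[OF r] x] by simp
  qed
  have "K \<subseteq> mod_ker ?E Y ?g"
  proof
   fix r assume "r \<in> K"
   hence r: "r \<in> carrier ?C" "lincomb N n r x = \<zero>\<^sub>N" unfolding K_def by auto
   thus "r \<in> mod_ker ?E Y ?g" unfolding mod_ker_def using GE[OF r(1)] hl[OF r(1)] ev_at_zero[OF h] by simp
  qed
  hence HK: "H \<subseteq> mod_ker ?E Y ?g" unfolding H_def
   by (rule E.span_least[OF ker_submodule[OF LE Y.left_module_axioms g]])
  have "\<exists>f\<in>mod_hom R T Y. \<forall>r\<in>carrier ?E. f (q r) = ?g r"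
  proof (rule factor_surjective[OF LE T.left_module_axioms Y.left_module_axioms q qs g])
   fix r assume r: "r \<in> carrier ?E" "q r = \<zero>\<^sub>T"
   hence "r \<in> H" using qk by blast
   thus "?g r = \<zero>\<^sub>Y" using HK unfolding mod_ker_def by blast
  qed
  then obtain f where f: "f \<in> mod_hom R T Y" and fq: "\<forall>r\<in>carrier ?E. f (q r) = ?g r" by blast
  note fH = HomsI[OF T Y f] and fe = ev_arr[OF T Y f]
  show ?thesis
  proof (intro ex1I conjI)
   show "arr T Y f \<in> Homs R T Y" by (rule fH)
   show "em T Y (arr T Y f) * arr N (eo T) u = h"
   proof (rule ev_eqI[OF Homs_comp[OF uH em_Hom[OF fH]] h])
    fix z assume z: "z IN N"
    obtain r where r: "r \<in> carrier ?C" "z = lincomb N n r x" using gen[OF z] by auto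
    have "ev N (eo Y) (em T Y (arr T Y f) * arr N (eo T) u) z = f (u z)"
     using ev_comp[OF uH em_Hom[OF fH] z] em_ev[OF fH mod_homD(2)[OF u z]] ue fe by simp
    also have "\<dots> = lincomb Y n r ?y" using uq[OF r(1)] r(2) fq GE[OF r(1)] by simp
    also have "\<dots> = ev N (eo Y) h z" using hl[OF r(1)] r(2) by simp
    finally show "ev N (eo Y) (em T Y (arr T Y f) * arr N (eo T) u) z = ev N (eo Y) h z" .
   qed
  next
   fix g' assume g': "g' \<in> Homs R T Y & em T Y g' * arr N (eo T) u = h"
   hence gH: "g' \<in> Homs R T Y" and gu: "em T Y g' * arr N (eo T) u = h" by auto
   have gx: "ev T Y g' (q (ae i)) = ?y i" if i: "i < n" for i
   proof -
    have "lincomb N n (ae i) x = lincomb N n (%j. if j = i then \<one>\<^sub>G else \<zero>\<^sub>G) x"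
     by (rule lincomb_cong) (auto simp: ae_def)
    also have "\<dots> = x i" by (rule N.lincomb_unit[OF i x])
    finally have "u (x i) = q (ae i)" using uq[OF aeC[of i]] by simp
    thus ?thesis using ev_comp[OF uH em_Hom[OF gH] x[OF i]] em_ev[OF gH mod_homD(2)[OF u x[OF i]]] ue gu by simp
   qed
   show "g' = arr T Y f"
   proof (rule ev_eqI[OF gH fH])
    fix t assume "t IN T"
    hence "t \<in> q ` carrier ?E" using qs by simp
    then obtain r where r: "r \<in> Ec" "t = q r" by auto
    have "t = q (lincomb ?E n r ae)" using aegen[OF r(1)] r(2) by simp
    also have "\<dots> = lincomb T n r (%i. q (ae i))"
     by (rule hom_lincomb[OF LE T.left_module_axioms q]) (use Ec1[OF r(1)] aeE in auto)
    finally have "ev T Y g' t = ev T Y g' (lincomb T n r (%i. q (ae i)))" by simp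
    also have "\<dots> = lincomb Y n r (%i. ev T Y g' (q (ae i)))"
     by (rule hom_lincomb[OF T.left_module_axioms Y.left_module_axioms ev_hom(1)[OF gH]]) (use Ec1[OF r(1)] qE GE[OF aeC] in auto)
    also have "\<dots> = lincomb Y n r ?y" using gx by (intro lincomb_cong) auto
    also have "\<dots> = f t" using fq r by simp
    finally show "ev T Y g' t = ev T Y (arr T Y f) t" unfolding fe .
   qed
  qed
 qed
 show ?thesis using T uH v vu univ by blast
qed

section \<open>Transport of the hypothesis and noetherianity\<close>

lemma ext_vanishes_extz:
 "X \<in> fgm R ==> Y \<in> fgm R ==> ext_vanishes R (Suc n) X Y \<longleftrightarrow> A.extz n X Y"
 "X' \<in> fgm G ==> Y' \<in> fgm G ==> ext_vanishes G (Suc n) X' Y' \<longleftrightarrow> B.extz n X' Y'"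
proof -
 show "X \<in> fgm R ==> Y \<in> fgm R ==> ext_vanishes R (Suc n) X Y \<longleftrightarrow> A.extz n X Y"
  by (rule A.ext_vanishes_iff[OF _ fgmD(1) _ mod_hom_idn[OF fgmD(1)] mod_hom_idn[OF fgmD(1)]]) simp_all
 show "X' \<in> fgm G ==> Y' \<in> fgm G ==> ext_vanishes G (Suc n) X' Y' \<longleftrightarrow> B.extz n X' Y'"
  by (rule B.ext_vanishes_iff[OF _ fgmD(1) _ mod_hom_idn[OF fgmD(1)] mod_hom_idn[OF fgmD(1)]]) simp_all
qed

text \<open>An isomorphism of groups is used only as a bijection: Ext vanishes exactly if its
  carrier has one element. From \<open>n\<close> at least \<open>nat t\<close> on, the degree
  \<open>Suc n\<close> that belongs to \<open>extz n\<close> exceeds \<open>t\<close>.\<close>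

lemma eventually_extz:
 assumes "\<exists>t::int. \<forall>X\<in>fgm R. \<forall>Y\<in>fgm R. \<forall>j::nat. int j > t --> ext_group R j X Y \<cong> ext_group G j (eo X) (eo Y)"
 shows "\<exists>t. \<forall>n\<ge>t. \<forall>X\<in>fgm R. \<forall>Y\<in>fgm R. A.extz n X Y \<longleftrightarrow> B.extz n (eo X) (eo Y)"
proof -
 obtain t :: int where t: "\<And>X Y j. X \<in> fgm R ==> Y \<in> fgm R ==> int j > t ==>
  ext_group R j X Y \<cong> ext_group G j (eo X) (eo Y)" using assms by blast
 show ?thesis
 proof (intro exI[of _ "nat t"] allI impI ballI)
  fix n X Y assume n: "nat t \<le> n" and X: "X \<in> fgm R" and Y: "Y \<in> fgm R"
  have "ext_group R (Suc n) X Y \<cong> ext_group G (Suc n) (eo X) (eo Y)" using t[OF X Y, of "Suc n"] n by simp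
  then obtain f where f: "bij_betw f (carrier (ext_group R (Suc n) X Y)) (carrier (ext_group G (Suc n) (eo X) (eo Y)))"
   unfolding is_iso_def iso_def by auto
  have "ext_vanishes R (Suc n) X Y \<longleftrightarrow> card (carrier (ext_group R (Suc n) X Y)) = 1"
   unfolding ext_vanishes_def using A.ext_one_closed[OF X fgmD(1)[OF Y], of n] by (auto simp: card_1_singleton_iff)
  also have "\<dots> \<longleftrightarrow> card (carrier (ext_group G (Suc n) (eo X) (eo Y))) = 1" using bij_betw_same_card[OF f] by simp
  also have "\<dots> \<longleftrightarrow> ext_vanishes G (Suc n) (eo X) (eo Y)"
   unfolding ext_vanishes_def using B.ext_one_closed[OF corner_fg[OF X] fgmD(1)[OF corner_fg[OF Y]], of n]
   by (auto simp: card_1_singleton_iff)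
  finally show "A.extz n X Y \<longleftrightarrow> B.extz n (eo X) (eo Y)"
   using ext_vanishes_extz(1)[OF X Y] ext_vanishes_extz(2)[OF corner_fg[OF X] corner_fg[OF Y]] by blast
 qed
qed

end

text \<open>One-sided ideals of the algebra and of its corner are all submodules of the algebra over
  the base ring, which is finitely generated over a noetherian ring. A scalar \<open>r\<close> acts
  on the corner through the element \<open>a \<phi>(r) a\<close>.\<close>

lemma left_noetherian_corner:
 fixes k :: "'k ring" and \<phi> :: "'k => 'a" and R :: "'a ring"
 assumes A: "artin_algebra k \<phi> R" and a: "a IN R" "a \<otimes>\<^sub>R a = a"
 shows "bi_noetherian R" "bi_noetherian (corner_ring R a)"
proof -
 have k: "cring k" "artinian_ring k" and R: "ring R" and \<phi>: "\<phi> \<in> ring_hom k R"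
  and c: "\<And>r x. r IN k ==> x IN R ==> \<phi> r \<otimes>\<^sub>R x = x \<otimes>\<^sub>R \<phi> r"
  and fg: "finitely_generated k (scalar_module \<phi> R)" using A unfolding artin_algebra_def by auto
 interpret k: cring k by fact
 interpret idempotent R a by (intro idempotent.intro idempotent_axioms.intro R a)
 note kn = artinian_imp_noetherian[OF k]
 have \<phi>c: "\<phi> r IN R" if "r IN k" for r using ring_hom_closed[OF \<phi> that] .
 let ?M = "scalar_module \<phi> R"
 have Ms [simp]: "carrier ?M = carrier R" "\<zero>\<^sub>?M = \<zero>\<^sub>R" "\<And>x y. x \<oplus>\<^sub>?M y = x \<oplus>\<^sub>R y" "\<And>r x. r \<odot>\<^sub>?M x = \<phi> r \<otimes>\<^sub>R x"
  by (simp_all add: scalar_module_def)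
 have LM: "lmod k ?M" by (rule left_moduleI[OF k.ring_axioms])
   (auto simp: \<phi>c ring_hom_add[OF \<phi>] ring_hom_mult[OF \<phi>] ring_hom_one[OF \<phi>] ring_hom_zero[OF \<phi> k.ring_axioms R]
    a_assoc l_distr r_distr m_assoc intro: a_comm)
 interpret M: left_module k ?M by (rule LM)
 have sub: "submodule I k ?M"
  if I: "submodule I S (reg S)" and S: "ring S" "carrier S \<subseteq> carrier R" "\<zero>\<^sub>S = \<zero>\<^sub>R" "\<And>x y. x \<oplus>\<^sub>S y = x \<oplus>\<^sub>R y"
   and m: "\<And>r x. r IN k ==> x IN S ==> \<exists>s\<in>carrier S. \<phi> r \<otimes>\<^sub>R x = s \<otimes>\<^sub>S x" for I and S :: "'a ring"
 proof -
  note d = left_module.submoduleD[OF reg_left_module[OF S(1)] I]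
  show ?thesis
  proof (rule M.submodule_intro)
   show "I \<subseteq> carrier ?M" using d(1) S(2) by auto
   show "\<zero>\<^sub>?M \<in> I" using d(2) S(3) by simp
   show "x \<oplus>\<^sub>?M y \<in> I" if "x \<in> I" "y \<in> I" for x y using d(3)[OF that] S(4) by simp
   show "r \<odot>\<^sub>?M x \<in> I" if r: "r IN k" and x: "x \<in> I" for r x
   proof -
    have "x IN S" using d(7)[OF x] by simp
    then obtain s where "s IN S" "\<phi> r \<otimes>\<^sub>R x = s \<otimes>\<^sub>S x" using m[OF r] by blast
    thus ?thesis using d(6)[of s x] x by simp
   qed
  qed
 qed
 have aug: "a \<otimes>\<^sub>R \<phi> r \<otimes>\<^sub>R a IN G" if "r IN k" for r using \<phi>c[OF that] by (simp add: corner_iff m_assoc aa aax)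
 have "left_noetherian R" by (rule left_noetherian_over[OF kn LM fg R], rule sub[of _ R]) (use \<phi>c R in auto)
 moreover have "left_noetherian (opposite_ring R)"
  by (rule left_noetherian_over[OF kn LM fg opposite_ring[OF R]], rule sub[of _ "opposite_ring R"])
   (use \<phi>c c opposite_ring[OF R] in auto)
 moreover have "left_noetherian G"
 proof (rule left_noetherian_over[OF kn LM fg corner_is_ring], rule sub[of _ G])
  show "\<exists>s\<in>carrier G. \<phi> r \<otimes>\<^sub>R x = s \<otimes>\<^sub>G x" if r: "r IN k" and x: "x IN G" for r x
  proof (intro bexI[OF _ aug[OF r]])
   have x': "x IN R" "a \<otimes>\<^sub>R x = x" using x by (auto simp: corner_iff)
   have "a \<otimes>\<^sub>R \<phi> r \<otimes>\<^sub>R a \<otimes>\<^sub>R x = a \<otimes>\<^sub>R (\<phi> r \<otimes>\<^sub>R x)" using x' \<phi>c[OF r] by (simp add: m_assoc)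
   also have "\<dots> = \<phi> r \<otimes>\<^sub>R x" using x' \<phi>c[OF r] c[OF r] by (metis a_closed m_assoc)
   finally show "\<phi> r \<otimes>\<^sub>R x = (a \<otimes>\<^sub>R \<phi> r \<otimes>\<^sub>R a) \<otimes>\<^sub>G x" by simp
  qed
 qed (use corner_carrier corner_is_ring in auto)
 moreover have "left_noetherian (opposite_ring G)"
 proof (rule left_noetherian_over[OF kn LM fg opposite_ring[OF corner_is_ring]], rule sub[of _ "opposite_ring G"])
  show "\<exists>s\<in>carrier (opposite_ring G). \<phi> r \<otimes>\<^sub>R x = s \<otimes>\<^sub>(opposite_ring G) x" if r: "r IN k" and x: "x IN (opposite_ring G)" for r x
  proof (intro bexI[of _ "a \<otimes>\<^sub>R \<phi> r \<otimes>\<^sub>R a"])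
   have x': "x IN R" "a \<otimes>\<^sub>R x = x" "x \<otimes>\<^sub>R a = x" using x by (auto simp: corner_iff)
   have "x \<otimes>\<^sub>R (a \<otimes>\<^sub>R \<phi> r \<otimes>\<^sub>R a) = (x \<otimes>\<^sub>R a) \<otimes>\<^sub>R \<phi> r \<otimes>\<^sub>R a" using x'(1) \<phi>c[OF r] by (metis a_closed m_assoc m_closed)
   also have "\<dots> = \<phi> r \<otimes>\<^sub>R x" unfolding x'(3) c[OF r x'(1), symmetric] m_assoc[OF \<phi>c[OF r] x'(1) a_closed] ..
   finally show "\<phi> r \<otimes>\<^sub>R x = (a \<otimes>\<^sub>R \<phi> r \<otimes>\<^sub>R a) \<otimes>\<^sub>(opposite_ring G) x" by simp
   show "a \<otimes>\<^sub>R \<phi> r \<otimes>\<^sub>R a IN (opposite_ring G)" using aug[OF r] by simp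
  qed
 qed (use corner_carrier opposite_ring[OF corner_is_ring] in auto)
 ultimately show "bi_noetherian R" "bi_noetherian (corner_ring R a)" by (auto intro: bi_noetherian.intro)
qed

section \<open>Triangles of Cohen-Macaulay modules\<close>

locale gorenstein_modules = noetherian_modules R for R :: "'a ring" +
 assumes gor: "gorenstein_category (fgm R) (Homs R) idm (exact_seq R) (rcopy R)"

sublocale gorenstein_modules \<subseteq> gorenstein_category "fgm R" "Homs R" idm "exact_seq R" "rcopy R"
 by (rule gor)

lemma ev_inj: "h \<in> Homs R X Y ==> k \<in> Homs R X Y ==> ev X Y h = ev X Y k \<longleftrightarrow> h = k"
 using ev_hom(2) by metis

lemma compose_ev:
 assumes "h \<in> Homs R X Y" "k \<in> Homs R Y Z" shows "cmp X (ev Y Z k) (ev X Y h) = ev X Z (k * h)"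
 using ev_comp[OF assms] mod_homD(1)[OF ev_hom(1)[OF Homs_comp[OF assms]]]
 by (intro extensionalityI[of _ "carrier X"]) (auto simp: compose_def)

lemma add_ev:
 assumes "h \<in> Homs R X Y" "k \<in> Homs R X Y" shows "(\<lambda>x\<in>carrier X. ev X Y h x \<oplus>\<^sub>Y ev X Y k x) = ev X Y (h + k)"
 using ev_add[OF assms] mod_homD(1)[OF ev_hom(1)[OF Homs_add[OF assms]]]
 by (intro extensionalityI[of _ "carrier X"]) auto

lemma idm_ev:
 assumes "X \<in> fgm R" shows "(\<lambda>x\<in>carrier X. x) = ev X X (idm X)"
 using ev_arr[OF assms assms mod_hom_idn[OF fgmD(1)[OF assms]]] unfolding idm_def by simp

lemma zero_ev:
 assumes "X \<in> fgm R" "Y \<in> fgm R" shows "zero_map X Y = ev X Y 0"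
 using ev_arr[OF assms mod_hom_zero_map[OF fgmD(1)[OF assms(1)] fgmD(1)[OF assms(2)]]]
  arr_zero[OF fgmD(1)[OF assms(1)] fgmD(1)[OF assms(2)]] by simp

lemma mod_hom_ev:
 assumes "X \<in> fgm R" "Y \<in> fgm R" "f \<in> mod_hom R X Y"
 shows "\<exists>h\<in>Homs R X Y. f = ev X Y h"
 using HomsI[OF assms] ev_arr[OF assms] by metis

lemma stable_CM_simps [simp]:
 "cat_ob (stable_CM R) = CM R" "cat_hom (stable_CM R) X Y = hom_group R X Y Mod projective_maps R X Y"
 "cat_comp (stable_CM R) = stcomp R" "cat_id (stable_CM R) = cat_id (stable_category R)"
 "tri_shift (stable_CM R) = susp_functor R" "tri_dist (stable_CM R) = distinguished_triangles R"
 "cat_ob (stable_category R) = CM R" "cat_hom (stable_category R) X Y = hom_group R X Y Mod projective_maps R X Y"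
 unfolding stable_CM_def category_data.defs triangulated_data.defs by (simp_all add: stable_category_def)

section \<open>Stable classes in terms of arrows\<close>

context gorenstein_modules
begin

definition sc :: "'a fg_module => 'a fg_module => 'a marr => 'a fg_map set" where
 "sc X Y h = stable_class R X Y (ev X Y h)"

lemma projective_maps_ev:
 assumes X: "X \<in> fgm R" and Y: "Y \<in> fgm R"
 shows "projective_maps R X Y = ev X Y ` pmaps X Y"
proof (intro equalityI subsetI)
 fix f assume "f \<in> projective_maps R X Y"
 then obtain Q g h where f: "f = cmp X h g" "Q \<in> projectives R" "g \<in> mod_hom R X Q" "h \<in> mod_hom R Q Y"
  unfolding projective_maps_def by auto
 have Q: "proj Q" using f(2) proj_iff by blast
 have O: "Q \<in> fgm R" using proj_Ob[OF Q] .
 have "arr Q Y h * arr X Q g \<in> pmaps X Y" using pmapsI[OF Q HomsI[OF X O f(3)] HomsI[OF O Y f(4)]] .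
 moreover have "f = ev X Y (arr Q Y h * arr X Q g)"
  using compose_ev[OF HomsI[OF X O f(3)] HomsI[OF O Y f(4)]] ev_arr[OF X O f(3)] ev_arr[OF O Y f(4)] f(1) by simp
 ultimately show "f \<in> ev X Y ` pmaps X Y" by blast
next
 fix f assume "f \<in> ev X Y ` pmaps X Y"
 then obtain k where k: "k \<in> pmaps X Y" "f = ev X Y k" by blast
 obtain Q g h where Q: "proj Q" "g \<in> Homs R X Q" "h \<in> Homs R Q Y" "k = h * g" using k(1) by (rule pmapsE)
 have "f = cmp X (ev Q Y h) (ev X Q g)" using compose_ev[OF Q(2,3)] Q(4) k(2) by simp
 thus "f \<in> projective_maps R X Y"
  unfolding projective_maps_def using Q(1) ev_hom(1)[OF Q(2)] ev_hom(1)[OF Q(3)] proj_iff by blast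
qed

context
 fixes X Y :: "'a fg_module"
 assumes X: "cm X" and Y: "Y \<in> fgm R"
begin

text \<open>With this, statements about cosets in the stable category turn into statements about
  \<open>eqv\<close> on arrows, where the abstract theory applies.\<close>

lemma sc_ev:
 assumes h: "h \<in> Homs R X Y" shows "sc X Y h = ev X Y ` {k. eqv X Y k h}"
proof -
 note O = cm_Ob[OF X]
 have "sc X Y h = (%k. \<lambda>x\<in>carrier X. ev X Y k x \<oplus>\<^sub>Y ev X Y h x) ` pmaps X Y"
  unfolding sc_def stable_class_def r_coset_def projective_maps_ev[OF O Y] by (auto simp: hom_group_def)
 also have "\<dots> = ev X Y ` ((%k. k + h) ` pmaps X Y)"
  unfolding image_image by (rule image_cong[OF refl]) (use add_ev[OF _ h] pmaps_Hom in blast)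
 also have "(%k. k + h) ` pmaps X Y = {k. eqv X Y k h}"
 proof (intro equalityI subsetI)
  fix k assume "k \<in> (%k. k + h) ` pmaps X Y"
  thus "k \<in> {k. eqv X Y k h}" unfolding eqv_def using X h Homs_add[OF pmaps_Hom h] by auto
 next
  fix k assume "k \<in> {k. eqv X Y k h}"
  thus "k \<in> (%k. k + h) ` pmaps X Y" using eqvD(4)[of X Y k h] by (intro image_eqI[of _ _ "k - h"]) auto
 qed
 finally show ?thesis .
qed

lemma sc_eq_iff:
 assumes h: "h \<in> Homs R X Y" and k: "k \<in> Homs R X Y" shows "sc X Y h = sc X Y k \<longleftrightarrow> eqv X Y h k"
proof
 assume "sc X Y h = sc X Y k"
 moreover have "ev X Y h \<in> sc X Y h" unfolding sc_ev[OF h] using eqv_refl[OF X h] by blast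
 ultimately obtain k' where k': "eqv X Y k' k" "ev X Y h = ev X Y k'" unfolding sc_ev[OF k] by auto
 thus "eqv X Y h k" using ev_inj[OF h eqvD(2)[OF k'(1)]] by simp
next
 assume e: "eqv X Y h k"
 have "{l. eqv X Y l h} = {l. eqv X Y l k}" using e eqv_trans eqv_sym by blast
 thus "sc X Y h = sc X Y k" unfolding sc_ev[OF h] sc_ev[OF k] by simp
qed

lemma sc_Mod: "carrier (hom_group R X Y Mod projective_maps R X Y) = sc X Y ` Homs R X Y"
proof -
 note O = cm_Ob[OF X]
 have "carrier (hom_group R X Y Mod projective_maps R X Y) = stable_class R X Y ` mod_hom R X Y"
  unfolding FactGroup_def RCOSETS_def stable_class_def by (auto simp: hom_group_def)
 also have "mod_hom R X Y = ev X Y ` Homs R X Y" using mod_hom_ev[OF O Y] ev_hom(1) by blast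
 finally show ?thesis unfolding sc_def by (simp add: image_image)
qed

lemma sc_mult:
 assumes h: "h \<in> Homs R X Y" and k: "k \<in> Homs R X Y"
 shows "sc X Y h \<otimes>\<^sub>(hom_group R X Y Mod projective_maps R X Y) sc X Y k = sc X Y (h + k)"
proof -
 have "sc X Y h \<otimes>\<^sub>(hom_group R X Y Mod projective_maps R X Y) sc X Y k =
  {\<lambda>x\<in>carrier X. f x \<oplus>\<^sub>Y g x | f g. f \<in> sc X Y h & g \<in> sc X Y k}"
  unfolding FactGroup_def set_mult_def by (auto simp: hom_group_def)
 also have "\<dots> = ev X Y ` {l. eqv X Y l (h + k)}"
 proof (intro equalityI subsetI)
  fix l assume "l \<in> {\<lambda>x\<in>carrier X. f x \<oplus>\<^sub>Y g x | f g. f \<in> sc X Y h & g \<in> sc X Y k}"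
  then obtain f g where l: "l = (\<lambda>x\<in>carrier X. f x \<oplus>\<^sub>Y g x)" "f \<in> sc X Y h" "g \<in> sc X Y k" by blast
  obtain f' where f: "eqv X Y f' h" "f = ev X Y f'" using l(2) unfolding sc_ev[OF h] by blast
  obtain g' where g: "eqv X Y g' k" "g = ev X Y g'" using l(3) unfolding sc_ev[OF k] by blast
  have "l = ev X Y (f' + g')" using l(1) f g add_ev[OF eqvD(2)[OF f(1)] eqvD(2)[OF g(1)]] by simp
  thus "l \<in> ev X Y ` {l. eqv X Y l (h + k)}" using eqv_add[OF f(1) g(1)] by blast
 next
  fix l assume "l \<in> ev X Y ` {l. eqv X Y l (h + k)}"
  then obtain l' where l: "eqv X Y l' (h + k)" "l = ev X Y l'" by blast
  have d: "l' - k \<in> Homs R X Y" by (rule Hom_diff[OF eqvD(2)[OF l(1)] k])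
  have "eqv X Y (l' - k) h" using eqvD[OF l(1)] h d unfolding eqv_def by (simp add: algebra_simps)
  hence "ev X Y (l' - k) \<in> sc X Y h" "ev X Y k \<in> sc X Y k" unfolding sc_ev[OF h] sc_ev[OF k] using eqv_refl[OF X k] by auto
  moreover have "l = (\<lambda>x\<in>carrier X. ev X Y (l' - k) x \<oplus>\<^sub>Y ev X Y k x)" using l(2) add_ev[OF d k] by simp
  ultimately show "l \<in> {\<lambda>x\<in>carrier X. f x \<oplus>\<^sub>Y g x | f g. f \<in> sc X Y h & g \<in> sc X Y k}" by blast
 qed
 finally show ?thesis using sc_ev[OF Homs_add[OF h k]] by simp
qed

end

lemma sc_comp:
 assumes X: "cm X" and Y: "cm Y" and h: "h \<in> Homs R X Y" and k: "k \<in> Homs R Y Z"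
 shows "stcomp R X Y Z (sc Y Z k) (sc X Y h) = sc X Z (k * h)"
proof -
 note OY = cm_Ob[OF Y] and OZ = HomsD(2)[OF k]
 have kh: "k * h \<in> Homs R X Z" by (rule Homs_comp[OF h k])
 have *: "stable_class R X Z (cmp X g f) = sc X Z (k * h)" if g: "g \<in> sc Y Z k" and f: "f \<in> sc X Y h" for g f
 proof -
  obtain g' where g: "eqv Y Z g' k" "g = ev Y Z g'" using g unfolding sc_ev[OF Y OZ k] by blast
  obtain f' where f: "eqv X Y f' h" "f = ev X Y f'" using f unfolding sc_ev[OF X OY h] by blast
  note f' = eqvD(2)[OF f(1)] and g' = eqvD(2)[OF g(1)]
  have "eqv X Z (g' * f') (g' * h)" by (rule eqv_left[OF f(1) g'])
  also have "eqv X Z (g' * h) (k * h)" by (rule eqv_right[OF g(1) X h])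
  finally have "sc X Z (g' * f') = sc X Z (k * h)" using sc_eq_iff[OF X OZ Homs_comp[OF f' g'] kh] by simp
  thus ?thesis unfolding f(2) g(2) compose_ev[OF f' g'] sc_def .
 qed
 have ne: "ev Y Z k \<in> sc Y Z k" "ev X Y h \<in> sc X Y h"
  unfolding sc_ev[OF Y OZ k] sc_ev[OF X OY h] using eqv_refl[OF X h] eqv_refl[OF Y k] by auto
 have "stcomp R X Y Z (sc Y Z k) (sc X Y h) = (\<Union>g\<in>sc Y Z k. \<Union>f\<in>sc X Y h. sc X Z (k * h))"
  unfolding stable_category_def using * by (auto simp del: UN_simps)
 thus ?thesis using ne by auto
qed

lemma sc_id: assumes "cm X" shows "cat_id (stable_category R) X = sc X X (idm X)"
 unfolding stable_category_def sc_def using idm_ev[OF cm_Ob[OF assms]] by simp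

lemma sc_hom:
 assumes "cm X" "Y \<in> fgm R"
 shows "hom_set (stable_category R) X Y = sc X Y ` Homs R X Y" "hom_set (stable_CM R) X Y = sc X Y ` Homs R X Y"
 using sc_Mod[OF assms] by simp_all

lemma is_isomorphism_sc:
 assumes X: "cm X" and Y: "cm Y" and h: "h \<in> Homs R X Y"
 shows "is_isomorphism (stable_category R) X Y (sc X Y h) \<longleftrightarrow> (\<exists>k. siso X Y h k)"
proof -
 note OX = cm_Ob[OF X] and OY = cm_Ob[OF Y]
 have "is_isomorphism (stable_category R) X Y (sc X Y h) \<longleftrightarrow>
  (\<exists>k\<in>Homs R Y X. sc X X (k * h) = sc X X (idm X) & sc Y Y (h * k) = sc Y Y (idm Y))"
  unfolding is_isomorphism_def sc_hom[OF X OY] sc_hom[OF Y OX] sc_id[OF X] sc_id[OF Y]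
  using sc_comp[OF X Y h] sc_comp[OF Y X _ h] h by auto
 also have "\<dots> \<longleftrightarrow> (\<exists>k. siso X Y h k)"
  unfolding siso_def using sc_eq_iff[OF X OX Homs_comp[OF h] Homs_idm[OF OX]] sc_eq_iff[OF Y OY Homs_comp[OF _ h] Homs_idm[OF OY]] h
  by blast
 finally show ?thesis .
qed

lemma is_isomorphism_stable_CM:
 "is_isomorphism (stable_CM R) X Y f \<longleftrightarrow> is_isomorphism (stable_category R) X Y f"
 unfolding is_isomorphism_def by simp

section \<open>Chosen suspensions and distinguished triangles\<close>

definition si :: "'a fg_module => 'a marr" where "si X = arr X (susp_I R X) (susp_i R X)"
definition sp :: "'a fg_module => 'a marr" where "sp X = arr (susp_I R X) (susp_ob R X) (susp_p R X)"

abbreviation "sI X \<equiv> susp_I R X"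
abbreviation "sS X \<equiv> susp_ob R X"

lemma
 assumes X: "cm X"
 shows susp_chosen: "susp X (sI X) (sS X) (si X) (sp X)"
  and si_ev: "ev X (sI X) (si X) = susp_i R X" and sp_ev: "ev (sI X) (sS X) (sp X) = susp_p R X"
proof -
 obtain I S i p where s: "susp X I S i p" using cm_susp[OF X] by metis
 note d = suspD[OF s] and e = exact_seqD[OF suspD(1)[OF s]]
 have "\<exists>q. case q of (I, S, i, p) => I \<in> projectives R & S \<in> CM R & short_exact R X I S i p"
  using d(2,3) e(13) proj_iff CM_iff by (intro exI[of _ "(I, S, ev X I i, ev I S p)"]) simp
 note q = someI_ex[OF this, folded susp_sequence_def]
 obtain I0 S0 i0 p0 where "susp_sequence R X = (I0, S0, i0, p0)" by (rule prod_cases4)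
 hence c: "sI X \<in> projectives R" "sS X \<in> CM R" "short_exact R X (sI X) (sS X) (susp_i R X) (susp_p R X)"
  using q unfolding susp_I_def susp_ob_def susp_i_def susp_p_def by simp_all
 have O: "X \<in> fgm R" "sI X \<in> fgm R" "sS X \<in> fgm R"
  using cm_Ob[OF X] c(1) c(2) CM_iff cm_Ob unfolding projectives_def by auto
 show "susp X (sI X) (sS X) (si X) (sp X)"
  unfolding susp_def si_def sp_def using exact_seqI[OF O c(3)] c(1,2) proj_iff CM_iff by blast
 have m: "susp_i R X \<in> mod_hom R X (sI X)" "susp_p R X \<in> mod_hom R (sI X) (sS X)" using c(3) unfolding short_exact_def by auto
 show "ev X (sI X) (si X) = susp_i R X" "ev (sI X) (sS X) (sp X) = susp_p R X"
  unfolding si_def sp_def using ev_arr[OF O(1,2) m(1)] ev_arr[OF O(2,3) m(2)] by auto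
qed

lemma sS_cm: "cm X ==> cm (sS X)" using suspD(3)[OF susp_chosen] .

definition shf :: "'a fg_module => 'a fg_module => 'a marr => 'a marr => bool" where
 "shf X Y f g \<longleftrightarrow> shifted (sI X) (sS X) (si X) (sp X) (sI Y) (sS Y) (si Y) (sp Y) f g"

lemma shf_exists: "cm X ==> cm Y ==> f \<in> Homs R X Y ==> \<exists>g. shf X Y f g"
 unfolding shf_def using shifted_exists[OF susp_chosen susp_chosen] by metis

lemma shf_Hom: "shf X Y f g ==> g \<in> Homs R (sS X) (sS Y)"
 unfolding shf_def shifted_def by blast

lemma susp_mor_sc:
 assumes X: "cm X" and Y: "cm Y" and f: "f \<in> Homs R X Y" and g: "shf X Y f g"
 shows "susp_mor R X Y (sc X Y f) = sc (sS X) (sS Y) g"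
proof -
 note sX = suspD[OF susp_chosen[OF X]] and sY = suspD[OF susp_chosen[OF Y]]
 note OX = cm_Ob[OF X] and OY = cm_Ob[OF Y] and e = si_ev[OF X, symmetric] si_ev[OF Y, symmetric] sp_ev[OF X, symmetric] sp_ev[OF Y, symmetric]
 let ?M = "{stable_class R (sS X) (sS Y) g | f' h g. f' \<in> sc X Y f & h \<in> mod_hom R (sI X) (sI Y) & g \<in> mod_hom R (sS X) (sS Y) &
   cmp X h (susp_i R X) = cmp X (susp_i R Y) f' &
   cmp (sI X) g (susp_p R X) = cmp (sI X) (susp_p R Y) h}"
 \<comment> \<open>Every member of the union comes from a shift of a representative of the class of
   \<open>f\<close>, and \<open>shifted_unique\<close> makes its class that of
   \<open>g\<close>.\<close>
 have "m = sc (sS X) (sS Y) g" if m: "m \<in> ?M" for m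
 proof -
  obtain f' h0 g0 where m: "m = stable_class R (sS X) (sS Y) g0" "f' \<in> sc X Y f" "h0 \<in> mod_hom R (sI X) (sI Y)" "g0 \<in> mod_hom R (sS X) (sS Y)"
   "cmp X h0 (susp_i R X) = cmp X (susp_i R Y) f'"
   "cmp (sI X) g0 (susp_p R X) = cmp (sI X) (susp_p R Y) h0" using m by blast
  obtain f1 where f1: "eqv X Y f1 f" "f' = ev X Y f1" using m(2) unfolding sc_ev[OF X OY f] by blast
  obtain h1 where h1: "h1 \<in> Homs R (sI X) (sI Y)" "h0 = ev (sI X) (sI Y) h1" using mod_hom_ev[OF sX(8) sY(8) m(3)] by blast
  obtain g1 where g1: "g1 \<in> Homs R (sS X) (sS Y)" "g0 = ev (sS X) (sS Y) g1" using mod_hom_ev[OF sX(9) sY(9) m(4)] by blast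
  note f1' = eqvD(2)[OF f1(1)]
  have "h1 * si X = si Y * f1"
   using m(5) unfolding e h1(2) f1(2) compose_ev[OF sX(5) h1(1)] compose_ev[OF f1' sY(5)] ev_inj[OF Homs_comp[OF sX(5) h1(1)] Homs_comp[OF f1' sY(5)]] .
  moreover have "g1 * sp X = sp Y * h1"
   using m(6) unfolding e h1(2) g1(2) compose_ev[OF sX(6) g1(1)] compose_ev[OF h1(1) sY(6)] ev_inj[OF Homs_comp[OF sX(6) g1(1)] Homs_comp[OF h1(1) sY(6)]] .
  ultimately have "shf X Y f1 g1" unfolding shf_def shifted_def using g1(1) h1(1) by blast
  hence "eqv (sS X) (sS Y) g1 g" using shifted_unique[OF susp_chosen[OF X] susp_chosen[OF Y] f1(1)] g unfolding shf_def by blast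
  thus ?thesis using sc_eq_iff[OF sX(3) sY(9) g1(1) shf_Hom[OF g]] m(1) g1(2) unfolding sc_def by simp
 qed
 moreover have "sc (sS X) (sS Y) g \<in> ?M"
 proof -
  obtain h where h: "h \<in> Homs R (sI X) (sI Y)" "h * si X = si Y * f" "g * sp X = sp Y * h" using g unfolding shf_def shifted_def by blast
  have "ev X Y f \<in> sc X Y f" unfolding sc_ev[OF X OY f] using eqv_refl[OF X f] by blast
  moreover have "cmp X (ev (sI X) (sI Y) h) (susp_i R X) = cmp X (susp_i R Y) (ev X Y f)"
   unfolding e compose_ev[OF sX(5) h(1)] compose_ev[OF f sY(5)] h(2) ..
  moreover have "cmp (sI X) (ev (sS X) (sS Y) g) (susp_p R X) = cmp (sI X) (susp_p R Y) (ev (sI X) (sI Y) h)"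
   unfolding e compose_ev[OF sX(6) shf_Hom[OF g]] compose_ev[OF h(1) sY(6)] h(3) ..
  ultimately show ?thesis unfolding sc_def[of "sS X"] using ev_hom(1)[OF h(1)] ev_hom(1)[OF shf_Hom[OF g]] by blast
 qed
 ultimately have "?M = {sc (sS X) (sS Y) g}" by blast
 thus ?thesis unfolding susp_mor_def by simp
qed

abbreviation "ccone X Y u Z v j w \<equiv> cone X (sI X) (sS X) (si X) (sp X) Y u Z v j w"

lemma CM_category_simps:
 "cat_ob (CM_category R) = CM R" "hom_set (CM_category R) X Y = mod_hom R X Y"
 "cat_comp (CM_category R) X Y Z g f = cmp X g f"
 unfolding CM_category_def mod_category_def by (simp_all add: hom_group_def)

text \<open>A pushout among Cohen-Macaulay modules is recognized as an abstract cone by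
  \<open>coneI\<close>; in the other direction the universal property of a cone holds for all
  modules, in particular for the Cohen-Macaulay ones.\<close>

lemma standard_triangles_iff:
 "T \<in> standard_triangles R \<longleftrightarrow> (\<exists>X Y u Z v j w. T = (X, Y, Z, sc X Y u, sc Y Z v, sc Z (sS X) w) & ccone X Y u Z v j w)"
proof
 assume "T \<in> standard_triangles R"
 then obtain X Y Z u v w j where T: "T = (X, Y, Z, stable_class R X Y u, stable_class R Y Z v, stable_class R Z (sS X) w)"
  and po: "is_pushout (CM_category R) X (sI X) Y Z (susp_i R X) u j v"
  and w: "w \<in> mod_hom R Z (sS X)" "cmp (sI X) w j = susp_p R X" "cmp Y w v = zero_map Y (sS X)"
  unfolding standard_triangles_def by blast
 have CMs: "cm X" "cm (sI X)" "cm Y" "cm Z"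
  and m: "u \<in> mod_hom R X Y" "j \<in> mod_hom R (sI X) Z" "v \<in> mod_hom R Y Z"
  and e: "cmp X j (susp_i R X) = cmp X v u"
  and un: "\<And>W p q. W \<in> CM R ==> p \<in> mod_hom R (sI X) W ==> q \<in> mod_hom R Y W ==>
    cmp X p (susp_i R X) = cmp X q u ==>
    \<exists>!h. h \<in> mod_hom R Z W & cmp (sI X) h j = p & cmp Y h v = q"
  using po unfolding is_pushout_def CM_category_simps by (auto simp: CM_iff)
 note O = CMs[THEN cm_Ob] and s = suspD[OF susp_chosen[OF CMs(1)]]
 obtain u' where u': "u' \<in> Homs R X Y" "u = ev X Y u'" using mod_hom_ev[OF O(1,3) m(1)] by blast
 obtain j' where j': "j' \<in> Homs R (sI X) Z" "j = ev (sI X) Z j'" using mod_hom_ev[OF O(2,4) m(2)] by blast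
 obtain v' where v': "v' \<in> Homs R Y Z" "v = ev Y Z v'" using mod_hom_ev[OF O(3,4) m(3)] by blast
 obtain w' where w': "w' \<in> Homs R Z (sS X)" "w = ev Z (sS X) w'" using mod_hom_ev[OF O(4) s(9) w(1)] by blast
 have "ccone X Y u' Z v' j' w'"
 proof (rule coneI[OF susp_chosen[OF CMs(1)] CMs(3) u'(1) CMs(4) j'(1) v'(1)])
  show "j' * si X = v' * u'"
   using e unfolding j'(2) v'(2) u'(2) si_ev[OF CMs(1), symmetric] compose_ev[OF s(5) j'(1)] compose_ev[OF u'(1) v'(1)]
    ev_inj[OF Homs_comp[OF s(5) j'(1)] Homs_comp[OF u'(1) v'(1)]] .
  show "w' \<in> Homs R Z (sS X)" by (rule w')
  show "w' * j' = sp X"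
   using w(2) unfolding w'(2) j'(2) sp_ev[OF CMs(1), symmetric] compose_ev[OF j'(1) w'(1)] ev_inj[OF Homs_comp[OF j'(1) w'(1)] s(6)] .
  show "w' * v' = 0"
   using w(3) unfolding w'(2) v'(2) zero_ev[OF O(3) s(9)] compose_ev[OF v'(1) w'(1)] ev_inj[OF Homs_comp[OF v'(1) w'(1)] Homs_zero[OF O(3) s(9)]] .
 next
  fix W g h assume W: "cm W" and g: "g \<in> Homs R (sI X) W" and h: "h \<in> Homs R Y W" and gh: "g * si X = h * u'"
  note OW = cm_Ob[OF W]
  have "\<exists>!t. t \<in> mod_hom R Z W & cmp (sI X) t j = ev (sI X) W g & cmp Y t v = ev Y W h"
  proof (rule un)
   show "W \<in> CM R" using W CM_iff by simp
   show "cmp X (ev (sI X) W g) (susp_i R X) = cmp X (ev Y W h) u"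
    unfolding si_ev[OF CMs(1), symmetric] u'(2) compose_ev[OF s(5) g] compose_ev[OF u'(1) h] gh ..
  qed (rule ev_hom(1)[OF g] ev_hom(1)[OF h])+
  then obtain t where t: "t \<in> mod_hom R Z W" "cmp (sI X) t j = ev (sI X) W g" "cmp Y t v = ev Y W h"
   and tu: "\<And>t'. t' \<in> mod_hom R Z W ==> cmp (sI X) t' j = ev (sI X) W g ==> cmp Y t' v = ev Y W h ==> t' = t"
   by (elim ex1E conjE) (rule that, assumption+, blast)
  have eq: "cmp (sI X) (ev Z W l) j = ev (sI X) W g \<longleftrightarrow> l * j' = g" "cmp Y (ev Z W l) v = ev Y W h \<longleftrightarrow> l * v' = h"
   if l: "l \<in> Homs R Z W" for l
   unfolding j'(2) v'(2) compose_ev[OF j'(1) l] compose_ev[OF v'(1) l] ev_inj[OF Homs_comp[OF j'(1) l] g] ev_inj[OF Homs_comp[OF v'(1) l] h] by simp_all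
  obtain t1 where t1: "t1 \<in> Homs R Z W" "t = ev Z W t1" using mod_hom_ev[OF O(4) OW t(1)] by blast
  show "\<exists>!t. t \<in> Homs R Z W & t * j' = g & t * v' = h"
  proof (intro ex1I conjI)
   show "t1 \<in> Homs R Z W" "t1 * j' = g" "t1 * v' = h" using t1 eq[OF t1(1)] t by auto
   fix l assume l: "l \<in> Homs R Z W & l * j' = g & l * v' = h"
   hence "ev Z W l = t" using tu[of "ev Z W l"] eq[of l] ev_hom(1)[of l R Z W] by blast
   thus "l = t1" using l t1 ev_inj by metis
  qed
 qed
 thus "\<exists>X Y u Z v j w. T = (X, Y, Z, sc X Y u, sc Y Z v, sc Z (sS X) w) & ccone X Y u Z v j w"
  unfolding T sc_def u'(2) v'(2) w'(2) by blast
next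
 assume "\<exists>X Y u Z v j w. T = (X, Y, Z, sc X Y u, sc Y Z v, sc Z (sS X) w) & ccone X Y u Z v j w"
 then obtain X Y u Z v j w where T: "T = (X, Y, Z, sc X Y u, sc Y Z v, sc Z (sS X) w)" and c: "ccone X Y u Z v j w" by blast
 note d = coneD[OF c] and s = suspD[OF coneD(1)[OF c]]
 note e = si_ev[OF s(4), symmetric] sp_ev[OF s(4), symmetric]
 have "is_pushout (CM_category R) X (sI X) Y Z (susp_i R X) (ev X Y u) (ev (sI X) Z j) (ev Y Z v)"
  unfolding is_pushout_def CM_category_simps
 proof (intro conjI ballI impI)
  show "{X, sI X, Y, Z} \<subseteq> CM R" using s(4) cm_proj[OF s(2)] d(2,10) CM_iff by auto
  show "susp_i R X \<in> mod_hom R X (sI X)" unfolding e by (rule ev_hom(1)[OF s(5)])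
  show "ev X Y u \<in> mod_hom R X Y" "ev (sI X) Z j \<in> mod_hom R (sI X) Z" "ev Y Z v \<in> mod_hom R Y Z"
   by (rule ev_hom(1)[OF d(3)] ev_hom(1)[OF d(5)] ev_hom(1)[OF d(8)])+
  show "cmp X (ev (sI X) Z j) (susp_i R X) = cmp X (ev Y Z v) (ev X Y u)"
   unfolding e compose_ev[OF s(5) d(5)] compose_ev[OF d(3,8)] d(6) ..
  fix W p q assume W: "W \<in> CM R" and p: "p \<in> mod_hom R (sI X) W" and q: "q \<in> mod_hom R Y W"
   and pq: "cmp X p (susp_i R X) = cmp X q (ev X Y u)"
  have OW: "W \<in> fgm R" using W cm_Ob CM_iff by blast
  obtain p' where p': "p' \<in> Homs R (sI X) W" "p = ev (sI X) W p'" using mod_hom_ev[OF s(8) OW p] by blast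
  obtain q' where q': "q' \<in> Homs R Y W" "q = ev Y W q'" using mod_hom_ev[OF cm_Ob[OF d(2)] OW q] by blast
  have "p' * si X = q' * u"
   using pq unfolding p'(2) q'(2) e compose_ev[OF s(5) p'(1)] compose_ev[OF d(3) q'(1)] ev_inj[OF Homs_comp[OF s(5) p'(1)] Homs_comp[OF d(3) q'(1)]] .
  then obtain t where t: "t \<in> Homs R Z W" "t * j = p'" "t * v = q'" using cone_universal[OF c p'(1) q'(1)] by blast
  have eq: "cmp (sI X) (ev Z W l) (ev (sI X) Z j) = p \<longleftrightarrow> l * j = p'" "cmp Y (ev Z W l) (ev Y Z v) = q \<longleftrightarrow> l * v = q'"
   if l: "l \<in> Homs R Z W" for l
   unfolding p'(2) q'(2) compose_ev[OF d(5) l] compose_ev[OF d(8) l] ev_inj[OF Homs_comp[OF d(5) l] p'(1)] ev_inj[OF Homs_comp[OF d(8) l] q'(1)] by simp_all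
  show "\<exists>!h. h \<in> mod_hom R Z W & cmp (sI X) h (ev (sI X) Z j) = p & cmp Y h (ev Y Z v) = q"
  proof (intro ex1I conjI)
   show "ev Z W t \<in> mod_hom R Z W" by (rule ev_hom(1)[OF t(1)])
   show "cmp (sI X) (ev Z W t) (ev (sI X) Z j) = p" "cmp Y (ev Z W t) (ev Y Z v) = q" using eq[OF t(1)] t by auto
   fix h assume h: "h \<in> mod_hom R Z W & cmp (sI X) h (ev (sI X) Z j) = p & cmp Y h (ev Y Z v) = q"
   obtain h' where h': "h' \<in> Homs R Z W" "h = ev Z W h'" using mod_hom_ev[OF cm_Ob[OF d(10)] OW] h by blast
   have "h' = t" by (rule cone_unique[OF c h'(1) t(1)]) (use eq[OF h'(1)] h h'(2) t in auto)
   thus "h = ev Z W t" using h'(2) by simp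
  qed
 qed
 moreover have "cmp (sI X) (ev Z (sS X) w) (ev (sI X) Z j) = susp_p R X" unfolding e compose_ev[OF d(5,9)] d(7) ..
 moreover have "cmp Y (ev Z (sS X) w) (ev Y Z v) = zero_map Y (sS X)"
  unfolding compose_ev[OF d(8,9)] d(11) zero_ev[OF cm_Ob[OF d(2)] s(9)] ..
 ultimately show "T \<in> standard_triangles R" unfolding standard_triangles_def T sc_def using ev_hom(1)[OF d(9)] by blast
qed

text \<open>Isomorphism to a standard triangle, normalized to be the identity at \<open>X\<close>
  and \<open>Y\<close>.\<close>

definition dtri :: "'a fg_module => 'a fg_module => 'a fg_module => 'a marr => 'a marr => 'a marr => bool" where
 "dtri X Y Z u v w \<longleftrightarrow> (\<exists>Z' v' j' w' c c'. ccone X Y u Z' v' j' w' & siso Z Z' c c' &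
   eqv Y Z' (c * v) v' & eqv Z (sS X) (w' * c) w)"

lemma distinguished_iff:
 assumes X: "cm X" and Y: "cm Y" and Z: "cm Z" and u: "u \<in> Homs R X Y" and v: "v \<in> Homs R Y Z" and w: "w \<in> Homs R Z (sS X)"
 shows "(X, Y, Z, sc X Y u, sc Y Z v, sc Z (sS X) w) \<in> distinguished_triangles R \<longleftrightarrow> dtri X Y Z u v w"
proof
 assume "(X, Y, Z, sc X Y u, sc Y Z v, sc Z (sS X) w) \<in> distinguished_triangles R"
 then obtain T' where T': "T' \<in> standard_triangles R"
  "isomorphic_triangles (stable_category R) (susp_functor R) (X, Y, Z, sc X Y u, sc Y Z v, sc Z (sS X) w) T'"
  unfolding distinguished_triangles_def by blast
 obtain X' Y' u' Z' v' j' w' where T: "T' = (X', Y', Z', sc X' Y' u', sc Y' Z' v', sc Z' (sS X') w')" and c': "ccone X' Y' u' Z' v' j' w'"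
  using T'(1) unfolding standard_triangles_iff by blast
 note d = coneD[OF c'] and s = suspD[OF coneD(1)[OF c']]
 obtain A B C where iso: "is_isomorphism (stable_category R) X X' A" "is_isomorphism (stable_category R) Y Y' B" "is_isomorphism (stable_category R) Z Z' C"
  and sq: "stcomp R X Y Y' B (sc X Y u) = stcomp R X X' Y' (sc X' Y' u') A"
   "stcomp R Y Z Z' C (sc Y Z v) = stcomp R Y Y' Z' (sc Y' Z' v') B"
   "stcomp R Z (sS X) (sS X') (susp_mor R X X' A) (sc Z (sS X) w) = stcomp R Z Z' (sS X') (sc Z' (sS X') w') C"
  using T'(2) unfolding T isomorphic_triangles_def susp_functor_def by auto
 have rep: "\<exists>h. h \<in> Homs R M N & H = sc M N h & (\<exists>k. siso M N h k)" if i: "is_isomorphism (stable_category R) M N H" "cm M" "cm N" for M N H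
 proof -
  obtain h where "h \<in> Homs R M N" "H = sc M N h" using i(1) sc_hom(1)[OF i(2) cm_Ob[OF i(3)]] unfolding is_isomorphism_def by auto
  thus ?thesis using is_isomorphism_sc[OF i(2,3)] i(1) by blast
 qed
 obtain a a' where a: "A = sc X X' a" "siso X X' a a'" using rep[OF iso(1) X s(4)] by blast
 obtain b b' where b: "B = sc Y Y' b" "siso Y Y' b b'" using rep[OF iso(2) Y d(2)] by blast
 obtain c k where c: "C = sc Z Z' c" "siso Z Z' c k" using rep[OF iso(3) Z d(10)] by blast
 note ah = sisoD(1)[OF a(2)] and bh = sisoD(1)[OF b(2)] and ch = sisoD(1)[OF c(2)]
 note OY' = cm_Ob[OF d(2)] and OZ' = cm_Ob[OF d(10)]
 have e1: "eqv X Y' (b * u) (u' * a)"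
  using sq(1) unfolding a(1) b(1) sc_comp[OF X Y u bh] sc_comp[OF X s(4) ah d(3)] sc_eq_iff[OF X OY' Homs_comp[OF u bh] Homs_comp[OF ah d(3)]] .
 have e2: "eqv Y Z' (c * v) (v' * b)"
  using sq(2) unfolding c(1) b(1) sc_comp[OF Y Z v ch] sc_comp[OF Y d(2) bh d(8)] sc_eq_iff[OF Y OZ' Homs_comp[OF v ch] Homs_comp[OF bh d(8)]] .
 \<comment> \<open>The given standard triangle is replaced by the cone of \<open>u\<close> itself.
   By \<open>cone_iso\<close> the isomorphisms \<open>a\<close> and \<open>b\<close> extend to the
   third vertices, so they can be removed from the comparison.\<close>
 obtain Z1 v1 j1 w1 where c1: "ccone X Y u Z1 v1 j1 w1" using cone_exists[OF susp_chosen[OF X] Y u] by metis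
 note d1 = coneD[OF c1]
 obtain m m' t where m: "siso Z1 Z' m m'" "shf X X' a t" "m * v1 = v' * b" "w' * m = t * w1"
  using cone_iso[OF c1 c' a(2) b(2) e1] unfolding shf_def by metis
 note th = shf_Hom[OF m(2)] and mh = sisoD(1,2)[OF m(1)]
 have e3: "eqv Z (sS X') (t * w) (w' * c)"
  using sq(3) unfolding c(1) a(1) susp_mor_sc[OF X s(4) ah m(2)] sc_comp[OF Z sS_cm[OF X] w th] sc_comp[OF Z d(10) ch d(9)]
   sc_eq_iff[OF Z s(9) Homs_comp[OF w th] Homs_comp[OF ch d(9)]] .
 have n: "siso Z Z1 (m' * c) (k * m)" by (rule siso_comp[OF c(2) siso_sym[OF m(1)]])
 have "eqv Y Z1 (m' * (c * v)) (m' * (v' * b))" by (rule eqv_left[OF e2 mh(2)])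
 also have "m' * (v' * b) = m' * (m * v1)" using m(3) by simp
 also have "eqv Y Z1 (m' * (m * v1)) v1" by (rule siso_cancel_left[OF m(1) d1(8) Y])
 finally have 1: "eqv Y Z1 ((m' * c) * v) v1" by (simp add: mult.assoc)
 \<comment> \<open>The equation for \<open>w\<close> is known only after composing with the shift
   \<open>t\<close> of \<open>a\<close>; its stable inverse \<open>t'\<close> allows
   \<open>t\<close> to be cancelled.\<close>
 obtain t' where t': "shf X' X a' t'" using shf_exists[OF s(4) X sisoD(2)[OF a(2)]] by blast
 have tt: "siso (sS X) (sS X') t t'"
  using shifted_siso[OF susp_chosen[OF X] susp_chosen[OF s(4)] a(2)] m(2) t' unfolding shf_def by blast
 have mc: "m' * c \<in> Homs R Z Z1" by (rule Homs_comp[OF ch mh(2)])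
 have "eqv Z (sS X') (t * (w1 * (m' * c))) (t * w)"
 proof -
  have "eqv Z Z' (m * (m' * c)) c" by (rule siso_cancel_left[OF siso_sym[OF m(1)] ch Z])
  hence "eqv Z (sS X') (w' * (m * (m' * c))) (w' * c)" by (rule eqv_left[OF _ d(9)])
  moreover have "w' * (m * (m' * c)) = t * (w1 * (m' * c))" using m(4) by (metis mult.assoc)
  ultimately show ?thesis using eqv_trans eqv_sym[OF e3] by metis
 qed
 hence "eqv Z (sS X) (t' * (t * (w1 * (m' * c)))) (t' * (t * w))" by (rule eqv_left[OF _ shf_Hom[OF t']])
 moreover have "eqv Z (sS X) (t' * (t * (w1 * (m' * c)))) (w1 * (m' * c))"
  by (rule siso_cancel_left[OF tt Homs_comp[OF mc d1(9)] Z])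
 moreover have "eqv Z (sS X) (t' * (t * w)) w" by (rule siso_cancel_left[OF tt w Z])
 ultimately have 2: "eqv Z (sS X) (w1 * (m' * c)) w" using eqv_trans eqv_sym by blast
 show "dtri X Y Z u v w" unfolding dtri_def using c1 n 1 2 by blast
next
 assume "dtri X Y Z u v w"
 then obtain Z' v' j' w' c c' where cc: "ccone X Y u Z' v' j' w'" and c: "siso Z Z' c c'"
  and e: "eqv Y Z' (c * v) v'" "eqv Z (sS X) (w' * c) w" unfolding dtri_def by blast
 note d = coneD[OF cc] and s = suspD[OF coneD(1)[OF cc]]
 note OX = cm_Ob[OF X] and OY = cm_Ob[OF Y] and OZ = cm_Ob[OF Z] and ch = sisoD(1)[OF c]
 have "(X, Y, Z', sc X Y u, sc Y Z' v', sc Z' (sS X) w') \<in> standard_triangles R"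
  unfolding standard_triangles_iff using cc by blast
 moreover have "isomorphic_triangles (stable_category R) (susp_functor R)
   (X, Y, Z, sc X Y u, sc Y Z v, sc Z (sS X) w) (X, Y, Z', sc X Y u, sc Y Z' v', sc Z' (sS X) w')"
 proof -
  have idX: "idm X \<in> Homs R X X" and idY: "idm Y \<in> Homs R Y Y" and idS: "idm (sS X) \<in> Homs R (sS X) (sS X)"
   by (rule Homs_idm OX OY s(9))+
  have shid: "shf X X (idm X) (idm (sS X))" unfolding shf_def by (rule shifted_idn[OF susp_chosen[OF X]])
  have "is_isomorphism (stable_category R) X X (sc X X (idm X))" "is_isomorphism (stable_category R) Y Y (sc Y Y (idm Y))"
   "is_isomorphism (stable_category R) Z Z' (sc Z Z' c)"
   using is_isomorphism_sc[OF X X idX] is_isomorphism_sc[OF Y Y idY] is_isomorphism_sc[OF Z d(10) ch] siso_idn[OF X] siso_idn[OF Y] c by blast+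
  moreover have "stcomp R X Y Y (sc Y Y (idm Y)) (sc X Y u) = stcomp R X X Y (sc X Y u) (sc X X (idm X))"
   unfolding sc_comp[OF X Y u idY] sc_comp[OF X X idX u] idm_left[OF u] idm_right[OF u] ..
  moreover have "stcomp R Y Z Z' (sc Z Z' c) (sc Y Z v) = stcomp R Y Y Z' (sc Y Z' v') (sc Y Y (idm Y))"
   unfolding sc_comp[OF Y Z v ch] sc_comp[OF Y Y idY d(8)] idm_right[OF d(8)]
    sc_eq_iff[OF Y cm_Ob[OF d(10)] Homs_comp[OF v ch] d(8)] by (rule e)
  moreover have "stcomp R Z (sS X) (sS X) (susp_mor R X X (sc X X (idm X))) (sc Z (sS X) w) =
    stcomp R Z Z' (sS X) (sc Z' (sS X) w') (sc Z Z' c)"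
   unfolding susp_mor_sc[OF X X idX shid] sc_comp[OF Z sS_cm[OF X] w idS] sc_comp[OF Z d(10) ch d(9)] idm_left[OF w]
    sc_eq_iff[OF Z s(9) w Homs_comp[OF ch d(9)]] by (rule eqv_sym[OF e(2)])
  ultimately show ?thesis unfolding isomorphic_triangles_def susp_functor_def by auto
 qed
 moreover have "is_triangle (stable_category R) (susp_functor R) (X, Y, Z, sc X Y u, sc Y Z v, sc Z (sS X) w)"
  unfolding is_triangle_def susp_functor_def using X Y Z u v w sc_hom(1)[OF X OY] sc_hom(1)[OF Y OZ] sc_hom(1)[OF Z s(9)] CM_iff by auto
 ultimately show "(X, Y, Z, sc X Y u, sc Y Z v, sc Z (sS X) w) \<in> distinguished_triangles R" unfolding distinguished_triangles_def by blast
qed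

end

context gorenstein_modules
begin

definition rep :: "'a fg_module => 'a fg_module => 'a fg_map set => 'a marr" where
 "rep X Y U = (SOME h. h \<in> Homs R X Y & U = sc X Y h)"

lemma rep_sc:
 assumes X: "cm X" and Y: "Y \<in> fgm R" and h: "h \<in> Homs R X Y"
 shows "eqv X Y (rep X Y (sc X Y h)) h"
proof -
 have "\<exists>k. k \<in> Homs R X Y & sc X Y h = sc X Y k" using h by blast
 from someI_ex[OF this, folded rep_def] have "rep X Y (sc X Y h) \<in> Homs R X Y" "sc X Y h = sc X Y (rep X Y (sc X Y h))" by blast+
 thus ?thesis using sc_eq_iff[OF X Y h] eqv_sym by blast
qed

end

section \<open>The triangle equivalence\<close>

locale stable_restriction =
 A: gorenstein_modules R + B: noetherian_modules S +
 restriction_adjunction "fgm R" "Homs R" idm "exact_seq R" "rcopy R"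
  "fgm S" "Homs S" idm "exact_seq S" "rcopy S" eo em lo un vn
 for R :: "'a ring" and S :: "'b ring" and eo em lo un vn

sublocale stable_restriction \<subseteq> B: gorenstein_modules S by unfold_locales

context stable_restriction
begin

text \<open>Not the restriction \<open>eo\<close>: for projective \<open>X\<close>, only finite
  projective dimension of \<open>eo X\<close> has been established. \<open>Fo X\<close> is instead a
  Cohen-Macaulay module whose induced module is stably isomorphic to \<open>X\<close>.\<close>

definition resF :: "('a fg_module, 'a fg_map set, 'b fg_module, 'b fg_map set) functor_data" where
 "resF = \<lparr>fun_ob = Fo, fun_mor = (%X Y U. B.sc (Fo X) (Fo Y) (Fm X Y (A.rep X Y U)))\<rparr>"

definition indF :: "('b fg_module, 'b fg_map set, 'a fg_module, 'a fg_map set) functor_data" where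
 "indF = \<lparr>fun_ob = lo, fun_mor = (%X Y U. A.sc (lo X) (lo Y) (lm X Y (B.rep X Y U)))\<rparr>"

lemma restriction_ob [simp]: "fun_ob resF = Fo" and induction_ob [simp]: "fun_ob indF = lo"
 by (simp_all add: resF_def indF_def)

lemma restriction_mor:
 assumes X: "A.cm X" and Y: "A.cm Y" and h: "h \<in> Homs R X Y"
 shows "fun_mor resF X Y (A.sc X Y h) = B.sc (Fo X) (Fo Y) (Fm X Y h)"
proof -
 note e = A.rep_sc[OF X A.cm_Ob[OF Y] h]
 have "B.eqv (Fo X) (Fo Y) (Fm X Y (A.rep X Y (A.sc X Y h))) (Fm X Y h)" by (rule Fm_eqv[OF X Y e])
 thus ?thesis using B.sc_eq_iff[OF Fo_cm[OF X] Fo_Ob[OF Y] Fm_Hom[OF X Y A.eqvD(2)[OF e]] Fm_Hom[OF X Y h]]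
  by (simp add: resF_def)
qed

lemma induction_mor:
 assumes X: "B.cm X" and Y: "B.cm Y" and h: "h \<in> Homs S X Y"
 shows "fun_mor indF X Y (B.sc X Y h) = A.sc (lo X) (lo Y) (lm X Y h)"
proof -
 note e = B.rep_sc[OF X B.cm_Ob[OF Y] h]
 have "A.eqv (lo X) (lo Y) (lm X Y (B.rep X Y (B.sc X Y h))) (lm X Y h)" by (rule lm_eqv[OF e])
 thus ?thesis using A.sc_eq_iff[OF cm_lo[OF X] lo_Ob[OF B.cm_Ob[OF Y]] lm_Hom[OF B.eqvD(2)[OF e]] lm_Hom[OF h]]
  by (simp add: indF_def)
qed

lemma A_hom_scE:
 assumes "U \<in> hom_set (stable_CM R) X Y" "X \<in> CM R" "Y \<in> CM R"
 obtains h where "h \<in> Homs R X Y" "U = A.sc X Y h" "A.cm X" "A.cm Y"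
 using assms A.sc_hom(2)[of X Y] A.CM_iff A.cm_Ob by auto

lemma B_hom_scE:
 assumes "U \<in> hom_set (stable_CM S) X Y" "X \<in> CM S" "Y \<in> CM S"
 obtains h where "h \<in> Homs S X Y" "U = B.sc X Y h" "B.cm X" "B.cm Y"
 using assms B.sc_hom(2)[of X Y] B.CM_iff B.cm_Ob by auto

lemma restriction_is_functor: "is_functor (stable_CM R) (stable_CM S) resF"
 unfolding is_functor_def stable_CM_simps(1,3,4) restriction_ob
proof (intro conjI ballI)
 show "Fo X \<in> CM S" if "X \<in> CM R" for X using Fo_cm that A.CM_iff B.CM_iff by blast
 fix X assume X: "X \<in> CM R"
 hence cX: "A.cm X" using A.CM_iff by blast
 note OX = A.cm_Ob[OF cX]
 show "fun_mor resF X X (cat_id (stable_category R) X) = cat_id (stable_category S) (Fo X)"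
  unfolding A.sc_id[OF cX] B.sc_id[OF Fo_cm[OF cX]] restriction_mor[OF cX cX Homs_idm[OF OX]]
   B.sc_eq_iff[OF Fo_cm[OF cX] Fo_Ob[OF cX] Fm_Hom[OF cX cX Homs_idm[OF OX]] Homs_idm[OF Fo_Ob[OF cX]]]
  by (rule Fm_idn[OF cX])
 fix Y assume Y: "Y \<in> CM R"
 show "fun_mor resF X Y U \<in> hom_set (stable_CM S) (Fo X) (Fo Y)" if U: "U \<in> hom_set (stable_CM R) X Y" for U
 proof -
  obtain h where h: "h \<in> Homs R X Y" "U = A.sc X Y h" "A.cm X" "A.cm Y" by (rule A_hom_scE[OF U X Y])
  show ?thesis unfolding h(2) restriction_mor[OF h(3,4,1)] B.sc_hom(2)[OF Fo_cm[OF h(3)] Fo_Ob[OF h(4)]]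
   using Fm_Hom[OF h(3,4,1)] by blast
 qed
 fix Z U V assume Z: "Z \<in> CM R" and U: "U \<in> hom_set (stable_CM R) X Y" and V: "V \<in> hom_set (stable_CM R) Y Z"
 obtain h where h: "h \<in> Homs R X Y" "U = A.sc X Y h" "A.cm X" "A.cm Y" by (rule A_hom_scE[OF U X Y])
 obtain k where k: "k \<in> Homs R Y Z" "V = A.sc Y Z k" "A.cm Y" "A.cm Z" by (rule A_hom_scE[OF V Y Z])
 note kh = Homs_comp[OF h(1) k(1)] and Fh = Fm_Hom[OF h(3,4,1)] and Fk = Fm_Hom[OF k(3,4,1)]
 show "fun_mor resF X Z (stcomp R X Y Z V U) =
  stcomp S (Fo X) (Fo Y) (Fo Z) (fun_mor resF Y Z V) (fun_mor resF X Y U)"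
  unfolding h(2) k(2) A.sc_comp[OF h(3,4,1) k(1)] restriction_mor[OF h(3,4,1)] restriction_mor[OF k(3,4,1)] restriction_mor[OF h(3) k(4) kh]
   B.sc_comp[OF Fo_cm[OF h(3)] Fo_cm[OF k(3)] Fh Fk]
   B.sc_eq_iff[OF Fo_cm[OF h(3)] Fo_Ob[OF k(4)] Fm_Hom[OF h(3) k(4) kh] Homs_comp[OF Fh Fk]]
  by (rule Fm_comp[OF h(3) k(3,4) h(1) k(1)])
qed

lemma restriction_additive: "additive_functor (stable_CM R) (stable_CM S) resF"
 unfolding additive_functor_def
proof (intro conjI ballI restriction_is_functor)
 fix X Y assume XY: "X \<in> cat_ob (stable_CM R)" "Y \<in> cat_ob (stable_CM R)"
 hence XY': "X \<in> CM R" "Y \<in> CM R" by simp_all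
 show "fun_mor resF X Y \<in> hom (cat_hom (stable_CM R) X Y) (cat_hom (stable_CM S) (fun_ob resF X) (fun_ob resF Y))"
 proof (rule homI)
  show "fun_mor resF X Y U \<in> hom_set (stable_CM S) (fun_ob resF X) (fun_ob resF Y)"
   if "U \<in> hom_set (stable_CM R) X Y" for U using restriction_is_functor that XY unfolding is_functor_def by blast
  fix U V assume U: "U \<in> hom_set (stable_CM R) X Y" and V: "V \<in> hom_set (stable_CM R) X Y"
  obtain h where h: "h \<in> Homs R X Y" "U = A.sc X Y h" "A.cm X" "A.cm Y" by (rule A_hom_scE[OF U XY'])
  obtain k where k: "k \<in> Homs R X Y" "V = A.sc X Y k" by (rule A_hom_scE[OF V XY'])
  show "fun_mor resF X Y (U \<otimes>\<^sub>(cat_hom (stable_CM R) X Y) V) =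
   fun_mor resF X Y U \<otimes>\<^sub>(cat_hom (stable_CM S) (fun_ob resF X) (fun_ob resF Y)) fun_mor resF X Y V"
   unfolding h(2) k(2) stable_CM_simps restriction_ob A.sc_mult[OF h(3) A.cm_Ob[OF h(4)] h(1) k(1)] restriction_mor[OF h(3,4,1)] restriction_mor[OF h(3,4) k(1)]
    restriction_mor[OF h(3,4) Homs_add[OF h(1) k(1)]]
    B.sc_mult[OF Fo_cm[OF h(3)] Fo_Ob[OF h(4)] Fm_Hom[OF h(3,4,1)] Fm_Hom[OF h(3,4) k(1)]] Fm_add[OF h(3,4,1) k(1)] ..
 qed
qed

lemma induction_is_functor: "is_functor (stable_CM S) (stable_CM R) indF"
 unfolding is_functor_def stable_CM_simps(1,3,4) induction_ob
proof (intro conjI ballI)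
 show "lo X \<in> CM R" if "X \<in> CM S" for X using cm_lo that A.CM_iff B.CM_iff by blast
 fix X assume X: "X \<in> CM S"
 hence cX: "B.cm X" using B.CM_iff by blast
 note OX = B.cm_Ob[OF cX]
 show "fun_mor indF X X (cat_id (stable_category S) X) = cat_id (stable_category R) (lo X)"
  unfolding B.sc_id[OF cX] A.sc_id[OF cm_lo[OF cX]] induction_mor[OF cX cX Homs_idm[OF OX]] lm_idn[OF OX] ..
 fix Y assume Y: "Y \<in> CM S"
 show "fun_mor indF X Y U \<in> hom_set (stable_CM R) (lo X) (lo Y)" if U: "U \<in> hom_set (stable_CM S) X Y" for U
 proof -
  obtain h where h: "h \<in> Homs S X Y" "U = B.sc X Y h" "B.cm X" "B.cm Y" by (rule B_hom_scE[OF U X Y])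
  show ?thesis unfolding h(2) induction_mor[OF h(3,4,1)] A.sc_hom(2)[OF cm_lo[OF h(3)] lo_Ob[OF B.cm_Ob[OF h(4)]]]
   using lm_Hom[OF h(1)] by blast
 qed
 fix Z U V assume Z: "Z \<in> CM S" and U: "U \<in> hom_set (stable_CM S) X Y" and V: "V \<in> hom_set (stable_CM S) Y Z"
 obtain h where h: "h \<in> Homs S X Y" "U = B.sc X Y h" "B.cm X" "B.cm Y" by (rule B_hom_scE[OF U X Y])
 obtain k where k: "k \<in> Homs S Y Z" "V = B.sc Y Z k" "B.cm Y" "B.cm Z" by (rule B_hom_scE[OF V Y Z])
 note kh = Homs_comp[OF h(1) k(1)]
 show "fun_mor indF X Z (stcomp S X Y Z V U) =
  stcomp R (lo X) (lo Y) (lo Z) (fun_mor indF Y Z V) (fun_mor indF X Y U)"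
  unfolding h(2) k(2) B.sc_comp[OF h(3,4,1) k(1)] induction_mor[OF h(3,4,1)] induction_mor[OF k(3,4,1)] induction_mor[OF h(3) k(4) kh]
   A.sc_comp[OF cm_lo[OF h(3)] cm_lo[OF k(3)] lm_Hom[OF h(1)] lm_Hom[OF k(1)]] lm_comp[OF h(1) k(1)] ..
qed

lemma restriction_equivalence: "is_equivalence (stable_CM R) (stable_CM S) resF"
 unfolding is_equivalence_def
proof (intro conjI exI[of _ indF] restriction_is_functor induction_is_functor exI)
 show "natural_iso (stable_CM R) (stable_CM R) (comp_functor indF resF) id_functor
  (%X. A.sc (lo (Fo X)) X (fz X))"
  unfolding natural_iso_def stable_CM_simps(1,3) comp_functor_def id_functor_def functor_data.simps restriction_ob induction_ob A.is_isomorphism_stable_CM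
 proof (intro conjI ballI)
  fix X assume X: "X \<in> CM R"
  hence cX: "A.cm X" using A.CM_iff by blast
  show "is_isomorphism (stable_category R) (lo (Fo X)) X (A.sc (lo (Fo X)) X (fz X))"
   using A.is_isomorphism_sc[OF cm_lo[OF Fo_cm[OF cX]] cX fz_Hom[OF cX]] Fo_siso[OF cX] by blast
  fix Y U assume Y: "Y \<in> CM R" and U: "U \<in> hom_set (stable_CM R) X Y"
  obtain h where h: "h \<in> Homs R X Y" "U = A.sc X Y h" "A.cm X" "A.cm Y" by (rule A_hom_scE[OF U X Y])
  note Fh = Fm_Hom[OF h(3,4,1)] and cl = cm_lo[OF Fo_cm[OF h(3)]]
  show "stcomp R (lo (Fo X)) (lo (Fo Y)) Y (A.sc (lo (Fo Y)) Y (fz Y))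
    (fun_mor indF (Fo X) (Fo Y) (fun_mor resF X Y U)) =
   stcomp R (lo (Fo X)) X Y U (A.sc (lo (Fo X)) X (fz X))"
   unfolding h(2) restriction_mor[OF h(3,4,1)] induction_mor[OF Fo_cm[OF h(3)] Fo_cm[OF h(4)] Fh]
    A.sc_comp[OF cl cm_lo[OF Fo_cm[OF h(4)]] lm_Hom[OF Fh] fz_Hom[OF h(4)]] A.sc_comp[OF cl h(3) fz_Hom[OF h(3)] h(1)]
    A.sc_eq_iff[OF cl A.cm_Ob[OF h(4)] Homs_comp[OF lm_Hom[OF Fh] fz_Hom[OF h(4)]] Homs_comp[OF fz_Hom[OF h(3)] h(1)]]
   by (rule fz_natural[OF h(3,4,1)])
 qed
 let ?b = "%X. linv (Fo (lo X)) X (fz (lo X))"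
 show "natural_iso (stable_CM S) (stable_CM S) (comp_functor resF indF) id_functor
  (%X. B.sc (Fo (lo X)) X (?b X))"
  unfolding natural_iso_def stable_CM_simps(1,3) comp_functor_def id_functor_def functor_data.simps restriction_ob induction_ob B.is_isomorphism_stable_CM
 proof (intro conjI ballI)
  fix X assume X: "X \<in> CM S"
  hence cX: "B.cm X" using B.CM_iff by blast
  show "is_isomorphism (stable_category S) (Fo (lo X)) X (B.sc (Fo (lo X)) X (?b X))"
   using B.is_isomorphism_sc[OF Fo_cm[OF cm_lo[OF cX]] cX B.sisoD(1)[OF Fo_lo_siso[OF cX]]] Fo_lo_siso[OF cX] by blast
  fix Y U assume Y: "Y \<in> CM S" and U: "U \<in> hom_set (stable_CM S) X Y"
  obtain h where h: "h \<in> Homs S X Y" "U = B.sc X Y h" "B.cm X" "B.cm Y" by (rule B_hom_scE[OF U X Y])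
  note lX = cm_lo[OF h(3)] and lY = cm_lo[OF h(4)] and lh = lm_Hom[OF h(1)]
  note Fh = Fm_Hom[OF lX lY lh] and bX = B.sisoD(1)[OF Fo_lo_siso[OF h(3)]] and bY = B.sisoD(1)[OF Fo_lo_siso[OF h(4)]]
  show "stcomp S (Fo (lo X)) (Fo (lo Y)) Y (B.sc (Fo (lo Y)) Y (?b Y))
    (fun_mor resF (lo X) (lo Y) (fun_mor indF X Y U)) =
   stcomp S (Fo (lo X)) X Y U (B.sc (Fo (lo X)) X (?b X))"
   unfolding h(2) induction_mor[OF h(3,4,1)] restriction_mor[OF lX lY lh]
    B.sc_comp[OF Fo_cm[OF lX] Fo_cm[OF lY] Fh bY] B.sc_comp[OF Fo_cm[OF lX] h(3) bX h(1)]
    B.sc_eq_iff[OF Fo_cm[OF lX] B.cm_Ob[OF h(4)] Homs_comp[OF Fh bY] Homs_comp[OF bX h(1)]]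
   by (rule Fo_lo_natural[OF h(3,4,1)])
 qed
qed

definition et :: "'a fg_module => 'b marr" where
 "et X = (SOME h. eta X (A.sI X) (A.sS X) (A.si X) (A.sp X) (B.sI (Fo X)) (B.sS (Fo X)) (B.si (Fo X)) (B.sp (Fo X)) h)"

lemma et:
 assumes X: "A.cm X"
 shows et_eta: "eta X (A.sI X) (A.sS X) (A.si X) (A.sp X) (B.sI (Fo X)) (B.sS (Fo X)) (B.si (Fo X)) (B.sp (Fo X)) (et X)"
  and et_siso: "\<exists>k. B.siso (Fo (A.sS X)) (B.sS (Fo X)) (et X) k"
  and et_Hom: "et X \<in> Homs S (Fo (A.sS X)) (B.sS (Fo X))"
proof -
 note sA = A.susp_chosen[OF X] and sB = B.susp_chosen[OF Fo_cm[OF X]]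
 show e: "eta X (A.sI X) (A.sS X) (A.si X) (A.sp X) (B.sI (Fo X)) (B.sS (Fo X)) (B.si (Fo X)) (B.sp (Fo X)) (et X)"
  using someI_ex[OF eta_exists[OF sA sB]] unfolding et_def .
 show "\<exists>k. B.siso (Fo (A.sS X)) (B.sS (Fo X)) (et X) k" by (rule eta_siso[OF sA sB e])
 thus "et X \<in> Homs S (Fo (A.sS X)) (B.sS (Fo X))" using B.sisoD(1) by blast
qed

lemma Fm_siso:
 assumes s: "A.siso X Y h k" shows "B.siso (Fo X) (Fo Y) (Fm X Y h) (Fm Y X k)"
proof -
 note d = A.sisoD[OF s]
 have 1: "B.eqv (Fo X) (Fo X) (Fm Y X k * Fm X Y h) (idm (Fo X))"
  using B.eqv_trans[OF B.eqv_sym[OF Fm_comp[OF d(5,6,5,1,2)]] B.eqv_trans[OF Fm_eqv[OF d(5,5,3)] Fm_idn[OF d(5)]]] .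
 have 2: "B.eqv (Fo Y) (Fo Y) (Fm X Y h * Fm Y X k) (idm (Fo Y))"
  using B.eqv_trans[OF B.eqv_sym[OF Fm_comp[OF d(6,5,6,2,1)]] B.eqv_trans[OF Fm_eqv[OF d(6,6,4)] Fm_idn[OF d(6)]]] .
 show ?thesis unfolding B.siso_def using Fm_Hom[OF d(5,6,1)] Fm_Hom[OF d(6,5,2)] 1 2 by blast
qed

text \<open>The image triangle is compared with the cone of \<open>Fm X Y u\<close>: first the given
  triangle with its cone through \<open>Fm Z Z' c\<close>, then the image of that cone with the cone
  in the corner through \<open>eta_cone\<close>.\<close>

lemma restriction_dtri:
 assumes X: "A.cm X" and Y: "A.cm Y" and Z: "A.cm Z" and u: "u \<in> Homs R X Y" and v: "v \<in> Homs R Y Z" and w: "w \<in> Homs R Z (A.sS X)"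
  and T: "A.dtri X Y Z u v w"
 shows "B.dtri (Fo X) (Fo Y) (Fo Z) (Fm X Y u) (Fm Y Z v) (et X * Fm Z (A.sS X) w)"
proof -
 obtain Z' v' j' w' c c' where cc: "A.ccone X Y u Z' v' j' w'" and c: "A.siso Z Z' c c'"
  and e: "A.eqv Y Z' (c * v) v'" "A.eqv Z (A.sS X) (w' * c) w" using T unfolding A.dtri_def by blast
 note d = A.coneD[OF cc] and SX = A.sS_cm[OF X] and ch = A.sisoD(1)[OF c]
 note FX = Fo_cm[OF X] and FY = Fo_cm[OF Y] and FZ = Fo_cm[OF Z] and FS = B.sS_cm[OF Fo_cm[OF X]]
 obtain D v'' j'' w'' where cd: "B.ccone (Fo X) (Fo Y) (Fm X Y u) D v'' j'' w''"
  using B.cone_exists[OF B.susp_chosen[OF FX] FY Fm_Hom[OF X Y u]] by metis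
 note d' = B.coneD[OF cd]
 obtain m m' where m: "B.siso (Fo Z') D m m'" "B.eqv (Fo Y) D (m * Fm Y Z' v') v''"
  "B.eqv (Fo Z') (B.sS (Fo X)) (w'' * m) (et X * Fm Z' (A.sS X) w')"
  using eta_cone[OF A.susp_chosen[OF X] B.susp_chosen[OF FX] et_eta[OF X] cc cd] by metis
 note mh = B.sisoD(1)[OF m(1)] and Fc = Fm_Hom[OF Z d(10) ch] and Fv = Fm_Hom[OF Y Z v] and Fw = Fm_Hom[OF Z SX w] and Fw' = Fm_Hom[OF d(10) SX d(9)]
 have n: "B.siso (Fo Z) D (m * Fm Z Z' c) (Fm Z' Z c' * m')" by (rule B.siso_comp[OF Fm_siso[OF c] m(1)])
 have "B.eqv (Fo Y) (Fo Z') (Fm Z Z' c * Fm Y Z v) (Fm Y Z' v')"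
  by (rule B.eqv_trans[OF B.eqv_sym[OF Fm_comp[OF Y Z d(10) v ch]] Fm_eqv[OF Y d(10) e(1)]])
 hence "B.eqv (Fo Y) D (m * (Fm Z Z' c * Fm Y Z v)) (m * Fm Y Z' v')" by (rule B.eqv_left[OF _ mh])
 hence 1: "B.eqv (Fo Y) D (m * Fm Z Z' c * Fm Y Z v) v''" using B.eqv_trans[OF _ m(2)] by (simp add: mult.assoc)
 have "B.eqv (Fo Z) (B.sS (Fo X)) (w'' * m * Fm Z Z' c) (et X * Fm Z' (A.sS X) w' * Fm Z Z' c)"
  by (rule B.eqv_right[OF m(3) FZ Fc])
 moreover have "B.eqv (Fo Z) (Fo (A.sS X)) (Fm Z' (A.sS X) w' * Fm Z Z' c) (Fm Z (A.sS X) w)"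
  by (rule B.eqv_trans[OF B.eqv_sym[OF Fm_comp[OF Z d(10) SX ch d(9)]] Fm_eqv[OF Z SX e(2)]])
 hence "B.eqv (Fo Z) (B.sS (Fo X)) (et X * (Fm Z' (A.sS X) w' * Fm Z Z' c)) (et X * Fm Z (A.sS X) w)"
  by (rule B.eqv_left[OF _ et_Hom[OF X]])
 ultimately have 2: "B.eqv (Fo Z) (B.sS (Fo X)) (w'' * (m * Fm Z Z' c)) (et X * Fm Z (A.sS X) w)"
  unfolding mult.assoc by (rule B.eqv_trans)
 show ?thesis unfolding B.dtri_def using cd n 1 2 by blast
qed

lemma restriction_triangle_functor:
 "triangle_functor (stable_CM R) (stable_CM S) resF (%X. B.sc (Fo (A.sS X)) (B.sS (Fo X)) (et X))"
 unfolding triangle_functor_def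
proof (intro conjI allI impI restriction_additive)
 show "natural_iso (stable_CM R) (stable_CM S) (comp_functor resF (tri_shift (stable_CM R)))
   (comp_functor (tri_shift (stable_CM S)) resF) (%X. B.sc (Fo (A.sS X)) (B.sS (Fo X)) (et X))"
  unfolding natural_iso_def stable_CM_simps(1,3,5) comp_functor_def susp_functor_def functor_data.simps restriction_ob B.is_isomorphism_stable_CM
 proof (intro conjI ballI)
  fix X assume X: "X \<in> CM R"
  hence cX: "A.cm X" using A.CM_iff by blast
  show "is_isomorphism (stable_category S) (Fo (A.sS X)) (B.sS (Fo X)) (B.sc (Fo (A.sS X)) (B.sS (Fo X)) (et X))"
   using B.is_isomorphism_sc[OF Fo_cm[OF A.sS_cm[OF cX]] B.sS_cm[OF Fo_cm[OF cX]] et_Hom[OF cX]] et_siso[OF cX] by blast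
  fix Y U assume Y: "Y \<in> CM R" and U: "U \<in> hom_set (stable_CM R) X Y"
  obtain h where h: "h \<in> Homs R X Y" "U = A.sc X Y h" "A.cm X" "A.cm Y" by (rule A_hom_scE[OF U X Y])
  note cX = h(3) and cY = h(4) and Fh = Fm_Hom[OF h(3,4,1)]
  obtain g where g: "A.shf X Y h g" using A.shf_exists[OF cX cY h(1)] by blast
  obtain t where t: "B.shf (Fo X) (Fo Y) (Fm X Y h) t" using B.shf_exists[OF Fo_cm[OF cX] Fo_cm[OF cY] Fh] by blast
  note SX = A.sS_cm[OF cX] and SY = A.sS_cm[OF cY] and gh = A.shf_Hom[OF g] and th = B.shf_Hom[OF t]
  note Fg = Fm_Hom[OF SX SY gh]
  show "stcomp S (Fo (A.sS X)) (Fo (A.sS Y)) (B.sS (Fo Y)) (B.sc (Fo (A.sS Y)) (B.sS (Fo Y)) (et Y))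
    (fun_mor resF (A.sS X) (A.sS Y) (susp_mor R X Y U)) =
   stcomp S (Fo (A.sS X)) (B.sS (Fo X)) (B.sS (Fo Y)) (susp_mor S (Fo X) (Fo Y) (fun_mor resF X Y U))
    (B.sc (Fo (A.sS X)) (B.sS (Fo X)) (et X))"
   unfolding h(2) A.susp_mor_sc[OF cX cY h(1) g] restriction_mor[OF SX SY gh] restriction_mor[OF cX cY h(1)]
    B.susp_mor_sc[OF Fo_cm[OF cX] Fo_cm[OF cY] Fh t]
    B.sc_comp[OF Fo_cm[OF SX] Fo_cm[OF SY] Fg et_Hom[OF cY]] B.sc_comp[OF Fo_cm[OF SX] B.sS_cm[OF Fo_cm[OF cX]] et_Hom[OF cX] th]
    B.sc_eq_iff[OF Fo_cm[OF SX] B.cm_Ob[OF B.sS_cm[OF Fo_cm[OF cY]]] Homs_comp[OF Fg et_Hom[OF cY]] Homs_comp[OF et_Hom[OF cX] th]]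
   by (rule eta_natural[OF A.susp_chosen[OF cX] B.susp_chosen[OF Fo_cm[OF cX]] A.susp_chosen[OF cY] B.susp_chosen[OF Fo_cm[OF cY]]
     et_eta[OF cX] et_eta[OF cY] h(1) g[unfolded A.shf_def] t[unfolded B.shf_def]])
 qed
 fix X Y Z U V W assume T: "(X, Y, Z, U, V, W) \<in> tri_dist (stable_CM R)"
 hence "is_triangle (stable_category R) (susp_functor R) (X, Y, Z, U, V, W)" unfolding stable_CM_simps distinguished_triangles_def by blast
 hence o: "X \<in> CM R" "Y \<in> CM R" "Z \<in> CM R" and U: "U \<in> hom_set (stable_CM R) X Y" and V: "V \<in> hom_set (stable_CM R) Y Z"
  and W: "W \<in> hom_set (stable_CM R) Z (A.sS X)" unfolding is_triangle_def susp_functor_def by auto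
 obtain u where u: "u \<in> Homs R X Y" "U = A.sc X Y u" "A.cm X" "A.cm Y" by (rule A_hom_scE[OF U o(1,2)])
 obtain v where v: "v \<in> Homs R Y Z" "V = A.sc Y Z v" "A.cm Y" "A.cm Z" by (rule A_hom_scE[OF V o(2,3)])
 note X = u(3) and Y = u(4) and Z = v(4) and SX = A.sS_cm[OF u(3)]
 have "A.sS X \<in> CM R" using SX A.CM_iff by simp
 then obtain w where w: "w \<in> Homs R Z (A.sS X)" "W = A.sc Z (A.sS X) w" using A_hom_scE[OF W o(3)] by metis
 note Fu = Fm_Hom[OF X Y u(1)] and Fv = Fm_Hom[OF Y Z v(1)] and Fw = Fm_Hom[OF Z SX w(1)]
 have "A.dtri X Y Z u v w"
  using T unfolding stable_CM_simps u(2) v(2) w(2) A.distinguished_iff[OF X Y Z u(1) v(1) w(1)] .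
 hence "B.dtri (Fo X) (Fo Y) (Fo Z) (Fm X Y u) (Fm Y Z v) (et X * Fm Z (A.sS X) w)" by (rule restriction_dtri[OF X Y Z u(1) v(1) w(1)])
 hence "(Fo X, Fo Y, Fo Z, B.sc (Fo X) (Fo Y) (Fm X Y u), B.sc (Fo Y) (Fo Z) (Fm Y Z v),
   B.sc (Fo Z) (B.sS (Fo X)) (et X * Fm Z (A.sS X) w)) \<in> distinguished_triangles S"
  unfolding B.distinguished_iff[OF Fo_cm[OF X] Fo_cm[OF Y] Fo_cm[OF Z] Fu Fv Homs_comp[OF Fw et_Hom[OF X]]] .
 thus "(fun_ob resF X, fun_ob resF Y, fun_ob resF Z,
   fun_mor resF X Y U, fun_mor resF Y Z V,
   cat_comp (stable_CM S) (fun_ob resF Z) (fun_ob resF (fun_ob (tri_shift (stable_CM R)) X))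
    (fun_ob (tri_shift (stable_CM S)) (fun_ob resF X)) (B.sc (Fo (A.sS X)) (B.sS (Fo X)) (et X))
    (fun_mor resF Z (fun_ob (tri_shift (stable_CM R)) X) W)) \<in> tri_dist (stable_CM S)"
  unfolding stable_CM_simps susp_functor_def functor_data.simps restriction_ob u(2) v(2) w(2)
   restriction_mor[OF X Y u(1)] restriction_mor[OF Y Z v(1)] restriction_mor[OF Z SX w(1)]
   B.sc_comp[OF Fo_cm[OF Z] Fo_cm[OF SX] Fw et_Hom[OF X]] .
qed

end

theorem corollary5p5:
  fixes k :: "'k ring" and \<phi> :: "'k \<Rightarrow> 'a" and \<Lambda> :: "'a ring" and a :: 'a
  assumes "artin_algebra k \<phi> \<Lambda>"
    and "gorenstein \<Lambda>"
    and "a \<in> carrier \<Lambda>" and "a \<otimes>\<^bsub>\<Lambda>\<^esub> a = a"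
    and "eventually_homological_iso \<Lambda> (corner_ring \<Lambda> a) (corner_functor a)"
  shows "triangle_equivalent (stable_CM \<Lambda>) (stable_CM (corner_ring \<Lambda> a))"
proof -
 let ?G = "corner_ring \<Lambda> a"
 have fg: "corner_module a X \<in> fgm ?G" if "X \<in> fgm \<Lambda>" for X
  using assms(5) that unfolding eventually_homological_iso_def is_functor_def mod_category_def corner_functor_def by auto
 have ext: "\<exists>t::int. \<forall>X\<in>fgm \<Lambda>. \<forall>Y\<in>fgm \<Lambda>. \<forall>j::nat. int j > t -->
   ext_group \<Lambda> j X Y \<cong> ext_group ?G j (corner_module a X) (corner_module a Y)"
  using assms(5) unfolding eventually_homological_iso_def corner_functor_def by simp
 interpret C: corner_restriction \<Lambda> a
  by (intro corner_restriction.intro left_noetherian_corner[OF assms(1,3,4)] assms(3,4) fg)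
 \<comment> \<open>The right injective dimension, read over the opposite ring, yields the embeddings
   of Cohen-Macaulay modules into projectives; the left one, taken next, bounds Ext into the
   algebra.\<close>
 have idop: "\<exists>d. \<forall>X\<in>fgm (opposite_ring \<Lambda>). \<forall>n\<ge>d. C.A.op.extz n X (rcopy (opposite_ring \<Lambda>))"
  using C.A.op.Reg_extz_of_injective_dimension assms(2) unfolding gorenstein_def by blast
 have id: "\<exists>d. \<forall>X\<in>fgm \<Lambda>. \<forall>n\<ge>d. C.A.extz n X (rcopy \<Lambda>)"
  using C.A.Reg_extz_of_injective_dimension assms(2) unfolding gorenstein_def by blast
 interpret A: gorenstein_category "fgm \<Lambda>" "Homs \<Lambda>" idm "exact_seq \<Lambda>" "rcopy \<Lambda>"
  by unfold_locales (rule id, rule C.A.cm_embed_of_injective_dimension[OF idop])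
 have "\<forall>N. \<exists>T u v. N \<in> fgm ?G --> T \<in> fgm \<Lambda> & u \<in> Homs ?G N (C.eo T) & v \<in> Homs ?G (C.eo T) N &
   v * u = idm N & u * v = idm (C.eo T) &
   (\<forall>Y\<in>fgm \<Lambda>. \<forall>h\<in>Homs ?G N (C.eo Y). \<exists>!g. g \<in> Homs \<Lambda> T Y & C.em T Y g * u = h)"
  using C.induced_module_exists by blast
 then obtain lo un vn where l: "\<And>N. N \<in> fgm ?G --> lo N \<in> fgm \<Lambda> & un N \<in> Homs ?G N (C.eo (lo N)) &
   vn N \<in> Homs ?G (C.eo (lo N)) N & vn N * un N = idm N & un N * vn N = idm (C.eo (lo N)) &
   (\<forall>Y\<in>fgm \<Lambda>. \<forall>h\<in>Homs ?G N (C.eo Y). \<exists>!g. g \<in> Homs \<Lambda> (lo N) Y & C.em (lo N) Y g * un N = h)"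
  by metis
 interpret stable_restriction \<Lambda> ?G C.eo C.em lo un vn
 proof (intro stable_restriction.intro gorenstein_modules.intro gorenstein_modules_axioms.intro)
  show "restriction_adjunction (fgm \<Lambda>) (Homs \<Lambda>) idm (exact_seq \<Lambda>) (rcopy \<Lambda>)
    (fgm ?G) (Homs ?G) idm (exact_seq ?G) (rcopy ?G) C.eo C.em lo un vn"
  proof (unfold_locales)
   show "C.em X Y f \<in> Homs ?G (C.eo X) (C.eo Y)" if "f \<in> Homs \<Lambda> X Y" for f X Y using C.em_Hom[OF that] .
   show "C.em X Z (g * f) = C.em Y Z g * C.em X Y f" if "f \<in> Homs \<Lambda> X Y" "g \<in> Homs \<Lambda> Y Z" for f g X Y Z using C.em_comp[OF that] .
   show "C.em X Y (f + g) = C.em X Y f + C.em X Y g" if "f \<in> Homs \<Lambda> X Y" "g \<in> Homs \<Lambda> X Y" for f g X Y using C.em_add[OF that] .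
   show "C.em X X (idm X) = idm (C.eo X)" if "X \<in> fgm \<Lambda>" for X using C.em_id[OF that] .
   show "exact_seq ?G (C.eo X) (C.eo Y) (C.eo Z) (C.em X Y i) (C.em Y Z p)" if "exact_seq \<Lambda> X Y Z i p" for X Y Z i p using C.em_ses[OF that] .
   show "un N \<in> Homs ?G N (C.eo (lo N))" "vn N \<in> Homs ?G (C.eo (lo N)) N" "vn N * un N = idm N" "un N * vn N = idm (C.eo (lo N))" "lo N \<in> fgm \<Lambda>"
    if "N \<in> fgm ?G" for N using l that by blast+
   show "\<exists>!g. g \<in> Homs \<Lambda> (lo N) Y & C.em (lo N) Y g * un N = h"
    if "N \<in> fgm ?G" "Y \<in> fgm \<Lambda>" "h \<in> Homs ?G N (C.eo Y)" for N Y h using l that by blast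
   show "\<exists>t. \<forall>n\<ge>t. \<forall>X\<in>fgm \<Lambda>. \<forall>Y\<in>fgm \<Lambda>. C.A.extz n X Y \<longleftrightarrow> C.B.extz n (C.eo X) (C.eo Y)"
    by (rule C.eventually_extz[OF ext])
   show "C.B.proj (rcopy ?G)" by (rule C.B.proj_rcopy)
   show "\<exists>P S h k. exact_seq ?G N P S h k & C.B.proj P & C.B.ext1z S (rcopy ?G)"
    if "C.B.cm N" "C.B.proj Q" "h \<in> Homs ?G N Q" "\<And>D d. d \<in> Homs ?G D N ==> h * d = 0 ==> d = 0" for N Q h
    using C.B_embed[OF that] .
  qed
 qed (rule A.gorenstein_category_axioms C.A.noetherian_modules_axioms C.B.noetherian_modules_axioms)+
 show ?thesis unfolding triangle_equivalent_def using restriction_triangle_functor restriction_equivalence by blast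
qed

end
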